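(* There exists an absolute constant $C>0$ such that the following holds. Given $p\in(3,\infty)$ and $u_0\in H\cap L^p(\mathbb{R}^3)$, $u_0\neq0$, there exist $$T\ge\left(\frac{C(1-3/p)}{\|u_0\|_p}\right)^{2p/(p-3)}$$ and a semi-strong solution $u$ of the Navier--Stokes equations on $[0,T)$ with $u(0)=u_0$.
   Context: All function spaces are over $\mathbb{R}^3$; $\int=\int_{\mathbb{R}^3}$; $\|\cdot\|_p$ is the $L^p$ norm. A vector field $v$ is weakly divergence free if $\int v\cdot\nabla g=0$ for all $g\in C_0^\infty(\mathbb{R}^3)$. $H=\{f\in L^2: f\text{ weakly divergence free}\}$. The Navier--Stokes equations (viscosity $1$) are $\partial_t u-\Delta u+\nabla \pi=-(u\cdot\nabla)u$, $\operatorname{div}u=0$, with pressure $\pi$. A function $u$ is a strong solution on the open interval $(0,T)$ if $u\in C((0,T);L^2)\cap C((0,T);L^\infty)$, $u(t)$ is weakly divergence free for each $t\in(0,T)$, and for some $\pi\in L^1_{loc}(\mathbb{R}^3\times(0,T))$ $$\int_0^T\!\!\int\big(u\cdot(f_t+\Delta f)+\pi\,\operatorname{div}f\big)=-\int_0^T\!\!\int u\cdot(u\cdot\nabla)f\qquad\text{for all } f\in C_0^\infty(\mathbb{R}^3\times(0,T);\mathbb{R}^3).$$ A function $u$ is a semi-strong solution of the Navier--Stokes equations on $[0,T)$ if it is a strong solution on the open interval $(0,T)$, $u\in C([0,T);L^2)$, and $\int_0^t\|u(s)\|_\infty^2\,ds<\infty$ for all $t\in(0,T)$. *)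

theory Defs
  imports "HOL-Analysis.Analysis" "HOL-Probability.Essential_Supremum"
begin

type_synonym space = "real ^ 3"

text \<open>Lebesgue spaces of vector fields. Elements are functions rather than classes;
  equality of elements is equality almost everywhere.\<close>

definition Lp :: "real \<Rightarrow> (space \<Rightarrow> space) set" where
  "Lp p = {v \<in> borel_measurable lebesgue. integrable lebesgue (\<lambda>x. norm (v x) powr p)}"

definition Lp_norm :: "real \<Rightarrow> (space \<Rightarrow> space) \<Rightarrow> real" where
  "Lp_norm p v = (LINT x|lebesgue. norm (v x) powr p) powr (1 / p)"

definition Linf :: "(space \<Rightarrow> space) set" where
  "Linf = {v \<in> borel_measurable lebesgue. esssup lebesgue (\<lambda>x. ereal (norm (v x))) < \<infinity>}"

definition Linf_norm :: "(space \<Rightarrow> space) \<Rightarrow> real" where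
  "Linf_norm v = real_of_ereal (esssup lebesgue (\<lambda>x. ereal (norm (v x))))"

definition cont_into ::
  "real set \<Rightarrow> (space \<Rightarrow> space) set \<Rightarrow> ((space \<Rightarrow> space) \<Rightarrow> real) \<Rightarrow> (real \<Rightarrow> space \<Rightarrow> space) \<Rightarrow> bool"
where
  "cont_into I X N u \<longleftrightarrow>
    (\<forall>t\<in>I. u t \<in> X \<and> ((\<lambda>s. N (\<lambda>x. u s x - u t x)) \<longlongrightarrow> 0) (at t within I))"

definition dderiv ::
  "'a::real_normed_vector \<Rightarrow> ('a \<Rightarrow> 'b::real_normed_vector) \<Rightarrow> 'a \<Rightarrow> 'b" where
  "dderiv v f z = frechet_derivative f (at z) v"

text \<open>\<open>Ck k f\<close>: all iterated directional derivatives of \<open>f\<close> up to order \<open>k\<close> exist and are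
  continuous.\<close>

primrec Ck :: "nat \<Rightarrow> ('a::real_normed_vector \<Rightarrow> 'b::real_normed_vector) \<Rightarrow> bool" where
  "Ck 0 f \<longleftrightarrow> continuous_on UNIV f"
| "Ck (Suc k) f \<longleftrightarrow> (\<forall>z. f differentiable (at z)) \<and> (\<forall>v. Ck k (dderiv v f))"

text \<open>\<open>test_fun \<Omega>\<close> is $C_0^\infty(\Omega)$, its elements being extended by zero outside \<open>\<Omega>\<close>.\<close>

definition test_fun :: "'a::real_normed_vector set \<Rightarrow> ('a \<Rightarrow> 'b::real_normed_vector) set" where
  "test_fun \<Omega> =
    {f. (\<forall>k. Ck k f) \<and> compact (closure {z. f z \<noteq> 0}) \<and> closure {z. f z \<noteq> 0} \<subseteq> \<Omega>}"

definition grad :: "(space \<Rightarrow> real) \<Rightarrow> space \<Rightarrow> space" where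
  "grad g x = (\<chi> j. dderiv (axis j 1) g x)"

text \<open>Applied only to fields in \<open>Lp 2\<close>, for which the integrand is integrable.\<close>

definition weakly_div_free :: "(space \<Rightarrow> space) \<Rightarrow> bool" where
  "weakly_div_free v \<longleftrightarrow> (\<forall>g \<in> test_fun UNIV. (LINT x|lebesgue. v x \<bullet> grad g x) = 0)"

definition H_space :: "(space \<Rightarrow> space) set" where
  "H_space = {v \<in> Lp 2. weakly_div_free v}"

text \<open>Differential operators on functions of \<open>(x, t)\<close>; all but \<open>dt\<close> act in \<open>x\<close> only.\<close>

definition dt :: "(space \<times> real \<Rightarrow> 'b::real_normed_vector) \<Rightarrow> space \<times> real \<Rightarrow> 'b" where
  "dt f = dderiv (0, 1) f"

definition dx :: "3 \<Rightarrow> (space \<times> real \<Rightarrow> 'b::real_normed_vector) \<Rightarrow> space \<times> real \<Rightarrow> 'b" where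
  "dx j f = dderiv (axis j 1, 0) f"

definition laplacian :: "(space \<times> real \<Rightarrow> space) \<Rightarrow> space \<times> real \<Rightarrow> space" where
  "laplacian f z = (\<Sum>j\<in>UNIV. dx j (dx j f) z)"

definition divergence :: "(space \<times> real \<Rightarrow> space) \<Rightarrow> space \<times> real \<Rightarrow> real" where
  "divergence f z = (\<Sum>j\<in>UNIV. dx j f z $ j)"

definition advect :: "space \<Rightarrow> (space \<times> real \<Rightarrow> space) \<Rightarrow> space \<times> real \<Rightarrow> space" where
  "advect w f z = (\<Sum>j\<in>UNIV. (w $ j) *\<^sub>R dx j f z)"

definition L1_loc :: "'a::euclidean_space set \<Rightarrow> ('a \<Rightarrow> real) set" where
  "L1_loc \<Omega> = {q. \<forall>K. compact K \<and> K \<subseteq> \<Omega> \<longrightarrow> q absolutely_integrable_on K}"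

text \<open>The space-time integrals are iterated. Since \<open>u\<close> is only a continuous curve in
  \<open>L\<^sup>2\<close>, it need not be jointly measurable as a function of \<open>(x, t)\<close>. The terms in \<open>u\<close> have
  inner integrals continuous in \<open>t\<close>, and the term in \<open>\<pi>\<close> is integrable over space-time, so
  no integral below takes the default value of a non-integrable function, except the inner
  one on a null set of \<open>t\<close>.\<close>

definition strong_solution :: "real \<Rightarrow> (real \<Rightarrow> space \<Rightarrow> space) \<Rightarrow> bool" where
  "strong_solution T u \<longleftrightarrow>
    cont_into {0<..<T} (Lp 2) (Lp_norm 2) u \<and>
    cont_into {0<..<T} Linf Linf_norm u \<and>
    (\<forall>t\<in>{0<..<T}. weakly_div_free (u t)) \<and>
    (\<exists>\<pi> \<in> L1_loc (UNIV \<times> {0<..<T}). \<forall>f \<in> test_fun (UNIV \<times> {0<..<T}).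
      (LINT t:{0<..<T}|lebesgue. LINT x|lebesgue.
          u t x \<bullet> (dt f (x, t) + laplacian f (x, t)) + \<pi> (x, t) * divergence f (x, t))
      = - (LINT t:{0<..<T}|lebesgue. LINT x|lebesgue. u t x \<bullet> advect (u t x) f (x, t)))"

definition semi_strong_solution :: "real \<Rightarrow> (real \<Rightarrow> space \<Rightarrow> space) \<Rightarrow> bool" where
  "semi_strong_solution T u \<longleftrightarrow>
    strong_solution T u \<and>
    cont_into {0..<T} (Lp 2) (Lp_norm 2) u \<and>
    (\<forall>t\<in>{0<..<T}. (\<integral>\<^sup>+ s\<in>{0<..<t}. ennreal ((Linf_norm (u s))\<^sup>2) \<partial>lebesgue) < \<infinity>)"

end

theory Submission
  imports Defs "HOL-Probability.Distributions" "HOL-Real_Asymp.Real_Asymp"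
begin

text \<open>The solution is the fixed point of $u(t) = e^{t\Delta} u_0 - \int_0^t e^{(t-s)\Delta}
  P\,\mathrm{div}(u \otimes u)(s)\, ds$, found by Picard iteration in the sup norm with weight
  $t^{3/(2p)}$. No Fourier analysis is needed: since $\Delta^{-1} = - \int_0^\infty e^{\sigma\Delta} d\sigma$,
  the kernel of $e^{t\Delta} P\,\mathrm{div}$ is the integral over $\sigma > t$ of third derivatives of the
  Gaussian at time $\sigma$, which are bounded by $\sigma^{-3/2}$ times the Gaussian at time $2\sigma$.
  All sup norm estimates thereby reduce to beta integrals, all $L^2$ estimates to Schur's test.
  The pressure is the integral over $\rho > 0$ of the second derivatives of the Gaussian at time
  $\rho$ against $u \otimes u$; it converges at $0$ because $u(t)$ is Hoelder continuous of exponent $1/2$,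
  and at infinity because $u(t) \in L^2$. For the weak equation the fixed point equation is tested with
  $(\partial_t + \Delta) f$; after moving all derivatives to $f$ the integrand is an exact time derivative.\<close>

subsection \<open>The heat kernel and its derivatives\<close>

text \<open>The weight has exponent \<alpha> = 3/(2p) because t^(-\<alpha>) is the rate at which the
  heat flow maps L^p to bounded functions. The quadratic term is then governed by integrals of
  s^(-2\<alpha>) (t-s)^(-1/2). They are finite exactly for p > 3 and blow up like 1/(1 - 3/p), which
  is the origin of the factor 1 - 3/p. The power of t that is left over, 1/2 - \<alpha> =
  (p-3)/(2p), is the inverse of the exponent in the lifespan. The main obstacle is a lack of
  absolute convergence: the second derivatives of the Gaussian at time \<rho> have L^1 norm of order
  1/\<rho>, which is integrable neither at 0 nor at infinity. Integrals over \<rho> that involve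
  them may therefore be exchanged with others only after a cancellation has been used, or else at
  fixed \<rho>. The iteration runs on genuine functions, jointly Borel in time and space, and the
  fixed point equation holds at every point; classes modulo null sets would not offer the joint
  measurability that Fubini's theorem needs.\<close>

lemma nn_integral_powr_near_0:
  fixes a c :: real
  assumes "a < 1" "0 \<le> c"
  shows "(\<integral>\<^sup>+s. ennreal (s powr - a) * indicator {0<..<c} s \<partial>lborel) = ennreal (c powr (1 - a) / (1 - a))"
proof -
  have "((\<lambda>s::real. s powr - a) has_integral (c powr (- a + 1) / (- a + 1))) {0..c}"
    using assms by (intro has_integral_powr_from_0) simp_all
  then have "((\<lambda>s::real. s powr - a) has_integral (c powr (- a + 1) / (- a + 1))) {0<..<c}"
    by (rule has_integral_spike_set_eq[THEN iffD1, rotated 2]) (rule negligible_subset[of "{0, c}"]; force)+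
  then have *: "((\<lambda>s::real. if s \<in> {0<..<c} then s powr - a else 0) has_integral (c powr (1 - a) / (1 - a))) UNIV"
    by (subst has_integral_restrict_UNIV) (simp add: add.commute)
  have "(\<integral>\<^sup>+s. ennreal (s powr - a) * indicator {0<..<c} s \<partial>lborel)
      = (\<integral>\<^sup>+s. ennreal (if s \<in> {0<..<c} then s powr - a else 0) \<partial>lborel)"
    by (rule nn_integral_cong) (simp add: indicator_def)
  also have "\<dots> = ennreal (c powr (1 - a) / (1 - a))"
    by (rule nn_integral_has_integral_lborel[OF _ _ *]) auto
  finally show ?thesis .
qed

lemma nn_integral_powr_tail:
  fixes b c :: real
  assumes "1 < b" "0 < c"
  shows "(\<integral>\<^sup>+s. ennreal (s powr - b) * indicator {c<..} s \<partial>lborel) = ennreal (c powr (1 - b) / (b - 1))"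
proof -
  have "(\<integral>\<^sup>+s. ennreal (s powr - b) * indicator {c<..} s \<partial>lborel)
      = (\<integral>\<^sup>+s. ennreal (s powr - b) * indicator {c..} s \<partial>lborel)"
    by (rule nn_integral_cong_AE)
       (use AE_lborel_singleton[of c] in \<open>auto elim!: eventually_mono split: split_indicator\<close>)
  also have "\<dots> = 0 - (- (c powr (1 - b) / (b - 1)))"
  proof (rule nn_integral_FTC_atLeast)
    fix x assume "c \<le> x"
    then have "((\<lambda>x. x powr (1 - b)) has_real_derivative (1 - b) * x powr (1 - b - 1)) (at x)"
      using assms by (intro has_real_derivative_powr) auto
    from DERIV_cmult[OF this, of "- 1 / (b - 1)"]
    have "((\<lambda>x. - (x powr (1 - b) / (b - 1))) has_real_derivative (- 1 / (b - 1)) * ((1 - b) * x powr (1 - b - 1))) (at x)"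
      by simp
    moreover have "(- 1 / (b - 1)) * ((1 - b) * x powr (1 - b - 1)) = x powr - b"
    proof -
      have "(- 1 / (b - 1)) * (1 - b) = 1" using assms by (simp add: divide_simps)
      then show ?thesis by (simp add: mult.assoc[symmetric] del: mult_minus_left divide_minus_left)
    qed
    ultimately show "((\<lambda>x. - (x powr (1 - b) / (b - 1))) has_real_derivative x powr - b) (at x)"
      by simp
  next
    have "((\<lambda>x::real. x powr (1 - b)) \<longlongrightarrow> 0) at_top"
      using assms by (intro tendsto_neg_powr) (auto simp: filterlim_ident)
    then show "((\<lambda>x::real. - (x powr (1 - b) / (b - 1))) \<longlongrightarrow> 0) at_top"
      using tendsto_mult[of "\<lambda>x. x powr (1 - b)" 0 at_top "\<lambda>_. - 1 / (b - 1)" "- 1 / (b - 1)"] by simp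
  qed auto
  finally show ?thesis by simp
qed

text \<open>At \<open>t = 1\<close> and for \<open>a, b < 1\<close> this is Euler's beta function at
  (1 - a, 1 - b). The value lies in \<open>ennreal\<close>, so that it can be handled before its
  finiteness is known.\<close>

definition beta_int :: "real \<Rightarrow> real \<Rightarrow> real \<Rightarrow> ennreal" where
  "beta_int a b t = (\<integral>\<^sup>+s. ennreal (s powr - a * (t - s) powr - b) * indicator {0<..<t} s \<partial>lborel)"

text \<open>The substitution s = t r puts all dependence on \<open>t\<close> into one power, so that
  a single constant serves every time.\<close>

lemma beta_int_scale:
  assumes "0 < t"
  shows "beta_int a b t = ennreal (t powr (1 - a - b)) * beta_int a b 1"
proof -
  have "beta_int a b t = ennreal t * (\<integral>\<^sup>+r. ennreal ((t * r) powr - a * (t - t * r) powr - b) * indicator {0<..<t} (t * r) \<partial>lborel)"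
    using assms unfolding beta_int_def
    by (subst nn_integral_real_affine[where c=t and t=0]) auto
  also have "(\<integral>\<^sup>+r. ennreal ((t * r) powr - a * (t - t * r) powr - b) * indicator {0<..<t} (t * r) \<partial>lborel)
     = (\<integral>\<^sup>+r. ennreal (t powr (- a - b)) * (ennreal (r powr - a * (1 - r) powr - b) * indicator {0<..<1} r) \<partial>lborel)"
  proof (rule nn_integral_cong)
    fix r :: real
    show "ennreal ((t * r) powr - a * (t - t * r) powr - b) * indicator {0<..<t} (t * r)
       = ennreal (t powr (- a - b)) * (ennreal (r powr - a * (1 - r) powr - b) * indicator {0<..<1} r)"
    proof (cases "0 < r \<and> r < 1")
      case True
      have "(t * r) powr - a * (t - t * r) powr - b = t powr (- a - b) * (r powr - a * (1 - r) powr - b)"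
      proof -
        have "t - t * r = t * (1 - r)" by (simp add: algebra_simps)
        then show ?thesis using assms True
          by (simp add: powr_mult powr_add[symmetric] mult_ac flip: powr_add)
      qed
      then show ?thesis using True assms
        by (simp add: ennreal_mult)
    qed (use assms in \<open>auto simp: indicator_def zero_less_mult_iff\<close>)
  qed
  also have "\<dots> = ennreal (t powr (- a - b)) * beta_int a b 1"
    unfolding beta_int_def by (rule nn_integral_cmult) auto
  also have "ennreal t * \<dots> = ennreal (t powr (1 - a - b)) * beta_int a b 1"
  proof -
    have "t * t powr (- a - b) = t powr (1 - a - b)"
      using assms by (simp add: powr_mult_base algebra_simps)
    then show ?thesis
      using assms by (simp add: ennreal_mult[symmetric] flip: mult.assoc)
  qed
  finally show ?thesis .
qed

text \<open>On either half of the unit interval one of the two factors is at most 2, since its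
  exponent lies below 1. The explicit dependence on \<open>1 - a\<close> is what becomes the factor
  1 - 3/p of the lifespan.\<close>

lemma beta_int_1_le:
  assumes "0 \<le> a" "a < 1" "0 \<le> b" "b < 1"
  shows "beta_int a b 1 \<le> ennreal (2 / (1 - a) + 2 / (1 - b))"
proof -
  have two: "2 powr b \<le> 2" "2 powr a \<le> 2"
    using powr_mono[of b 1 2] powr_mono[of a 1 2] assms by auto
  have "beta_int a b 1 \<le> (\<integral>\<^sup>+s. ennreal 2 * (ennreal (s powr - a) * indicator {0<..<1} s)
        + ennreal 2 * (ennreal ((1 - s) powr - b) * indicator {0<..<1} (1 - s)) \<partial>lborel)"
    unfolding beta_int_def
  proof (rule nn_integral_mono)
    fix s :: real
    show "ennreal (s powr - a * (1 - s) powr - b) * indicator {0<..<1} s \<le> ennreal 2 * (ennreal (s powr - a) * indicator {0<..<1} s)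
        + ennreal 2 * (ennreal ((1 - s) powr - b) * indicator {0<..<1} (1 - s))"
    proof (cases "0 < s \<and> s < 1")
      case True
      have "s powr - a * (1 - s) powr - b \<le> 2 * s powr - a + 2 * (1 - s) powr - b"
      proof (cases "s \<le> 1/2")
        case True
        have "(1 - s) powr - b \<le> (1/2) powr - b"
          using True assms by (intro powr_mono2') auto
        also have "\<dots> \<le> 2" using two by (simp add: powr_minus powr_divide)
        finally have "s powr - a * (1 - s) powr - b \<le> s powr - a * 2"
          by (intro mult_left_mono) auto
        then show ?thesis by (smt (verit) powr_ge_zero)
      next
        case False
        have "s powr - a \<le> (1/2) powr - a"
          using False assms by (intro powr_mono2') auto
        also have "\<dots> \<le> 2" using two by (simp add: powr_minus powr_divide)
        finally have "s powr - a * (1 - s) powr - b \<le> 2 * (1 - s) powr - b"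
          by (intro mult_right_mono) auto
        then show ?thesis by (smt (verit) powr_ge_zero)
      qed
      then have "ennreal (s powr - a * (1 - s) powr - b) \<le> ennreal (2 * s powr - a + 2 * (1 - s) powr - b)"
        by (rule ennreal_leI)
      then show ?thesis using True
        by (simp add: ennreal_mult)
    qed auto
  qed
  also have "\<dots> = ennreal 2 * (\<integral>\<^sup>+s. ennreal (s powr - a) * indicator {0<..<1} s \<partial>lborel)
     + ennreal 2 * (\<integral>\<^sup>+s. ennreal ((1 - s) powr - b) * indicator {0<..<1} (1 - s) \<partial>lborel)"
    by (subst nn_integral_add) (auto simp: nn_integral_cmult)
  also have "(\<integral>\<^sup>+s. ennreal ((1 - s) powr - b) * indicator {0<..<1} (1 - s) \<partial>lborel)
     = (\<integral>\<^sup>+s. ennreal (s powr - b) * indicator {0<..<1} s \<partial>lborel)"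
    using nn_integral_real_affine[of "\<lambda>s. ennreal (s powr - b) * indicator {0<..<1::real} s" "-1" 1]
    by auto
  finally show ?thesis
    using assms by (simp add: nn_integral_powr_near_0 ennreal_mult'[symmetric] ennreal_plus[symmetric] del: ennreal_plus ennreal_numeral)
qed

section \<open>The Gaussian\<close>

definition gauss :: "real \<Rightarrow> space \<Rightarrow> real" where
  "gauss s z = (4 * pi * s) powr (- 3 / 2) * exp (- (z \<bullet> z) / (4 * s))"

lemma gauss_nonneg [simp]: "0 \<le> gauss s z"
  by (simp add: gauss_def)

lemma gauss_minus [simp]: "gauss s (- z) = gauss s z"
  by (simp add: gauss_def)

lemma gauss_measurable [measurable (raw)]:
  assumes [measurable]: "f \<in> borel_measurable M" "g \<in> borel_measurable M"
  shows "(\<lambda>w. gauss (f w) (g w)) \<in> borel_measurable M"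
  unfolding gauss_def by measurable

text \<open>The heat kernel is the product over the three coordinates of normal densities of
  variance 2s.\<close>

lemma nn_integral_gauss:
  assumes "0 < s"
  shows "(\<integral>\<^sup>+z. ennreal (gauss s z) \<partial>lborel) = 1"
proof -
  interpret N: prob_space "density lborel (normal_density 0 (sqrt (2 * s)))"
    using assms by (intro prob_space_normal_density) auto
  have one: "(\<integral>\<^sup>+x. ennreal (normal_density 0 (sqrt (2 * s)) x) \<partial>lborel) = 1"
    using N.emeasure_space_1 by (simp add: emeasure_density)
  have "gauss s z = (\<Prod>b\<in>Basis. normal_density 0 (sqrt (2 * s)) (z \<bullet> b))" for z
  proof -
    have "(\<Prod>b\<in>(Basis::space set). normal_density 0 (sqrt (2 * s)) (z \<bullet> b))
       = (1 / sqrt (2 * pi * (2 * s))) ^ 3 * exp (\<Sum>b\<in>(Basis::space set). - (z \<bullet> b)\<^sup>2 / (4 * s))"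
      using assms by (simp add: normal_density_def prod_dividef exp_sum power_divide)
    also have "(\<Sum>b\<in>(Basis::space set). - (z \<bullet> b)\<^sup>2 / (4 * s)) = - (z \<bullet> z) / (4 * s)"
      by (subst (2) euclidean_inner) (simp add: sum_negf sum_divide_distrib power2_eq_square)
    also have "(1 / sqrt (2 * pi * (2 * s))) ^ 3 = (4 * pi * s) powr (- 3 / 2)"
    proof -
      have "1 / sqrt (2 * pi * (2 * s)) = (4 * pi * s) powr (- 1 / 2)"
        using assms by (simp add: powr_half_sqrt[symmetric] powr_minus_divide mult_ac)
      then show ?thesis using assms by (simp add: powr_power)
    qed
    finally show ?thesis by (simp add: gauss_def)
  qed
  then have "(\<integral>\<^sup>+z. ennreal (gauss s z) \<partial>lborel) = (\<integral>\<^sup>+z. (\<Prod>b\<in>(Basis::space set). ennreal (normal_density 0 (sqrt (2 * s)) (z \<bullet> b))) \<partial>lborel)"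
    by (simp add: prod_ennreal)
  also have "\<dots> = (\<Prod>b\<in>(Basis::space set). (\<integral>\<^sup>+x. ennreal (normal_density 0 (sqrt (2 * s)) x) \<partial>lborel))"
    by (intro nn_integral_lborel_prod) auto
  finally show ?thesis by (simp add: one)
qed

lemma nn_integral_translate:
  fixes f :: "'a::euclidean_space \<Rightarrow> ennreal"
  assumes [measurable]: "f \<in> borel_measurable borel"
  shows "(\<integral>\<^sup>+y. f (y + c) \<partial>lborel) = (\<integral>\<^sup>+y. f y \<partial>lborel)"
proof -
  have "(\<integral>\<^sup>+y. f y \<partial>lborel) = (\<integral>\<^sup>+y. f y \<partial>distr lborel borel ((+) c))"
    by (simp add: lborel_distr_plus)
  also have "\<dots> = (\<integral>\<^sup>+y. f (c + y) \<partial>lborel)"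
    by (subst nn_integral_distr) auto
  finally show ?thesis by (simp add: add.commute)
qed

lemma nn_integral_reflect:
  fixes f :: "'a::euclidean_space \<Rightarrow> ennreal"
  assumes [measurable]: "f \<in> borel_measurable borel"
  shows "(\<integral>\<^sup>+y. f (c - y) \<partial>lborel) = (\<integral>\<^sup>+y. f y \<partial>lborel)"
proof -
  have "(\<integral>\<^sup>+y. f y \<partial>lborel) = (\<integral>\<^sup>+y. f y \<partial>density (distr lborel borel (\<lambda>x. c + (- 1) *\<^sub>R x)) (\<lambda>_. 1))"
    using lborel_affine[of "- 1" c] by (simp add: one_ereal_def[symmetric])
  also have "\<dots> = (\<integral>\<^sup>+y. f (c - y) \<partial>lborel)"
    by (simp add: nn_integral_density nn_integral_distr)
  finally show ?thesis by simp
qed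

lemma nn_integral_gauss_shift:
  assumes "0 < s"
  shows "(\<integral>\<^sup>+y. ennreal (gauss s (x - y)) \<partial>lborel) = 1"
    and "(\<integral>\<^sup>+x. ennreal (gauss s (x - y)) \<partial>lborel) = 1"
    and "(\<integral>\<^sup>+y. ennreal (gauss s (x + h - y)) \<partial>lborel) = 1"
  using nn_integral_reflect[of "\<lambda>z. ennreal (gauss s z)" x] nn_integral_translate[of "\<lambda>z. ennreal (gauss s z)" "-y"]
    nn_integral_reflect[of "\<lambda>z. ennreal (gauss s z)" "x + h"]
    nn_integral_gauss[OF assms] by auto

lemma power_times_exp_le:
  fixes r :: real
  assumes "0 \<le> r" "n \<le> 4"
  shows "r ^ n * exp (- r\<^sup>2 / 8) \<le> 4 ^ n"
proof -
  \<comment> \<open>In terms of \<open>q\<close> the reciprocal of the exponential is the square of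
    exp(q^2), which dominates (1 + q^2)^2 and hence every power of q up to the fourth.\<close>
  define q where "q = r / 4"
  have q: "0 \<le> q" "r = 4 * q" using assms by (auto simp: q_def)
  have "q ^ n \<le> (1 + q\<^sup>2)\<^sup>2"
  proof -
    have "q ^ n \<le> 1 + q ^ 4"
    proof (cases "q \<le> 1")
      case True
      then have "q ^ n \<le> 1" using q by (simp add: power_le_one)
      then show ?thesis using q by (smt (verit) zero_le_power)
    next
      case False
      then have "q ^ n \<le> q ^ 4" using assms by (intro power_increasing) auto
      then show ?thesis by simp
    qed
    also have "\<dots> \<le> (1 + q\<^sup>2)\<^sup>2"
      using q by (simp add: power2_sum power_mult[symmetric])
    finally show ?thesis .
  qed
  also have "\<dots> \<le> (exp (q\<^sup>2))\<^sup>2"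
    by (intro power_mono exp_ge_add_one_self) auto
  also have "\<dots> = exp (r\<^sup>2 / 8)"
    by (simp add: q power_mult_distrib exp_double[symmetric])
  finally have "q ^ n * exp (- r\<^sup>2 / 8) \<le> 1"
    by (simp add: exp_minus field_simps)
  then show ?thesis
    by (simp add: q(2) power_mult_distrib mult.assoc)
qed

lemma two_powr_32_le: "2 powr (3/2) \<le> (3::real)"
proof (rule power2_le_imp_le)
  show "(2 powr (3/2))\<^sup>2 \<le> (3::real)\<^sup>2"
    by (simp add: power2_eq_square powr_add[symmetric])
qed simp

text \<open>Half of the Gaussian decay is split off to absorb powers of |z|; the other half is a
  Gaussian at twice the time. The factor 2^(3/2) is the ratio of the two normalizations.\<close>

lemma gauss_double:
  assumes "0 < s"
  shows "gauss s z = 2 powr (3/2) * exp (- (z \<bullet> z) / (8 * s)) * gauss (2 * s) z"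
proof -
  have "(4 * pi * s) powr (- 3 / 2) = 2 powr (3/2) * (4 * pi * (2 * s)) powr (- 3 / 2)"
  proof -
    have "4 * pi * (2 * s) = 2 * (4 * pi * s)" by simp
    then show ?thesis
      using assms by (simp only: powr_mult) (simp add: powr_minus field_simps)
  qed
  moreover have "exp (- (z \<bullet> z) / (4 * s)) = exp (- (z \<bullet> z) / (8 * s)) * exp (- (z \<bullet> z) / (4 * (2 * s)))"
    using assms by (simp add: exp_add[symmetric] field_simps)
  ultimately show ?thesis by (simp add: gauss_def)
qed

text \<open>By parabolic scaling each factor |z| costs one factor sqrt s. The highest power, the
  fourth, occurs when the third derivatives of the Gaussian are differentiated once more
  (\<open>oseen_deriv_le\<close>).\<close>

lemma norm_power_gauss_le:
  assumes "0 < s" "n \<le> 4"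
  shows "norm z ^ n * gauss s z \<le> 3 * 4 ^ n * sqrt s ^ n * gauss (2 * s) z"
proof -
  define r where "r = norm z / sqrt s"
  have r: "0 \<le> r" "norm z = r * sqrt s" using assms by (auto simp: r_def)
  have e: "exp (- (z \<bullet> z) / (8 * s)) = exp (- r\<^sup>2 / 8)"
  proof -
    have "r\<^sup>2 = (z \<bullet> z) / s"
      using assms by (simp add: r_def power_divide power2_norm_eq_inner)
    then show ?thesis by simp
  qed
  have "norm z ^ n * gauss s z = 2 powr (3/2) * (r ^ n * exp (- r\<^sup>2 / 8)) * (sqrt s ^ n * gauss (2 * s) z)"
    unfolding gauss_double[OF assms(1), of z] e r(2) by (simp add: power_mult_distrib)
  also have "\<dots> \<le> 3 * 4 ^ n * (sqrt s ^ n * gauss (2 * s) z)"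
    using two_powr_32_le power_times_exp_le[OF r(1) assms(2)] r assms
    by (intro mult_right_mono mult_mono) auto
  finally show ?thesis by simp
qed

lemma gauss_le: "0 < s \<Longrightarrow> gauss s z \<le> s powr (- 3 / 2)"
proof -
  assume "0 < s"
  have "1 \<le> 4 * pi" using pi_gt3 by simp
  have "(4 * pi * s) powr (- 3 / 2) \<le> s powr (- 3 / 2)"
    using \<open>0 < s\<close> \<open>1 \<le> 4 * pi\<close> by (intro powr_mono2') (auto simp: mult_le_cancel_right1)
  moreover have "exp (- (z \<bullet> z) / (4 * s)) \<le> 1" using \<open>0 < s\<close> by simp
  ultimately show ?thesis
    unfolding gauss_def by (metis mult_mono' mult.right_neutral exp_ge_zero powr_ge_zero)
qed

text \<open>For all \<open>s\<close> between \<open>t\<close> and \<open>2 * t\<close> one fixed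
  Gaussian is a majorant, which turns the mean value theorem in time into a kernel bound
  (\<open>gauss_time_diff_le\<close>).\<close>

lemma gauss_comparison:
  assumes "0 < t" "t \<le> s" "s \<le> 2 * t"
  shows "gauss (2 * s) z \<le> 3 * gauss (4 * t) z"
proof -
  have "(4 * pi * (2 * s)) powr (- 3 / 2) \<le> (4 * pi * (2 * t)) powr (- 3 / 2)"
    using assms by (intro powr_mono2') auto
  also have "\<dots> = 2 powr (3/2) * (4 * pi * (4 * t)) powr (- 3 / 2)"
  proof -
    have "4 * pi * (4 * t) = 2 * (4 * pi * (2 * t))" by simp
    then show ?thesis
      using assms by (simp only: powr_mult) (simp add: powr_minus field_simps)
  qed
  also have "\<dots> \<le> 3 * (4 * pi * (4 * t)) powr (- 3 / 2)"
    by (intro mult_right_mono two_powr_32_le) auto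
  finally have 1: "(4 * pi * (2 * s)) powr (- 3 / 2) \<le> 3 * (4 * pi * (4 * t)) powr (- 3 / 2)" .
  have "(z \<bullet> z) / (16 * t) \<le> (z \<bullet> z) / (8 * s)"
    using assms by (intro divide_left_mono) auto
  then have 2: "exp (- (z \<bullet> z) / (4 * (2 * s))) \<le> exp (- (z \<bullet> z) / (4 * (4 * t)))"
    by simp
  show ?thesis unfolding gauss_def using mult_mono[OF 1 2] by simp
qed

text \<open>Moving the centre by at most sqrt s costs only a constant: |z|^2 is at most 2|z + h|^2 +
  2|h|^2, and the last term adds at most 1/8 to the exponent. This makes the mean value theorem in
  space usable in \<open>kernel_shift_le\<close>.\<close>

lemma gauss_nearby:
  assumes "0 < s" "norm h \<le> sqrt s"
  shows "gauss (2 * s) (z + h) \<le> 6 * gauss (4 * s) z"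
proof -
  have "norm z \<le> norm (z + h) + norm h"
    using norm_triangle_ineq4[of "z + h" h] by simp
  then have "(norm z)\<^sup>2 \<le> (norm (z + h) + norm h)\<^sup>2"
    by (intro power_mono) auto
  also have "\<dots> \<le> 2 * (norm (z + h))\<^sup>2 + 2 * (norm h)\<^sup>2"
    using sum_squares_bound[of "norm (z+h)" "norm h"] by (simp add: power2_sum)
  also have "(norm h)\<^sup>2 \<le> s"
    using assms power_mono[OF assms(2), of 2] by simp
  finally have "(norm z)\<^sup>2 / (16 * s) \<le> (2 * (norm (z + h))\<^sup>2 + 2 * s) / (16 * s)"
    using assms by (intro divide_right_mono) auto
  also have "\<dots> = (norm (z + h))\<^sup>2 / (8 * s) + 1 / 8"
    using assms by (simp add: field_simps)
  finally have "exp (- ((norm (z + h))\<^sup>2 / (8 * s))) \<le> exp (1 / 8 + - ((norm z)\<^sup>2 / (16 * s)))"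
    by simp
  also have "\<dots> \<le> 2 * exp (- ((norm z)\<^sup>2 / (16 * s)))"
  proof -
    have "exp (1/8) \<le> (2::real)"
      using exp_bound_half[of "1/8::real"] by simp
    then show ?thesis by (subst exp_add) (intro mult_right_mono, auto)
  qed
  finally have 2: "exp (- (norm (z + h))\<^sup>2 / (4 * (2 * s))) \<le> 2 * exp (- (norm z)\<^sup>2 / (4 * (4 * s)))"
    by simp
  have "(4 * pi * (2 * s)) powr (- 3 / 2) = 2 powr (3/2) * (4 * pi * (4 * s)) powr (- 3 / 2)"
  proof -
    have "4 * pi * (4 * s) = 2 * (4 * pi * (2 * s))" by simp
    then show ?thesis
      using assms by (simp only: powr_mult) (simp add: powr_minus field_simps)
  qed
  also have "\<dots> \<le> 3 * (4 * pi * (4 * s)) powr (- 3 / 2)"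
    by (intro mult_right_mono two_powr_32_le) auto
  finally have 1: "(4 * pi * (2 * s)) powr (- 3 / 2) \<le> 3 * (4 * pi * (4 * s)) powr (- 3 / 2)" .
  show ?thesis unfolding gauss_def using mult_mono[OF 1 2] by (simp add: power2_norm_eq_inner)
qed

text \<open>\<open>G1\<close>, \<open>G2\<close> and \<open>G3\<close> are the directional
  derivatives of the Gaussian of order one, two and three (see \<open>gauss_deriv\<close>,
  \<open>G1_deriv\<close>, \<open>G2_deriv\<close>). The closed formulas reduce their bounds to
  algebra.\<close>

definition G1 :: "real \<Rightarrow> space \<Rightarrow> space \<Rightarrow> real" where
  "G1 s z a = - (z \<bullet> a) / (2 * s) * gauss s z"

definition G2 :: "real \<Rightarrow> space \<Rightarrow> space \<Rightarrow> space \<Rightarrow> real" where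
  "G2 s z a b = ((z \<bullet> a) * (z \<bullet> b) / (4 * s\<^sup>2) - (a \<bullet> b) / (2 * s)) * gauss s z"

definition G3 :: "real \<Rightarrow> space \<Rightarrow> space \<Rightarrow> space \<Rightarrow> space \<Rightarrow> real" where
  "G3 s z a b c = (- ((z \<bullet> a) * (z \<bullet> b) * (z \<bullet> c)) / (8 * s ^ 3)
     + ((a \<bullet> b) * (z \<bullet> c) + (a \<bullet> c) * (z \<bullet> b) + (b \<bullet> c) * (z \<bullet> a)) / (4 * s\<^sup>2)) * gauss s z"

definition lap_gauss :: "real \<Rightarrow> space \<Rightarrow> real" where
  "lap_gauss s z = ((z \<bullet> z) / (4 * s\<^sup>2) - 3 / (2 * s)) * gauss s z"

text \<open>In the direction of \<open>a\<close>, counted in units of (z . a) / (4 s^2), the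
  gradient of the second derivative along \<open>a\<close> contributes 2 and the Laplacian part
  contributes -5, which makes the -3 here. In the direction of \<open>z\<close>
  (\<open>oseen2\<close>) only the gradient contributes.\<close>

definition oseen1 :: "real \<Rightarrow> space \<Rightarrow> space \<Rightarrow> real" where
  "oseen1 s z a = ((z \<bullet> z) * (z \<bullet> a) / (8 * s ^ 3) - 3 * (z \<bullet> a) / (4 * s\<^sup>2)) * gauss s z"

definition oseen2 :: "real \<Rightarrow> space \<Rightarrow> space \<Rightarrow> real" where
  "oseen2 s z a = (- (z \<bullet> a)\<^sup>2 / (8 * s ^ 3) + (a \<bullet> a) / (4 * s\<^sup>2)) * gauss s z"

text \<open>Here $(\partial_a \partial_a \nabla - a\, \partial_a \Delta)$ is applied to the Gaussian at time \<open>s\<close>.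
  Its integral over $s > t$ is the kernel of $e^{t\Delta} P\,\mathrm{div}$, applied to $a \otimes a$.\<close>

definition oseen :: "real \<Rightarrow> space \<Rightarrow> space \<Rightarrow> space" where
  "oseen s z a = oseen1 s z a *\<^sub>R a + oseen2 s z a *\<^sub>R z"

text \<open>The derivative of \<open>oseen s z a\<close> as \<open>z\<close> moves in the direction
  \<open>h\<close> (\<open>oseen_has_deriv\<close>): the product rule, with the derivative of the
  Gaussian left as \<open>G1\<close>.\<close>

definition oseen_deriv :: "real \<Rightarrow> space \<Rightarrow> space \<Rightarrow> space \<Rightarrow> space" where
  "oseen_deriv s z a h =
    (((2 * (z \<bullet> h) * (z \<bullet> a) + (z \<bullet> z) * (h \<bullet> a)) / (8 * s ^ 3) - 3 * (h \<bullet> a) / (4 * s\<^sup>2)) * gauss s z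
      + ((z \<bullet> z) * (z \<bullet> a) / (8 * s ^ 3) - 3 * (z \<bullet> a) / (4 * s\<^sup>2)) * G1 s z h) *\<^sub>R a
    + (- 2 * (z \<bullet> a) * (h \<bullet> a) / (8 * s ^ 3) * gauss s z
      + (- (z \<bullet> a)\<^sup>2 / (8 * s ^ 3) + (a \<bullet> a) / (4 * s\<^sup>2)) * G1 s z h) *\<^sub>R z
    + oseen2 s z a *\<^sub>R h"

lemma G2_measurable [measurable (raw)]:
  assumes [measurable]: "f \<in> borel_measurable M" "g \<in> borel_measurable M" "k \<in> borel_measurable M" "l \<in> borel_measurable M"
  shows "(\<lambda>w. G2 (f w) (g w) (k w) (l w)) \<in> borel_measurable M"
  unfolding G2_def by measurable

lemma lap_gauss_measurable [measurable (raw)]: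
  assumes [measurable]: "f \<in> borel_measurable M" "g \<in> borel_measurable M"
  shows "(\<lambda>w. lap_gauss (f w) (g w)) \<in> borel_measurable M"
  unfolding lap_gauss_def by measurable

lemma oseen_measurable [measurable (raw)]:
  assumes [measurable]: "f \<in> borel_measurable M" "g \<in> borel_measurable M" "k \<in> borel_measurable M"
  shows "(\<lambda>w. oseen (f w) (g w) (k w)) \<in> borel_measurable M"
  unfolding oseen_def oseen1_def oseen2_def by measurable

text \<open>The closed formula of the kernel is checked here against the operator it stands for. The
  form with third derivatives of the Gaussian is the one that can be integrated by parts.\<close>

lemma oseen_inner:
  "oseen s z a \<bullet> w = G3 s z a a w - (\<Sum>i\<in>UNIV. G3 s z (axis i 1) (axis i 1) a) * (a \<bullet> w)"
  unfolding oseen_def oseen1_def oseen2_def G3_def sum_3 inner_vec_def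
  by (simp add: inner_axis inner_axis' inner_vec_def sum_3 axis_def power2_eq_square)
     (simp add: algebra_simps add_divide_distrib diff_divide_distrib)

lemma lap_gauss_eq: "lap_gauss s z = (\<Sum>i\<in>UNIV. G2 s z (axis i 1) (axis i 1))"
  unfolding lap_gauss_def G2_def sum_3
  by (simp add: inner_axis inner_axis' inner_vec_def sum_3 axis_def algebra_simps add_divide_distrib)

lemma oseen_0 [simp]: "oseen s z 0 = 0"
  by (simp add: oseen_def oseen1_def oseen2_def)

lemma G2_0 [simp]: "G2 s z 0 0 = 0"
  by (simp add: G2_def)

text \<open>All kernels are differentiated along lines, so that calculus in one real variable is
  enough.\<close>

lemma line_derivs:
  fixes z h a :: "'a::real_inner"
  shows "((\<lambda>r. (z + r *\<^sub>R h) \<bullet> a) has_real_derivative h \<bullet> a) (at r)"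
    and "((\<lambda>r. (z + r *\<^sub>R h) \<bullet> (z + r *\<^sub>R h)) has_real_derivative 2 * ((z + r *\<^sub>R h) \<bullet> h)) (at r)"
  by (auto intro!: derivative_eq_intros simp: inner_add_left inner_add_right inner_commute algebra_simps)

lemma gauss_deriv:
  assumes "0 < s"
  shows "((\<lambda>r. gauss s (z + r *\<^sub>R h)) has_real_derivative G1 s (z + r *\<^sub>R h) h) (at r)"
  unfolding gauss_def G1_def using assms
  by (auto intro!: derivative_eq_intros simp: inner_add_left inner_add_right inner_commute field_simps)

lemma G1_deriv:
  assumes "0 < s"
  shows "((\<lambda>r. G1 s (z + r *\<^sub>R h) a) has_real_derivative G2 s (z + r *\<^sub>R h) a h) (at r)"
proof -
  have "((\<lambda>r. G1 s (z + r *\<^sub>R h) a) has_real_derivative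
     (- (h \<bullet> a) / (2 * s)) * gauss s (z + r *\<^sub>R h) + G1 s (z + r *\<^sub>R h) h * (- ((z + r *\<^sub>R h) \<bullet> a) / (2 * s))) (at r)"
    unfolding G1_def[of _ _ a] using assms
    by (intro DERIV_mult gauss_deriv) (auto intro!: derivative_eq_intros simp: inner_add_left)
  then show ?thesis
  proof (rule DERIV_cong)
    have "(- (h \<bullet> a) / (2 * s)) * gauss s w + G1 s w h * (- (w \<bullet> a) / (2 * s)) = G2 s w a h" for w
      using assms by (simp add: G1_def G2_def power2_eq_square inner_commute field_simps)
    then show "(- (h \<bullet> a) / (2 * s)) * gauss s (z + r *\<^sub>R h) + G1 s (z + r *\<^sub>R h) h * (- ((z + r *\<^sub>R h) \<bullet> a) / (2 * s))
      = G2 s (z + r *\<^sub>R h) a h" .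
  qed
qed

lemma G2_deriv:
  assumes "0 < s"
  shows "((\<lambda>r. G2 s (z + r *\<^sub>R h) a b) has_real_derivative G3 s (z + r *\<^sub>R h) a b h) (at r)"
proof -
  let ?w = "z + r *\<^sub>R h"
  have "((\<lambda>r. G2 s (z + r *\<^sub>R h) a b) has_real_derivative
     (((h \<bullet> a) * (?w \<bullet> b) + (h \<bullet> b) * (?w \<bullet> a)) / (4 * s\<^sup>2)) * gauss s ?w
     + G1 s ?w h * ((?w \<bullet> a) * (?w \<bullet> b) / (4 * s\<^sup>2) - (a \<bullet> b) / (2 * s))) (at r)"
    unfolding G2_def using assms
    by (intro DERIV_mult gauss_deriv)
       (rule DERIV_cong, (rule DERIV_mult DERIV_diff DERIV_cdivide DERIV_const line_derivs)+,
        simp add: algebra_simps add_divide_distrib)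
  moreover have "(((h \<bullet> a) * (w \<bullet> b) + (h \<bullet> b) * (w \<bullet> a)) / (4 * s\<^sup>2)) * gauss s w
     + G1 s w h * ((w \<bullet> a) * (w \<bullet> b) / (4 * s\<^sup>2) - (a \<bullet> b) / (2 * s)) = G3 s w a b h" for w
    using assms by (simp add: G1_def G3_def inner_commute field_simps power2_eq_square power3_eq_cube)
  ultimately show ?thesis by simp
qed

text \<open>This is the heat equation, since \<open>lap_gauss\<close> is also the Laplacian in space
  by \<open>lap_gauss_eq\<close>.\<close>

lemma gauss_time_deriv:
  assumes "0 < s"
  shows "((\<lambda>s. gauss s z) has_real_derivative lap_gauss s z) (at s)"
proof -
  have "((\<lambda>s. (4 * pi * s) powr (- 3 / 2)) has_real_derivative (- 3 / 2) * (4 * pi * s) powr (- 3 / 2 - 1) * (4 * pi)) (at s)"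
    using assms by (auto intro!: derivative_eq_intros)
  moreover have "(4 * pi * s) powr (- 3 / 2 - 1) * (4 * pi) = (4 * pi * s) powr (- 3 / 2) / s"
    using assms powr_mult_base[of "4 * pi * s" "- 3 / 2 - 1"] by (simp add: field_simps)
  ultimately have 1: "((\<lambda>s. (4 * pi * s) powr (- 3 / 2)) has_real_derivative - 3 / (2 * s) * (4 * pi * s) powr (- 3 / 2)) (at s)"
    by (elim DERIV_cong) (simp only: mult.assoc, simp)
  have 2: "((\<lambda>s. exp (- (z \<bullet> z) / (4 * s))) has_real_derivative exp (- (z \<bullet> z) / (4 * s)) * ((z \<bullet> z) / (4 * s\<^sup>2))) (at s)"
    using assms by (auto intro!: derivative_eq_intros simp: power2_eq_square)
  show ?thesis
    using DERIV_mult[OF 1 2] unfolding gauss_def lap_gauss_def by (simp add: algebra_simps)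
qed

lemma oseen_has_deriv:
  assumes "0 < s"
  shows "((\<lambda>r. oseen s (z + r *\<^sub>R h) a) has_vector_derivative oseen_deriv s (z + r *\<^sub>R h) a h) (at r)"
proof -
  let ?w = "\<lambda>r. z + r *\<^sub>R h"
  have w: "(?w has_vector_derivative h) (at r)"
    by (auto intro!: derivative_eq_intros simp: has_vector_derivative_def)
  have 1: "((\<lambda>r. oseen1 s (?w r) a) has_real_derivative
     (((2 * (?w r \<bullet> h) * (?w r \<bullet> a) + (?w r \<bullet> ?w r) * (h \<bullet> a)) / (8 * s ^ 3) - 3 * (h \<bullet> a) / (4 * s\<^sup>2)) * gauss s (?w r)
      + G1 s (?w r) h * ((?w r \<bullet> ?w r) * (?w r \<bullet> a) / (8 * s ^ 3) - 3 * (?w r \<bullet> a) / (4 * s\<^sup>2)))) (at r)"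
    unfolding oseen1_def
    by (intro DERIV_mult gauss_deriv assms,
        rule DERIV_cong, (rule DERIV_mult DERIV_diff DERIV_cdivide DERIV_const line_derivs)+)
       (simp add: algebra_simps add_divide_distrib)
  have 2: "((\<lambda>r. oseen2 s (?w r) a) has_real_derivative
     ((- 2 * (?w r \<bullet> a) * (h \<bullet> a) / (8 * s ^ 3)) * gauss s (?w r)
      + G1 s (?w r) h * (- (?w r \<bullet> a)\<^sup>2 / (8 * s ^ 3) + (a \<bullet> a) / (4 * s\<^sup>2)))) (at r)"
    unfolding oseen2_def power2_eq_square[of "_ \<bullet> a"]
    by (intro DERIV_mult gauss_deriv assms,
        rule DERIV_cong, (rule DERIV_mult DERIV_add DERIV_minus DERIV_cdivide DERIV_const line_derivs)+)
       (simp add: algebra_simps add_divide_distrib)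
  show ?thesis
    unfolding oseen_def
    using has_vector_derivative_add[OF has_vector_derivative_scaleR[OF 1 has_vector_derivative_const[of a]]
       has_vector_derivative_scaleR[OF 2 w]]
    by (simp add: oseen_deriv_def oseen_def algebra_simps)
qed

section \<open>Pointwise bounds for the kernels and their increments\<close>

lemma powr_neg_32: "0 < s \<Longrightarrow> s powr (- 3 / 2) = sqrt s / s\<^sup>2" for s :: real
proof -
  assume s: "0 < s"
  have "sqrt s / s\<^sup>2 = s powr (1/2 - 2)"
    using s by (simp only: powr_diff) (simp add: powr_half_sqrt powr_numeral)
  then show ?thesis by simp
qed

lemma power_gauss_bounds:
  assumes s: "0 < s"
  shows "gauss s z \<le> 3 * gauss (2 * s) z"
    "norm z * gauss s z \<le> 12 * sqrt s * gauss (2 * s) z"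
    "(norm z)\<^sup>2 * gauss s z \<le> 48 * s * gauss (2 * s) z"
    "norm z ^ 3 * gauss s z \<le> 192 * (s * sqrt s) * gauss (2 * s) z"
    "norm z ^ 4 * gauss s z \<le> 768 * s\<^sup>2 * gauss (2 * s) z"
proof -
  have "sqrt s ^ 3 = s * sqrt s" "sqrt s ^ 4 = s\<^sup>2" "(sqrt s)\<^sup>2 = s"
    using s by (simp_all add: power3_eq_cube power4_eq_xxxx power2_eq_square)
  then show "gauss s z \<le> 3 * gauss (2 * s) z"
    "norm z * gauss s z \<le> 12 * sqrt s * gauss (2 * s) z"
    "(norm z)\<^sup>2 * gauss s z \<le> 48 * s * gauss (2 * s) z"
    "norm z ^ 3 * gauss s z \<le> 192 * (s * sqrt s) * gauss (2 * s) z"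
    "norm z ^ 4 * gauss s z \<le> 768 * s\<^sup>2 * gauss (2 * s) z"
    using norm_power_gauss_le[OF s, of 0 z] norm_power_gauss_le[OF s, of 1 z] norm_power_gauss_le[OF s, of 2 z]
      norm_power_gauss_le[OF s, of 3 z] norm_power_gauss_le[OF s, of 4 z] by simp_all
qed

text \<open>The nonlinearity is quadratic, and every difference of quadratic terms has a factor a -
  b. On this rests the local Lipschitz bound that makes the iteration contract.\<close>

lemma abs_quad_diff:
  fixes a b z :: "'a::real_inner"
  shows "\<bar>(z \<bullet> a)\<^sup>2 - (z \<bullet> b)\<^sup>2\<bar> \<le> norm z ^ 2 * (norm (a - b) * (norm a + norm b))"
    and "\<bar>a \<bullet> a - b \<bullet> b\<bar> \<le> norm (a - b) * (norm a + norm b)"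
    and "norm ((z \<bullet> a) *\<^sub>R a - (z \<bullet> b) *\<^sub>R b) \<le> norm z * (norm (a - b) * (norm a + norm b))"
proof -
  have "(z \<bullet> a)\<^sup>2 - (z \<bullet> b)\<^sup>2 = (z \<bullet> (a - b)) * (z \<bullet> (a + b))"
    by (simp add: inner_diff_right inner_add_right power2_eq_square algebra_simps)
  also have "\<bar>\<dots>\<bar> \<le> (norm z * norm (a - b)) * (norm z * norm (a + b))"
    unfolding abs_mult by (intro mult_mono Cauchy_Schwarz_ineq2) auto
  also have "\<dots> \<le> (norm z * norm (a - b)) * (norm z * (norm a + norm b))"
    by (intro mult_left_mono norm_triangle_ineq) auto
  finally show "\<bar>(z \<bullet> a)\<^sup>2 - (z \<bullet> b)\<^sup>2\<bar> \<le> norm z ^ 2 * (norm (a - b) * (norm a + norm b))"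
    by (simp add: power2_eq_square mult_ac)
  have "a \<bullet> a - b \<bullet> b = (a - b) \<bullet> (a + b)"
    by (simp add: inner_diff_left inner_add_right inner_commute[of b a])
  also have "\<bar>\<dots>\<bar> \<le> norm (a - b) * norm (a + b)"
    by (rule Cauchy_Schwarz_ineq2)
  also have "\<dots> \<le> norm (a - b) * (norm a + norm b)"
    by (intro mult_left_mono norm_triangle_ineq) auto
  finally show "\<bar>a \<bullet> a - b \<bullet> b\<bar> \<le> norm (a - b) * (norm a + norm b)" .
  have "(z \<bullet> a) *\<^sub>R a - (z \<bullet> b) *\<^sub>R b = (z \<bullet> (a - b)) *\<^sub>R a + (z \<bullet> b) *\<^sub>R (a - b)"
    by (simp add: inner_diff_right algebra_simps)
  also have "norm \<dots> \<le> \<bar>z \<bullet> (a - b)\<bar> * norm a + \<bar>z \<bullet> b\<bar> * norm (a - b)"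
    using norm_triangle_ineq[of "(z \<bullet> (a - b)) *\<^sub>R a" "(z \<bullet> b) *\<^sub>R (a - b)"] by simp
  also have "\<dots> \<le> (norm z * norm (a - b)) * norm a + (norm z * norm b) * norm (a - b)"
    by (intro add_mono mult_right_mono Cauchy_Schwarz_ineq2) auto
  finally show "norm ((z \<bullet> a) *\<^sub>R a - (z \<bullet> b) *\<^sub>R b) \<le> norm z * (norm (a - b) * (norm a + norm b))"
    by (simp add: algebra_simps)
qed

text \<open>Once the quadratic difference is factored out, a cubic and a linear term in |z| remain;
  their constants 192/4 and 12 add up to 60. The case \<open>b = 0\<close> is the size bound
  \<open>oseen_le\<close>.\<close>

lemma oseen_diff_le:
  assumes s: "0 < s"
  shows "norm (oseen s z a - oseen s z b) \<le> 60 * (norm (a - b) * (norm a + norm b)) * (s powr (- 3 / 2) * gauss (2 * s) z)"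
proof -
  define e where "e = norm (a - b) * (norm a + norm b)"
  define g where "g = gauss s z"
  have e: "0 \<le> e" and g: "0 \<le> g" by (auto simp: e_def g_def)
  have eq: "oseen s z a - oseen s z b =
     (((z \<bullet> z) / (8 * s ^ 3) - 3 / (4 * s\<^sup>2)) * g) *\<^sub>R ((z \<bullet> a) *\<^sub>R a - (z \<bullet> b) *\<^sub>R b)
     + ((- ((z \<bullet> a)\<^sup>2 - (z \<bullet> b)\<^sup>2) / (8 * s ^ 3) + (a \<bullet> a - b \<bullet> b) / (4 * s\<^sup>2)) * g) *\<^sub>R z"
    by (simp add: oseen_def oseen1_def oseen2_def g_def algebra_simps diff_divide_distrib add_divide_distrib)
  have "norm (oseen s z a - oseen s z b) \<le> \<bar>((z \<bullet> z) / (8 * s ^ 3) - 3 / (4 * s\<^sup>2)) * g\<bar> * norm ((z \<bullet> a) *\<^sub>R a - (z \<bullet> b) *\<^sub>R b)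
     + \<bar>(- ((z \<bullet> a)\<^sup>2 - (z \<bullet> b)\<^sup>2) / (8 * s ^ 3) + (a \<bullet> a - b \<bullet> b) / (4 * s\<^sup>2)) * g\<bar> * norm z"
    unfolding eq by (intro order_trans[OF norm_triangle_ineq]) simp
  also have "\<dots> \<le> (((norm z)\<^sup>2 / (8 * s ^ 3) + 3 / (4 * s\<^sup>2)) * g) * (norm z * e)
     + ((norm z ^ 2 * e / (8 * s ^ 3) + e / (4 * s\<^sup>2)) * g) * norm z"
  proof (rule add_mono[OF mult_mono mult_right_mono])
    have "\<bar>(z \<bullet> z) / (8 * s ^ 3) - 3 / (4 * s\<^sup>2)\<bar> \<le> (norm z)\<^sup>2 / (8 * s ^ 3) + 3 / (4 * s\<^sup>2)"
      using s by (intro order_trans[OF abs_triangle_ineq4]) (simp add: power2_norm_eq_inner)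
    then show "\<bar>((z \<bullet> z) / (8 * s ^ 3) - 3 / (4 * s\<^sup>2)) * g\<bar> \<le> ((norm z)\<^sup>2 / (8 * s ^ 3) + 3 / (4 * s\<^sup>2)) * g"
      using g by (simp add: abs_mult mult_right_mono)
    have "\<bar>- ((z \<bullet> a)\<^sup>2 - (z \<bullet> b)\<^sup>2) / (8 * s ^ 3) + (a \<bullet> a - b \<bullet> b) / (4 * s\<^sup>2)\<bar>
      \<le> \<bar>(z \<bullet> a)\<^sup>2 - (z \<bullet> b)\<^sup>2\<bar> / (8 * s ^ 3) + \<bar>a \<bullet> a - b \<bullet> b\<bar> / (4 * s\<^sup>2)"
      using s by (intro order_trans[OF abs_triangle_ineq]) (simp add: abs_minus_commute)
    also have "\<dots> \<le> norm z ^ 2 * e / (8 * s ^ 3) + e / (4 * s\<^sup>2)"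
      unfolding e_def using s by (intro add_mono divide_right_mono abs_quad_diff) auto
    finally show "\<bar>(- ((z \<bullet> a)\<^sup>2 - (z \<bullet> b)\<^sup>2) / (8 * s ^ 3) + (a \<bullet> a - b \<bullet> b) / (4 * s\<^sup>2)) * g\<bar>
      \<le> (norm z ^ 2 * e / (8 * s ^ 3) + e / (4 * s\<^sup>2)) * g"
      using g by (simp add: abs_mult mult_right_mono)
    show "norm ((z \<bullet> a) *\<^sub>R a - (z \<bullet> b) *\<^sub>R b) \<le> norm z * e"
      unfolding e_def by (rule abs_quad_diff)
  qed (use s g e in auto)
  also have "\<dots> = e * ((norm z ^ 3 * g) / (4 * s ^ 3) + (norm z * g) / s\<^sup>2)"
    by (simp add: field_simps power2_eq_square power3_eq_cube)
  also have "\<dots> \<le> e * ((192 * (s * sqrt s) * gauss (2 * s) z) / (4 * s ^ 3) + (12 * sqrt s * gauss (2 * s) z) / s\<^sup>2)"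
    unfolding g_def using s e power_gauss_bounds[OF s, of z]
    by (intro mult_left_mono add_mono divide_right_mono) auto
  also have "\<dots> = 60 * e * (s powr (- 3 / 2) * gauss (2 * s) z)"
    unfolding powr_neg_32[OF s] using s by (simp add: field_simps power2_eq_square power3_eq_cube)
  finally show ?thesis by (simp add: e_def)
qed

lemma oseen_le:
  assumes s: "0 < s"
  shows "norm (oseen s z a) \<le> 60 * (norm a)\<^sup>2 * (s powr (- 3 / 2) * gauss (2 * s) z)"
  using oseen_diff_le[OF s, of z a 0] unfolding oseen_0 diff_0_right norm_zero add_0_right power2_eq_square .

text \<open>The kernel factor is left as it is because it is used in two ways: with a plain power
  bound in \<open>G2_le\<close>, and with an extra factor sqrt |z| in
  \<open>G2_diff_sqrt_le\<close>.\<close>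

lemma G2_diff_le:
  "\<bar>G2 s z a a - G2 s z b b\<bar> \<le> norm (a - b) * (norm a + norm b) * (((norm z)\<^sup>2 / (4 * s\<^sup>2) + 1 / (2 * s)) * gauss s z)"
  if s: "0 < s"
proof -
  define e where "e = norm (a - b) * (norm a + norm b)"
  have "G2 s z a a - G2 s z b b = (((z \<bullet> a)\<^sup>2 - (z \<bullet> b)\<^sup>2) / (4 * s\<^sup>2) - (a \<bullet> a - b \<bullet> b) / (2 * s)) * gauss s z"
    by (simp add: G2_def power2_eq_square algebra_simps diff_divide_distrib)
  also have "\<bar>\<dots>\<bar> \<le> (\<bar>(z \<bullet> a)\<^sup>2 - (z \<bullet> b)\<^sup>2\<bar> / (4 * s\<^sup>2) + \<bar>a \<bullet> a - b \<bullet> b\<bar> / (2 * s)) * gauss s z"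
    unfolding abs_mult using s by (intro mult_mono order_trans[OF abs_triangle_ineq4]) auto
  also have "\<dots> \<le> (norm z ^ 2 * e / (4 * s\<^sup>2) + e / (2 * s)) * gauss s z"
    unfolding e_def using s by (intro mult_right_mono add_mono divide_right_mono abs_quad_diff) auto
  finally show ?thesis by (simp add: e_def algebra_simps add_divide_distrib)
qed

lemma G2_le:
  assumes s: "0 < s"
  shows "\<bar>G2 s z a a\<bar> \<le> 14 * (norm a)\<^sup>2 * (gauss (2 * s) z / s)"
proof -
  have "\<bar>G2 s z a a\<bar> \<le> (norm a)\<^sup>2 * (((norm z)\<^sup>2 / (4 * s\<^sup>2) + 1 / (2 * s)) * gauss s z)"
    using G2_diff_le[OF s, of z a 0] unfolding G2_0 diff_0_right norm_zero add_0_right power2_eq_square[of "norm a"] .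
  also have "\<dots> = (norm a)\<^sup>2 * (((norm z)\<^sup>2 * gauss s z) / (4 * s\<^sup>2) + gauss s z / (2 * s))"
    by (simp add: algebra_simps)
  also have "\<dots> \<le> (norm a)\<^sup>2 * ((48 * s * gauss (2 * s) z) / (4 * s\<^sup>2) + 3 * gauss (2 * s) z / (2 * s))"
    using s by (intro mult_left_mono add_mono divide_right_mono power_gauss_bounds) auto
  also have "\<dots> = 13.5 * ((norm a)\<^sup>2 * (gauss (2 * s) z / s))"
    using s by (simp add: field_simps power2_eq_square)
  also have "\<dots> \<le> 14 * ((norm a)\<^sup>2 * (gauss (2 * s) z / s))"
    using s by (intro mult_right_mono) auto
  finally show ?thesis by simp
qed

text \<open>The extra factor \<open>sqrt (norm z)\<close> makes up for the singularity \<open>1 / s\<close> at \<open>s = 0\<close>.\<close>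

lemma G2_diff_sqrt_le:
  assumes s: "0 < s" and L: "norm (a - b) \<le> L * sqrt (norm z)" "0 \<le> L"
  shows "\<bar>G2 s z a a - G2 s z b b\<bar> \<le> 68 * L * (norm a + norm b) * (s powr (- 3 / 4) * gauss (2 * s) z)"
proof -
  have sq: "sqrt (norm z) \<le> sqrt (sqrt s) * (1 + norm z / sqrt s)"
  proof -
    have "sqrt (norm z) = sqrt (sqrt s) * sqrt (norm z / sqrt s)"
      using s by (simp add: real_sqrt_mult[symmetric])
    also have "sqrt (norm z / sqrt s) \<le> 1 + norm z / sqrt s"
    proof (rule real_le_lsqrt)
      have "0 \<le> norm z / sqrt s" using s by simp
      then show "norm z / sqrt s \<le> (1 + norm z / sqrt s)\<^sup>2"
        using zero_le_power2[of "norm z / sqrt s"] unfolding power2_sum one_power2 mult_1_right by linarith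
    qed (use s in auto)
    finally show ?thesis using s by simp
  qed
  have "norm (a - b) \<le> L * (sqrt (sqrt s) * (1 + norm z / sqrt s))"
    using L sq by (meson mult_left_mono order_trans)
  then have "norm (a - b) * (norm a + norm b) * (((norm z)\<^sup>2 / (4 * s\<^sup>2) + 1 / (2 * s)) * gauss s z)
     \<le> L * (sqrt (sqrt s) * (1 + norm z / sqrt s)) * (norm a + norm b) * (((norm z)\<^sup>2 / (4 * s\<^sup>2) + 1 / (2 * s)) * gauss s z)"
    using s by (intro mult_right_mono) auto
  also have "\<dots> = L * (norm a + norm b) * sqrt (sqrt s) *
     (((norm z)\<^sup>2 * gauss s z) / (4 * s\<^sup>2) + gauss s z / (2 * s) + (norm z ^ 3 * gauss s z) / (4 * s\<^sup>2 * sqrt s) + (norm z * gauss s z) / (2 * s * sqrt s))"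
    using s by (simp add: field_simps power2_eq_square power3_eq_cube)
  also have "\<dots> \<le> L * (norm a + norm b) * sqrt (sqrt s) *
     ((48 * s * gauss (2 * s) z) / (4 * s\<^sup>2) + (3 * gauss (2 * s) z) / (2 * s) + (192 * (s * sqrt s) * gauss (2 * s) z) / (4 * s\<^sup>2 * sqrt s) + (12 * sqrt s * gauss (2 * s) z) / (2 * s * sqrt s))"
    using s L by (intro mult_left_mono add_mono divide_right_mono power_gauss_bounds) auto
  also have "\<dots> = 67.5 * (L * (norm a + norm b) * (sqrt (sqrt s) / s * gauss (2 * s) z))"
    using s by (simp add: field_simps power2_eq_square)
  also have "\<dots> \<le> 68 * (L * (norm a + norm b) * (sqrt (sqrt s) / s * gauss (2 * s) z))"
    using s L by (intro mult_right_mono) auto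
  also have "sqrt (sqrt s) / s = s powr (- 3 / 4)"
  proof -
    have "sqrt (sqrt s) / s = s powr (1/4 - 1)"
      using s by (simp only: powr_diff) (simp add: powr_half_sqrt[symmetric] powr_powr)
    then show ?thesis by simp
  qed
  finally show ?thesis
    using G2_diff_le[OF s, of z a b] by (simp add: mult.assoc)
qed

lemma lap_gauss_le:
  assumes s: "0 < s"
  shows "\<bar>lap_gauss s z\<bar> \<le> 17 * (gauss (2 * s) z / s)"
proof -
  have "\<bar>lap_gauss s z\<bar> \<le> ((norm z)\<^sup>2 / (4 * s\<^sup>2) + 3 / (2 * s)) * gauss s z"
    unfolding lap_gauss_def abs_mult using s
    by (intro mult_mono order_trans[OF abs_triangle_ineq4]) (auto simp: power2_norm_eq_inner)
  also have "\<dots> = ((norm z)\<^sup>2 * gauss s z) / (4 * s\<^sup>2) + 3 * gauss s z / (2 * s)"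
    by (simp add: algebra_simps)
  also have "\<dots> \<le> (48 * s * gauss (2 * s) z) / (4 * s\<^sup>2) + 3 * (3 * gauss (2 * s) z) / (2 * s)"
    using s by (intro add_mono divide_right_mono mult_left_mono power_gauss_bounds) auto
  also have "\<dots> = 16.5 * (gauss (2 * s) z / s)"
    using s by (simp add: field_simps power2_eq_square)
  also have "\<dots> \<le> 17 * (gauss (2 * s) z / s)"
    using s by (intro mult_right_mono) auto
  finally show ?thesis by simp
qed

lemma G1_le:
  assumes s: "0 < s"
  shows "\<bar>G1 s z h\<bar> \<le> 6 * (norm h / sqrt s) * gauss (2 * s) z"
proof -
  have "\<bar>G1 s z h\<bar> \<le> (norm z * norm h / (2 * s)) * gauss s z"
    unfolding G1_def abs_mult using s Cauchy_Schwarz_ineq2[of z h]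
    by (intro mult_mono) (auto simp: divide_right_mono)
  also have "\<dots> = (norm h / (2 * s)) * (norm z * gauss s z)" by simp
  also have "\<dots> \<le> (norm h / (2 * s)) * (12 * sqrt s * gauss (2 * s) z)"
    using s by (intro mult_left_mono power_gauss_bounds) auto
  also have "\<dots> = 6 * (norm h / sqrt s) * gauss (2 * s) z"
    using s by (simp add: field_simps)
  finally show ?thesis .
qed

text \<open>One more derivative costs one more factor 1 / sqrt s. The constant is 1.25 * 48 + 3 +
  768/8 = 159, rounded up, from the terms of order 2, 0 and 4 in |z|.\<close>

lemma oseen_deriv_le:
  assumes s: "0 < s"
  shows "norm (oseen_deriv s z a h) \<le> 160 * (norm a)\<^sup>2 * s powr (- 3 / 2) * (norm h / sqrt s) * gauss (2 * s) z"
proof -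
  define n where "n = norm z" define A where "A = norm a" define H where "H = norm h" define g where "g = gauss s z"
  have nn: "0 \<le> n" "0 \<le> A" "0 \<le> H" "0 \<le> g" by (auto simp: n_def A_def H_def g_def)
  have za: "\<bar>z \<bullet> a\<bar> \<le> n * A" and zh: "\<bar>z \<bullet> h\<bar> \<le> n * H" and ha: "\<bar>h \<bullet> a\<bar> \<le> H * A"
    using Cauchy_Schwarz_ineq2 by (auto simp: n_def A_def H_def)
  have zz: "z \<bullet> z = n\<^sup>2" and aa: "a \<bullet> a = A\<^sup>2" by (auto simp: n_def A_def power2_norm_eq_inner)
  have za2: "(z \<bullet> a)\<^sup>2 \<le> (n * A)\<^sup>2" using za by (metis abs_ge_zero power2_abs power_mono)
  have g1: "\<bar>G1 s z h\<bar> \<le> n * H / (2 * s) * g"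
    unfolding G1_def abs_mult g_def using s zh by (intro mult_mono) (auto simp: divide_right_mono)
  have p1: "\<bar>(2 * (z \<bullet> h) * (z \<bullet> a) + (z \<bullet> z) * (h \<bullet> a)) / (8 * s ^ 3) - 3 * (h \<bullet> a) / (4 * s\<^sup>2)\<bar>
     \<le> 3 * n\<^sup>2 * H * A / (8 * s ^ 3) + 3 * (H * A) / (4 * s\<^sup>2)"
  proof -
    have 1: "\<bar>2 * (z \<bullet> h) * (z \<bullet> a)\<bar> \<le> 2 * ((n * H) * (n * A))"
      using mult_mono[OF zh za] nn by (simp add: abs_mult)
    have 2: "\<bar>(z \<bullet> z) * (h \<bullet> a)\<bar> \<le> n\<^sup>2 * (H * A)"
      using mult_left_mono[OF ha, of "n\<^sup>2"] by (simp add: abs_mult zz)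
    have "\<bar>2 * (z \<bullet> h) * (z \<bullet> a) + (z \<bullet> z) * (h \<bullet> a)\<bar> \<le> 3 * n\<^sup>2 * H * A"
      using 1 2 by (simp add: power2_eq_square algebra_simps)
    then have 3: "\<bar>(2 * (z \<bullet> h) * (z \<bullet> a) + (z \<bullet> z) * (h \<bullet> a)) / (8 * s ^ 3)\<bar> \<le> 3 * n\<^sup>2 * H * A / (8 * s ^ 3)"
      using s by (simp add: divide_right_mono)
    have 4: "\<bar>3 * (h \<bullet> a) / (4 * s\<^sup>2)\<bar> \<le> 3 * (H * A) / (4 * s\<^sup>2)"
      using ha by (simp add: abs_mult divide_right_mono)
    show ?thesis using 3 4 by linarith
  qed
  have p2: "\<bar>(z \<bullet> z) * (z \<bullet> a) / (8 * s ^ 3) - 3 * (z \<bullet> a) / (4 * s\<^sup>2)\<bar> \<le> n\<^sup>2 * (n * A) / (8 * s ^ 3) + 3 * (n * A) / (4 * s\<^sup>2)"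
  proof -
    have 3: "\<bar>(z \<bullet> z) * (z \<bullet> a) / (8 * s ^ 3)\<bar> \<le> n\<^sup>2 * (n * A) / (8 * s ^ 3)"
      using s mult_left_mono[OF za, of "n\<^sup>2"] by (simp add: abs_mult zz divide_right_mono)
    have 4: "\<bar>3 * (z \<bullet> a) / (4 * s\<^sup>2)\<bar> \<le> 3 * (n * A) / (4 * s\<^sup>2)"
      using za by (simp add: abs_mult divide_right_mono)
    show ?thesis using 3 4 by linarith
  qed
  have p3: "\<bar>- 2 * (z \<bullet> a) * (h \<bullet> a) / (8 * s ^ 3)\<bar> \<le> 2 * (n * A) * (H * A) / (8 * s ^ 3)"
  proof -
    have "\<bar>(z \<bullet> a) * (h \<bullet> a)\<bar> \<le> (n * A) * (H * A)"
      unfolding abs_mult using za ha nn by (intro mult_mono) auto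
    then have "2 * \<bar>(z \<bullet> a) * (h \<bullet> a)\<bar> / (8 * s ^ 3) \<le> 2 * ((n * A) * (H * A)) / (8 * s ^ 3)"
      using s by (intro divide_right_mono mult_left_mono) auto
    then show ?thesis using s by (simp add: abs_mult mult.assoc)
  qed
  have p4: "\<bar>- (z \<bullet> a)\<^sup>2 / (8 * s ^ 3) + (a \<bullet> a) / (4 * s\<^sup>2)\<bar> \<le> (n * A)\<^sup>2 / (8 * s ^ 3) + A\<^sup>2 / (4 * s\<^sup>2)"
  proof -
    have 3: "\<bar>- (z \<bullet> a)\<^sup>2 / (8 * s ^ 3)\<bar> \<le> (n * A)\<^sup>2 / (8 * s ^ 3)"
      using s za2 by (simp add: divide_right_mono)
    have 4: "\<bar>(a \<bullet> a) / (4 * s\<^sup>2)\<bar> \<le> A\<^sup>2 / (4 * s\<^sup>2)" by (simp add: aa)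
    show ?thesis using 3 4 by linarith
  qed
  let ?P1 = "3 * n\<^sup>2 * H * A / (8 * s ^ 3) + 3 * (H * A) / (4 * s\<^sup>2)"
  let ?P2 = "n\<^sup>2 * (n * A) / (8 * s ^ 3) + 3 * (n * A) / (4 * s\<^sup>2)"
  let ?P3 = "2 * (n * A) * (H * A) / (8 * s ^ 3)"
  let ?P4 = "(n * A)\<^sup>2 / (8 * s ^ 3) + A\<^sup>2 / (4 * s\<^sup>2)"
  have P: "0 \<le> ?P1" "0 \<le> ?P2" "0 \<le> ?P3" "0 \<le> ?P4" using nn s by auto
  have "norm (oseen_deriv s z a h) \<le> (?P1 * g + ?P2 * (n * H / (2 * s) * g)) * A + (?P3 * g + ?P4 * (n * H / (2 * s) * g)) * n + ?P4 * g * H"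
  proof -
    have t1: "\<bar>((2 * (z \<bullet> h) * (z \<bullet> a) + (z \<bullet> z) * (h \<bullet> a)) / (8 * s ^ 3) - 3 * (h \<bullet> a) / (4 * s\<^sup>2)) * gauss s z\<bar> \<le> ?P1 * g"
      using mult_right_mono[OF p1 nn(4)] nn(4) unfolding abs_mult[of _ "gauss s z"] g_def by linarith
    have t2: "\<bar>((z \<bullet> z) * (z \<bullet> a) / (8 * s ^ 3) - 3 * (z \<bullet> a) / (4 * s\<^sup>2)) * G1 s z h\<bar> \<le> ?P2 * (n * H / (2 * s) * g)"
      unfolding abs_mult[of _ "G1 s z h"] by (rule mult_mono[OF p2 g1 P(2)]) simp
    have t3: "\<bar>- 2 * (z \<bullet> a) * (h \<bullet> a) / (8 * s ^ 3) * gauss s z\<bar> \<le> ?P3 * g"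
      using mult_right_mono[OF p3 nn(4)] nn(4) unfolding abs_mult[of _ "gauss s z"] g_def by linarith
    have t4: "\<bar>(- (z \<bullet> a)\<^sup>2 / (8 * s ^ 3) + (a \<bullet> a) / (4 * s\<^sup>2)) * G1 s z h\<bar> \<le> ?P4 * (n * H / (2 * s) * g)"
      unfolding abs_mult[of _ "G1 s z h"] by (rule mult_mono[OF p4 g1 P(4)]) simp
    have t5: "\<bar>oseen2 s z a\<bar> \<le> ?P4 * g"
      using mult_right_mono[OF p4 nn(4)] nn(4) unfolding oseen2_def abs_mult[of _ "gauss s z"] g_def by linarith
    have tri: "norm (u *\<^sub>R a + v *\<^sub>R z + w *\<^sub>R h) \<le> \<bar>u\<bar> * A + \<bar>v\<bar> * n + \<bar>w\<bar> * H" for u v w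
      using norm_triangle_ineq[of "u *\<^sub>R a + v *\<^sub>R z" "w *\<^sub>R h"] norm_triangle_ineq[of "u *\<^sub>R a" "v *\<^sub>R z"]
      by (simp add: A_def n_def H_def)
    show ?thesis
      unfolding oseen_deriv_def
      by (rule order_trans[OF tri], intro add_mono mult_right_mono order_trans[OF abs_triangle_ineq] t1 t2 t3 t4 t5 nn)
  qed
  also have "\<dots> = A\<^sup>2 * H * (1.25 * (n\<^sup>2 * g) / s ^ 3 + g / s\<^sup>2 + (n ^ 4 * g) / (8 * s ^ 4))"
    using s by (simp add: field_simps power2_eq_square power3_eq_cube power4_eq_xxxx)
  also have "\<dots> \<le> A\<^sup>2 * H * (1.25 * (48 * s * gauss (2 * s) z) / s ^ 3 + (3 * gauss (2 * s) z) / s\<^sup>2 + (768 * s\<^sup>2 * gauss (2 * s) z) / (8 * s ^ 4))"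
    unfolding n_def g_def using s nn power_gauss_bounds[OF s, of z]
    by (intro mult_left_mono add_mono divide_right_mono) auto
  also have "\<dots> = 159 * (A\<^sup>2 * H * (gauss (2 * s) z / s\<^sup>2))"
    using s by (simp add: field_simps power2_eq_square power3_eq_cube power4_eq_xxxx)
  also have "\<dots> \<le> 160 * (A\<^sup>2 * H * (gauss (2 * s) z / s\<^sup>2))"
    using s nn by (intro mult_right_mono) auto
  also have "\<dots> = 160 * A\<^sup>2 * s powr (- 3 / 2) * (H / sqrt s) * gauss (2 * s) z"
    unfolding powr_neg_32[OF s] using s by simp
  finally show ?thesis by (simp add: A_def H_def)
qed

text \<open>An interpolation between size and derivative. With q = |h| / sqrt s, the mean value
  theorem gives a factor q if q \<le> 1 and the triangle inequality a factor 1 otherwise; both are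
  at most sqrt q. The full power q would be useless: for \<open>oseen\<close> it leaves
  \<sigma>^(-2), whose integral over \<sigma> > t - s is 1/(t - s) and not integrable in s, whereas
  half a power leaves the integrable (t - s)^(-3/4).\<close>

lemma kernel_shift_le:
  fixes k k' :: "space \<Rightarrow> 'b::real_inner"
  assumes s: "0 < s" and A: "0 \<le> A"
    and bnd: "\<And>z. norm (k z) \<le> A * gauss (2 * s) z"
    and der: "\<And>z r. ((\<lambda>r. k (z + r *\<^sub>R h)) has_vector_derivative k' (z + r *\<^sub>R h)) (at r)"
    and bnd': "\<And>z. norm (k' z) \<le> A * (norm h / sqrt s) * gauss (2 * s) z"
  shows "norm (k (z + h) - k z)
    \<le> 6 * A * sqrt (norm h / sqrt s) * (gauss (2 * s) (z + h) + gauss (2 * s) z + gauss (4 * s) z)"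
proof -
  define q where "q = norm h / sqrt s"
  have q: "0 \<le> q" using s by (simp add: q_def)
  show ?thesis
  proof (cases "norm h \<le> sqrt s")
    case True
    then have "q \<le> 1" using s by (simp add: q_def)
    then have qq: "q \<le> sqrt q" using q by (simp add: real_le_rsqrt power2_eq_square mult_left_le)
    have "\<exists>r\<in>{0<..<1}. norm (k (z + 1 *\<^sub>R h) - k (z + 0 *\<^sub>R h)) \<le> norm ((1 - 0) *\<^sub>R k' (z + r *\<^sub>R h))"
      using der by (intro mvt_general[where f'="\<lambda>r t. t *\<^sub>R k' (z + r *\<^sub>R h)"])
        (auto simp: has_vector_derivative_def intro!: continuous_at_imp_continuous_on has_vector_derivative_continuous[OF der])
    then obtain r where r: "0 < r" "r < 1" "norm (k (z + h) - k z) \<le> norm (k' (z + r *\<^sub>R h))"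
      by auto
    have "norm (r *\<^sub>R h) \<le> sqrt s"
      using r True mult_right_mono[of r 1 "norm h"] by simp
    then have "gauss (2 * s) (z + r *\<^sub>R h) \<le> 6 * gauss (4 * s) z"
      by (rule gauss_nearby[OF s])
    then have "A * q * gauss (2 * s) (z + r *\<^sub>R h) \<le> A * sqrt q * (6 * gauss (4 * s) z)"
      using A q qq by (intro mult_mono) auto
    then have "norm (k (z + h) - k z) \<le> 6 * A * sqrt q * gauss (4 * s) z"
      using r(3) bnd'[of "z + r *\<^sub>R h"] by (simp add: q_def)
    also have "\<dots> \<le> 6 * A * sqrt q * (gauss (2 * s) (z + h) + gauss (2 * s) z + gauss (4 * s) z)"
      using A q by (intro mult_left_mono) auto
    finally show ?thesis by (simp add: q_def)
  next
    case False
    then have "1 \<le> sqrt q" using s by (simp add: q_def)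
    have "norm (k (z + h) - k z) \<le> A * (gauss (2 * s) (z + h) + gauss (2 * s) z)"
      using bnd[of "z + h"] bnd[of z] norm_triangle_ineq4[of "k (z + h)" "k z"] by (simp add: algebra_simps)
    also have "\<dots> \<le> (6 * A * sqrt q) * (gauss (2 * s) (z + h) + gauss (2 * s) z + gauss (4 * s) z)"
    proof (rule mult_mono)
      show "A \<le> 6 * A * sqrt q"
        using mult_left_mono[of 1 "6 * sqrt q" A] A \<open>1 \<le> sqrt q\<close> by simp
    qed (use A q in auto)
    finally show ?thesis by (simp add: q_def)
  qed
qed

lemma gauss_shift_le:
  assumes s: "0 < s"
  shows "\<bar>gauss s (z + h) - gauss s z\<bar>
    \<le> 36 * sqrt (norm h / sqrt s) * (gauss (2 * s) (z + h) + gauss (2 * s) z + gauss (4 * s) z)"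
proof -
  have "norm (gauss s (z + h) - gauss s z)
      \<le> 6 * 6 * sqrt (norm h / sqrt s) * (gauss (2 * s) (z + h) + gauss (2 * s) z + gauss (4 * s) z)"
  proof (rule kernel_shift_le[OF s])
    show "norm (gauss s z) \<le> 6 * gauss (2 * s) z" for z
    proof -
      have "gauss s z \<le> 3 * gauss (2 * s) z" "0 \<le> gauss (2 * s) z" "0 \<le> gauss s z"
        using power_gauss_bounds(1)[OF s, of z] by auto
      then show ?thesis unfolding real_norm_def by linarith
    qed
    show "((\<lambda>r. gauss s (z + r *\<^sub>R h)) has_vector_derivative G1 s (z + r *\<^sub>R h) h) (at r)" for z r
      using gauss_deriv[OF s] by (simp add: has_real_derivative_iff_has_vector_derivative)
    show "norm (G1 s z h) \<le> 6 * (norm h / sqrt s) * gauss (2 * s) z" for z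
      using G1_le[OF s] by simp
  qed simp
  then show ?thesis by simp
qed

lemma oseen_shift_le:
  assumes s: "0 < s"
  shows "norm (oseen s (z + h) a - oseen s z a)
    \<le> 960 * (norm a)\<^sup>2 * s powr (- 3 / 2) * sqrt (norm h / sqrt s) * (gauss (2 * s) (z + h) + gauss (2 * s) z + gauss (4 * s) z)"
proof -
  have "norm (oseen s z a) \<le> 160 * (norm a)\<^sup>2 * s powr (- 3 / 2) * gauss (2 * s) z" for z
  proof -
    define X where "X = (norm a)\<^sup>2 * (s powr (- 3 / 2) * gauss (2 * s) z)"
    have "norm (oseen s z a) \<le> 60 * X" "0 \<le> X"
      using oseen_le[OF s, of z a] by (auto simp: X_def mult.assoc)
    then have "norm (oseen s z a) \<le> 160 * X" by linarith
    then show ?thesis by (simp add: X_def mult.assoc)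
  qed
  then show ?thesis
    using kernel_shift_le[of s "160 * (norm a)\<^sup>2 * s powr (- 3 / 2)" "\<lambda>z. oseen s z a" h "\<lambda>z. oseen_deriv s z a h" z]
      s oseen_has_deriv[OF s] oseen_deriv_le[OF s] by simp
qed

text \<open>The mean value theorem in time, with the heat equation replacing the time derivative; 51
  = 17 * 3 combines \<open>lap_gauss_le\<close> with \<open>gauss_comparison\<close>.\<close>

lemma gauss_time_diff_le:
  assumes "0 < t" "t \<le> s" "s \<le> 2 * t"
  shows "\<bar>gauss s z - gauss t z\<bar> \<le> 51 * ((s - t) / t) * gauss (4 * t) z"
proof (cases "t = s")
  case False
  then have "t < s" using assms by simp
  then obtain r where r: "t < r" "r < s" "gauss s z - gauss t z = (s - t) * lap_gauss r z"
    using MVT2[of t s "\<lambda>s. gauss s z" "\<lambda>s. lap_gauss s z"] gauss_time_deriv assms by fastforce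
  have "\<bar>lap_gauss r z\<bar> \<le> 17 * (gauss (2 * r) z / r)"
    using r assms by (intro lap_gauss_le) auto
  also have "\<dots> \<le> 17 * (3 * gauss (4 * t) z / t)"
    using r assms by (intro mult_left_mono frac_le gauss_comparison) auto
  finally have "(s - t) * \<bar>lap_gauss r z\<bar> \<le> (s - t) * (17 * (3 * gauss (4 * t) z / t))"
    using \<open>t < s\<close> by (intro mult_left_mono) auto
  moreover have "\<bar>gauss s z - gauss t z\<bar> = (s - t) * \<bar>lap_gauss r z\<bar>"
    using \<open>t < s\<close> by (simp add: r(3) abs_mult)
  moreover have "(s - t) * (17 * (3 * gauss (4 * t) z / t)) = 51 * ((s - t) / t) * gauss (4 * t) z"
    by (simp add: field_simps)
  ultimately show ?thesis by linarith
qed simp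

section \<open>Integration by parts on the whole space\<close>

lemma lborel_distr_reflect: "distr lborel borel (\<lambda>x. c - x) = lborel"
  using lborel_affine[of "- 1" c] by (simp add: density_1)

lemma
  fixes f :: "'a::euclidean_space \<Rightarrow> 'b::{banach, second_countable_topology}"
  assumes [measurable]: "f \<in> borel_measurable borel"
  shows integral_translate: "(LINT y|lborel. f (y + c)) = (LINT y|lborel. f y)"
    and integral_reflect: "(LINT y|lborel. f (c - y)) = (LINT y|lborel. f y)"
    and integrable_translate: "integrable lborel (\<lambda>y. f (y + c)) \<longleftrightarrow> integrable lborel f"
    and integrable_reflect: "integrable lborel (\<lambda>y. f (c - y)) \<longleftrightarrow> integrable lborel f"
proof -
  have "(LINT y|lborel. f y) = (LINT y|distr lborel borel ((+) c). f y)"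
    by (simp add: lborel_distr_plus)
  also have "\<dots> = (LINT y|lborel. f (c + y))"
    by (rule integral_distr) auto
  finally show "(LINT y|lborel. f (y + c)) = (LINT y|lborel. f y)"
    by (simp add: add.commute)
  have "(LINT y|lborel. f y) = (LINT y|distr lborel borel (\<lambda>x. c - x). f y)"
    by (simp add: lborel_distr_reflect)
  also have "\<dots> = (LINT y|lborel. f (c - y))"
    by (rule integral_distr) auto
  finally show "(LINT y|lborel. f (c - y)) = (LINT y|lborel. f y)" by simp
  have "integrable lborel f \<longleftrightarrow> integrable (distr lborel borel ((+) c)) f"
    by (simp add: lborel_distr_plus)
  also have "\<dots> \<longleftrightarrow> integrable lborel (\<lambda>y. f (c + y))"
    by (rule integrable_distr_eq) auto
  finally show "integrable lborel (\<lambda>y. f (y + c)) \<longleftrightarrow> integrable lborel f"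
    by (simp add: add.commute)
  have "integrable lborel f \<longleftrightarrow> integrable (distr lborel borel (\<lambda>x. c - x)) f"
    by (simp add: lborel_distr_reflect)
  also have "\<dots> \<longleftrightarrow> integrable lborel (\<lambda>y. f (c - y))"
    by (rule integrable_distr_eq) auto
  finally show "integrable lborel (\<lambda>y. f (c - y)) \<longleftrightarrow> integrable lborel f" by simp
qed

text \<open>By translation invariance the integral of \<psi>' does not change when \<psi>' is
  averaged over the shifts \<open>r *\<^sub>R v\<close> with r in [0, 1]. By the fundamental theorem
  this average is \<psi>(x + v) - \<psi>(x), which integrates to 0. No decay beyond integrability
  enters.\<close>

lemma integral_line_derivative_0:
  fixes \<psi> \<psi>' :: "'a::euclidean_space \<Rightarrow> real"
  assumes i: "integrable lborel \<psi>" and i': "integrable lborel \<psi>'"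
    and der: "\<And>x r. ((\<lambda>r. \<psi> (x + r *\<^sub>R v)) has_real_derivative \<psi>' (x + r *\<^sub>R v)) (at r)"
    and cont: "continuous_on UNIV \<psi>'"
  shows "(LINT x|lborel. \<psi>' x) = 0"
proof -
  note [measurable] = borel_measurable_integrable[OF i, simplified] borel_measurable_integrable[OF i', simplified]
  have FTC: "(LINT r|lborel. \<psi>' (x + r *\<^sub>R v) * indicator {0..1} r) = \<psi> (x + v) - \<psi> x" for x
  proof -
    have "continuous_on UNIV (\<lambda>r. \<psi>' (x + r *\<^sub>R v))"
      by (rule continuous_on_compose2[OF cont]) (auto intro!: continuous_intros)
    then have "isCont (\<lambda>r. \<psi>' (x + r *\<^sub>R v)) r" for r
      by (simp add: continuous_on_eq_continuous_at)
    then show ?thesis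
      using integral_FTC_Icc_real[of 0 1 "\<lambda>r. \<psi> (x + r *\<^sub>R v)" "\<lambda>r. \<psi>' (x + r *\<^sub>R v)"] der by simp
  qed
  have fi: "integrable lborel (\<lambda>x. \<psi>' (x + r *\<^sub>R v) * indicator {0..1} r)" for r :: real
    using i' by (simp add: integrable_translate)
  have n: "(LINT x|lborel. norm (\<psi>' (x + r *\<^sub>R v) * indicator {0..1} r)) = (LINT x|lborel. norm (\<psi>' x)) * indicator {0..1} r" for r :: real
    using integral_translate[of "\<lambda>x. \<bar>\<psi>' x\<bar>" "r *\<^sub>R v"] by (simp add: abs_mult)
  have int: "integrable (lborel \<Otimes>\<^sub>M lborel) (\<lambda>(r::real, x). \<psi>' (x + r *\<^sub>R v) * indicator {0..1} r)"
  proof (rule lborel_pair.Fubini_integrable)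
    show "integrable lborel (\<lambda>r::real. LINT x|lborel. norm (case (r, x) of (r, x) \<Rightarrow> \<psi>' (x + r *\<^sub>R v) * indicator {0..1} r))"
      unfolding prod.case n by simp
  qed (use fi in auto)
  have "(LINT x|lborel. \<psi>' x) = (LINT r|lborel. (LINT x|lborel. \<psi>' x) * indicator {0..1::real} r)"
    by simp
  also have "\<dots> = (LINT r|lborel. LINT x|lborel. \<psi>' (x + r *\<^sub>R v) * indicator {0..1::real} r)"
    by (rule Bochner_Integration.integral_cong) (simp_all add: integral_translate)
  also have "\<dots> = (LINT x|lborel. LINT r|lborel. \<psi>' (x + r *\<^sub>R v) * indicator {0..1::real} r)"
    by (rule lborel_pair.Fubini_integral[symmetric]) (rule int)
  also have "\<dots> = (LINT x|lborel. \<psi> (x + v) - \<psi> x)"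
    unfolding FTC ..
  also have "\<dots> = 0"
    using i by (subst Bochner_Integration.integral_diff) (auto simp: integrable_translate integral_translate)
  finally show ?thesis .
qed

lemma integrable_compact_support:
  fixes f :: "'a::euclidean_space \<Rightarrow> 'b::{banach, second_countable_topology}"
  assumes "continuous_on UNIV f" "compact K" "\<And>x. x \<notin> K \<Longrightarrow> f x = 0"
  shows "integrable lborel f"
proof -
  have "integrable lborel (\<lambda>x. indicator K x *\<^sub>R f x)"
    using assms by (intro borel_integrable_compact) (auto intro: continuous_on_subset)
  also have "(\<lambda>x. indicator K x *\<^sub>R f x) = f"
    using assms(3) by (auto simp: indicator_def)
  finally show ?thesis .
qed

lemma integration_by_parts_line:
  fixes k k' \<phi> \<phi>' :: "'a::euclidean_space \<Rightarrow> real"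
  assumes c: "continuous_on UNIV k" "continuous_on UNIV k'" "continuous_on UNIV \<phi>" "continuous_on UNIV \<phi>'"
    and K: "compact K" "\<And>x. x \<notin> K \<Longrightarrow> \<phi> x = 0" "\<And>x. x \<notin> K \<Longrightarrow> \<phi>' x = 0"
    and dk: "\<And>z r. ((\<lambda>r. k (z + r *\<^sub>R v)) has_real_derivative k' (z + r *\<^sub>R v)) (at r)"
    and d\<phi>: "\<And>z r. ((\<lambda>r. \<phi> (z + r *\<^sub>R v)) has_real_derivative \<phi>' (z + r *\<^sub>R v)) (at r)"
  shows "(LINT x|lborel. k' (x - y) * \<phi> x) = - (LINT x|lborel. k (x - y) * \<phi>' x)"
proof -
  have cc: "continuous_on UNIV (\<lambda>x. k (x - y))" "continuous_on UNIV (\<lambda>x. k' (x - y))"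
    by (intro continuous_on_compose2[OF c(1)] continuous_on_compose2[OF c(2)] continuous_intros; simp)+
  have i: "integrable lborel (\<lambda>x. k' (x - y) * \<phi> x)" "integrable lborel (\<lambda>x. k (x - y) * \<phi>' x)"
    "integrable lborel (\<lambda>x. k (x - y) * \<phi> x)"
    by (rule integrable_compact_support[OF _ K(1)]; use c cc K in \<open>auto intro!: continuous_intros\<close>)+
  have "(LINT x|lborel. k' (x - y) * \<phi> x + k (x - y) * \<phi>' x) = 0"
  proof (rule integral_line_derivative_0[OF i(3)])
    show "((\<lambda>r. k (x + r *\<^sub>R v - y) * \<phi> (x + r *\<^sub>R v)) has_real_derivative
      k' (x + r *\<^sub>R v - y) * \<phi> (x + r *\<^sub>R v) + k (x + r *\<^sub>R v - y) * \<phi>' (x + r *\<^sub>R v)) (at r)" for x r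
      using DERIV_mult[OF dk[of "x - y" r] d\<phi>[of x r]] by (simp add: algebra_simps)
    show "continuous_on UNIV (\<lambda>x. k' (x - y) * \<phi> x + k (x - y) * \<phi>' x)"
      using c cc by (intro continuous_intros)
  qed (use i in auto)
  then show ?thesis using i by simp
qed

subsection \<open>Test functions\<close>

lemma dderiv_eqI: "(f has_derivative f') (at z) \<Longrightarrow> dderiv v f z = f' v"
  unfolding dderiv_def using frechet_derivative_at by metis

lemma has_derivative_dderiv: "f differentiable (at z) \<Longrightarrow> (f has_derivative (\<lambda>v. dderiv v f z)) (at z)"
  unfolding dderiv_def using frechet_derivative_works by blast

definition smooth :: "('a::real_normed_vector \<Rightarrow> 'b::real_normed_vector) \<Rightarrow> bool" where
  "smooth f \<longleftrightarrow> (\<forall>k. Ck k f)"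

lemma smooth_differentiable: "smooth f \<Longrightarrow> f differentiable (at z)"
  unfolding smooth_def by (metis Ck.simps(2))

lemma smooth_dderiv: "smooth f \<Longrightarrow> smooth (dderiv v f)"
  unfolding smooth_def by (metis Ck.simps(2))

lemma smooth_continuous: "smooth f \<Longrightarrow> continuous_on UNIV f"
  unfolding smooth_def by (metis Ck.simps(1))

lemma dderiv_linear:
  assumes "smooth f"
  shows "dderiv (a + b) f z = dderiv a f z + dderiv b f z"
    and "dderiv (t *\<^sub>R a) f z = t *\<^sub>R dderiv a f z"
    and "dderiv 0 f z = 0"
proof -
  interpret bounded_linear "\<lambda>v. dderiv v f z"
    using has_derivative_dderiv[OF smooth_differentiable[OF assms]] by (rule has_derivative_bounded_linear)
  show "dderiv (a + b) f z = dderiv a f z + dderiv b f z" by (rule add)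
  show "dderiv (t *\<^sub>R a) f z = t *\<^sub>R dderiv a f z" by (rule scaleR)
  show "dderiv 0 f z = 0" by (rule zero)
qed

lemma smooth_line_derivative:
  assumes "smooth f"
  shows "((\<lambda>r. f (z + r *\<^sub>R v)) has_vector_derivative dderiv v f (z + r *\<^sub>R v)) (at r)"
proof -
  have "((\<lambda>r. z + r *\<^sub>R v) has_derivative (\<lambda>t. t *\<^sub>R v)) (at r)"
    by (auto intro!: derivative_eq_intros)
  from has_derivative_compose[OF this has_derivative_dderiv[OF smooth_differentiable[OF assms]]]
  have "((\<lambda>r. f (z + r *\<^sub>R v)) has_derivative (\<lambda>t. dderiv (t *\<^sub>R v) f (z + r *\<^sub>R v))) (at r)" .
  moreover have "dderiv (t *\<^sub>R v) f w = t *\<^sub>R dderiv v f w" for t w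
    by (rule dderiv_linear[OF assms])
  ultimately show ?thesis by (simp add: has_vector_derivative_def)
qed

lemma smooth_line_derivative_real:
  fixes f :: "'a::real_normed_vector \<Rightarrow> real"
  shows "smooth f \<Longrightarrow> ((\<lambda>r. f (z + r *\<^sub>R v)) has_real_derivative dderiv v f (z + r *\<^sub>R v)) (at r)"
  using smooth_line_derivative by (simp add: has_real_derivative_iff_has_vector_derivative)

lemma dderiv_bounded_linear:
  assumes "bounded_linear L" "f differentiable (at z)"
  shows "dderiv v (\<lambda>z. L (f z)) z = L (dderiv v f z)"
  using bounded_linear.has_derivative[OF assms(1) has_derivative_dderiv[OF assms(2)]] by (rule dderiv_eqI)

lemma dderiv_add:
  assumes "f differentiable (at z)" "g differentiable (at z)"
  shows "dderiv v (\<lambda>z. f z + g z) z = dderiv v f z + dderiv v g z"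
  using has_derivative_add[OF has_derivative_dderiv[OF assms(1)] has_derivative_dderiv[OF assms(2)]] by (rule dderiv_eqI)

lemma dderiv_translate:
  assumes "f differentiable (at (z + c))"
  shows "dderiv v (\<lambda>z. f (z + c)) z = dderiv v f (z + c)"
proof -
  have "((\<lambda>z. z + c) has_derivative (\<lambda>v. v)) (at z)"
    by (auto intro!: derivative_eq_intros)
  from has_derivative_compose[OF this has_derivative_dderiv[OF assms]] show ?thesis by (rule dderiv_eqI)
qed

lemma Ck_bounded_linear:
  assumes L: "bounded_linear L"
  shows "Ck k f \<Longrightarrow> Ck k (\<lambda>z. L (f z))"
proof (induction k arbitrary: f)
  case 0
  then show ?case using bounded_linear.continuous_on[OF L] by auto
next
  case (Suc k)
  then have d: "f differentiable (at z)" for z by auto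
  then have "dderiv v (\<lambda>z. L (f z)) = (\<lambda>z. L (dderiv v f z))" for v
    using dderiv_bounded_linear[OF L] by blast
  moreover have "(\<lambda>z. L (f z)) differentiable (at z)" for z
    using bounded_linear.has_derivative[OF L has_derivative_dderiv[OF d]] by (auto simp: differentiable_def)
  ultimately show ?case using Suc by auto
qed

lemma Ck_add: "Ck k f \<Longrightarrow> Ck k g \<Longrightarrow> Ck k (\<lambda>z. f z + g z)"
proof (induction k arbitrary: f g)
  case 0
  then show ?case by (simp add: continuous_on_add)
next
  case (Suc k)
  then have "dderiv v (\<lambda>z. f z + g z) = (\<lambda>z. dderiv v f z + dderiv v g z)" for v
    by (intro ext dderiv_add) auto
  then show ?case using Suc by (auto intro: differentiable_add)
qed

lemma Ck_translate: "Ck k f \<Longrightarrow> Ck k (\<lambda>z. f (z + c))"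
proof (induction k arbitrary: f)
  case 0
  then have "continuous_on UNIV f" by simp
  then have "continuous_on UNIV (\<lambda>z. f (z + c))"
    by (rule continuous_on_compose2) (auto intro!: continuous_intros)
  then show ?case by simp
next
  case (Suc k)
  then have d: "f differentiable (at z)" for z by auto
  then have "dderiv v (\<lambda>z. f (z + c)) = (\<lambda>z. dderiv v f (z + c))" for v
    using dderiv_translate by blast
  moreover have "(\<lambda>z. f (z + c)) differentiable (at z)" for z
  proof -
    have "((\<lambda>z. z + c) has_derivative (\<lambda>v. v)) (at z)"
      by (auto intro!: derivative_eq_intros)
    from has_derivative_compose[OF this has_derivative_dderiv[OF d]] show ?thesis
      by (auto simp: differentiable_def)
  qed
  ultimately show ?case using Suc by auto
qed

lemma smooth_bounded_linear: "bounded_linear L \<Longrightarrow> smooth f \<Longrightarrow> smooth (\<lambda>z. L (f z))"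
  by (simp add: smooth_def Ck_bounded_linear)

lemma smooth_add: "smooth f \<Longrightarrow> smooth g \<Longrightarrow> smooth (\<lambda>z. f z + g z)"
  by (simp add: smooth_def Ck_add)

lemma smooth_translate: "smooth f \<Longrightarrow> smooth (\<lambda>z. f (z + c))"
  by (simp add: smooth_def Ck_translate)

lemma dderiv_inner: "smooth f \<Longrightarrow> dderiv v (\<lambda>z. f z \<bullet> w) = (\<lambda>z. dderiv v f z \<bullet> w)"
  using dderiv_bounded_linear[OF bounded_linear_inner_left smooth_differentiable] by blast

text \<open>The second difference is symmetric in \<open>v\<close> and \<open>w\<close>. Reading it
  as a mixed derivative in either order is what proves that the two mixed derivatives agree.\<close>

lemma second_difference_mvt:
  fixes f :: "'a::real_normed_vector \<Rightarrow> real"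
  assumes f: "smooth f" and e: "0 < \<epsilon>"
  shows "\<exists>p. norm (p - z) \<le> \<epsilon> * (norm v + norm w) \<and>
    f (z + \<epsilon> *\<^sub>R v + \<epsilon> *\<^sub>R w) - f (z + \<epsilon> *\<^sub>R v) - f (z + \<epsilon> *\<^sub>R w) + f z = \<epsilon>\<^sup>2 * dderiv w (dderiv v f) p"
proof -
  note line = smooth_line_derivative_real
  let ?g = "\<lambda>s. f ((z + \<epsilon> *\<^sub>R w) + s *\<^sub>R v) - f (z + s *\<^sub>R v)"
  have "(?g has_real_derivative dderiv v f ((z + \<epsilon> *\<^sub>R w) + s *\<^sub>R v) - dderiv v f (z + s *\<^sub>R v)) (at s)" for s
    by (intro DERIV_diff line f)
  from MVT2[OF e, of ?g, OF this] obtain s where s: "0 < s" "s < \<epsilon>"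
    "?g \<epsilon> - ?g 0 = (\<epsilon> - 0) * (dderiv v f ((z + \<epsilon> *\<^sub>R w) + s *\<^sub>R v) - dderiv v f (z + s *\<^sub>R v))"
    by blast
  let ?k = "\<lambda>t. dderiv v f ((z + s *\<^sub>R v) + t *\<^sub>R w)"
  have "(?k has_real_derivative dderiv w (dderiv v f) ((z + s *\<^sub>R v) + t *\<^sub>R w)) (at t)" for t
    by (intro line smooth_dderiv f)
  from MVT2[OF e, of ?k, OF this] obtain t where t: "0 < t" "t < \<epsilon>"
    "?k \<epsilon> - ?k 0 = (\<epsilon> - 0) * dderiv w (dderiv v f) ((z + s *\<^sub>R v) + t *\<^sub>R w)"
    by blast
  have "norm (s *\<^sub>R v + t *\<^sub>R w) \<le> s * norm v + t * norm w"
    using norm_triangle_ineq[of "s *\<^sub>R v" "t *\<^sub>R w"] s t by simp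
  also have "\<dots> \<le> \<epsilon> * norm v + \<epsilon> * norm w"
    using s t by (intro add_mono mult_right_mono) auto
  finally have n: "norm ((z + s *\<^sub>R v) + t *\<^sub>R w - z) \<le> \<epsilon> * (norm v + norm w)"
    by (simp add: algebra_simps)
  have "f (z + \<epsilon> *\<^sub>R v + \<epsilon> *\<^sub>R w) - f (z + \<epsilon> *\<^sub>R v) - f (z + \<epsilon> *\<^sub>R w) + f z = ?g \<epsilon> - ?g 0"
    by (simp add: algebra_simps)
  also have "\<dots> = \<epsilon> * (?k \<epsilon> - ?k 0)"
    unfolding s(3) by (simp add: algebra_simps)
  also have "\<dots> = \<epsilon>\<^sup>2 * dderiv w (dderiv v f) ((z + s *\<^sub>R v) + t *\<^sub>R w)"
    unfolding t(3) by (simp add: power2_eq_square)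
  finally show ?thesis using n by blast
qed

lemma dderiv_commute_real:
  fixes f :: "'a::real_normed_vector \<Rightarrow> real"
  assumes f: "smooth f"
  shows "dderiv w (dderiv v f) z = dderiv v (dderiv w f) z"
proof -
  let ?e = "\<lambda>n::nat. inverse (real (Suc n))"
  \<comment> \<open>The two mixed derivatives agree at points \<open>p\<close> and \<open>q\<close>
    that may differ from each other and from \<open>z\<close>; both tend to \<open>z\<close> with
    the step, and continuity does the rest.\<close>
  have "\<exists>p q. norm (p - z) \<le> ?e n * (norm v + norm w) \<and> norm (q - z) \<le> ?e n * (norm v + norm w)
     \<and> dderiv w (dderiv v f) p = dderiv v (dderiv w f) q" for n
  proof -
    have e: "0 < ?e n" by simp
    obtain p where p: "norm (p - z) \<le> ?e n * (norm v + norm w)"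
      "f (z + ?e n *\<^sub>R v + ?e n *\<^sub>R w) - f (z + ?e n *\<^sub>R v) - f (z + ?e n *\<^sub>R w) + f z = (?e n)\<^sup>2 * dderiv w (dderiv v f) p"
      using second_difference_mvt[OF f e] by blast
    obtain q where q: "norm (q - z) \<le> ?e n * (norm w + norm v)"
      "f (z + ?e n *\<^sub>R w + ?e n *\<^sub>R v) - f (z + ?e n *\<^sub>R w) - f (z + ?e n *\<^sub>R v) + f z = (?e n)\<^sup>2 * dderiv v (dderiv w f) q"
      using second_difference_mvt[OF f e] by blast
    have "(?e n)\<^sup>2 * dderiv w (dderiv v f) p = (?e n)\<^sup>2 * dderiv v (dderiv w f) q"
      using p(2) q(2) by (simp add: algebra_simps)
    then have "dderiv w (dderiv v f) p = dderiv v (dderiv w f) q" using e by simp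
    then show ?thesis using p(1) q(1) by (metis add.commute)
  qed
  then obtain p q where pq: "\<And>n. norm (p n - z) \<le> ?e n * (norm v + norm w)" "\<And>n. norm (q n - z) \<le> ?e n * (norm v + norm w)"
     "\<And>n. dderiv w (dderiv v f) (p n) = dderiv v (dderiv w f) (q n)"
    by metis
  have e0: "(\<lambda>n. ?e n * (norm v + norm w)) \<longlonglongrightarrow> 0"
    using tendsto_mult_left_zero[OF LIMSEQ_inverse_real_of_nat] by blast
  have lim: "p \<longlonglongrightarrow> z" "q \<longlonglongrightarrow> z"
    by (rule LIM_zero_cancel, rule Lim_null_comparison[OF always_eventually e0], use pq in blast)+
  have "isCont (dderiv w (dderiv v f)) z" "isCont (dderiv v (dderiv w f)) z"
    using smooth_continuous[OF smooth_dderiv[OF smooth_dderiv[OF f]]] continuous_on_eq_continuous_at by blast+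
  then have "(\<lambda>n. dderiv w (dderiv v f) (p n)) \<longlonglongrightarrow> dderiv w (dderiv v f) z"
    "(\<lambda>n. dderiv v (dderiv w f) (q n)) \<longlonglongrightarrow> dderiv v (dderiv w f) z"
    using lim by (auto intro: isCont_tendsto_compose)
  then show ?thesis unfolding pq(3) using LIMSEQ_unique by blast
qed

lemma dderiv_commute:
  fixes f :: "'a::real_normed_vector \<Rightarrow> 'b::real_inner"
  assumes f: "smooth f"
  shows "dderiv w (dderiv v f) = dderiv v (dderiv w f)"
proof
  fix z
  have "dderiv w (dderiv v f) z \<bullet> u = dderiv v (dderiv w f) z \<bullet> u" for u
    using dderiv_commute_real[OF smooth_bounded_linear[OF bounded_linear_inner_left[of u] f], of w v z]
    by (simp add: dderiv_inner f smooth_dderiv)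
  then show "dderiv w (dderiv v f) z = dderiv v (dderiv w f) z"
    by (metis inner_commute vector_eq_rdot)
qed

section \<open>Supports and bounds of test functions\<close>

lemma test_fun_smooth: "f \<in> test_fun \<Omega> \<Longrightarrow> smooth f"
  by (simp add: test_fun_def smooth_def)

lemma test_fun_support:
  assumes "f \<in> test_fun \<Omega>"
  shows "\<exists>K. compact K \<and> K \<subseteq> \<Omega> \<and> (\<forall>z. z \<notin> K \<longrightarrow> f z = 0)"
  using assms closure_subset[of "{z. f z \<noteq> 0}"] unfolding test_fun_def by blast

text \<open>Some compact set outside which \<open>f\<close> vanishes is easier to exhibit than the
  closure of the set where \<open>f\<close> is nonzero.\<close>

lemma test_funI:
  assumes "smooth f" "compact K" "K \<subseteq> \<Omega>" "\<And>z. z \<notin> K \<Longrightarrow> f z = 0"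
  shows "f \<in> test_fun \<Omega>"
proof -
  have "closure {z. f z \<noteq> 0} \<subseteq> K"
    using assms by (intro closure_minimal) (auto simp: compact_imp_closed)
  moreover from this have "compact (closure {z. f z \<noteq> 0})"
    by (metis assms(2) closed_closure compact_Int_closed inf.absorb_iff2)
  ultimately show ?thesis using assms by (auto simp: test_fun_def smooth_def)
qed

lemma dderiv_eq_0:
  assumes "compact K" "\<And>z. z \<notin> K \<Longrightarrow> f z = 0" "z \<notin> K"
  shows "dderiv v f z = 0"
proof -
  have "open (- K)" using compact_imp_closed[OF assms(1)] by (rule open_Compl)
  then have "(f has_derivative (\<lambda>_. 0)) (at z)"
    using assms by (intro has_derivative_transform_within_open[OF has_derivative_const[of 0]]) auto
  then show ?thesis by (rule dderiv_eqI)
qed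

lemma test_fun_dderiv: "f \<in> test_fun \<Omega> \<Longrightarrow> dderiv v f \<in> test_fun \<Omega>"
  by (metis dderiv_eq_0 smooth_dderiv test_funI test_fun_smooth test_fun_support)

lemma test_fun_add: "f \<in> test_fun \<Omega> \<Longrightarrow> g \<in> test_fun \<Omega> \<Longrightarrow> (\<lambda>z. f z + g z) \<in> test_fun \<Omega>"
proof -
  assume fg: "f \<in> test_fun \<Omega>" "g \<in> test_fun \<Omega>"
  obtain K where K: "compact K" "K \<subseteq> \<Omega>" "\<And>z. z \<notin> K \<Longrightarrow> f z = 0" using test_fun_support[OF fg(1)] by blast
  obtain L where L: "compact L" "L \<subseteq> \<Omega>" "\<And>z. z \<notin> L \<Longrightarrow> g z = 0" using test_fun_support[OF fg(2)] by blast
  show ?thesis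
    using K L by (intro test_funI[of _ "K \<union> L"] smooth_add test_fun_smooth[OF fg(1)] test_fun_smooth[OF fg(2)]) auto
qed

lemma test_fun_bounded_linear: "bounded_linear L \<Longrightarrow> f \<in> test_fun \<Omega> \<Longrightarrow> (\<lambda>z. L (f z)) \<in> test_fun \<Omega>"
  by (metis linear_simps(3) smooth_bounded_linear test_funI test_fun_smooth test_fun_support)

lemma test_fun_sum:
  assumes "finite I" "I \<noteq> {}" "\<And>i. i \<in> I \<Longrightarrow> f i \<in> test_fun \<Omega>"
  shows "(\<lambda>z. \<Sum>i\<in>I. f i z) \<in> test_fun \<Omega>"
  using assms
proof (induction rule: finite_ne_induct)
  case (insert i F)
  have "(\<lambda>z. f i z + (\<Sum>i\<in>F. f i z)) \<in> test_fun \<Omega>"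
    by (rule test_fun_add) (use insert in blast)+
  then show ?case unfolding sum.insert[OF insert(1) insert(3)] .
qed simp

lemma test_fun_bounded:
  assumes "f \<in> test_fun \<Omega>"
  obtains B where "0 \<le> B" "\<And>z. norm (f z) \<le> B"
proof -
  obtain K where K: "compact K" "\<And>z. z \<notin> K \<Longrightarrow> f z = 0" using test_fun_support[OF assms] by blast
  have "compact (f ` K)"
    by (intro compact_continuous_image continuous_on_subset[OF smooth_continuous[OF test_fun_smooth[OF assms]]] K subset_UNIV)
  then obtain B where B: "\<And>z. z \<in> K \<Longrightarrow> norm (f z) \<le> B"
    using compact_imp_bounded[of "f ` K"] by (auto simp: bounded_iff)
  have "norm (f z) \<le> max B 0" for z
    using B[of z] K(2)[of z] by (cases "z \<in> K") auto
  then show ?thesis using that[of "max B 0"] by simp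
qed

lemma test_fun_measurable: "f \<in> test_fun \<Omega> \<Longrightarrow> f \<in> borel_measurable borel"
  by (intro borel_measurable_continuous_onI smooth_continuous test_fun_smooth)

lemma test_fun_integrable:
  fixes f :: "'a::euclidean_space \<Rightarrow> 'b::{banach, second_countable_topology}"
  shows "f \<in> test_fun \<Omega> \<Longrightarrow> integrable lborel f"
  by (metis integrable_compact_support smooth_continuous test_fun_smooth test_fun_support)

subsection \<open>Pairing the kernels with test functions\<close>

lemma measurable_pair_compose:
  fixes q :: "'a::second_countable_topology \<times> 'b::second_countable_topology \<Rightarrow> 'c::topological_space"
  assumes "q \<in> borel_measurable borel" "g \<in> borel_measurable M" "h \<in> borel_measurable M"
  shows "(\<lambda>w. q (g w, h w)) \<in> borel_measurable M"
proof -
  have "(\<lambda>w. (g w, h w)) \<in> M \<rightarrow>\<^sub>M borel"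
    using assms(2,3) by (simp add: borel_prod[symmetric])
  from measurable_compose[OF this assms(1)] show ?thesis by simp
qed

lemma gauss_continuous_on:
  assumes "\<And>z. z \<in> S \<Longrightarrow> 0 < \<sigma> z" "continuous_on S \<sigma>" "continuous_on S p"
  shows "continuous_on S (\<lambda>z. gauss (\<sigma> z) (p z))"
    and "continuous_on S (\<lambda>z. lap_gauss (\<sigma> z) (p z))"
  unfolding gauss_def lap_gauss_def using assms
  by (auto intro!: continuous_intros dest!: assms(1) simp: less_imp_neq[symmetric] less_imp_le)

lemma kernels_continuous:
  assumes "0 < s"
  shows "continuous_on UNIV (gauss s)" "continuous_on UNIV (\<lambda>z. G1 s z a)"
    "continuous_on UNIV (\<lambda>z. G2 s z a b)" "continuous_on UNIV (\<lambda>z. G3 s z a b c)"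
    "continuous_on UNIV (lap_gauss s)" "continuous_on UNIV (\<lambda>z. oseen s z a)"
  unfolding gauss_def G1_def G2_def G3_def lap_gauss_def oseen_def oseen1_def oseen2_def using assms
  by (intro continuous_intros; simp)+

lemma compact_projections:
  assumes "compact K"
  shows "compact (fst ` K)" "compact (snd ` K)"
  using assms by (auto intro!: compact_continuous_image continuous_intros)

lemma notin_projections:
  "x \<notin> fst ` K \<Longrightarrow> (x, t) \<notin> K" "t \<notin> snd ` K \<Longrightarrow> (x, t) \<notin> K"
  by force+

lemma smooth_pair_continuous:
  assumes "smooth q" "continuous_on S g" "continuous_on S h"
  shows "continuous_on S (\<lambda>z. q (g z, h z))"
  by (rule continuous_on_compose2[OF smooth_continuous[OF assms(1)] continuous_on_Pair[OF assms(2,3)] subset_UNIV])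

text \<open>Only the space variable is integrated: the slice of a space-time test function at time
  \<open>t\<close> is supported in the projection of the support, whatever \<open>t\<close>
  is.\<close>

lemma slice_by_parts:
  fixes q :: "space \<times> real \<Rightarrow> real"
  assumes q: "q \<in> test_fun UNIV"
    and c: "continuous_on UNIV k" "continuous_on UNIV k'"
    and dk: "\<And>z r. ((\<lambda>r. k (z + r *\<^sub>R v)) has_real_derivative k' (z + r *\<^sub>R v)) (at r)"
  shows "(LINT x|lborel. k' (x - y) * q (x, t)) = - (LINT x|lborel. k (x - y) * dderiv (v, 0) q (x, t))"
proof -
  obtain K where K: "compact K" "\<And>z. z \<notin> K \<Longrightarrow> q z = 0" using test_fun_support[OF q] by blast
  have K': "dderiv (v, 0) q z = 0" if "z \<notin> K" for z
    using dderiv_eq_0[OF K that] .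
  have cq: "continuous_on UNIV (\<lambda>x. q (x, t))" "continuous_on UNIV (\<lambda>x. dderiv (v, 0) q (x, t))"
    by (intro smooth_pair_continuous test_fun_smooth[OF q] smooth_dderiv continuous_on_id continuous_on_const)+
  show ?thesis
  proof (rule integration_by_parts_line[OF c cq])
    show "((\<lambda>r. q (z + r *\<^sub>R v, t)) has_real_derivative dderiv (v, 0) q (z + r *\<^sub>R v, t)) (at r)" for z r
      using smooth_line_derivative_real[OF test_fun_smooth[OF q], of "(z, t)" "(v, 0)" r] by simp
    show "q (x, t) = 0" "dderiv (v, 0) q (x, t) = 0" if "x \<notin> fst ` K" for x
      using K(2) K' notin_projections(1)[OF that] by auto
  qed (intro compact_projections K dk)+
qed

lemma kernel_by_parts:
  fixes q :: "space \<times> real \<Rightarrow> real"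
  assumes q: "q \<in> test_fun UNIV" and s: "0 < s"
  shows "(LINT x|lborel. G1 s (x - y) a * q (x, t)) = - (LINT x|lborel. gauss s (x - y) * dderiv (a, 0) q (x, t))"
    and "(LINT x|lborel. G2 s (x - y) a b * q (x, t)) = - (LINT x|lborel. G1 s (x - y) a * dderiv (b, 0) q (x, t))"
    and "(LINT x|lborel. G3 s (x - y) a b c * q (x, t)) = - (LINT x|lborel. G2 s (x - y) a b * dderiv (c, 0) q (x, t))"
  by (rule slice_by_parts[OF q]; intro kernels_continuous[OF s] gauss_deriv[OF s] G1_deriv[OF s] G2_deriv[OF s])+

lemma G2_by_parts:
  fixes q :: "space \<times> real \<Rightarrow> real"
  assumes q: "q \<in> test_fun UNIV" and s: "0 < s"
  shows "(LINT x|lborel. G2 s (x - y) a b * q (x, t)) = (LINT x|lborel. gauss s (x - y) * dderiv (a, 0) (dderiv (b, 0) q) (x, t))"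
  using kernel_by_parts(1)[OF test_fun_dderiv[OF q] s] kernel_by_parts(2)[OF q s] by simp

lemma kernel_test_integrable:
  fixes q :: "space \<times> real \<Rightarrow> 'b::euclidean_space" and k :: "space \<Rightarrow> real"
  assumes q: "q \<in> test_fun \<Omega>" and k: "continuous_on UNIV k"
  shows "integrable lborel (\<lambda>x. k (x - y) *\<^sub>R q (x, t))"
proof -
  obtain K where K: "compact K" "\<And>z. z \<notin> K \<Longrightarrow> q z = 0" using test_fun_support[OF q] by blast
  have "continuous_on UNIV (\<lambda>x. q (x, t))"
    by (intro smooth_pair_continuous test_fun_smooth[OF q] continuous_on_id continuous_on_const)
  moreover have "continuous_on UNIV (\<lambda>x. k (x - y))"
    by (rule continuous_on_compose2[OF k]) (auto intro!: continuous_intros)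
  ultimately show ?thesis
    using compact_projections(1)[OF K(1)] K(2)[OF notin_projections(1)]
    by (intro integrable_compact_support[of _ "fst ` K"] continuous_on_scaleR) auto
qed

lemma kernel_test_integrable_real:
  fixes q :: "space \<times> real \<Rightarrow> real" and k :: "space \<Rightarrow> real"
  assumes "q \<in> test_fun \<Omega>" "continuous_on UNIV k"
  shows "integrable lborel (\<lambda>x. k (x - y) * q (x, t))"
  using kernel_test_integrable[OF assms] by simp

text \<open>Up to sign this is the formal adjoint of the heat operator, that is, the backward heat
  operator; it is what the weak equation puts on the test function.\<close>

definition heat_op :: "(space \<times> real \<Rightarrow> 'b::real_normed_vector) \<Rightarrow> space \<times> real \<Rightarrow> 'b" where
  "heat_op q z = dt q z + (\<Sum>j\<in>UNIV. dx j (dx j q) z)"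

lemma heat_op_test: "q \<in> test_fun \<Omega> \<Longrightarrow> heat_op q \<in> test_fun \<Omega>"
  unfolding heat_op_def[abs_def] dt_def dx_def
  by (intro test_fun_add test_fun_sum test_fun_dderiv) auto

lemma dderiv_sum:
  assumes "finite I" "\<And>i. i \<in> I \<Longrightarrow> f i differentiable (at z)"
  shows "dderiv v (\<lambda>z. \<Sum>i\<in>I. f i z) z = (\<Sum>i\<in>I. dderiv v (f i) z)"
  by (rule dderiv_eqI) (intro has_derivative_sum has_derivative_dderiv assms)

lemma dderiv_heat_op:
  fixes q :: "space \<times> real \<Rightarrow> 'b::real_inner"
  assumes q: "smooth q"
  shows "dderiv v (heat_op q) = heat_op (dderiv v q)"
proof
  fix z
  have c: "dderiv v (dderiv w q) = dderiv w (dderiv v q)" for w by (rule dderiv_commute[OF q])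
  have c2: "dderiv v (dderiv w (dderiv w q)) = dderiv w (dderiv w (dderiv v q))" for w
    using dderiv_commute[OF smooth_dderiv[OF q], of v w w] c[of w] by simp
  have d: "dderiv w q differentiable (at z)" "dderiv w (dderiv w q) differentiable (at z)" for w
    by (intro smooth_differentiable smooth_dderiv q)+
  have "dderiv v (heat_op q) z = dderiv v (dt q) z + dderiv v (\<lambda>z. \<Sum>j\<in>UNIV. dx j (dx j q) z) z"
    unfolding heat_op_def[abs_def] dt_def dx_def
    by (rule dderiv_add) (auto intro!: d differentiable_sum)
  also have "\<dots> = heat_op (dderiv v q) z"
    unfolding dt_def dx_def heat_op_def by (subst dderiv_sum) (auto intro!: d simp: c c2)
  finally show "dderiv v (heat_op q) z = heat_op (dderiv v q) z" .
qed

lemma heat_op_bounded_linear: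
  assumes L: "bounded_linear L" and q: "smooth q"
  shows "heat_op (\<lambda>z. L (q z)) z = L (heat_op q z)"
proof -
  interpret bounded_linear L by fact
  have d: "dderiv w (\<lambda>z. L (q z)) = (\<lambda>z. L (dderiv w q z))" if "smooth q" for w q
    using dderiv_bounded_linear[OF L smooth_differentiable[OF that]] by blast
  show ?thesis
    by (simp add: heat_op_def dt_def dx_def d q smooth_dderiv add sum)
qed

text \<open>The integrand is the \<open>\<tau>\<close>-derivative of \<open>gauss (\<rho> + \<tau>) (x - y) * q (x, s + \<tau>)\<close> after
  moving the Laplacian from the kernel to \<open>q\<close>.\<close>

lemma heat_identity:
  fixes q :: "space \<times> real \<Rightarrow> real"
  assumes q: "q \<in> test_fun UNIV" and \<rho>: "0 < \<rho>"
  shows "(LINT \<tau>|lborel. (LINT x|lborel. gauss (\<rho> + \<tau>) (x - y) * heat_op q (x, s + \<tau>)) * indicator {0<..} \<tau>)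
    = - (LINT x|lborel. gauss \<rho> (x - y) * q (x, s))"
proof -
  note sm = test_fun_smooth[OF q]
  note qd = test_fun_dderiv[OF q]
  obtain K where K: "compact K" "\<And>z. z \<notin> K \<Longrightarrow> q z = 0" using test_fun_support[OF q] by blast
  have K'1: "dderiv v q z = 0" if "z \<notin> K" for z v
    by (rule dderiv_eq_0[OF K that])
  have K'2: "dderiv v (dderiv v q) z = 0" if "z \<notin> K" for z v
    by (rule dderiv_eq_0[OF K(1) K'1 that])
  note K' = K'1 K'2
  have K1: "q (x, t) = 0" "dderiv v q (x, t) = 0" if "x \<notin> fst ` K" for x t v
    using K(2)[OF notin_projections(1)[OF that]] K'1[OF notin_projections(1)[OF that]] by auto
  obtain R0 where "\<And>t. t \<in> snd ` K \<Longrightarrow> norm t \<le> R0"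
    using compact_imp_bounded[OF compact_projections(2)[OF K(1)]] unfolding bounded_iff by blast
  then have R0: "q (x, t) = 0" "dderiv v q (x, t) = 0" "dderiv v (dderiv v q) (x, t) = 0" if "t > R0" for x t v
  proof -
    have t: "t \<notin> snd ` K"
    proof
      assume "t \<in> snd ` K"
      then have "norm t \<le> R0" by fact
      then show False using \<open>t > R0\<close> by simp
    qed
    show "q (x, t) = 0" by (rule K(2)[OF notin_projections(2)[OF t]])
    show "dderiv v q (x, t) = 0" by (rule K'1[OF notin_projections(2)[OF t]])
    show "dderiv v (dderiv v q) (x, t) = 0" by (rule K'2[OF notin_projections(2)[OF t]])
  qed
  \<comment> \<open>For \<tau> \<ge> R the time s + \<tau> lies beyond the support of
    \<open>q\<close>, so that the upper endpoint of the \<tau>-integral contributes nothing and the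
    whole result comes from \<tau> = 0.\<close>
  define R where "R = \<bar>R0\<bar> + \<bar>s\<bar> + 1"
  have Rq: "heat_op q (x, s + \<tau>) = 0" "q (x, s + \<tau>) = 0" if "\<tau> \<ge> R" for x \<tau>
    using R0 that by (auto simp: R_def heat_op_def dt_def dx_def)
  have R': "0 < R" by (auto simp: R_def)
  define D where "D = (\<lambda>(\<tau>, x). lap_gauss (\<rho> + \<tau>) (x - y) * q (x, s + \<tau>) + gauss (\<rho> + \<tau>) (x - y) * dt q (x, s + \<tau>))"
  define S where "S = {0..R} \<times> (fst ` K)"
  have S: "compact S" unfolding S_def by (intro compact_Times compact_projections K compact_Icc)
  have cq: "continuous_on S (\<lambda>z. q (snd z, s + fst z))" "continuous_on S (\<lambda>z. dt q (snd z, s + fst z))"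
    unfolding dt_def by (intro smooth_pair_continuous sm smooth_dderiv continuous_intros)+
  have "continuous_on S D"
    unfolding D_def case_prod_beta using \<rho>
    by (intro continuous_intros cq gauss_continuous_on) (auto simp: S_def)
  then have int: "integrable (lborel \<Otimes>\<^sub>M lborel) (\<lambda>(\<tau>, x). indicator S (\<tau>, x) * D (\<tau>, x))"
    using borel_integrable_compact[OF S, of D] by (simp add: lborel_prod case_prod_beta')
  have time: "(LINT \<tau>|lborel. indicator S (\<tau>, x) * D (\<tau>, x)) = - (gauss \<rho> (x - y) * q (x, s))" for x
  proof (cases "x \<in> fst ` K")
    case True
    have "(LINT \<tau>|lborel. indicator S (\<tau>, x) * D (\<tau>, x)) = (LINT \<tau>|lborel. D (\<tau>, x) * indicator {0..R} \<tau>)"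
      using True by (intro Bochner_Integration.integral_cong) (auto simp: S_def indicator_def)
    also have "\<dots> = gauss (\<rho> + R) (x - y) * q (x, s + R) - gauss (\<rho> + 0) (x - y) * q (x, s + 0)"
    proof (rule integral_FTC_Icc_real)
      fix \<tau> assume "0 \<le> \<tau>" "\<tau> \<le> R"
      then have pos: "0 < \<rho> + \<tau>" using \<rho> by simp
      have 1: "((\<lambda>\<tau>. gauss (\<rho> + \<tau>) (x - y)) has_real_derivative lap_gauss (\<rho> + \<tau>) (x - y)) (at \<tau>)"
      proof -
        have "((\<lambda>\<tau>. \<rho> + \<tau>) has_real_derivative 1) (at \<tau>)"
          by (auto intro!: derivative_eq_intros)
        from DERIV_chain2[where f="\<lambda>s. gauss s (x - y)" and g="\<lambda>\<tau>. \<rho> + \<tau>", OF gauss_time_deriv[OF pos] this]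
        show ?thesis by simp
      qed
      have 2: "((\<lambda>\<tau>. q (x, s + \<tau>)) has_real_derivative dt q (x, s + \<tau>)) (at \<tau>)"
        using smooth_line_derivative_real[OF sm, of "(x, s)" "(0, 1)" \<tau>] by (simp add: dt_def)
      show "((\<lambda>\<tau>. gauss (\<rho> + \<tau>) (x - y) * q (x, s + \<tau>)) has_real_derivative D (\<tau>, x)) (at \<tau>)"
        using DERIV_mult[OF 1 2] by (simp add: D_def algebra_simps)
      have "continuous_on {- \<rho><..} (\<lambda>\<tau>. q (x, s + \<tau>))" "continuous_on {- \<rho><..} (\<lambda>\<tau>. dt q (x, s + \<tau>))"
        unfolding dt_def by (intro smooth_pair_continuous sm smooth_dderiv continuous_intros)+
      then have "continuous_on {- \<rho><..} (\<lambda>\<tau>. D (\<tau>, x))"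
        unfolding D_def prod.case by (intro continuous_intros gauss_continuous_on) auto
      then show "isCont (\<lambda>\<tau>. D (\<tau>, x)) \<tau>"
        using pos by (simp add: continuous_on_eq_continuous_at)
    qed (use R' in simp)
    finally show ?thesis using Rq by simp
  next
    case False
    then show ?thesis using K1(1)[OF False] by (simp add: S_def)
  qed
  \<comment> \<open>The compact set \<open>S\<close> contains the slice \<tau> = 0 and the indicator
    does not; hence the exclusion of this one point, which is a null set.\<close>
  have sp: "(LINT x|lborel. indicator S (\<tau>, x) * D (\<tau>, x)) = (LINT x|lborel. gauss (\<rho> + \<tau>) (x - y) * heat_op q (x, s + \<tau>)) * indicator {0<..} \<tau>"
    if "\<tau> \<noteq> 0" for \<tau>
  proof (cases "0 < \<tau> \<and> \<tau> \<le> R")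
    case True
    then have pos: "0 < \<rho> + \<tau>" using \<rho> by simp
    note kc = kernels_continuous[OF pos]
    note ki = kernel_test_integrable_real[where \<Omega>=UNIV, OF _ kc(1)] kernel_test_integrable_real[where \<Omega>=UNIV, OF _ kc(3)] kernel_test_integrable_real[where \<Omega>=UNIV, OF _ kc(5)]
    have "(LINT x|lborel. lap_gauss (\<rho> + \<tau>) (x - y) * q (x, s + \<tau>))
      = (\<Sum>j\<in>UNIV. LINT x|lborel. G2 (\<rho> + \<tau>) (x - y) (axis j 1) (axis j 1) * q (x, s + \<tau>))"
      unfolding lap_gauss_eq sum_distrib_right by (intro Bochner_Integration.integral_sum ki q)
    also have "\<dots> = (\<Sum>j\<in>UNIV. LINT x|lborel. gauss (\<rho> + \<tau>) (x - y) * dx j (dx j q) (x, s + \<tau>))"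
      unfolding dx_def by (intro sum.cong refl G2_by_parts q pos)
    also have "\<dots> = (LINT x|lborel. (\<Sum>j\<in>UNIV. gauss (\<rho> + \<tau>) (x - y) * dx j (dx j q) (x, s + \<tau>)))"
      unfolding dx_def by (intro Bochner_Integration.integral_sum[symmetric] ki test_fun_dderiv q)
    finally have lap: "(LINT x|lborel. lap_gauss (\<rho> + \<tau>) (x - y) * q (x, s + \<tau>))
      = (LINT x|lborel. (\<Sum>j\<in>UNIV. gauss (\<rho> + \<tau>) (x - y) * dx j (dx j q) (x, s + \<tau>)))" .
    have "(LINT x|lborel. indicator S (\<tau>, x) * D (\<tau>, x)) = (LINT x|lborel. D (\<tau>, x))"
      using True K1 by (intro Bochner_Integration.integral_cong) (auto simp: S_def indicator_def D_def dt_def)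
    also have "\<dots> = (LINT x|lborel. lap_gauss (\<rho> + \<tau>) (x - y) * q (x, s + \<tau>)) + (LINT x|lborel. gauss (\<rho> + \<tau>) (x - y) * dt q (x, s + \<tau>))"
      unfolding D_def prod.case dt_def by (intro Bochner_Integration.integral_add ki q qd)
    also have "\<dots> = (LINT x|lborel. (\<Sum>j\<in>UNIV. gauss (\<rho> + \<tau>) (x - y) * dx j (dx j q) (x, s + \<tau>)) + gauss (\<rho> + \<tau>) (x - y) * dt q (x, s + \<tau>))"
      unfolding lap unfolding dx_def dt_def
      by (intro Bochner_Integration.integral_add[symmetric] Bochner_Integration.integrable_sum ki test_fun_dderiv q)
    also have "\<dots> = (LINT x|lborel. gauss (\<rho> + \<tau>) (x - y) * heat_op q (x, s + \<tau>))"
      by (simp add: heat_op_def sum_distrib_left algebra_simps)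
    finally show ?thesis using True by simp
  next
    case False
    then consider "\<tau> < 0" | "\<tau> > R" using \<open>\<tau> \<noteq> 0\<close> by linarith
    then show ?thesis
    proof cases
      case 2
      then show ?thesis using Rq[of \<tau>] by (simp add: S_def)
    qed (simp add: S_def)
  qed
  note [measurable (raw)] = measurable_pair_compose[OF test_fun_measurable[OF heat_op_test[OF q]]]
  have m: "(\<lambda>\<tau>. (LINT x|lborel. gauss (\<rho> + \<tau>) (x - y) * heat_op q (x, s + \<tau>)) * indicator {0<..} \<tau>) \<in> borel_measurable lborel"
    by measurable
  have "(LINT \<tau>|lborel. (LINT x|lborel. gauss (\<rho> + \<tau>) (x - y) * heat_op q (x, s + \<tau>)) * indicator {0<..} \<tau>)
     = (LINT \<tau>|lborel. LINT x|lborel. indicator S (\<tau>, x) * D (\<tau>, x))"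
  proof (rule integral_cong_AE[OF m])
    show "(\<lambda>\<tau>. LINT x|lborel. indicator S (\<tau>, x) * D (\<tau>, x)) \<in> borel_measurable lborel"
      using borel_measurable_integrable[OF lborel_pair.integrable_fst'[OF int]] by simp
    show "AE \<tau> in lborel. (LINT x|lborel. gauss (\<rho> + \<tau>) (x - y) * heat_op q (x, s + \<tau>)) * indicator {0<..} \<tau>
      = (LINT x|lborel. indicator S (\<tau>, x) * D (\<tau>, x))"
      using AE_lborel_singleton[of 0] by eventually_elim (rule sp[symmetric])
  qed
  also have "\<dots> = (LINT x|lborel. LINT \<tau>|lborel. indicator S (\<tau>, x) * D (\<tau>, x))"
    by (rule lborel_pair.Fubini_integral[OF int, symmetric])
  finally show ?thesis unfolding time by simp
qed

text \<open>The exponents are those of the pressure kernel. Its second derivatives have size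
  1/\<rho>; near 0 they gain \<rho>^(1/4) from half a power of |z| (\<open>G2_diff_sqrt_le\<close>),
  and at infinity \<rho>^(-3/2) from the maximum of the Gaussian.\<close>

definition major :: "real \<Rightarrow> real" where
  "major \<rho> = \<rho> powr (- 3 / 4) * indicator {0<..1} \<rho> + \<rho> powr (- 5 / 2) * indicator {1<..} \<rho>"

lemma major_nonneg [simp]: "0 \<le> major \<rho>"
  by (simp add: major_def)

lemma major_measurable [measurable]: "major \<in> borel_measurable borel"
  unfolding major_def[abs_def] by measurable

lemma major_integrable: "integrable lborel major"
proof (rule integrableI_bounded)
  have "(\<integral>\<^sup>+\<rho>. ennreal (norm (major \<rho>)) \<partial>lborel)
     \<le> (\<integral>\<^sup>+\<rho>. ennreal (\<rho> powr - (3/4)) * indicator {0<..<2} \<rho> + ennreal (\<rho> powr - (5/2)) * indicator {1<..} \<rho> \<partial>lborel)"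
    by (intro nn_integral_mono) (auto simp: major_def indicator_def)
  also have "\<dots> = ennreal (2 powr (1 - 3/4) / (1 - 3/4)) + ennreal (1 powr (1 - 5/2) / (5/2 - 1))"
    by (subst nn_integral_add) (simp_all add: nn_integral_powr_near_0 nn_integral_powr_tail)
  also have "\<dots> < \<infinity>" by (simp flip: ennreal_plus)
  finally show "(\<integral>\<^sup>+\<rho>. ennreal (norm (major \<rho>)) \<partial>lborel) < \<infinity>" .
qed simp

lemma le_major:
  assumes "0 < \<rho>" "0 \<le> C1" "0 \<le> C2" "\<rho> \<le> 1 \<Longrightarrow> r \<le> C1 * \<rho> powr (- 3 / 4)" "r \<le> C2 * \<rho> powr (- 5 / 2)"
  shows "r \<le> (C1 + C2) * major \<rho>"
proof (cases "\<rho> \<le> 1")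
  case True
  then have "r \<le> C1 * \<rho> powr (- 3 / 4)" using assms by simp
  also have "\<dots> \<le> (C1 + C2) * \<rho> powr (- 3 / 4)" using assms by (intro mult_right_mono) auto
  finally show ?thesis using True assms by (simp add: major_def)
next
  case False
  have "r \<le> C2 * \<rho> powr (- 5 / 2)" by fact
  also have "\<dots> \<le> (C1 + C2) * \<rho> powr (- 5 / 2)" using assms by (intro mult_right_mono) auto
  finally show ?thesis using False assms by (simp add: major_def)
qed

lemma one_le_powr_neg: "0 < \<rho> \<Longrightarrow> \<rho> \<le> 1 \<Longrightarrow> 0 \<le> c \<Longrightarrow> 1 \<le> \<rho> powr (- c)" for \<rho> :: real
  using powr_mono2'[of "- c" \<rho> 1] by simp

lemma gauss_integral:
  assumes "0 < s"
  shows "integrable lborel (\<lambda>y. gauss s (x - y))" "(LINT y|lborel. gauss s (x - y)) = 1"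
    "integrable lborel (\<lambda>x. gauss s (x - y))" "(LINT x|lborel. gauss s (x - y)) = 1"
proof -
  show "integrable lborel (\<lambda>y. gauss s (x - y))" "integrable lborel (\<lambda>x. gauss s (x - y))"
    using nn_integral_gauss_shift(1,2)[OF assms] by (auto intro!: integrableI_bounded)
  then show "(LINT y|lborel. gauss s (x - y)) = 1" "(LINT x|lborel. gauss s (x - y)) = 1"
    using nn_integral_gauss_shift(1,2)[OF assms] by (simp_all add: integral_eq_nn_integral)
qed

section \<open>Uniform bounds and limits for kernels paired with test functions\<close>

lemma dderiv_axis:
  fixes q :: "space \<times> real \<Rightarrow> 'b::real_normed_vector"
  assumes q: "smooth q"
  shows "dderiv (a, 0) q z = (\<Sum>j\<in>UNIV. (a $ j) *\<^sub>R dx j q z)"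
proof -
  have L: "linear (\<lambda>v. dderiv (v, 0) q z)"
  proof (rule linearI)
    show "dderiv (u + v, 0) q z = dderiv (u, 0) q z + dderiv (v, 0) q z" for u v
      using dderiv_linear(1)[OF q, of "(u, 0)" "(v, 0)" z] by simp
    show "dderiv (t *\<^sub>R v, 0) q z = t *\<^sub>R dderiv (v, 0) q z" for t v
      using dderiv_linear(2)[OF q, of t "(v, 0)" z] by simp
  qed
  have "a = (\<Sum>j\<in>UNIV. (a $ j) *\<^sub>R axis j 1)"
    using basis_expansion[of a] by (simp add: scalar_mult_eq_scaleR)
  then have "dderiv (a, 0) q z = dderiv (\<Sum>j\<in>UNIV. (a $ j) *\<^sub>R axis j 1, 0) q z" by simp
  also have "\<dots> = (\<Sum>j\<in>UNIV. (a $ j) *\<^sub>R dx j q z)"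
    by (simp add: linear_sum[OF L] linear_cmul[OF L] dx_def)
  finally show ?thesis .
qed

lemma dderiv_test_bound:
  fixes q :: "space \<times> real \<Rightarrow> real"
  assumes q: "q \<in> test_fun \<Omega>"
  shows "\<exists>C\<ge>0. \<forall>a z. \<bar>dderiv (a, 0) q z\<bar> \<le> C * norm a"
proof -
  have "\<exists>B\<ge>0. \<forall>z. norm (dx j q z) \<le> B" for j
    unfolding dx_def using test_fun_bounded[OF test_fun_dderiv[OF q]] by metis
  then obtain B where B: "\<And>j. 0 \<le> B j" "\<And>j z. norm (dx j q z) \<le> B j" by metis
  have "\<bar>dderiv (a, 0) q z\<bar> \<le> (\<Sum>j\<in>UNIV. B j) * norm a" for a z
  proof -
    have "\<bar>dderiv (a, 0) q z\<bar> \<le> (\<Sum>j\<in>UNIV. \<bar>a $ j * dx j q z\<bar>)"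
      unfolding dderiv_axis[OF test_fun_smooth[OF q]] real_scaleR_def by (rule sum_abs)
    also have "\<dots> \<le> (\<Sum>j\<in>UNIV. norm a * B j)"
      unfolding abs_mult using B component_le_norm_cart[of a] by (intro sum_mono mult_mono) auto
    finally show ?thesis by (simp add: sum_distrib_left mult.commute)
  qed
  then show ?thesis using B by (intro exI[of _ "\<Sum>j\<in>UNIV. B j"]) (auto intro: sum_nonneg)
qed

lemma dderiv2_test_bound:
  fixes q :: "space \<times> real \<Rightarrow> real"
  assumes q: "q \<in> test_fun \<Omega>"
  shows "\<exists>C\<ge>0. \<forall>a z. \<bar>dderiv (a, 0) (dderiv (a, 0) q) z\<bar> \<le> C * (norm a)\<^sup>2"
proof -
  note sm = test_fun_smooth[OF q]
  have "\<exists>C\<ge>0. \<forall>a z. \<bar>dderiv (a, 0) (dx j q) z\<bar> \<le> C * norm a" for j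
    unfolding dx_def by (rule dderiv_test_bound[OF test_fun_dderiv[OF q]])
  then obtain B where B: "\<And>j. 0 \<le> B j" "\<And>j a z. \<bar>dderiv (a, 0) (dx j q) z\<bar> \<le> B j * norm a" by metis
  have "\<bar>dderiv (a, 0) (dderiv (a, 0) q) z\<bar> \<le> (\<Sum>j\<in>UNIV. B j) * (norm a)\<^sup>2" for a z
  proof -
    have "dderiv (a, 0) (dderiv (a, 0) q) z = (\<Sum>j\<in>UNIV. a $ j * dderiv (a, 0) (dx j q) z)"
    proof -
      have "dx j (dderiv (a, 0) q) = dderiv (a, 0) (dx j q)" for j
        unfolding dx_def by (rule dderiv_commute[OF sm])
      then show ?thesis
        using dderiv_axis[OF smooth_dderiv[OF sm], of a "(a, 0)" z] by simp
    qed
    also have "\<bar>\<dots>\<bar> \<le> (\<Sum>j\<in>UNIV. \<bar>a $ j * dderiv (a, 0) (dx j q) z\<bar>)" by (rule sum_abs)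
    also have "\<dots> \<le> (\<Sum>j\<in>UNIV. norm a * (B j * norm a))"
      unfolding abs_mult using B component_le_norm_cart[of a] by (intro sum_mono mult_mono) auto
    finally show ?thesis by (simp add: sum_distrib_left mult_ac power2_eq_square)
  qed
  then show ?thesis using B by (intro exI[of _ "\<Sum>j\<in>UNIV. B j"]) (auto intro: sum_nonneg)
qed

lemma test_slice_integrable:
  fixes q :: "space \<times> real \<Rightarrow> 'b::euclidean_space"
  assumes q: "q \<in> test_fun \<Omega>"
  shows "integrable lborel (\<lambda>x. q (x, t))"
  using kernel_test_integrable[OF q, of "\<lambda>_. 1"] by simp

text \<open>One bound serves all times because all slices live in the same compact projection of the
  support.\<close>

lemma test_slice_L1_bound:
  fixes q :: "space \<times> real \<Rightarrow> 'b::euclidean_space"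
  assumes q: "q \<in> test_fun \<Omega>"
  shows "\<exists>C\<ge>0. \<forall>t. (LINT x|lborel. norm (q (x, t))) \<le> C"
proof -
  obtain K where K: "compact K" "\<And>z. z \<notin> K \<Longrightarrow> q z = 0" using test_fun_support[OF q] by blast
  obtain B where B: "0 \<le> B" "\<And>z. norm (q z) \<le> B" using test_fun_bounded[OF q] by metis
  note cK = compact_projections(1)[OF K(1)]
  have iK: "integrable lborel (\<lambda>x. B * indicator (fst ` K) x)"
    using emeasure_compact_finite[OF cK] cK by (intro integrable_mult_right integrable_real_indicator) (auto intro: borel_compact)
  have "(LINT x|lborel. norm (q (x, t))) \<le> (LINT x|lborel. B * indicator (fst ` K) x)" for t
  proof (rule integral_mono[OF integrable_norm[OF test_slice_integrable[OF q]] iK])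
    show "norm (q (x, t)) \<le> B * indicator (fst ` K) x" for x
      using B(2)[of "(x, t)"] K(2)[OF notin_projections(1), of x t] by (cases "x \<in> fst ` K") auto
  qed
  then show ?thesis using B
    by (intro exI[of _ "LINT x|lborel. B * indicator (fst ` K) x"] conjI allI Bochner_Integration.integral_nonneg) auto
qed

text \<open>For small \<rho> both derivatives are moved to \<open>q\<close> and the Gaussian has
  mass 1; for large \<rho> the kernel itself is small. The bound is quadratic in \<open>a\<close>
  because \<open>a\<close> will be the velocity at \<open>y\<close>, which is square integrable in
  \<open>y\<close>.\<close>

lemma G2_test_bound:
  fixes q :: "space \<times> real \<Rightarrow> real"
  assumes q: "q \<in> test_fun UNIV"
  shows "\<exists>C\<ge>0. \<forall>\<rho>>0. \<forall>y t a. \<bar>LINT x|lborel. G2 \<rho> (x - y) a a * q (x, t)\<bar> \<le> C * (norm a)\<^sup>2 * major \<rho>"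
proof -
  obtain C1 where C1: "0 \<le> C1" "\<And>a z. \<bar>dderiv (a, 0) (dderiv (a, 0) q) z\<bar> \<le> C1 * (norm a)\<^sup>2"
    using dderiv2_test_bound[OF q] by blast
  obtain C2 where C2: "0 \<le> C2" "\<And>t. (LINT x|lborel. norm (q (x, t))) \<le> C2"
    using test_slice_L1_bound[OF q] by blast
  have "\<bar>LINT x|lborel. G2 \<rho> (x - y) a a * q (x, t)\<bar> \<le> (C1 + 14 * C2) * (norm a)\<^sup>2 * major \<rho>"
    if \<rho>: "0 < \<rho>" for \<rho> y t a
  proof -
    note gi = gauss_integral[OF \<rho>]
    have "\<bar>LINT x|lborel. G2 \<rho> (x - y) a a * q (x, t)\<bar> \<le> (C1 * (norm a)\<^sup>2 + 14 * C2 * (norm a)\<^sup>2) * major \<rho>"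
    proof (rule le_major[OF \<rho>])
      assume "\<rho> \<le> 1"
      have "\<bar>LINT x|lborel. G2 \<rho> (x - y) a a * q (x, t)\<bar> = \<bar>LINT x|lborel. gauss \<rho> (x - y) * dderiv (a, 0) (dderiv (a, 0) q) (x, t)\<bar>"
        by (simp add: G2_by_parts[OF q \<rho>])
      also have "\<dots> \<le> (LINT x|lborel. norm (gauss \<rho> (x - y) * dderiv (a, 0) (dderiv (a, 0) q) (x, t)))"
        using integral_norm_bound[of lborel "\<lambda>x. gauss \<rho> (x - y) * dderiv (a, 0) (dderiv (a, 0) q) (x, t)"] by simp
      also have "\<dots> \<le> (LINT x|lborel. gauss \<rho> (x - y) * (C1 * (norm a)\<^sup>2))"
      proof (rule integral_mono)
        show "integrable lborel (\<lambda>x. norm (gauss \<rho> (x - y) * dderiv (a, 0) (dderiv (a, 0) q) (x, t)))"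
          by (intro integrable_norm kernel_test_integrable_real[where \<Omega>=UNIV] test_fun_dderiv q kernels_continuous \<rho>)
      qed (use gi C1 in \<open>auto simp: abs_mult intro!: mult_left_mono\<close>)
      also have "\<dots> = C1 * (norm a)\<^sup>2" using gi by simp
      also have "\<dots> \<le> C1 * (norm a)\<^sup>2 * \<rho> powr (- 3 / 4)"
        using mult_left_mono[OF one_le_powr_neg[of \<rho> "3/4"], of "C1 * (norm a)\<^sup>2"] \<rho> \<open>\<rho> \<le> 1\<close> C1(1) by simp
      finally show "\<bar>LINT x|lborel. G2 \<rho> (x - y) a a * q (x, t)\<bar> \<le> C1 * (norm a)\<^sup>2 * \<rho> powr (- 3 / 4)" .
    next
      have "\<bar>LINT x|lborel. G2 \<rho> (x - y) a a * q (x, t)\<bar> \<le> (LINT x|lborel. norm (G2 \<rho> (x - y) a a * q (x, t)))"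
        using integral_norm_bound[of lborel "\<lambda>x. G2 \<rho> (x - y) a a * q (x, t)"] by simp
      also have "\<dots> \<le> (LINT x|lborel. (14 * (norm a)\<^sup>2 * \<rho> powr (- 5 / 2)) * norm (q (x, t)))"
      proof (rule integral_mono)
        show "integrable lborel (\<lambda>x. norm (G2 \<rho> (x - y) a a * q (x, t)))"
          by (intro integrable_norm kernel_test_integrable_real[where \<Omega>=UNIV] q kernels_continuous \<rho>)
        show "norm (G2 \<rho> (x - y) a a * q (x, t)) \<le> (14 * (norm a)\<^sup>2 * \<rho> powr (- 5 / 2)) * norm (q (x, t))" for x
        proof -
          have "gauss (2 * \<rho>) (x - y) \<le> (2 * \<rho>) powr (- 3 / 2)" using \<rho> by (intro gauss_le) simp
          also have "\<dots> \<le> \<rho> powr (- 3 / 2)" using \<rho> by (intro powr_mono2') auto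
          finally have "gauss (2 * \<rho>) (x - y) / \<rho> \<le> \<rho> powr (- 3 / 2) / \<rho>"
            using \<rho> by (intro divide_right_mono) auto
          also have "\<dots> = \<rho> powr (- 5 / 2)"
            using \<rho> powr_diff[of \<rho> "- 3/2" 1] by simp
          finally have "\<bar>G2 \<rho> (x - y) a a\<bar> \<le> 14 * (norm a)\<^sup>2 * \<rho> powr (- 5 / 2)"
            using G2_le[OF \<rho>, of "x - y" a] by (meson mult_left_mono order_trans zero_le_mult_iff zero_le_numeral zero_le_power2)
          then show ?thesis by (simp add: abs_mult mult_right_mono)
        qed
      qed (intro integrable_mult_right integrable_norm test_slice_integrable[OF q])
      also have "\<dots> \<le> (14 * (norm a)\<^sup>2 * \<rho> powr (- 5 / 2)) * C2"
        using C2 by (simp add: mult_left_mono)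
      finally show "\<bar>LINT x|lborel. G2 \<rho> (x - y) a a * q (x, t)\<bar> \<le> 14 * C2 * (norm a)\<^sup>2 * \<rho> powr (- 5 / 2)"
        by (simp add: mult_ac)
    qed (use C1 C2 in auto)
    then show ?thesis by (simp add: algebra_simps)
  qed
  then show ?thesis using C1 C2 by (intro exI[of _ "C1 + 14 * C2"]) auto
qed

lemma lap_gauss_test_eq:
  fixes q :: "space \<times> real \<Rightarrow> real"
  assumes q: "q \<in> test_fun UNIV" and \<rho>: "0 < \<rho>"
  shows "(LINT x|lborel. lap_gauss \<rho> (x - y) * q (x, t)) = (\<Sum>i\<in>UNIV. LINT x|lborel. G2 \<rho> (x - y) (axis i 1) (axis i 1) * q (x, t))"
  unfolding lap_gauss_eq sum_distrib_right
  by (intro Bochner_Integration.integral_sum kernel_test_integrable_real[where \<Omega>=UNIV] q kernels_continuous \<rho>)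

lemma lap_gauss_test_bound:
  fixes q :: "space \<times> real \<Rightarrow> real"
  assumes q: "q \<in> test_fun UNIV"
  shows "\<exists>C\<ge>0. \<forall>\<rho>>0. \<forall>y t. \<bar>LINT x|lborel. lap_gauss \<rho> (x - y) * q (x, t)\<bar> \<le> C * major \<rho>"
proof -
  obtain C where C: "0 \<le> C" "\<And>\<rho> y t a. 0 < \<rho> \<Longrightarrow> \<bar>LINT x|lborel. G2 \<rho> (x - y) a a * q (x, t)\<bar> \<le> C * (norm a)\<^sup>2 * major \<rho>"
    using G2_test_bound[OF q] by blast
  have "\<bar>LINT x|lborel. lap_gauss \<rho> (x - y) * q (x, t)\<bar> \<le> 3 * C * major \<rho>" if \<rho>: "0 < \<rho>" for \<rho> y t
  proof -
    have "\<bar>LINT x|lborel. lap_gauss \<rho> (x - y) * q (x, t)\<bar> \<le> (\<Sum>i\<in>(UNIV::3 set). \<bar>LINT x|lborel. G2 \<rho> (x - y) (axis i 1) (axis i 1) * q (x, t)\<bar>)"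
      unfolding lap_gauss_test_eq[OF q \<rho>] by (rule sum_abs)
    also have "\<dots> \<le> (\<Sum>i\<in>(UNIV::3 set). C * major \<rho>)"
      using C(2)[OF \<rho>, of y "axis _ 1"] by (intro sum_mono) (simp add: norm_axis_1)
    finally show ?thesis by simp
  qed
  then show ?thesis using C(1) by (intro exI[of _ "3 * C"]) auto
qed

lemma test_lipschitz:
  fixes q :: "space \<times> real \<Rightarrow> real"
  assumes q: "q \<in> test_fun \<Omega>"
  shows "\<exists>C\<ge>0. \<forall>x y t. \<bar>q (x, t) - q (y, t)\<bar> \<le> C * norm (x - y)"
proof -
  obtain C where C: "0 \<le> C" "\<And>a z. \<bar>dderiv (a, 0) q z\<bar> \<le> C * norm a"
    using dderiv_test_bound[OF q] by blast
  have "\<bar>q (x, t) - q (y, t)\<bar> \<le> C * norm (x - y)" for x y t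
  proof -
    have "((\<lambda>r. q (y + r *\<^sub>R (x - y), t)) has_real_derivative dderiv (x - y, 0) q (y + r *\<^sub>R (x - y), t)) (at r)" for r
      using smooth_line_derivative_real[OF test_fun_smooth[OF q], of "(y, t)" "(x - y, 0)" r] by simp
    then obtain r where "q (y + 1 *\<^sub>R (x - y), t) - q (y + 0 *\<^sub>R (x - y), t) = (1 - 0) * dderiv (x - y, 0) q (y + r *\<^sub>R (x - y), t)"
      using MVT2[of 0 1 "\<lambda>r. q (y + r *\<^sub>R (x - y), t)" "\<lambda>r. dderiv (x - y, 0) q (y + r *\<^sub>R (x - y), t)"] by auto
    then show ?thesis using C(2)[of "x - y"] by simp
  qed
  then show ?thesis using C(1) by blast
qed

text \<open>\<open>q\<close> is Lipschitz and the first moment of the Gaussian is of order sqrt s,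
  so the error is of that order as well.\<close>

lemma gauss_test_small_time:
  fixes q :: "space \<times> real \<Rightarrow> real"
  assumes q: "q \<in> test_fun \<Omega>"
  shows "((\<lambda>s. LINT x|lborel. gauss s (x - y) * q (x, t)) \<longlongrightarrow> q (y, t)) (at_right 0)"
proof -
  obtain C where C: "0 \<le> C" "\<And>x y t. \<bar>q (x, t) - q (y, t)\<bar> \<le> C * norm (x - y)"
    using test_lipschitz[OF q] by blast
  have "\<bar>(LINT x|lborel. gauss s (x - y) * q (x, t)) - q (y, t)\<bar> \<le> 12 * C * sqrt s" if s: "0 < s" for s
  proof -
    note gi = gauss_integral[OF s] and gi2 = gauss_integral[of "2 * s"]
    have i: "integrable lborel (\<lambda>x. gauss s (x - y) * q (x, t))"
      by (intro kernel_test_integrable_real[OF q] kernels_continuous s)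
    have "(LINT x|lborel. gauss s (x - y) * q (x, t)) - q (y, t) = (LINT x|lborel. gauss s (x - y) * q (x, t) - gauss s (x - y) * q (y, t))"
      using i gi by (subst Bochner_Integration.integral_diff) auto
    also have "\<bar>\<dots>\<bar> \<le> (LINT x|lborel. norm (gauss s (x - y) * q (x, t) - gauss s (x - y) * q (y, t)))"
      using integral_norm_bound[of lborel "\<lambda>x. gauss s (x - y) * q (x, t) - gauss s (x - y) * q (y, t)"] by simp
    also have "\<dots> \<le> (LINT x|lborel. (12 * C * sqrt s) * gauss (2 * s) (x - y))"
    proof (rule integral_mono)
      show "norm (gauss s (x - y) * q (x, t) - gauss s (x - y) * q (y, t)) \<le> (12 * C * sqrt s) * gauss (2 * s) (x - y)" for x
      proof -
        have "norm (gauss s (x - y) * q (x, t) - gauss s (x - y) * q (y, t)) = gauss s (x - y) * \<bar>q (x, t) - q (y, t)\<bar>"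
          by (simp add: right_diff_distrib[symmetric] abs_mult)
        also have "\<dots> \<le> gauss s (x - y) * (C * norm (x - y))"
          using C by (intro mult_left_mono) auto
        also have "\<dots> = C * (norm (x - y) * gauss s (x - y))" by simp
        also have "\<dots> \<le> C * (12 * sqrt s * gauss (2 * s) (x - y))"
          using power_gauss_bounds(2)[OF s] C by (intro mult_left_mono) auto
        finally show ?thesis by simp
      qed
    qed (use i gi gi2 s in auto)
    also have "\<dots> = 12 * C * sqrt s" using gi2 s by simp
    finally show ?thesis .
  qed
  then have "\<forall>\<^sub>F s in at_right 0. norm ((LINT x|lborel. gauss s (x - y) * q (x, t)) - q (y, t)) \<le> 12 * C * sqrt s"
    by (auto simp: eventually_at_right_field intro: exI[of _ 1])
  moreover have "((\<lambda>s. 12 * C * sqrt s) \<longlongrightarrow> 0) (at_right 0)"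
    by (auto intro!: tendsto_eq_intros)
  ultimately show ?thesis
    by (rule LIM_zero_cancel[OF Lim_null_comparison])
qed

lemma gauss_test_large_time:
  fixes q :: "space \<times> real \<Rightarrow> real"
  assumes q: "q \<in> test_fun \<Omega>"
  shows "((\<lambda>s. LINT x|lborel. gauss s (x - y) * q (x, t)) \<longlongrightarrow> 0) at_top"
proof -
  note qi = test_slice_integrable[OF q]
  define C where "C = (LINT x|lborel. norm (q (x, t)))"
  have "\<bar>LINT x|lborel. gauss s (x - y) * q (x, t)\<bar> \<le> s powr (- 3 / 2) * C" if s: "0 < s" for s
  proof -
    have "\<bar>LINT x|lborel. gauss s (x - y) * q (x, t)\<bar> \<le> (LINT x|lborel. norm (gauss s (x - y) * q (x, t)))"
      using integral_norm_bound[of lborel "\<lambda>x. gauss s (x - y) * q (x, t)"] by simp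
    also have "\<dots> \<le> (LINT x|lborel. s powr (- 3 / 2) * norm (q (x, t)))"
    proof (intro integral_mono integrable_norm kernel_test_integrable_real[OF q] kernels_continuous s integrable_mult_right qi)
      show "norm (gauss s (x - y) * q (x, t)) \<le> s powr (- 3 / 2) * norm (q (x, t))" for x
        using mult_right_mono[OF gauss_le[OF s, of "x - y"], of "norm (q (x, t))"] by (simp add: abs_mult)
    qed
    finally show ?thesis by (simp add: C_def)
  qed
  then have "\<forall>\<^sub>F s in at_top. norm (LINT x|lborel. gauss s (x - y) * q (x, t)) \<le> s powr (- 3 / 2) * C"
    by (intro eventually_mono[OF eventually_gt_at_top[of 0]]) auto
  moreover have "((\<lambda>s::real. s powr (- 3 / 2) * C) \<longlongrightarrow> 0) at_top"
    by (intro tendsto_mult_left_zero tendsto_neg_powr filterlim_ident) simp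
  ultimately show ?thesis by (rule Lim_null_comparison)
qed

text \<open>The integrand is the \<rho>-derivative of the Gaussian paired with \<open>q\<close>, so
  the integral is the limit 0 at infinity minus the limit \<open>q (y, t)\<close> at 0. In operator
  terms: the Laplacian cancels the representation of its inverse.\<close>

lemma lap_gauss_total_integral:
  fixes q :: "space \<times> real \<Rightarrow> real"
  assumes q: "q \<in> test_fun UNIV"
  shows "integrable lborel (\<lambda>\<rho>. (LINT x|lborel. lap_gauss \<rho> (x - y) * q (x, t)) * indicator {0<..} \<rho>)"
    and "(LINT \<rho>|lborel. (LINT x|lborel. lap_gauss \<rho> (x - y) * q (x, t)) * indicator {0<..} \<rho>) = - q (y, t)"
proof -
  note [measurable (raw)] = measurable_pair_compose[OF test_fun_measurable[OF q]]
  obtain C where C: "0 \<le> C" "\<And>\<rho> y t. 0 < \<rho> \<Longrightarrow> \<bar>LINT x|lborel. lap_gauss \<rho> (x - y) * q (x, t)\<bar> \<le> C * major \<rho>"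
    using lap_gauss_test_bound[OF q] by blast
  let ?r = "\<lambda>\<rho>. LINT x|lborel. lap_gauss \<rho> (x - y) * q (x, t)"
  have bound: "norm (?r \<rho> * indicator A \<rho>) \<le> C * major \<rho>" if "A \<subseteq> {0<..}" for \<rho> A
    using C(2)[of \<rho> y t] C(1) that by (cases "\<rho> \<in> A") (auto simp: indicator_def)
  have im: "integrable lborel (\<lambda>\<rho>. C * major \<rho>)" using major_integrable by simp
  show int: "integrable lborel (\<lambda>\<rho>. ?r \<rho> * indicator {0<..} \<rho>)"
    by (rule Bochner_Integration.integrable_bound[OF im]) (use bound[of "{0<..}"] C in \<open>auto simp: abs_mult\<close>)
  obtain K where K: "compact K" "\<And>z. z \<notin> K \<Longrightarrow> q z = 0" using test_fun_support[OF q] by blast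
  define e where "e n = 1 / (real n + 1)" for n
  define R where "R n = real n + 1" for n
  have eR: "0 < e n" "e n \<le> R n" for n
    by (auto simp: e_def R_def field_simps)
  \<comment> \<open>The integrals in x and \<rho> are exchanged on a compact range of heat times
    only, since the double integral need not converge absolutely near \<rho> = 0. The half-line is
    reached afterwards by dominated convergence with \<open>major\<close>.\<close>
  have fin: "(LINT \<rho>|lborel. ?r \<rho> * indicator {e n..R n} \<rho>)
     = (LINT x|lborel. gauss (R n) (x - y) * q (x, t)) - (LINT x|lborel. gauss (e n) (x - y) * q (x, t))" for n
  proof -
    define S where "S = {e n..R n} \<times> (fst ` K)"
    define D where "D = (\<lambda>(\<rho>, x). lap_gauss \<rho> (x - y) * q (x, t))"
    have S: "compact S" unfolding S_def by (intro compact_Times compact_projections K compact_Icc)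
    have "continuous_on S D"
      unfolding D_def case_prod_beta using eR[of n]
      by (intro continuous_intros gauss_continuous_on smooth_pair_continuous test_fun_smooth[OF q]) (auto simp: S_def)
    then have int: "integrable (lborel \<Otimes>\<^sub>M lborel) (\<lambda>(\<rho>, x). indicator S (\<rho>, x) * D (\<rho>, x))"
      using borel_integrable_compact[OF S, of D] by (simp add: lborel_prod case_prod_beta')
    have "(LINT \<rho>|lborel. ?r \<rho> * indicator {e n..R n} \<rho>) = (LINT \<rho>|lborel. LINT x|lborel. indicator S (\<rho>, x) * D (\<rho>, x))"
    proof (rule Bochner_Integration.integral_cong[OF refl])
      fix \<rho>
      have "(LINT x|lborel. indicator S (\<rho>, x) * D (\<rho>, x)) = (LINT x|lborel. (lap_gauss \<rho> (x - y) * q (x, t)) * indicator {e n..R n} \<rho>)"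
      proof (rule Bochner_Integration.integral_cong[OF refl])
        show "indicator S (\<rho>, x) * D (\<rho>, x) = (lap_gauss \<rho> (x - y) * q (x, t)) * indicator {e n..R n} \<rho>" for x
          using K(2)[OF notin_projections(1), of x t] by (cases "x \<in> fst ` K") (auto simp: S_def D_def indicator_def)
      qed
      then show "?r \<rho> * indicator {e n..R n} \<rho> = (LINT x|lborel. indicator S (\<rho>, x) * D (\<rho>, x))" by simp
    qed
    also have "\<dots> = (LINT x|lborel. LINT \<rho>|lborel. indicator S (\<rho>, x) * D (\<rho>, x))"
      by (rule lborel_pair.Fubini_integral[OF int, symmetric])
    also have "\<dots> = (LINT x|lborel. gauss (R n) (x - y) * q (x, t) - gauss (e n) (x - y) * q (x, t))"
    proof (rule Bochner_Integration.integral_cong[OF refl])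
      fix x
      have "(LINT \<rho>|lborel. lap_gauss \<rho> (x - y) * indicator {e n..R n} \<rho>) = gauss (R n) (x - y) - gauss (e n) (x - y)"
      proof (rule integral_FTC_Icc_real[OF eR(2)])
        fix \<rho> assume "e n \<le> \<rho>"
        then have pos: "0 < \<rho>" using eR(1)[of n] by linarith
        show "((\<lambda>s. gauss s (x - y)) has_real_derivative lap_gauss \<rho> (x - y)) (at \<rho>)"
          by (rule gauss_time_deriv[OF pos])
        have "continuous_on {0<..} (\<lambda>\<rho>. lap_gauss \<rho> (x - y))"
          by (intro gauss_continuous_on continuous_intros) auto
        then show "isCont (\<lambda>\<rho>. lap_gauss \<rho> (x - y)) \<rho>"
          using pos by (simp add: continuous_on_eq_continuous_at)
      qed
      then have "(LINT \<rho>|lborel. (lap_gauss \<rho> (x - y) * indicator {e n..R n} \<rho>) * q (x, t)) = gauss (R n) (x - y) * q (x, t) - gauss (e n) (x - y) * q (x, t)"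
        by (simp add: left_diff_distrib)
      moreover have "indicator S (\<rho>, x) * D (\<rho>, x) = (lap_gauss \<rho> (x - y) * indicator {e n..R n} \<rho>) * q (x, t)" for \<rho>
        using K(2)[OF notin_projections(1), of x t] by (cases "x \<in> fst ` K") (auto simp: S_def D_def indicator_def)
      ultimately show "(LINT \<rho>|lborel. indicator S (\<rho>, x) * D (\<rho>, x)) = gauss (R n) (x - y) * q (x, t) - gauss (e n) (x - y) * q (x, t)"
        by simp
    qed
    also have "\<dots> = (LINT x|lborel. gauss (R n) (x - y) * q (x, t)) - (LINT x|lborel. gauss (e n) (x - y) * q (x, t))"
      using eR[of n] by (intro Bochner_Integration.integral_diff kernel_test_integrable_real[OF q] kernels_continuous) auto
    finally show ?thesis .
  qed
  have lim1: "(\<lambda>n. LINT \<rho>|lborel. ?r \<rho> * indicator {e n..R n} \<rho>) \<longlonglongrightarrow> (LINT \<rho>|lborel. ?r \<rho> * indicator {0<..} \<rho>)"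
  proof (rule integral_dominated_convergence[OF _ _ im])
    show "AE \<rho> in lborel. (\<lambda>n. ?r \<rho> * indicator {e n..R n} \<rho>) \<longlonglongrightarrow> ?r \<rho> * indicator {0<..} \<rho>"
    proof (intro AE_I2 tendsto_mult tendsto_const)
      fix \<rho> :: real
      have "\<forall>\<^sub>F n in sequentially. indicator {e n..R n} \<rho> = (indicator {0<..} \<rho> :: real)"
      proof (cases "0 < \<rho>")
        case True
        have "\<forall>\<^sub>F n in sequentially. e n < \<rho>"
          using True unfolding e_def by real_asymp
        moreover have "\<forall>\<^sub>F n in sequentially. \<rho> < R n" unfolding R_def by real_asymp
        ultimately show ?thesis by eventually_elim (use True in auto)
      next
        case False
        then have "\<rho> \<notin> {e n..R n}" for n using eR[of n] by (auto simp: not_less)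
        then show ?thesis using False by simp
      qed
      then show "(\<lambda>n. indicator {e n..R n} \<rho> :: real) \<longlonglongrightarrow> indicator {0<..} \<rho>"
        by (rule tendsto_eventually)
    qed
    show "AE \<rho> in lborel. norm (?r \<rho> * indicator {e n..R n} \<rho>) \<le> C * major \<rho>" for n
      using eR(1)[of n] by (intro AE_I2 bound) auto
  qed auto
  have "filterlim e (at_right 0) sequentially" "filterlim R at_top sequentially"
    unfolding e_def R_def by real_asymp+
  then have "(\<lambda>n. (LINT x|lborel. gauss (R n) (x - y) * q (x, t)) - (LINT x|lborel. gauss (e n) (x - y) * q (x, t))) \<longlonglongrightarrow> 0 - q (y, t)"
    by (intro tendsto_diff filterlim_compose[OF gauss_test_large_time[OF q]] filterlim_compose[OF gauss_test_small_time[OF q]])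
  then show "(LINT \<rho>|lborel. ?r \<rho> * indicator {0<..} \<rho>) = - q (y, t)"
    using lim1 unfolding fin by (simp add: LIMSEQ_unique)
qed

section \<open>Moving the Oseen kernel onto test functions\<close>

lemma dderiv_sum_fun:
  assumes "finite I" "\<And>i. i \<in> I \<Longrightarrow> smooth (f i)"
  shows "dderiv v (\<lambda>z. \<Sum>i\<in>I. f i z) = (\<lambda>z. \<Sum>i\<in>I. dderiv v (f i) z)"
  using assms by (intro ext dderiv_sum) (auto intro: smooth_differentiable)

lemma heat_op_sum:
  assumes "finite I" "\<And>i. i \<in> I \<Longrightarrow> smooth (f i)"
  shows "heat_op (\<lambda>z. \<Sum>i\<in>I. f i z) = (\<lambda>z. \<Sum>i\<in>I. heat_op (f i) z)"
proof -
  have "(\<Sum>j\<in>UNIV. \<Sum>i\<in>I. dx j (dx j (f i)) z) = (\<Sum>i\<in>I. \<Sum>j\<in>UNIV. dx j (dx j (f i)) z)" for z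
    by (rule sum.swap)
  then show ?thesis
    using assms by (simp add: heat_op_def[abs_def] dt_def dx_def dderiv_sum_fun smooth_dderiv sum.distrib)
qed

lemma dderiv_add_fun:
  "smooth f \<Longrightarrow> smooth g \<Longrightarrow> dderiv v (\<lambda>z. f z + g z) = (\<lambda>z. dderiv v f z + dderiv v g z)"
  by (intro ext dderiv_add smooth_differentiable)

lemma heat_op_add:
  assumes "smooth f" "smooth g"
  shows "heat_op (\<lambda>z. f z + g z) = (\<lambda>z. heat_op f z + heat_op g z)"
  using assms by (simp add: heat_op_def[abs_def] dt_def dx_def dderiv_add_fun smooth_dderiv sum.distrib algebra_simps)

lemma test_fun_inner: "h \<in> test_fun \<Omega> \<Longrightarrow> (\<lambda>z. h z \<bullet> w) \<in> test_fun \<Omega>"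
  by (rule test_fun_bounded_linear[OF bounded_linear_inner_left])

lemma divergence_eq:
  assumes "smooth h"
  shows "divergence h = (\<lambda>z. \<Sum>j\<in>UNIV. dx j (\<lambda>z. h z \<bullet> axis j 1) z)"
  unfolding divergence_def[abs_def] dx_def dderiv_inner[OF assms] by (simp add: inner_axis)

lemma divergence_test:
  assumes h: "h \<in> test_fun \<Omega>"
  shows "divergence h \<in> test_fun \<Omega>"
  unfolding divergence_eq[OF test_fun_smooth[OF h]] dx_def
  by (intro test_fun_sum test_fun_dderiv test_fun_inner h) auto

lemma divergence_heat_op:
  assumes h: "smooth h"
  shows "divergence (heat_op h) = heat_op (divergence h)"
proof -
  have "heat_op (\<lambda>z. h z \<bullet> w) = (\<lambda>z. heat_op h z \<bullet> w)" for w
    using heat_op_bounded_linear[OF bounded_linear_inner_left h] by blast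
  moreover have sm: "smooth (\<lambda>z. h z \<bullet> w)" for w
    by (rule smooth_bounded_linear[OF bounded_linear_inner_left h])
  moreover have "smooth (heat_op h)"
  proof -
    have "smooth (\<lambda>z. \<Sum>j\<in>UNIV. dx j (dx j h) z)"
      unfolding sum_3 dx_def by (intro smooth_add smooth_dderiv h)
    then show ?thesis unfolding heat_op_def[abs_def] dt_def by (intro smooth_add smooth_dderiv h)
  qed
  ultimately show ?thesis
    by (simp add: divergence_eq h heat_op_sum dx_def smooth_dderiv dderiv_heat_op[symmetric])
qed

lemma G3_expand: "G3 s z a b w = (\<Sum>j\<in>UNIV. G3 s z a b (axis j 1) * (w \<bullet> axis j 1))"
proof -
  have L: "linear (G3 s z a b)"
    by (rule linearI) (simp_all add: G3_def inner_add_right algebra_simps add_divide_distrib diff_divide_distrib)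
  have "w = (\<Sum>j\<in>UNIV. (w $ j) *\<^sub>R axis j 1)"
    using basis_expansion[of w] by (simp add: scalar_mult_eq_scaleR)
  then have "G3 s z a b w = G3 s z a b (\<Sum>j\<in>UNIV. (w $ j) *\<^sub>R axis j 1)" by simp
  then show ?thesis
    by (simp add: linear_sum[OF L] linear_cmul[OF L] inner_axis mult.commute)
qed

text \<open>Only one derivative is moved. The gradient becomes the divergence of \<open>h\<close>,
  which leads to the pressure; the derivative along \<open>a\<close> falls on
  \<open>h z \<bullet> a\<close>, which leads to the transport term once the remaining Laplacian of
  the Gaussian has been integrated over all heat times.\<close>

lemma oseen_by_parts:
  assumes h: "h \<in> test_fun UNIV" and s: "0 < s"
  shows "(LINT x|lborel. oseen s (x - y) a \<bullet> h (x, t)) =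
    - (LINT x|lborel. G2 s (x - y) a a * divergence h (x, t))
    + (LINT x|lborel. lap_gauss s (x - y) * dderiv (a, 0) (\<lambda>z. h z \<bullet> a) (x, t))"
proof -
  note ki = kernel_test_integrable_real[where \<Omega>=UNIV] and kc = kernels_continuous[OF s]
  have "(LINT x|lborel. oseen s (x - y) a \<bullet> h (x, t)) =
     (LINT x|lborel. (\<Sum>j\<in>UNIV. G3 s (x - y) a a (axis j 1) * (h (x, t) \<bullet> axis j 1))
       - (\<Sum>i\<in>UNIV. G3 s (x - y) (axis i 1) (axis i 1) a * (h (x, t) \<bullet> a)))"
    unfolding oseen_inner by (subst G3_expand) (simp add: sum_distrib_right inner_commute)
  also have "\<dots> = (LINT x|lborel. (\<Sum>j\<in>UNIV. G3 s (x - y) a a (axis j 1) * (h (x, t) \<bullet> axis j 1)))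
       - (LINT x|lborel. (\<Sum>i\<in>UNIV. G3 s (x - y) (axis i 1) (axis i 1) a * (h (x, t) \<bullet> a)))"
    by (intro Bochner_Integration.integral_diff Bochner_Integration.integrable_sum ki test_fun_inner h kc)
  also have "(LINT x|lborel. (\<Sum>j\<in>UNIV. G3 s (x - y) a a (axis j 1) * (h (x, t) \<bullet> axis j 1)))
     = (\<Sum>j\<in>UNIV. LINT x|lborel. G3 s (x - y) a a (axis j 1) * (h (x, t) \<bullet> axis j 1))"
    by (intro Bochner_Integration.integral_sum ki test_fun_inner h kc)
  also have "\<dots> = (\<Sum>j\<in>UNIV. - (LINT x|lborel. G2 s (x - y) a a * dx j (\<lambda>z. h z \<bullet> axis j 1) (x, t)))"
    unfolding dx_def by (intro sum.cong refl kernel_by_parts test_fun_inner h s)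
  also have "\<dots> = - (LINT x|lborel. (\<Sum>j\<in>UNIV. G2 s (x - y) a a * dx j (\<lambda>z. h z \<bullet> axis j 1) (x, t)))"
    unfolding dx_def sum_negf
    by (intro arg_cong[of _ _ uminus] Bochner_Integration.integral_sum[symmetric] ki test_fun_dderiv test_fun_inner h kc)
  also have "(LINT x|lborel. (\<Sum>i\<in>UNIV. G3 s (x - y) (axis i 1) (axis i 1) a * (h (x, t) \<bullet> a)))
     = (\<Sum>i\<in>UNIV. LINT x|lborel. G3 s (x - y) (axis i 1) (axis i 1) a * (h (x, t) \<bullet> a))"
    by (intro Bochner_Integration.integral_sum ki test_fun_inner h kc)
  also have "\<dots> = (\<Sum>i\<in>UNIV. - (LINT x|lborel. G2 s (x - y) (axis i 1) (axis i 1) * dderiv (a, 0) (\<lambda>z. h z \<bullet> a) (x, t)))"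
    by (intro sum.cong refl kernel_by_parts test_fun_inner h s)
  also have "\<dots> = - (LINT x|lborel. lap_gauss s (x - y) * dderiv (a, 0) (\<lambda>z. h z \<bullet> a) (x, t))"
    by (simp add: sum_negf lap_gauss_test_eq test_fun_dderiv test_fun_inner h s)
  finally show ?thesis
    by (simp add: divergence_eq[OF test_fun_smooth[OF h]] sum_distrib_left)
qed

text \<open>The formal adjoint of \<open>oseen\<close>: all three derivatives are moved to
  \<open>h\<close>, hence the reversed signs. It reduces statements on the vector kernel to
  statements on the scalar Gaussian.\<close>

definition oseen_adj :: "space \<Rightarrow> (space \<times> real \<Rightarrow> space) \<Rightarrow> space \<times> real \<Rightarrow> real" where
  "oseen_adj a h z = - dderiv (a, 0) (dderiv (a, 0) (divergence h)) z
     + (\<Sum>j\<in>UNIV. dx j (dx j (dderiv (a, 0) (\<lambda>z. h z \<bullet> a))) z)"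

lemma oseen_adj_test:
  assumes "h \<in> test_fun \<Omega>"
  shows "oseen_adj a h \<in> test_fun \<Omega>"
  unfolding oseen_adj_def[abs_def] dx_def
  by (intro test_fun_add test_fun_sum test_fun_dderiv test_fun_inner divergence_test assms
      test_fun_bounded_linear[OF bounded_linear_minus[OF bounded_linear_ident]]) auto

lemma oseen_gauss:
  assumes h: "h \<in> test_fun UNIV" and s: "0 < s"
  shows "(LINT x|lborel. oseen s (x - y) a \<bullet> h (x, t)) = (LINT x|lborel. gauss s (x - y) * oseen_adj a h (x, t))"
proof -
  note ki = kernel_test_integrable_real[where \<Omega>=UNIV] and kc = kernels_continuous[OF s]
  let ?\<phi> = "dderiv (a, 0) (\<lambda>z. h z \<bullet> a)"
  have \<phi>: "?\<phi> \<in> test_fun UNIV" by (intro test_fun_dderiv test_fun_inner h)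
  have "(LINT x|lborel. lap_gauss s (x - y) * ?\<phi> (x, t)) = (\<Sum>j\<in>UNIV. LINT x|lborel. gauss s (x - y) * dx j (dx j ?\<phi>) (x, t))"
    unfolding lap_gauss_test_eq[OF \<phi> s] dx_def by (intro sum.cong refl G2_by_parts \<phi> s)
  also have "\<dots> = (LINT x|lborel. (\<Sum>j\<in>UNIV. gauss s (x - y) * dx j (dx j ?\<phi>) (x, t)))"
    unfolding dx_def by (intro Bochner_Integration.integral_sum[symmetric] ki test_fun_dderiv[OF test_fun_dderiv[OF \<phi>]] kc)
  finally have 1: "(LINT x|lborel. lap_gauss s (x - y) * ?\<phi> (x, t)) = (LINT x|lborel. (\<Sum>j\<in>UNIV. gauss s (x - y) * dx j (dx j ?\<phi>) (x, t)))" .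
  have 2: "- (LINT x|lborel. G2 s (x - y) a a * divergence h (x, t)) =
     (LINT x|lborel. - (gauss s (x - y) * dderiv (a, 0) (dderiv (a, 0) (divergence h)) (x, t)))"
    by (simp add: G2_by_parts divergence_test h s)
  have "(LINT x|lborel. oseen s (x - y) a \<bullet> h (x, t)) = (LINT x|lborel. - (gauss s (x - y) * dderiv (a, 0) (dderiv (a, 0) (divergence h)) (x, t))
     + (\<Sum>j\<in>UNIV. gauss s (x - y) * dx j (dx j ?\<phi>) (x, t)))"
    unfolding oseen_by_parts[OF h s] 1 2 unfolding dx_def
    by (intro Bochner_Integration.integral_add[symmetric] Bochner_Integration.integrable_sum Bochner_Integration.integrable_minus
        ki kc test_fun_dderiv[OF test_fun_dderiv[OF \<phi>]] test_fun_dderiv[OF test_fun_dderiv[OF divergence_test[OF h]]])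
  also have "\<dots> = (LINT x|lborel. gauss s (x - y) * oseen_adj a h (x, t))"
    by (simp add: oseen_adj_def algebra_simps sum_distrib_left)
  finally show ?thesis .
qed

lemma oseen_adj_heat_op:
  assumes h: "h \<in> test_fun UNIV"
  shows "oseen_adj a (heat_op h) = heat_op (oseen_adj a h)"
proof -
  note sm = test_fun_smooth[OF h] and sd = test_fun_smooth[OF divergence_test[OF h]]
  have e1: "dderiv (a, 0) (dderiv (a, 0) (divergence (heat_op h))) = heat_op (dderiv (a, 0) (dderiv (a, 0) (divergence h)))"
    by (simp add: divergence_heat_op sm sd dderiv_heat_op smooth_dderiv)
  have e2: "(\<lambda>z. heat_op h z \<bullet> a) = heat_op (\<lambda>z. h z \<bullet> a)"
    using heat_op_bounded_linear[OF bounded_linear_inner_left sm] by (intro ext) simp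
  have si: "smooth (\<lambda>z. h z \<bullet> a)" by (rule smooth_bounded_linear[OF bounded_linear_inner_left sm])
  let ?\<phi> = "dderiv (a, 0) (\<lambda>z. h z \<bullet> a)"
  have e3: "dx j (dx j (dderiv (a, 0) (\<lambda>z. heat_op h z \<bullet> a))) = heat_op (dx j (dx j ?\<phi>))" for j
    unfolding e2 dx_def by (simp add: si dderiv_heat_op smooth_dderiv)
  have s1: "smooth (\<lambda>z. - dderiv (a, 0) (dderiv (a, 0) (divergence h)) z)"
    by (intro smooth_bounded_linear[OF bounded_linear_minus[OF bounded_linear_ident]] smooth_dderiv sd)
  have s2: "smooth (\<lambda>z. \<Sum>j\<in>UNIV. dx j (dx j ?\<phi>) z)"
    unfolding sum_3 dx_def by (intro smooth_add smooth_dderiv si)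
  have e4: "heat_op (\<lambda>z. - dderiv (a, 0) (dderiv (a, 0) (divergence h)) z) = (\<lambda>z. - heat_op (dderiv (a, 0) (dderiv (a, 0) (divergence h))) z)"
    using heat_op_bounded_linear[OF bounded_linear_minus[OF bounded_linear_ident] smooth_dderiv[OF smooth_dderiv[OF sd]]] by (intro ext) simp
  have e5: "heat_op (\<lambda>z. \<Sum>j\<in>UNIV. dx j (dx j ?\<phi>) z) = (\<lambda>z. \<Sum>j\<in>UNIV. heat_op (dx j (dx j ?\<phi>)) z)"
    unfolding dx_def by (intro heat_op_sum smooth_dderiv si) simp
  show ?thesis
    unfolding oseen_adj_def[abs_def] heat_op_add[OF s1 s2] e1 e3 e4 e5 ..
qed

text \<open>The derivatives in \<open>oseen\<close> commute with the backward heat operator, so this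
  is \<open>heat_identity\<close> for the scalar test function \<open>oseen_adj a h\<close>.\<close>

lemma heat_identity_oseen:
  assumes h: "h \<in> test_fun UNIV" and \<rho>: "0 < \<rho>"
  shows "(LINT \<tau>|lborel. (LINT x|lborel. oseen (\<rho> + \<tau>) (x - y) a \<bullet> heat_op h (x, s + \<tau>)) * indicator {0<..} \<tau>)
    = - (LINT x|lborel. oseen \<rho> (x - y) a \<bullet> h (x, s))"
proof -
  have eq: "(LINT x|lborel. oseen (\<rho> + \<tau>) (x - y) a \<bullet> heat_op h (x, s + \<tau>)) * indicator {0<..} \<tau>
     = (LINT x|lborel. gauss (\<rho> + \<tau>) (x - y) * heat_op (oseen_adj a h) (x, s + \<tau>)) * indicator {0<..} \<tau>" for \<tau>
    using \<rho> by (cases "0 < \<tau>") (simp_all add: oseen_gauss heat_op_test h oseen_adj_heat_op)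
  show ?thesis
    unfolding eq oseen_gauss[OF h \<rho>] by (intro heat_identity oseen_adj_test h \<rho>)
qed

text \<open>No derivative is moved here: the decay s^(-3/2) of the kernel itself is what makes the
  double integral in \<open>oseen_duality\<close> converge absolutely.\<close>

lemma oseen_test_bound:
  fixes h :: "space \<times> real \<Rightarrow> space"
  assumes h: "\<And>z. norm (h z) \<le> B" "0 \<le> B" and m: "h \<in> borel_measurable borel" and s: "0 < s"
  shows "integrable lborel (\<lambda>x. oseen s (x - y) a \<bullet> h (x, t))"
    and "\<bar>LINT x|lborel. oseen s (x - y) a \<bullet> h (x, t)\<bar> \<le> 60 * (norm a)\<^sup>2 * B * s powr (- 3 / 2)"
proof -
  note [measurable (raw)] = measurable_pair_compose[OF m]
  have s2: "0 < 2 * s" using s by simp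
  note gi = gauss_integral[OF s2]
  have b: "\<bar>oseen s (x - y) a \<bullet> h (x, t)\<bar> \<le> (60 * (norm a)\<^sup>2 * B * s powr (- 3 / 2)) * gauss (2 * s) (x - y)" for x
  proof -
    have "\<bar>oseen s (x - y) a \<bullet> h (x, t)\<bar> \<le> norm (oseen s (x - y) a) * norm (h (x, t))"
      by (rule Cauchy_Schwarz_ineq2)
    also have "\<dots> \<le> (60 * (norm a)\<^sup>2 * (s powr (- 3 / 2) * gauss (2 * s) (x - y))) * B"
      using h by (intro mult_mono oseen_le s) auto
    finally show ?thesis by (simp add: mult_ac)
  qed
  have im: "integrable lborel (\<lambda>x. (60 * (norm a)\<^sup>2 * B * s powr (- 3 / 2)) * gauss (2 * s) (x - y))"
    using gi by simp
  show i: "integrable lborel (\<lambda>x. oseen s (x - y) a \<bullet> h (x, t))"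
  proof (rule Bochner_Integration.integrable_bound[OF im])
    show "AE x in lborel. norm (oseen s (x - y) a \<bullet> h (x, t)) \<le> norm ((60 * (norm a)\<^sup>2 * B * s powr (- 3 / 2)) * gauss (2 * s) (x - y))"
      unfolding real_norm_def by (intro AE_I2 order_trans[OF b abs_ge_self])
  qed measurable
  have "\<bar>LINT x|lborel. oseen s (x - y) a \<bullet> h (x, t)\<bar> \<le> (LINT x|lborel. norm (oseen s (x - y) a \<bullet> h (x, t)))"
    using integral_norm_bound[of lborel "\<lambda>x. oseen s (x - y) a \<bullet> h (x, t)"] by simp
  also have "\<dots> \<le> (LINT x|lborel. (60 * (norm a)\<^sup>2 * B * s powr (- 3 / 2)) * gauss (2 * s) (x - y))"
    by (intro integral_mono integrable_norm i im) (use b in simp)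
  finally show "\<bar>LINT x|lborel. oseen s (x - y) a \<bullet> h (x, t)\<bar> \<le> 60 * (norm a)\<^sup>2 * B * s powr (- 3 / 2)"
    using gi by simp
qed

lemma nn_integral_shifted_tail:
  fixes \<tau> :: real
  assumes "0 < \<tau>"
  shows "(\<integral>\<^sup>+\<rho>. ennreal ((\<rho> + \<tau>) powr - (3/2)) * indicator {0<..} \<rho> \<partial>lborel) = ennreal (2 * \<tau> powr - (1/2))"
proof -
  have "(\<integral>\<^sup>+\<rho>. ennreal ((\<rho> + \<tau>) powr - (3/2)) * indicator {0<..} \<rho> \<partial>lborel)
     = (\<integral>\<^sup>+\<rho>. ennreal ((\<rho> + \<tau>) powr - (3/2)) * indicator {\<tau><..} (\<rho> + \<tau>) \<partial>lborel)"
    by (intro nn_integral_cong) (auto simp: indicator_def)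
  also have "\<dots> = (\<integral>\<^sup>+\<sigma>. ennreal (\<sigma> powr - (3/2)) * indicator {\<tau><..} \<sigma> \<partial>lborel)"
    by (rule nn_integral_translate) simp
  also have "\<dots> = ennreal (2 * \<tau> powr - (1/2))"
    using nn_integral_powr_tail[of "3/2" \<tau>] assms by simp
  finally show ?thesis .
qed

text \<open>With \<rho> + \<tau> as the heat time, the integral over \<rho> is the kernel of the
  Duhamel term at elapsed time \<tau>. After the exchange \<tau> is integrated first, by
  \<open>heat_identity_oseen\<close>, which leaves the kernel at heat time \<rho> against
  \<open>f\<close> itself. One integration by parts splits this into a Laplacian part, whose
  \<rho>-integral is a point value, and the pressure part.\<close>

lemma oseen_duality:
  assumes f: "f \<in> test_fun UNIV"
  shows "(LINT \<tau>|lborel. (LINT \<rho>|lborel.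
        (LINT x|lborel. oseen (\<rho> + \<tau>) (x - y) a \<bullet> heat_op f (x, s + \<tau>)) * indicator {0<..} \<rho>) * indicator {0<..} \<tau>)
    = dderiv (a, 0) (\<lambda>z. f z \<bullet> a) (y, s)
      + (LINT \<rho>|lborel. (LINT x|lborel. G2 \<rho> (x - y) a a * divergence f (x, s)) * indicator {0<..} \<rho>)"
proof -
  define h where "h = heat_op f"
  have h: "h \<in> test_fun UNIV" unfolding h_def by (rule heat_op_test[OF f])
  note [measurable (raw)] = measurable_pair_compose[OF test_fun_measurable[OF h]]
  obtain B where B: "0 \<le> B" "\<And>z. norm (h z) \<le> B" using test_fun_bounded[OF h] by metis
  obtain K where K: "compact K" "\<And>z. z \<notin> K \<Longrightarrow> h z = 0" using test_fun_support[OF h] by blast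
  obtain R0 where R0: "\<And>t. t \<in> snd ` K \<Longrightarrow> norm t \<le> R0"
    using compact_imp_bounded[OF compact_projections(2)[OF K(1)]] unfolding bounded_iff by blast
  define R where "R = \<bar>R0\<bar> + \<bar>s\<bar> + 1"
  have Rh: "h (x, s + \<tau>) = 0" if "\<tau> \<ge> R" for x \<tau>
  proof -
    have "s + \<tau> \<notin> snd ` K"
    proof
      assume "s + \<tau> \<in> snd ` K"
      from R0[OF this] that show False unfolding R_def real_norm_def by linarith
    qed
    then show ?thesis using K(2)[OF notin_projections(2)] by blast
  qed
  define I where "I = (\<lambda>\<tau> \<rho>. LINT x|lborel. oseen (\<rho> + \<tau>) (x - y) a \<bullet> h (x, s + \<tau>))"
  define Z where "Z = (\<lambda>(\<tau>, \<rho>). I \<tau> \<rho> * indicator {0<..} \<rho> * indicator {0<..} \<tau>)"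
  have Zm: "Z \<in> borel_measurable (lborel \<Otimes>\<^sub>M lborel)"
    unfolding Z_def I_def by measurable
  define c where "c = 60 * (norm a)\<^sup>2 * B"
  have c: "0 \<le> c" using B by (simp add: c_def)
  \<comment> \<open>The integral of this bound over \<rho> > 0 is a multiple of \<tau>^(-1/2), which
    is integrable up to \<open>R\<close>, where the test function has died out.\<close>
  have bound: "ennreal (norm (Z (\<tau>, \<rho>))) \<le> ennreal c * indicator {0<..<R} \<tau> * (ennreal ((\<rho> + \<tau>) powr - (3/2)) * indicator {0<..} \<rho>)" for \<tau> \<rho>
  proof (cases "0 < \<tau> \<and> \<tau> < R \<and> 0 < \<rho>")
    case True
    then have "norm (Z (\<tau>, \<rho>)) \<le> c * (\<rho> + \<tau>) powr - (3/2)"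
      using oseen_test_bound(2)[of h B "\<rho> + \<tau>" y a "s + \<tau>"] B test_fun_measurable[OF h] by (simp add: Z_def I_def c_def)
    then show ?thesis using True c by (simp add: ennreal_mult[symmetric] ennreal_leI)
  next
    case False
    then have "Z (\<tau>, \<rho>) = 0" using Rh[of \<tau>] by (auto simp: Z_def I_def indicator_def)
    then show ?thesis by simp
  qed
  have int: "integrable (lborel \<Otimes>\<^sub>M lborel) Z"
  proof (rule integrableI_bounded[OF Zm])
    have "(\<integral>\<^sup>+w. ennreal (norm (Z w)) \<partial>(lborel \<Otimes>\<^sub>M lborel)) = (\<integral>\<^sup>+\<tau>. \<integral>\<^sup>+\<rho>. ennreal (norm (Z (\<tau>, \<rho>))) \<partial>lborel \<partial>lborel)"
      using Zm by (intro lborel.nn_integral_fst[symmetric]) simp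
    also have "\<dots> \<le> (\<integral>\<^sup>+\<tau>. \<integral>\<^sup>+\<rho>. ennreal c * indicator {0<..<R} \<tau> * (ennreal ((\<rho> + \<tau>) powr - (3/2)) * indicator {0<..} \<rho>) \<partial>lborel \<partial>lborel)"
      by (intro nn_integral_mono bound)
    also have "\<dots> = (\<integral>\<^sup>+\<tau>. ennreal c * indicator {0<..<R} \<tau> * (\<integral>\<^sup>+\<rho>. ennreal ((\<rho> + \<tau>) powr - (3/2)) * indicator {0<..} \<rho> \<partial>lborel) \<partial>lborel)"
      by (intro nn_integral_cong nn_integral_cmult) measurable
    also have "\<dots> = (\<integral>\<^sup>+\<tau>. ennreal (2 * c) * (ennreal (\<tau> powr - (1/2)) * indicator {0<..<R} \<tau>) \<partial>lborel)"
    proof (intro nn_integral_cong)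
      fix \<tau> :: real
      show "ennreal c * indicator {0<..<R} \<tau> * (\<integral>\<^sup>+\<rho>. ennreal ((\<rho> + \<tau>) powr - (3/2)) * indicator {0<..} \<rho> \<partial>lborel)
        = ennreal (2 * c) * (ennreal (\<tau> powr - (1/2)) * indicator {0<..<R} \<tau>)"
      proof (cases "0 < \<tau> \<and> \<tau> < R")
        case True
        then have e: "(\<integral>\<^sup>+\<rho>. ennreal ((\<rho> + \<tau>) powr - (3/2)) * indicator {0<..} \<rho> \<partial>lborel) = ennreal (2 * \<tau> powr - (1/2))"
          by (intro nn_integral_shifted_tail) simp
        show ?thesis unfolding e using True c by (simp add: ennreal_mult[symmetric] mult_ac)
      qed auto
    qed
    also have "\<dots> = ennreal (2 * c) * ennreal (R powr (1 - 1/2) / (1 - 1/2))"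
      by (subst nn_integral_cmult) (simp_all add: nn_integral_powr_near_0 R_def)
    also have "\<dots> < \<infinity>" by (simp add: ennreal_mult_less_top)
    finally show "(\<integral>\<^sup>+w. ennreal (norm (Z w)) \<partial>(lborel \<Otimes>\<^sub>M lborel)) < \<infinity>" .
  qed
  let ?\<phi> = "dderiv (a, 0) (\<lambda>z. f z \<bullet> a)"
  have \<phi>: "?\<phi> \<in> test_fun UNIV" by (intro test_fun_dderiv test_fun_inner f)
  note div = divergence_test[OF f]
  obtain C where C: "0 \<le> C" "\<And>\<rho> y t a. 0 < \<rho> \<Longrightarrow> \<bar>LINT x|lborel. G2 \<rho> (x - y) a a * divergence f (x, t)\<bar> \<le> C * (norm a)\<^sup>2 * major \<rho>"
    using G2_test_bound[OF div] by blast
  note [measurable (raw)] = measurable_pair_compose[OF test_fun_measurable[OF div]]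
  have iG: "integrable lborel (\<lambda>\<rho>. (LINT x|lborel. G2 \<rho> (x - y) a a * divergence f (x, s)) * indicator {0<..} \<rho>)"
  proof (rule Bochner_Integration.integrable_bound)
    show "integrable lborel (\<lambda>\<rho>. C * (norm a)\<^sup>2 * major \<rho>)" using major_integrable by simp
    show "AE \<rho> in lborel. norm ((LINT x|lborel. G2 \<rho> (x - y) a a * divergence f (x, s)) * indicator {0<..} \<rho>) \<le> norm (C * (norm a)\<^sup>2 * major \<rho>)"
    proof (rule AE_I2)
      fix \<rho>
      show "norm ((LINT x|lborel. G2 \<rho> (x - y) a a * divergence f (x, s)) * indicator {0<..} \<rho>) \<le> norm (C * (norm a)\<^sup>2 * major \<rho>)"
        using C(2)[of \<rho> y a s] C(1) by (cases "0 < \<rho>") auto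
    qed
  qed measurable
  have "(LINT \<tau>|lborel. (LINT \<rho>|lborel. I \<tau> \<rho> * indicator {0<..} \<rho>) * indicator {0<..} \<tau>) = (LINT \<tau>|lborel. LINT \<rho>|lborel. Z (\<tau>, \<rho>))"
    by (simp add: Z_def)
  also have "\<dots> = (LINT \<rho>|lborel. LINT \<tau>|lborel. Z (\<tau>, \<rho>))"
    using lborel_pair.Fubini_integral[of "\<lambda>\<tau> \<rho>. Z (\<tau>, \<rho>)"] int by simp
  also have "\<dots> = (LINT \<rho>|lborel. (LINT \<tau>|lborel. I \<tau> \<rho> * indicator {0<..} \<tau>) * indicator {0<..} \<rho>)"
  proof (intro Bochner_Integration.integral_cong refl)
    fix \<rho> :: real
    have "Z (\<tau>, \<rho>) = (I \<tau> \<rho> * indicator {0<..} \<tau>) * indicator {0<..} \<rho>" for \<tau>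
      by (simp add: Z_def)
    then show "(LINT \<tau>|lborel. Z (\<tau>, \<rho>)) = (LINT \<tau>|lborel. I \<tau> \<rho> * indicator {0<..} \<tau>) * indicator {0<..} \<rho>"
      by simp
  qed
  also have "\<dots> = (LINT \<rho>|lborel. (LINT x|lborel. G2 \<rho> (x - y) a a * divergence f (x, s)) * indicator {0<..} \<rho>
      - (LINT x|lborel. lap_gauss \<rho> (x - y) * ?\<phi> (x, s)) * indicator {0<..} \<rho>)"
  proof (intro Bochner_Integration.integral_cong refl)
    fix \<rho> :: real
    show "(LINT \<tau>|lborel. I \<tau> \<rho> * indicator {0<..} \<tau>) * indicator {0<..} \<rho> =
      (LINT x|lborel. G2 \<rho> (x - y) a a * divergence f (x, s)) * indicator {0<..} \<rho>
      - (LINT x|lborel. lap_gauss \<rho> (x - y) * ?\<phi> (x, s)) * indicator {0<..} \<rho>"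
    proof (cases "0 < \<rho>")
      case True
      then have "(LINT \<tau>|lborel. I \<tau> \<rho> * indicator {0<..} \<tau>) = - (LINT x|lborel. oseen \<rho> (x - y) a \<bullet> f (x, s))"
        unfolding I_def h_def by (intro heat_identity_oseen f)
      then show ?thesis using True by (simp add: oseen_by_parts[OF f True])
    qed simp
  qed
  also have "\<dots> = (LINT \<rho>|lborel. (LINT x|lborel. G2 \<rho> (x - y) a a * divergence f (x, s)) * indicator {0<..} \<rho>) + ?\<phi> (y, s)"
    using Bochner_Integration.integral_diff[OF iG lap_gauss_total_integral(1)[OF \<phi>]] lap_gauss_total_integral(2)[OF \<phi>] by simp
  finally show ?thesis unfolding I_def h_def by simp
qed

subsection \<open>Potential operators\<close>

text \<open>Cauchy-Schwarz with respect to the measure of density \<open>k x\<close>, followed by an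
  exchange of integrals. Only the row integrals are replaced by a bound; the column integrals stay,
  since in \<open>wpot_L2\<close> they depend on the source.\<close>

lemma schur_test:
  fixes k :: "'x \<Rightarrow> 'w \<Rightarrow> ennreal" and g :: "'w \<Rightarrow> ennreal"
  assumes M: "sigma_finite_measure M" and N: "sigma_finite_measure N"
    and k [measurable]: "case_prod k \<in> borel_measurable (M \<Otimes>\<^sub>M N)" and g [measurable]: "g \<in> borel_measurable N"
    and A: "\<And>x. x \<in> space M \<Longrightarrow> (\<integral>\<^sup>+w. k x w \<partial>N) \<le> A"
  shows "(\<integral>\<^sup>+x. (\<integral>\<^sup>+w. k x w * g w \<partial>N)\<^sup>2 \<partial>M) \<le> A * (\<integral>\<^sup>+w. (\<integral>\<^sup>+x. k x w \<partial>M) * (g w)\<^sup>2 \<partial>N)"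
proof -
  interpret M: sigma_finite_measure M by fact
  interpret N: sigma_finite_measure N by fact
  interpret pair_sigma_finite M N ..
  have "(\<integral>\<^sup>+x. (\<integral>\<^sup>+w. k x w * g w \<partial>N)\<^sup>2 \<partial>M) \<le> (\<integral>\<^sup>+x. A * (\<integral>\<^sup>+w. k x w * (g w)\<^sup>2 \<partial>N) \<partial>M)"
  proof (rule nn_integral_mono)
    fix x assume x: "x \<in> space M"
    have [measurable]: "k x \<in> borel_measurable N"
      using x measurable_compose[OF measurable_Pair1'[OF x] k] by simp
    have "(\<integral>\<^sup>+w. k x w * g w \<partial>N)\<^sup>2 = (\<integral>\<^sup>+w. 1 * g w \<partial>density N (k x))\<^sup>2"
      by (simp add: nn_integral_density)
    also have "\<dots> \<le> (\<integral>\<^sup>+w. 1\<^sup>2 \<partial>density N (k x)) * (\<integral>\<^sup>+w. (g w)\<^sup>2 \<partial>density N (k x))"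
      by (rule Cauchy_Schwarz_nn_integral) auto
    also have "\<dots> = (\<integral>\<^sup>+w. k x w \<partial>N) * (\<integral>\<^sup>+w. k x w * (g w)\<^sup>2 \<partial>N)"
      by (simp add: emeasure_density nn_integral_density)
    also have "\<dots> \<le> A * (\<integral>\<^sup>+w. k x w * (g w)\<^sup>2 \<partial>N)"
      using A[OF x] by (intro mult_right_mono) auto
    finally show "(\<integral>\<^sup>+w. k x w * g w \<partial>N)\<^sup>2 \<le> A * (\<integral>\<^sup>+w. k x w * (g w)\<^sup>2 \<partial>N)" .
  qed
  also have "\<dots> = A * (\<integral>\<^sup>+x. \<integral>\<^sup>+w. k x w * (g w)\<^sup>2 \<partial>N \<partial>M)"
    by (rule nn_integral_cmult) measurable
  also have "(\<integral>\<^sup>+x. \<integral>\<^sup>+w. k x w * (g w)\<^sup>2 \<partial>N \<partial>M) = (\<integral>\<^sup>+w. \<integral>\<^sup>+x. k x w * (g w)\<^sup>2 \<partial>M \<partial>N)"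
    by (rule Fubini'[symmetric]) measurable
  also have "\<dots> = (\<integral>\<^sup>+w. (\<integral>\<^sup>+x. k x w \<partial>M) * (g w)\<^sup>2 \<partial>N)"
  proof (rule nn_integral_cong)
    fix w assume w: "w \<in> space N"
    have [measurable]: "(\<lambda>x. k x w) \<in> borel_measurable M"
      using w measurable_compose[OF measurable_Pair2'[OF w] k] by simp
    show "(\<integral>\<^sup>+x. k x w * (g w)\<^sup>2 \<partial>M) = (\<integral>\<^sup>+x. k x w \<partial>M) * (g w)\<^sup>2"
      by (rule nn_integral_multc) measurable
  qed
  finally show ?thesis .
qed

text \<open>A point \<open>((s, y), \<sigma>)\<close> consists of the source time, the source
  position and the heat time at which the kernel is evaluated.\<close>

abbreviation M3 :: "((real \<times> space) \<times> real) measure" where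
  "M3 \<equiv> (lborel \<Otimes>\<^sub>M lborel) \<Otimes>\<^sub>M lborel"

lemma sigma_finite_M2: "sigma_finite_measure ((lborel :: real measure) \<Otimes>\<^sub>M (lborel :: space measure))"
  by (simp add: lborel_prod lborel.sigma_finite_measure_axioms)

lemma sigma_finite_M3: "sigma_finite_measure M3"
  by (simp add: lborel_prod lborel.sigma_finite_measure_axioms)

text \<open>With \<open>y\<close> innermost, the Gaussian integrates to 1 before the two time
  variables are touched.\<close>

lemma nn_integral_M3:
  assumes [measurable]: "f \<in> borel_measurable M3"
  shows "(\<integral>\<^sup>+w. f w \<partial>M3) = (\<integral>\<^sup>+s. \<integral>\<^sup>+\<sigma>. \<integral>\<^sup>+y. f ((s, y), \<sigma>) \<partial>lborel \<partial>lborel \<partial>lborel)"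
proof -
  have "(\<integral>\<^sup>+w. f w \<partial>M3) = (\<integral>\<^sup>+sy. \<integral>\<^sup>+\<sigma>. f (sy, \<sigma>) \<partial>lborel \<partial>(lborel \<Otimes>\<^sub>M lborel))"
    by (intro lborel.nn_integral_fst[symmetric]) measurable
  also have "\<dots> = (\<integral>\<^sup>+s. \<integral>\<^sup>+y. \<integral>\<^sup>+\<sigma>. f ((s, y), \<sigma>) \<partial>lborel \<partial>lborel \<partial>lborel)"
    by (subst lborel.nn_integral_fst[symmetric]) measurable
  also have "\<dots> = (\<integral>\<^sup>+s. \<integral>\<^sup>+\<sigma>. \<integral>\<^sup>+y. f ((s, y), \<sigma>) \<partial>lborel \<partial>lborel \<partial>lborel)"
    by (intro nn_integral_cong lborel_pair.Fubini') measurable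
  finally show ?thesis .
qed

text \<open>Weights may change sign, since differences of two of them describe increments in time.
  The support condition confines every estimate to positive times, where the kernel bounds
  hold.\<close>

definition weight :: "(real \<Rightarrow> real \<Rightarrow> real) \<Rightarrow> bool" where
  "weight \<theta> \<longleftrightarrow> case_prod \<theta> \<in> borel_measurable borel \<and> (\<forall>s \<sigma>. \<theta> s \<sigma> \<noteq> 0 \<longrightarrow> 0 < s \<and> 0 < \<sigma>)"

definition field :: "(real \<Rightarrow> space \<Rightarrow> space) \<Rightarrow> bool" where
  "field U \<longleftrightarrow> case_prod U \<in> borel_measurable borel"

lemma case_prod_measurable:
  fixes f :: "'a::second_countable_topology \<Rightarrow> 'b::second_countable_topology \<Rightarrow> 'c::topological_space"
  assumes "case_prod f \<in> borel_measurable borel" "g \<in> borel_measurable M" "h \<in> borel_measurable M"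
  shows "(\<lambda>w. f (g w) (h w)) \<in> borel_measurable M"
  using measurable_pair_compose[OF assms] by simp

lemmas weight_measurable = case_prod_measurable[OF conjunct1[OF iffD1[OF weight_def]]]
lemmas field_measurable = case_prod_measurable[OF iffD1[OF field_def]]

text \<open>The mass of the weight against the two singularities of the integrand:
  \<open>oseen\<close> brings \<sigma>^(-3/2) and the field brings s^(-a).\<close>

definition Th :: "real \<Rightarrow> (real \<Rightarrow> real \<Rightarrow> real) \<Rightarrow> ennreal" where
  "Th a \<theta> = (\<integral>\<^sup>+s. \<integral>\<^sup>+\<sigma>. ennreal (\<bar>\<theta> s \<sigma>\<bar> * \<sigma> powr (- 3 / 2) * s powr (- a)) \<partial>lborel \<partial>lborel)"

text \<open>A positive majorant, up to a constant, for the integrand of the quadratic potential; by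
  \<open>pk_total\<close> its mass is \<open>Th a \<theta>\<close> for every
  \<open>x\<close>.\<close>

definition pk :: "(real \<Rightarrow> real \<Rightarrow> real) \<Rightarrow> real \<Rightarrow> space \<Rightarrow> (real \<times> space) \<times> real \<Rightarrow> real" where
  "pk \<theta> a x w = \<bar>\<theta> (fst (fst w)) (snd w)\<bar> * snd w powr (- 3 / 2) * fst (fst w) powr (- a)
     * gauss (2 * snd w) (x - snd (fst w))"

lemma pk_nonneg [simp]: "0 \<le> pk \<theta> a x w"
  by (simp add: pk_def)

lemma pk_measurable:
  assumes "weight \<theta>"
  shows "case_prod (pk \<theta> a) \<in> borel_measurable (lborel \<Otimes>\<^sub>M M3)" "pk \<theta> a x \<in> borel_measurable M3"
proof -
  note [measurable (raw)] = weight_measurable[OF assms]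
  show "case_prod (pk \<theta> a) \<in> borel_measurable (lborel \<Otimes>\<^sub>M M3)" "pk \<theta> a x \<in> borel_measurable M3"
    unfolding pk_def[abs_def] by measurable
qed

lemma pk_total:
  assumes w: "weight \<theta>"
  shows "(\<integral>\<^sup>+w. ennreal (pk \<theta> a x w) \<partial>M3) = Th a \<theta>"
proof -
  note [measurable] = pk_measurable[OF w]
  have "(\<integral>\<^sup>+w. ennreal (pk \<theta> a x w) \<partial>M3) = (\<integral>\<^sup>+s. \<integral>\<^sup>+\<sigma>. \<integral>\<^sup>+y. ennreal (pk \<theta> a x ((s, y), \<sigma>)) \<partial>lborel \<partial>lborel \<partial>lborel)"
    by (rule nn_integral_M3) measurable
  also have "\<dots> = Th a \<theta>"
    unfolding Th_def
  proof (intro nn_integral_cong)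
    fix s \<sigma> :: real
    show "(\<integral>\<^sup>+y. ennreal (pk \<theta> a x ((s, y), \<sigma>)) \<partial>lborel) = ennreal (\<bar>\<theta> s \<sigma>\<bar> * \<sigma> powr (- 3 / 2) * s powr (- a))"
    proof (cases "\<theta> s \<sigma> = 0")
      case False
      then have "0 < \<sigma>" using w by (auto simp: weight_def)
      then show ?thesis
        by (simp add: pk_def ennreal_mult nn_integral_cmult nn_integral_gauss_shift)
    qed (simp add: pk_def)
  qed
  finally show ?thesis .
qed

lemma pk_space_integral:
  assumes w: "weight \<theta>"
  shows "(\<integral>\<^sup>+x. ennreal (pk \<theta> a x ((s, y), \<sigma>)) \<partial>lborel) = ennreal (\<bar>\<theta> s \<sigma>\<bar> * \<sigma> powr (- 3 / 2) * s powr (- a))"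
proof (cases "\<theta> s \<sigma> = 0")
  case False
  then have "0 < \<sigma>" using w by (auto simp: weight_def)
  then show ?thesis
    by (simp add: pk_def ennreal_mult nn_integral_cmult nn_integral_gauss_shift)
qed (simp add: pk_def)

lemma pk_dominated:
  fixes F :: "(real \<times> space) \<times> real \<Rightarrow> 'b::{banach, second_countable_topology}"
  assumes w: "weight \<theta>" and F: "F \<in> borel_measurable M3" and c: "0 \<le> c"
    and b: "\<And>w. norm (F w) \<le> c * pk \<theta> a x w" and fin: "Th a \<theta> < \<infinity>"
  shows "integrable M3 F" "ennreal (norm (integral\<^sup>L M3 F)) \<le> ennreal c * Th a \<theta>"
proof -
  note [measurable] = pk_measurable[OF w] F
  have le: "(\<integral>\<^sup>+w. ennreal (norm (F w)) \<partial>M3) \<le> ennreal c * Th a \<theta>"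
  proof -
    have "(\<integral>\<^sup>+w. ennreal (norm (F w)) \<partial>M3) \<le> (\<integral>\<^sup>+w. ennreal c * ennreal (pk \<theta> a x w) \<partial>M3)"
      using c by (intro nn_integral_mono) (simp add: ennreal_mult[symmetric] ennreal_leI b)
    also have "\<dots> = ennreal c * Th a \<theta>"
      by (subst nn_integral_cmult) (simp_all add: pk_total[OF w])
    finally show ?thesis .
  qed
  show i: "integrable M3 F"
    using le fin by (intro integrableI_bounded F) (auto intro: order_le_less_trans simp: ennreal_mult_less_top)
  show "ennreal (norm (integral\<^sup>L M3 F)) \<le> ennreal c * Th a \<theta>"
    using integral_norm_bound_ennreal[OF i] le by (rule order_trans)
qed

section \<open>The quadratic potential\<close>

definition oz :: "(real \<Rightarrow> real \<Rightarrow> real) \<Rightarrow> (real \<Rightarrow> space \<Rightarrow> space) \<Rightarrow> space \<Rightarrow> (real \<times> space) \<times> real \<Rightarrow> space" where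
  "oz \<theta> U x w = \<theta> (fst (fst w)) (snd w) *\<^sub>R oseen (snd w) (x - snd (fst w)) (U (fst (fst w)) (snd (fst w)))"

definition wpot :: "(real \<Rightarrow> real \<Rightarrow> real) \<Rightarrow> (real \<Rightarrow> space \<Rightarrow> space) \<Rightarrow> space \<Rightarrow> space" where
  "wpot \<theta> U x = (LINT w|M3. oz \<theta> U x w)"

lemma oz_measurable:
  assumes "weight \<theta>" "field U"
  shows "oz \<theta> U x \<in> borel_measurable M3" "case_prod (oz \<theta> U) \<in> borel_measurable (lborel \<Otimes>\<^sub>M M3)"
proof -
  note [measurable (raw)] = weight_measurable[OF assms(1)] field_measurable[OF assms(2)]
  show "oz \<theta> U x \<in> borel_measurable M3" "case_prod (oz \<theta> U) \<in> borel_measurable (lborel \<Otimes>\<^sub>M M3)"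
    unfolding oz_def[abs_def] by measurable
qed

text \<open>Of the two factors of the field one carries the difference and the other the size; each
  brings s^(-b), hence the exponent \<open>2 * b\<close>.\<close>

lemma oz_diff_le:
  assumes w: "weight \<theta>" and e: "\<And>s y. 0 < s \<Longrightarrow> norm (U s y - U' s y) \<le> \<delta> * s powr (- b)"
    and M: "\<And>s y. 0 < s \<Longrightarrow> norm (U s y) + norm (U' s y) \<le> M * s powr (- b)"
    and c: "0 \<le> \<delta>"
  shows "norm (oz \<theta> U x w - oz \<theta> U' x w) \<le> (60 * \<delta> * M) * pk \<theta> (2 * b) x w"
proof -
  obtain s y \<sigma> where ws: "w = ((s, y), \<sigma>)" by (metis surj_pair)
  show ?thesis
  proof (cases "\<theta> s \<sigma> = 0")
    case False
    then have pos: "0 < s" "0 < \<sigma>" using w by (auto simp: weight_def)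
    have "norm (oz \<theta> U x w - oz \<theta> U' x w) = \<bar>\<theta> s \<sigma>\<bar> * norm (oseen \<sigma> (x - y) (U s y) - oseen \<sigma> (x - y) (U' s y))"
      by (simp add: oz_def ws flip: scaleR_diff_right)
    also have "\<dots> \<le> \<bar>\<theta> s \<sigma>\<bar> * (60 * (norm (U s y - U' s y) * (norm (U s y) + norm (U' s y))) * (\<sigma> powr (- 3 / 2) * gauss (2 * \<sigma>) (x - y)))"
      by (intro mult_left_mono oseen_diff_le pos) auto
    also have "\<dots> \<le> \<bar>\<theta> s \<sigma>\<bar> * (60 * ((\<delta> * s powr (- b)) * (M * s powr (- b))) * (\<sigma> powr (- 3 / 2) * gauss (2 * \<sigma>) (x - y)))"
      using c by (intro mult_left_mono mult_right_mono mult_mono e M pos) auto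
    also have "\<dots> = (60 * \<delta> * M) * pk \<theta> (2 * b) x w"
      using powr_add[of s "- b" "- b"] by (simp add: pk_def ws mult_ac)
    finally show ?thesis .
  qed (simp add: oz_def pk_def ws)
qed

lemma oz_0 [simp]: "oz \<theta> (\<lambda>s y. 0) x w = 0"
  by (simp add: oz_def)

lemma oz_le:
  assumes w: "weight \<theta>" and M: "\<And>s y. 0 < s \<Longrightarrow> norm (U s y) \<le> M * s powr (- b)" "0 \<le> M"
  shows "norm (oz \<theta> U x w) \<le> (60 * M * M) * pk \<theta> (2 * b) x w"
  using oz_diff_le[OF w, where U=U and U'="\<lambda>s y. 0" and \<delta>=M and b=b and M=M and x=x and w=w] M by simp

lemma wpot_le:
  assumes w: "weight \<theta>" and U: "field U" and M: "\<And>s y. 0 < s \<Longrightarrow> norm (U s y) \<le> M * s powr (- b)" "0 \<le> M"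
    and fin: "Th (2 * b) \<theta> < \<infinity>"
  shows "integrable M3 (oz \<theta> U x)" "ennreal (norm (wpot \<theta> U x)) \<le> ennreal (60 * M * M) * Th (2 * b) \<theta>"
  unfolding wpot_def
  by (rule pk_dominated[OF w oz_measurable(1)[OF w U] _ oz_le[OF w M] fin]; use M in simp)+

text \<open>\<open>M\<close> bounds each of the two fields separately, so the constant 60 is
  doubled.\<close>

lemma wpot_diff_le:
  assumes w: "weight \<theta>" and U: "field U" "field U'"
    and e: "\<And>s y. 0 < s \<Longrightarrow> norm (U s y - U' s y) \<le> \<delta> * s powr (- b)" "0 \<le> \<delta>"
    and M: "\<And>s y. 0 < s \<Longrightarrow> norm (U s y) \<le> M * s powr (- b)" "\<And>s y. 0 < s \<Longrightarrow> norm (U' s y) \<le> M * s powr (- b)" "0 \<le> M"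
    and fin: "Th (2 * b) \<theta> < \<infinity>"
  shows "ennreal (norm (wpot \<theta> U x - wpot \<theta> U' x)) \<le> ennreal (120 * \<delta> * M) * Th (2 * b) \<theta>"
proof -
  note i = wpot_le(1)[OF w U(1) M(1,3) fin] wpot_le(1)[OF w U(2) M(2,3) fin]
  have MM: "norm (U s y) + norm (U' s y) \<le> (2 * M) * s powr (- b)" if "0 < s" for s y
    using M(1)[OF that, of y] M(2)[OF that, of y] by simp
  have "wpot \<theta> U x - wpot \<theta> U' x = (LINT w|M3. oz \<theta> U x w - oz \<theta> U' x w)"
    unfolding wpot_def using i by simp
  moreover have "ennreal (norm (LINT w|M3. oz \<theta> U x w - oz \<theta> U' x w)) \<le> ennreal (60 * \<delta> * (2 * M)) * Th (2 * b) \<theta>"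
    using i e(2) M(3) by (intro pk_dominated(2)[OF w _ _ oz_diff_le[OF w e(1) MM e(2)] fin]) auto
  ultimately show ?thesis by (simp add: mult.assoc)
qed

text \<open>The potential is linear in the weight, which turns continuity in time into a question
  about the mass of weight differences (\<open>Th_th_diff\<close>).\<close>

lemma wpot_weight_diff:
  assumes w: "weight \<theta>" "weight \<theta>'" and U: "field U" and M: "\<And>s y. 0 < s \<Longrightarrow> norm (U s y) \<le> M * s powr (- b)" "0 \<le> M"
    and fin: "Th (2 * b) \<theta> < \<infinity>" "Th (2 * b) \<theta>' < \<infinity>"
  shows "wpot \<theta> U x - wpot \<theta>' U x = wpot (\<lambda>s \<sigma>. \<theta> s \<sigma> - \<theta>' s \<sigma>) U x"
proof -
  note i = wpot_le(1)[OF w(1) U M fin(1)] wpot_le(1)[OF w(2) U M fin(2)]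
  have "wpot \<theta> U x - wpot \<theta>' U x = (LINT w|M3. oz \<theta> U x w - oz \<theta>' U x w)"
    unfolding wpot_def using i by simp
  also have "\<dots> = wpot (\<lambda>s \<sigma>. \<theta> s \<sigma> - \<theta>' s \<sigma>) U x"
    unfolding wpot_def by (intro Bochner_Integration.integral_cong) (auto simp: oz_def scaleR_diff_left)
  finally show ?thesis .
qed

text \<open>One factor of the quadratic term is taken in the sup norm and the other in L^2, so that
  the mass \<open>Th b \<theta>\<close> appears and not \<open>Th (2 * b) \<theta>\<close>. In
  Schur's test the row and the column integrals both lead to this mass, hence its square.\<close>

lemma wpot_L2:
  assumes w: "weight \<theta>" and U: "field U" and M: "\<And>s y. 0 < s \<Longrightarrow> norm (U s y) \<le> M * s powr (- b)" "0 \<le> M"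
    and N: "\<And>s. 0 < s \<Longrightarrow> (\<integral>\<^sup>+y. (ennreal (norm (U s y)))\<^sup>2 \<partial>lborel) \<le> N"
    and fin: "Th (2 * b) \<theta> < \<infinity>"
  shows "(\<integral>\<^sup>+x. (ennreal (norm (wpot \<theta> U x)))\<^sup>2 \<partial>lborel) \<le> (ennreal (60 * M) * Th b \<theta>)\<^sup>2 * N"
proof -
  note [measurable (raw)] = weight_measurable[OF w] field_measurable[OF U]
  note [measurable] = pk_measurable[OF w, of b] oz_measurable[OF w U]
  define g where "g w = ennreal (norm (U (fst (fst w)) (snd (fst w))))" for w :: "(real \<times> space) \<times> real"
  have [measurable]: "g \<in> borel_measurable M3" unfolding g_def[abs_def] by measurable
  have le: "ennreal (norm (wpot \<theta> U x)) \<le> ennreal (60 * M) * (\<integral>\<^sup>+w. ennreal (pk \<theta> b x w) * g w \<partial>M3)" for x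
  proof -
    have "ennreal (norm (wpot \<theta> U x)) \<le> (\<integral>\<^sup>+w. ennreal (norm (oz \<theta> U x w)) \<partial>M3)"
      unfolding wpot_def by (rule integral_norm_bound_ennreal[OF wpot_le(1)[OF w U M fin]])
    also have "\<dots> \<le> (\<integral>\<^sup>+w. ennreal (60 * M) * (ennreal (pk \<theta> b x w) * g w) \<partial>M3)"
    proof (rule nn_integral_mono)
      fix w :: "(real \<times> space) \<times> real"
      obtain s y \<sigma> where ws: "w = ((s, y), \<sigma>)" by (metis surj_pair)
      have "norm (oz \<theta> U x w) \<le> 60 * M * (pk \<theta> b x w * norm (U s y))"
      proof (cases "\<theta> s \<sigma> = 0")
        case False
        then have pos: "0 < s" "0 < \<sigma>" using w by (auto simp: weight_def)
        have "norm (oz \<theta> U x w) \<le> \<bar>\<theta> s \<sigma>\<bar> * (60 * (norm (U s y))\<^sup>2 * (\<sigma> powr (- 3 / 2) * gauss (2 * \<sigma>) (x - y)))"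
          unfolding oz_def ws fst_conv snd_conv norm_scaleR by (intro mult_left_mono oseen_le pos) auto
        also have "\<dots> \<le> \<bar>\<theta> s \<sigma>\<bar> * (60 * ((M * s powr (- b)) * norm (U s y)) * (\<sigma> powr (- 3 / 2) * gauss (2 * \<sigma>) (x - y)))"
          unfolding power2_eq_square using M pos by (intro mult_left_mono mult_right_mono) auto
        finally show ?thesis by (simp add: pk_def ws mult_ac)
      qed (simp add: oz_def pk_def ws)
      then show "ennreal (norm (oz \<theta> U x w)) \<le> ennreal (60 * M) * (ennreal (pk \<theta> b x w) * g w)"
        using M by (simp add: g_def ws ennreal_mult[symmetric] ennreal_leI)
    qed
    also have "\<dots> = ennreal (60 * M) * (\<integral>\<^sup>+w. ennreal (pk \<theta> b x w) * g w \<partial>M3)"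
      by (rule nn_integral_cmult) measurable
    finally show ?thesis .
  qed
  interpret M3: sigma_finite_measure M3 by (rule sigma_finite_M3)
  have "(\<integral>\<^sup>+x. (ennreal (norm (wpot \<theta> U x)))\<^sup>2 \<partial>lborel)
     \<le> (\<integral>\<^sup>+x. (ennreal (60 * M) * (\<integral>\<^sup>+w. ennreal (pk \<theta> b x w) * g w \<partial>M3))\<^sup>2 \<partial>lborel)"
    by (intro nn_integral_mono power_mono le) auto
  also have "\<dots> = (ennreal (60 * M))\<^sup>2 * (\<integral>\<^sup>+x. (\<integral>\<^sup>+w. ennreal (pk \<theta> b x w) * g w \<partial>M3)\<^sup>2 \<partial>lborel)"
    unfolding power_mult_distrib by (rule nn_integral_cmult) measurable
  also have "(\<integral>\<^sup>+x. (\<integral>\<^sup>+w. ennreal (pk \<theta> b x w) * g w \<partial>M3)\<^sup>2 \<partial>lborel)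
     \<le> Th b \<theta> * (\<integral>\<^sup>+w. (\<integral>\<^sup>+x. ennreal (pk \<theta> b x w) \<partial>lborel) * (g w)\<^sup>2 \<partial>M3)"
    by (rule schur_test[OF lborel.sigma_finite_measure_axioms sigma_finite_M3]) (auto simp: pk_total[OF w])
  also have "(\<integral>\<^sup>+w. (\<integral>\<^sup>+x. ennreal (pk \<theta> b x w) \<partial>lborel) * (g w)\<^sup>2 \<partial>M3)
     = (\<integral>\<^sup>+s. \<integral>\<^sup>+\<sigma>. \<integral>\<^sup>+y. (\<integral>\<^sup>+x. ennreal (pk \<theta> b x ((s, y), \<sigma>)) \<partial>lborel) * (g ((s, y), \<sigma>))\<^sup>2 \<partial>lborel \<partial>lborel \<partial>lborel)"
    by (rule nn_integral_M3) measurable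
  also have "\<dots> \<le> (\<integral>\<^sup>+s. \<integral>\<^sup>+\<sigma>. ennreal (\<bar>\<theta> s \<sigma>\<bar> * \<sigma> powr (- 3 / 2) * s powr (- b)) * N \<partial>lborel \<partial>lborel)"
  proof (intro nn_integral_mono)
    fix s \<sigma> :: real
    show "(\<integral>\<^sup>+y. (\<integral>\<^sup>+x. ennreal (pk \<theta> b x ((s, y), \<sigma>)) \<partial>lborel) * (g ((s, y), \<sigma>))\<^sup>2 \<partial>lborel)
      \<le> ennreal (\<bar>\<theta> s \<sigma>\<bar> * \<sigma> powr (- 3 / 2) * s powr (- b)) * N"
    proof (cases "\<theta> s \<sigma> = 0")
      case False
      then have pos: "0 < s" using w by (auto simp: weight_def)
      show ?thesis
        unfolding pk_space_integral[OF w] g_def fst_conv snd_conv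
        by (subst nn_integral_cmult) (auto intro!: mult_left_mono N pos)
    qed (simp add: pk_space_integral[OF w])
  qed
  also have "\<dots> = Th b \<theta> * N"
    unfolding Th_def by (simp add: nn_integral_multc)
  finally have "(\<integral>\<^sup>+x. (ennreal (norm (wpot \<theta> U x)))\<^sup>2 \<partial>lborel) \<le> (ennreal (60 * M))\<^sup>2 * (Th b \<theta> * (Th b \<theta> * N))"
    by (meson mult_left_mono order_trans zero_le)
  then show ?thesis by (simp add: power2_eq_square mult_ac)
qed

text \<open>With this weight \<open>wpot\<close> is the quadratic Duhamel term at time \<open>t\<close>: \<open>\<sigma>\<close> exceeds the elapsed
  time \<open>t - s\<close> because of the representation of the kernel by \<open>oseen\<close>.\<close>

definition th :: "real \<Rightarrow> real \<Rightarrow> real \<Rightarrow> real" where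
  "th t s \<sigma> = (if 0 < s \<and> s < t \<and> t - s < \<sigma> then 1 else 0)"

lemma th_weight: "weight (th t)"
proof -
  have "(\<lambda>p. th t (fst p) (snd p)) \<in> borel_measurable (borel \<Otimes>\<^sub>M borel)"
    unfolding th_def by measurable
  then show ?thesis
    by (auto simp: weight_def borel_prod case_prod_beta' th_def split: if_splits)
qed

text \<open>Integrating \<sigma>^(-3/2) over \<sigma> > t - s gives 2 (t - s)^(-1/2), the rate of
  the usual bound for the operator e^((t - s) \<Delta>) P div.\<close>

lemma th_inner:
  "(\<integral>\<^sup>+\<sigma>. ennreal (\<bar>th t s \<sigma>\<bar> * \<sigma> powr (- 3 / 2) * s powr (- a)) \<partial>lborel)
    = ennreal 2 * (ennreal (s powr - a * (t - s) powr - (1/2)) * indicator {0<..<t} s)"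
proof (cases "0 < s \<and> s < t")
  case True
  have "(\<integral>\<^sup>+\<sigma>. ennreal (\<bar>th t s \<sigma>\<bar> * \<sigma> powr (- 3 / 2) * s powr (- a)) \<partial>lborel)
     = (\<integral>\<^sup>+\<sigma>. ennreal (s powr (- a)) * (ennreal (\<sigma> powr - (3/2)) * indicator {t - s<..} \<sigma>) \<partial>lborel)"
    using True by (intro nn_integral_cong) (auto simp: th_def indicator_def ennreal_mult[symmetric] mult_ac)
  also have "\<dots> = ennreal (s powr (- a)) * ennreal ((t - s) powr (1 - 3/2) / (3/2 - 1))"
    using True by (subst nn_integral_cmult) (auto simp: nn_integral_powr_tail)
  also have "\<dots> = ennreal 2 * (ennreal (s powr - a * (t - s) powr - (1/2)) * indicator {0<..<t} s)"
    using True by (simp add: ennreal_mult mult_ac)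
  finally show ?thesis .
qed (auto simp: th_def)

lemma Th_th: "Th a (th t) = 2 * beta_int a (1/2) t"
  unfolding Th_def th_inner beta_int_def by (subst nn_integral_cmult) auto

lemma Th_th_nonpos: "t \<le> 0 \<Longrightarrow> Th a (th t) = 0"
  by (simp add: Th_th beta_int_def)

definition beta1 :: "real \<Rightarrow> real" where
  "beta1 a = enn2real (beta_int a (1/2) 1)"

lemma beta1:
  assumes "0 \<le> a" "a < 1"
  shows "beta_int a (1/2) 1 = ennreal (beta1 a)" "0 \<le> beta1 a" "beta1 a \<le> 6 / (1 - a)"
proof -
  have le: "beta_int a (1/2) 1 \<le> ennreal (2 / (1 - a) + 2 / (1 - 1/2))"
    using assms by (intro beta_int_1_le) auto
  then have "beta_int a (1/2) 1 < \<infinity>" by (rule order_le_less_trans) simp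
  then show e: "beta_int a (1/2) 1 = ennreal (beta1 a)" by (simp add: beta1_def)
  show "0 \<le> beta1 a" by (simp add: beta1_def)
  have "beta1 a \<le> 2 / (1 - a) + 4"
    using le assms unfolding e by (subst (asm) ennreal_le_iff) auto
  \<comment> \<open>The constant is weakened so that the bound becomes a single multiple of 1/(1 -
    a).\<close>
  also have "4 \<le> 4 / (1 - a)" using assms by (simp add: field_simps)
  finally show "beta1 a \<le> 6 / (1 - a)" by (simp add: field_simps)
qed

lemma Th_th_eq:
  assumes "0 \<le> a" "a < 1" "0 < t"
  shows "Th a (th t) = ennreal (2 * beta1 a * t powr (1/2 - a))"
  unfolding Th_th beta_int_scale[OF assms(3)] beta1(1)[OF assms(1,2)]
proof -
  have "2 * (ennreal (t powr (1 - a - 1/2)) * ennreal (beta1 a)) = ennreal 2 * ennreal (t powr (1 - a - 1/2) * beta1 a)"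
    using beta1(2)[OF assms(1,2)] by (simp add: ennreal_mult)
  also have "\<dots> = ennreal (2 * (t powr (1 - a - 1/2) * beta1 a))"
    by (rule ennreal_mult'[symmetric]) simp
  also have "2 * (t powr (1 - a - 1/2) * beta1 a) = 2 * beta1 a * t powr (1/2 - a)"
    by (simp add: algebra_simps)
  finally show "2 * (ennreal (t powr (1 - a - 1/2)) * ennreal (beta1 a)) = ennreal (2 * beta1 a * t powr (1/2 - a))" .
qed

lemma Th_th_finite:
  assumes "0 \<le> a" "a < 1"
  shows "Th a (th t) < \<infinity>"
  using Th_th_eq[OF assms, of t] Th_th_nonpos[of t a] by (cases "0 < t") auto

text \<open>The difference of the weights is nonpositive for s < t and nonnegative for later s. Its
  mass is obtained from an identity and not by estimating the parts separately; the first
  contribution is therefore an exact difference of beta integrals, which tends to 0 with t' -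
  t.\<close>

lemma Th_th_diff:
  assumes a: "0 \<le> a" "a < 1" and t: "0 < t" "t < t'"
  shows "Th a (\<lambda>s \<sigma>. th t' s \<sigma> - th t s \<sigma>)
    \<le> ennreal (2 * beta1 a * (t powr (1/2 - a) - t' powr (1/2 - a)) + 8 * t powr (- a) * sqrt (t' - t))"
proof -
  note [measurable (raw)] = weight_measurable[OF th_weight]
  define E :: "real \<Rightarrow> real \<Rightarrow> real" where "E s \<sigma> = (if t \<le> s \<and> s < t' \<and> t' - s < \<sigma> then 1 else 0)" for s \<sigma>
  have E[measurable]: "(\<lambda>(s, \<sigma>). E s \<sigma>) \<in> borel_measurable (lborel \<Otimes>\<^sub>M lborel)"
    unfolding E_def by measurable
  \<comment> \<open>This is |\<theta>' - \<theta>| + \<theta>' = \<theta> + 2 E, where E is the part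
    of \<theta>' with s in [t, t'). It avoids subtraction in \<open>ennreal\<close>; the finite mass
    of \<theta>' is subtracted at the end, among real numbers.\<close>
  have id: "ennreal (\<bar>th t' s \<sigma> - th t s \<sigma>\<bar> * \<sigma> powr (- 3 / 2) * s powr (- a)) + ennreal (\<bar>th t' s \<sigma>\<bar> * \<sigma> powr (- 3 / 2) * s powr (- a))
     = ennreal (\<bar>th t s \<sigma>\<bar> * \<sigma> powr (- 3 / 2) * s powr (- a)) + ennreal 2 * ennreal (E s \<sigma> * \<sigma> powr (- 3 / 2) * s powr (- a))" for s \<sigma>
  proof -
    have "\<bar>th t' s \<sigma> - th t s \<sigma>\<bar> + \<bar>th t' s \<sigma>\<bar> = \<bar>th t s \<sigma>\<bar> + 2 * E s \<sigma>"
      using t by (auto simp: th_def E_def indicator_def)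
    then have "(\<bar>th t' s \<sigma> - th t s \<sigma>\<bar> + \<bar>th t' s \<sigma>\<bar>) * (\<sigma> powr (- 3 / 2) * s powr (- a))
      = (\<bar>th t s \<sigma>\<bar> + 2 * E s \<sigma>) * (\<sigma> powr (- 3 / 2) * s powr (- a))" by simp
    then have e: "\<bar>th t' s \<sigma> - th t s \<sigma>\<bar> * \<sigma> powr (- 3 / 2) * s powr (- a) + \<bar>th t' s \<sigma>\<bar> * \<sigma> powr (- 3 / 2) * s powr (- a)
       = \<bar>th t s \<sigma>\<bar> * \<sigma> powr (- 3 / 2) * s powr (- a) + 2 * (E s \<sigma> * \<sigma> powr (- 3 / 2) * s powr (- a))"
      by (simp add: algebra_simps)
    have "0 \<le> E s \<sigma>" by (simp add: E_def)
    then have "ennreal 2 * ennreal (E s \<sigma> * \<sigma> powr (- 3 / 2) * s powr (- a)) = ennreal (2 * (E s \<sigma> * \<sigma> powr (- 3 / 2) * s powr (- a)))"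
      by (intro ennreal_mult[symmetric]) auto
    then show ?thesis
      using \<open>0 \<le> E s \<sigma>\<close> e by (simp only: ennreal_plus[symmetric] mult_nonneg_nonneg abs_ge_zero powr_ge_zero zero_le_numeral)
  qed
  have "Th a (\<lambda>s \<sigma>. th t' s \<sigma> - th t s \<sigma>) + Th a (th t')
     = (\<integral>\<^sup>+s. \<integral>\<^sup>+\<sigma>. ennreal (\<bar>th t' s \<sigma> - th t s \<sigma>\<bar> * \<sigma> powr (- 3 / 2) * s powr (- a)) + ennreal (\<bar>th t' s \<sigma>\<bar> * \<sigma> powr (- 3 / 2) * s powr (- a)) \<partial>lborel \<partial>lborel)"
    unfolding Th_def by (simp add: nn_integral_add)
  also have "\<dots> = Th a (th t) + ennreal 2 * (\<integral>\<^sup>+s. \<integral>\<^sup>+\<sigma>. ennreal (E s \<sigma> * \<sigma> powr (- 3 / 2) * s powr (- a)) \<partial>lborel \<partial>lborel)"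
    unfolding id Th_def by (simp add: nn_integral_add nn_integral_cmult)
  also have "(\<integral>\<^sup>+s. \<integral>\<^sup>+\<sigma>. ennreal (E s \<sigma> * \<sigma> powr (- 3 / 2) * s powr (- a)) \<partial>lborel \<partial>lborel) \<le> ennreal (4 * t powr (- a) * sqrt (t' - t))"
  proof -
    have "(\<integral>\<^sup>+\<sigma>. ennreal (E s \<sigma> * \<sigma> powr (- 3 / 2) * s powr (- a)) \<partial>lborel)
       \<le> ennreal (2 * t powr (- a)) * (ennreal ((t' - s) powr - (1/2)) * indicator {0<..<t' - t} (t' - s))"
      if "s \<noteq> t" for s
    proof (cases "t < s \<and> s < t'")
      case True
      have "(\<integral>\<^sup>+\<sigma>. ennreal (E s \<sigma> * \<sigma> powr (- 3 / 2) * s powr (- a)) \<partial>lborel)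
         = (\<integral>\<^sup>+\<sigma>. ennreal (s powr (- a)) * (ennreal (\<sigma> powr - (3/2)) * indicator {t' - s<..} \<sigma>) \<partial>lborel)"
        using True by (intro nn_integral_cong) (auto simp: E_def indicator_def ennreal_mult[symmetric] mult_ac)
      also have "\<dots> = ennreal (s powr (- a)) * ennreal ((t' - s) powr (1 - 3/2) / (3/2 - 1))"
        using True by (subst nn_integral_cmult) (auto simp: nn_integral_powr_tail)
      also have "\<dots> = ennreal (s powr (- a) * (2 * (t' - s) powr - (1/2)))"
        using True by (simp add: ennreal_mult[symmetric] mult_ac)
      also have "\<dots> \<le> ennreal (t powr (- a) * (2 * (t' - s) powr - (1/2)))"
        using True t a by (intro ennreal_leI mult_right_mono powr_mono2') auto
      finally show ?thesis using True by (simp add: ennreal_mult[symmetric] mult_ac)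
    next
      case False
      then show ?thesis using that by (auto simp: E_def indicator_def)
    qed
    then have "(\<integral>\<^sup>+s. \<integral>\<^sup>+\<sigma>. ennreal (E s \<sigma> * \<sigma> powr (- 3 / 2) * s powr (- a)) \<partial>lborel \<partial>lborel)
      \<le> (\<integral>\<^sup>+s. ennreal (2 * t powr (- a)) * (ennreal ((t' - s) powr - (1/2)) * indicator {0<..<t' - t} (t' - s)) \<partial>lborel)"
      using AE_lborel_singleton[of t] by (intro nn_integral_mono_AE) (auto elim!: eventually_mono)
    also have "\<dots> = ennreal (2 * t powr (- a)) * (\<integral>\<^sup>+s. ennreal ((t' - s) powr - (1/2)) * indicator {0<..<t' - t} (t' - s) \<partial>lborel)"
      by (rule nn_integral_cmult) simp
    also have "(\<integral>\<^sup>+s. ennreal ((t' - s) powr - (1/2)) * indicator {0<..<t' - t} (t' - s) \<partial>lborel)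
      = (\<integral>\<^sup>+s. ennreal (s powr - (1/2)) * indicator {0<..<t' - t} s \<partial>lborel)"
      by (rule nn_integral_reflect[of "\<lambda>s. ennreal (s powr - (1/2)) * indicator {0<..<t' - t} s"]) simp
    also have "\<dots> = ennreal ((t' - t) powr (1 - 1/2) / (1 - 1/2))"
      using t by (intro nn_integral_powr_near_0) auto
    also have "ennreal (2 * t powr (- a)) * \<dots> = ennreal (4 * t powr (- a) * sqrt (t' - t))"
      using t by (simp add: ennreal_mult'[symmetric] powr_half_sqrt mult_ac)
    finally show ?thesis .
  qed
  finally have le: "Th a (\<lambda>s \<sigma>. th t' s \<sigma> - th t s \<sigma>) + Th a (th t') \<le> Th a (th t) + ennreal 2 * ennreal (4 * t powr (- a) * sqrt (t' - t))"
    by (simp add: mult_left_mono)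
  have t'0: "0 < t'" using t by simp
  obtain r where r: "Th a (\<lambda>s \<sigma>. th t' s \<sigma> - th t s \<sigma>) = ennreal r" "0 \<le> r"
  proof -
    have "Th a (\<lambda>s \<sigma>. th t' s \<sigma> - th t s \<sigma>) \<le> Th a (th t) + ennreal 2 * ennreal (4 * t powr (- a) * sqrt (t' - t))"
      using le by (meson le_iff_add order_trans zero_le add_increasing2 order_refl)
    also have "\<dots> < \<infinity>" using Th_th_finite[OF a, of t] by (simp add: ennreal_mult_less_top)
    finally show ?thesis using that by (cases "Th a (\<lambda>s \<sigma>. th t' s \<sigma> - th t s \<sigma>)") auto
  qed
  have "r + 2 * beta1 a * t' powr (1/2 - a) \<le> 2 * beta1 a * t powr (1/2 - a) + 2 * (4 * t powr (- a) * sqrt (t' - t))"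
  proof -
    define L X Y where "L = 2 * beta1 a * t' powr (1/2 - a)" and "X = 2 * beta1 a * t powr (1/2 - a)"
      and "Y = 4 * t powr (- a) * sqrt (t' - t)"
    have nn: "0 \<le> L" "0 \<le> X" "0 \<le> Y" using beta1(2)[OF a] t by (auto simp: L_def X_def Y_def)
    have "ennreal 2 * ennreal Y = ennreal (2 * Y)" using nn by (intro ennreal_mult[symmetric]) auto
    then have "ennreal r + ennreal L \<le> ennreal X + ennreal (2 * Y)"
      using le unfolding r(1) Th_th_eq[OF a t'0] Th_th_eq[OF a t(1)] L_def X_def Y_def by simp
    then have "ennreal (r + L) \<le> ennreal (X + 2 * Y)"
      using nn r(2) by (subst ennreal_plus, simp, simp, subst ennreal_plus) auto
    then have "r + L \<le> X + 2 * Y" using nn by (subst (asm) ennreal_le_iff) auto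
    then show ?thesis by (simp add: L_def X_def Y_def)
  qed
  then have "r \<le> 2 * beta1 a * (t powr (1/2 - a) - t' powr (1/2 - a)) + 8 * t powr (- a) * sqrt (t' - t)"
    by (simp add: algebra_simps)
  then show ?thesis unfolding r(1) by (rule ennreal_leI)
qed

subsection \<open>Picard iteration\<close>

definition heat :: "(space \<Rightarrow> space) \<Rightarrow> real \<Rightarrow> space \<Rightarrow> space" where
  "heat v t x = (LINT y|lborel. gauss t (x - y) *\<^sub>R v y)"

text \<open>Hoelder's inequality is replaced by f \<le> l + l^(1-p) f^p: the constant is paired with
  the mass of the Gaussian, the second term with its maximum s^(-3/2).\<close>

lemma gauss_pot_Lp_le:
  fixes f :: "space \<Rightarrow> real"
  assumes [measurable]: "f \<in> borel_measurable borel" and f: "\<And>y. 0 \<le> f y"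
    and p: "1 < p" and A: "0 < A" "(\<integral>\<^sup>+y. ennreal (f y powr p) \<partial>lborel) \<le> ennreal (A powr p)" and s: "0 < s"
  shows "(\<integral>\<^sup>+y. ennreal (gauss s (x - y) * f y) \<partial>lborel) \<le> ennreal (2 * A * s powr (- (3 / (2 * p))))"
proof -
  \<comment> \<open>This level makes both contributions equal to \<open>l\<close>, which explains
    the factor 2 in the result.\<close>
  define l where "l = A * s powr (- (3 / (2 * p)))"
  have l: "0 < l" using A s by (simp add: l_def)
  have split: "f y \<le> l + l powr (1 - p) * f y powr p" for y
  proof (cases "f y \<le> l")
    case False
    then have fy: "0 < f y" using l by simp
    have "1 \<le> (f y / l) powr (p - 1)"
      using False l p by (intro ge_one_powr_ge_zero) (auto simp: field_simps)
    then have "f y * 1 \<le> f y * (f y / l) powr (p - 1)"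
      using fy by (intro mult_left_mono) auto
    also have "\<dots> = l powr (1 - p) * f y powr p"
    proof -
      have "(f y / l) powr (p - 1) = f y powr (p - 1) * l powr (1 - p)"
      proof -
        have "(f y / l) powr (p - 1) = f y powr (p - 1) / l powr (p - 1)"
          using fy l by (simp add: powr_divide)
        moreover have "l powr (1 - p) = inverse (l powr (p - 1))"
          using powr_minus[of l "p - 1"] by simp
        ultimately show ?thesis by (simp add: divide_inverse)
      qed
      moreover have "f y * f y powr (p - 1) = f y powr p"
        using fy by (simp add: powr_mult_base)
      ultimately show ?thesis by (simp add: mult_ac)
    qed
    finally show ?thesis using l by simp
  qed (use l in \<open>simp add: add_increasing2\<close>)
  have "(\<integral>\<^sup>+y. ennreal (gauss s (x - y) * f y) \<partial>lborel)
     \<le> (\<integral>\<^sup>+y. ennreal l * ennreal (gauss s (x - y)) + ennreal (s powr (- 3 / 2) * l powr (1 - p)) * ennreal (f y powr p) \<partial>lborel)"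
  proof (rule nn_integral_mono)
    fix y
    have "gauss s (x - y) * f y \<le> gauss s (x - y) * (l + l powr (1 - p) * f y powr p)"
      by (intro mult_left_mono split) auto
    also have "\<dots> \<le> l * gauss s (x - y) + s powr (- 3 / 2) * (l powr (1 - p) * f y powr p)"
      using mult_right_mono[OF gauss_le[OF s, of "x - y"], of "l powr (1 - p) * f y powr p"]
      unfolding distrib_left by (simp add: mult.commute)
    finally have "ennreal (gauss s (x - y) * f y) \<le> ennreal (l * gauss s (x - y) + s powr (- 3 / 2) * (l powr (1 - p) * f y powr p))"
      by (rule ennreal_leI)
    also have "\<dots> = ennreal l * ennreal (gauss s (x - y)) + ennreal (s powr (- 3 / 2) * l powr (1 - p)) * ennreal (f y powr p)"
      using l by (simp add: ennreal_mult mult.assoc)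
    finally show "ennreal (gauss s (x - y) * f y) \<le> ennreal l * ennreal (gauss s (x - y)) + ennreal (s powr (- 3 / 2) * l powr (1 - p)) * ennreal (f y powr p)" .
  qed
  also have "\<dots> = ennreal l + ennreal (s powr (- 3 / 2) * l powr (1 - p)) * (\<integral>\<^sup>+y. ennreal (f y powr p) \<partial>lborel)"
    by (subst nn_integral_add) (simp_all add: nn_integral_cmult nn_integral_gauss_shift[OF s])
  also have "\<dots> \<le> ennreal l + ennreal (s powr (- 3 / 2) * l powr (1 - p)) * ennreal (A powr p)"
    by (intro add_left_mono mult_left_mono A) auto
  also have "\<dots> = ennreal (l + s powr (- 3 / 2) * l powr (1 - p) * A powr p)"
    using l by (simp add: ennreal_mult)
  also have "s powr (- 3 / 2) * l powr (1 - p) * A powr p = l"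
  proof -
    have "l powr (1 - p) = A powr (1 - p) * s powr (- (3 / (2 * p)) * (1 - p))"
      using A s by (simp add: l_def powr_mult powr_powr)
    then have "s powr (- 3 / 2) * l powr (1 - p) * A powr p
      = (A powr (1 - p) * A powr p) * (s powr (- 3 / 2) * s powr (- (3 / (2 * p)) * (1 - p)))" by (simp add: mult_ac)
    also have "\<dots> = A powr 1 * s powr (- 3 / 2 + - (3 / (2 * p)) * (1 - p))"
      by (simp add: powr_add[symmetric])
    also have "- 3 / 2 + - (3 / (2 * p)) * (1 - p) = - (3 / (2 * p))"
      using p by (simp add: field_simps)
    finally show ?thesis using A by (simp add: l_def)
  qed
  finally show ?thesis by (simp add: l_def mult.assoc)
qed

lemma gauss_pot_L2_le:
  fixes f :: "space \<Rightarrow> ennreal"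
  assumes [measurable]: "f \<in> borel_measurable borel" and s: "0 < s"
  shows "(\<integral>\<^sup>+x. (\<integral>\<^sup>+y. ennreal (gauss s (x - y)) * f y \<partial>lborel)\<^sup>2 \<partial>lborel) \<le> (\<integral>\<^sup>+y. (f y)\<^sup>2 \<partial>lborel)"
  using schur_test[OF lborel.sigma_finite_measure_axioms lborel.sigma_finite_measure_axioms,
      of "\<lambda>x y. ennreal (gauss s (x - y))" f 1]
  by (simp add: nn_integral_gauss_shift[OF s])

lemma field_heat:
  assumes [measurable]: "v \<in> borel_measurable borel"
  shows "field (heat v)"
proof -
  have "(\<lambda>q. heat v (fst q) (snd q)) \<in> borel_measurable (borel \<Otimes>\<^sub>M borel)"
    unfolding heat_def by measurable
  then show ?thesis by (simp add: field_def borel_prod case_prod_beta')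
qed

lemma field_wpot:
  assumes U: "field U"
  shows "field (\<lambda>t. wpot (th t) U)"
proof -
  note [measurable (raw)] = field_measurable[OF U] sigma_finite_measure.borel_measurable_lebesgue_integral[OF sigma_finite_M3]
  have "(\<lambda>q. wpot (th (fst q)) U (snd q)) \<in> borel_measurable (borel \<Otimes>\<^sub>M borel)"
    unfolding wpot_def oz_def th_def by measurable
  then show ?thesis by (simp add: field_def borel_prod case_prod_beta')
qed

lemma field_slice: "field U \<Longrightarrow> U t \<in> borel_measurable borel"
  using field_measurable[of U "\<lambda>_. t" borel "\<lambda>x. x"] by simp

lemma ennreal_sum_square_le:
  fixes a b :: "'a::real_normed_vector"
  shows "(ennreal (norm (a + b)))\<^sup>2 \<le> 2 * (ennreal (norm a))\<^sup>2 + 2 * (ennreal (norm b))\<^sup>2"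
proof -
  have "(norm (a + b))\<^sup>2 \<le> (norm a + norm b)\<^sup>2"
    by (intro power_mono norm_triangle_ineq) auto
  also have "\<dots> \<le> 2 * (norm a)\<^sup>2 + 2 * (norm b)\<^sup>2"
    using sum_squares_bound[of "norm a" "norm b"] by (simp add: power2_sum)
  finally have "ennreal ((norm (a + b))\<^sup>2) \<le> ennreal (2 * (norm a)\<^sup>2 + 2 * (norm b)\<^sup>2)"
    by (rule ennreal_leI)
  then show ?thesis by (simp add: ennreal_power ennreal_mult)
qed

text \<open>The square of the L^2 norm, with values in \<open>ennreal\<close> so that it makes sense
  without integrability.\<close>

definition N2 :: "(space \<Rightarrow> space) \<Rightarrow> ennreal" where
  "N2 f = (\<integral>\<^sup>+x. (ennreal (norm (f x)))\<^sup>2 \<partial>lborel)"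

lemma N2_add_le:
  assumes [measurable]: "f \<in> borel_measurable borel" "g \<in> borel_measurable borel"
  shows "N2 (\<lambda>x. f x + g x) \<le> 2 * N2 f + 2 * N2 g"
proof -
  have "N2 (\<lambda>x. f x + g x) \<le> (\<integral>\<^sup>+x. 2 * (ennreal (norm (f x)))\<^sup>2 + 2 * (ennreal (norm (g x)))\<^sup>2 \<partial>lborel)"
    unfolding N2_def by (intro nn_integral_mono ennreal_sum_square_le)
  also have "\<dots> = 2 * N2 f + 2 * N2 g"
    unfolding N2_def by (simp add: nn_integral_add nn_integral_cmult)
  finally show ?thesis .
qed

lemma N2_diff_le:
  assumes "f \<in> borel_measurable borel" "g \<in> borel_measurable borel"
  shows "N2 (\<lambda>x. f x - g x) \<le> 2 * N2 f + 2 * N2 g"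
proof -
  have "(\<lambda>x. - g x) \<in> borel_measurable borel" using assms by simp
  from N2_add_le[OF assms(1) this] show ?thesis by (simp add: N2_def)
qed

text \<open>\<open>M / 2\<close> and \<open>N\<close> bound the weighted sup norm of the heat flow of \<open>u0\<close> and the squared
  $L^2$ norm of \<open>u0\<close>; the last two assumptions make the quadratic term a contraction.\<close>

locale picard =
  fixes u0 :: "space \<Rightarrow> space" and M \<alpha> T :: real and N :: ennreal
  assumes u0 [measurable]: "u0 \<in> borel_measurable borel"
    and pot: "\<And>t x. 0 < t \<Longrightarrow> (\<integral>\<^sup>+y. ennreal (gauss t (x - y) * norm (u0 y)) \<partial>lborel) \<le> ennreal (M / 2 * t powr (- \<alpha>))"
    and L2: "N2 u0 \<le> N" "N < \<infinity>"
    and \<alpha>: "0 \<le> \<alpha>" "\<alpha> < 1/2" and M: "0 < M" and T: "0 < T"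
    and small: "120 * M * beta1 (2 * \<alpha>) * T powr (1/2 - \<alpha>) \<le> 1/4"
      "120 * M * beta1 \<alpha> * T powr (1/2 - \<alpha>) \<le> 1/4"
begin

lemma heat_integrable: "0 < t \<Longrightarrow> integrable lborel (\<lambda>y. gauss t (x - y) *\<^sub>R u0 y)"
  using order_le_less_trans[OF pot[of t x]] by (intro integrableI_bounded) auto

lemma heat_norm_le_nn: "0 < t \<Longrightarrow> ennreal (norm (heat u0 t x)) \<le> (\<integral>\<^sup>+y. ennreal (gauss t (x - y)) * ennreal (norm (u0 y)) \<partial>lborel)"
  unfolding heat_def using integral_norm_bound_ennreal[OF heat_integrable, of t x] by (simp add: ennreal_mult)

lemma heat_le:
  assumes "0 < t"
  shows "norm (heat u0 t x) \<le> M / 2 * t powr (- \<alpha>)"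
proof -
  have "ennreal (norm (heat u0 t x)) \<le> ennreal (M / 2 * t powr (- \<alpha>))"
    using heat_norm_le_nn[OF assms, of x] pot[OF assms, of x] by (simp add: ennreal_mult)
  then show ?thesis using M by (simp add: ennreal_le_iff)
qed

lemma pot_L2:
  assumes "0 < t"
  shows "(\<integral>\<^sup>+x. (\<integral>\<^sup>+y. ennreal (gauss t (x - y)) * ennreal (norm (u0 y)) \<partial>lborel)\<^sup>2 \<partial>lborel) \<le> N"
  using gauss_pot_L2_le[OF _ assms, of "\<lambda>y. ennreal (norm (u0 y))"] L2(1) by (auto simp: N2_def)

lemma heat_L2:
  assumes "0 < t"
  shows "N2 (heat u0 t) \<le> N"
proof -
  have "N2 (heat u0 t) \<le> (\<integral>\<^sup>+x. (\<integral>\<^sup>+y. ennreal (gauss t (x - y)) * ennreal (norm (u0 y)) \<partial>lborel)\<^sup>2 \<partial>lborel)"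
    unfolding N2_def by (intro nn_integral_mono power_mono heat_norm_le_nn assms) auto
  then show ?thesis using pot_L2[OF assms] by (rule order_trans)
qed

text \<open>The set that the iteration preserves. The heat flow and the quadratic term each take
  half of the sup bound; in L^2 the square of each is at most \<open>N\<close>, and 2 N + 2 N gives
  the \<open>4 * N\<close>.\<close>

definition bounded_field :: "(real \<Rightarrow> space \<Rightarrow> space) \<Rightarrow> bool" where
  "bounded_field U \<longleftrightarrow> field U \<and> (\<forall>s y. 0 < s \<longrightarrow> norm (U s y) \<le> M * s powr (- \<alpha>)) \<and> (\<forall>s. 0 < s \<longrightarrow> N2 (U s) \<le> 4 * N)"

lemma bounded_fieldD:
  assumes "bounded_field U"
  shows "field U" "\<And>s y. 0 < s \<Longrightarrow> norm (U s y) \<le> M * s powr (- \<alpha>)" "\<And>s. 0 < s \<Longrightarrow> N2 (U s) \<le> 4 * N"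
  using assms by (auto simp: bounded_field_def)

lemma fin: "Th (2 * \<alpha>) (th t) < \<infinity>" "Th \<alpha> (th t) < \<infinity>"
  by (rule Th_th_finite; use \<alpha> in simp)+

lemma powr_T: "0 < t \<Longrightarrow> t < T \<Longrightarrow> t powr (1/2 - \<alpha>) \<le> T powr (1/2 - \<alpha>)"
  using \<alpha> by (intro powr_mono2) auto

lemma small_t:
  assumes "0 < t" "t < T"
  shows "120 * M * beta1 (2 * \<alpha>) * t powr (1/2 - \<alpha>) \<le> 1/4" "120 * M * beta1 \<alpha> * t powr (1/2 - \<alpha>) \<le> 1/4"
proof -
  have "0 \<le> 120 * M * beta1 (2 * \<alpha>)" "0 \<le> 120 * M * beta1 \<alpha>"
    using M beta1(2)[of "2 * \<alpha>"] beta1(2)[of \<alpha>] \<alpha> by auto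
  from this[THEN mult_left_mono[OF powr_T[OF assms]]] small
  show "120 * M * beta1 (2 * \<alpha>) * t powr (1/2 - \<alpha>) \<le> 1/4" "120 * M * beta1 \<alpha> * t powr (1/2 - \<alpha>) \<le> 1/4"
    by linarith+
qed

text \<open>The exponent 1/2 - 2\<alpha> from the beta integral is split into -\<alpha>, the weight
  of the norm, and 1/2 - \<alpha>, the power that the smallness assumption controls.\<close>

lemma W_contract:
  assumes U: "bounded_field U" "bounded_field U'" and t: "0 < t" "t < T"
    and e: "\<And>s y. 0 < s \<Longrightarrow> norm (U s y - U' s y) \<le> \<delta> * s powr (- \<alpha>)" "0 \<le> \<delta>"
  shows "norm (wpot (th t) U x - wpot (th t) U' x) \<le> \<delta> / 2 * t powr (- \<alpha>)"
proof -
  have b: "0 \<le> beta1 (2 * \<alpha>)" using beta1(2)[of "2 * \<alpha>"] \<alpha> by simp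
  have "ennreal (norm (wpot (th t) U x - wpot (th t) U' x)) \<le> ennreal (120 * \<delta> * M) * Th (2 * \<alpha>) (th t)"
    using M by (intro wpot_diff_le th_weight bounded_fieldD[OF U(1)] bounded_fieldD[OF U(2)] e fin) auto
  also have "\<dots> = ennreal (120 * \<delta> * M * (2 * beta1 (2 * \<alpha>) * t powr (1/2 - 2 * \<alpha>)))"
  proof -
    have "Th (2 * \<alpha>) (th t) = ennreal (2 * beta1 (2 * \<alpha>) * t powr (1/2 - 2 * \<alpha>))"
      using \<alpha> t by (intro Th_th_eq) auto
    then show ?thesis using M e(2) b by (simp only:) (rule ennreal_mult[symmetric]; simp)
  qed
  finally have "norm (wpot (th t) U x - wpot (th t) U' x) \<le> 120 * \<delta> * M * (2 * beta1 (2 * \<alpha>) * t powr (1/2 - 2 * \<alpha>))"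
    using e(2) M b by (simp add: ennreal_le_iff)
  also have "t powr (1/2 - 2 * \<alpha>) = t powr (1/2 - \<alpha>) * t powr (- \<alpha>)"
    by (simp add: powr_add[symmetric])
  also have "120 * \<delta> * M * (2 * beta1 (2 * \<alpha>) * (t powr (1/2 - \<alpha>) * t powr (- \<alpha>)))
      = (2 * \<delta> * t powr (- \<alpha>)) * (120 * M * beta1 (2 * \<alpha>) * t powr (1/2 - \<alpha>))" by simp
  also have "\<dots> \<le> (2 * \<delta> * t powr (- \<alpha>)) * (1/4)"
    using small_t(1)[OF t] e(2) by (intro mult_left_mono) auto
  finally show ?thesis by simp
qed

lemma zero_bounded: "bounded_field (\<lambda>_ _. 0)"
  using M by (auto simp: bounded_field_def field_def N2_def)

lemma wpot_0 [simp]: "wpot \<theta> (\<lambda>_ _. 0) x = 0"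
  by (simp add: wpot_def)

lemma W_le:
  assumes U: "bounded_field U" and t: "0 < t" "t < T"
  shows "norm (wpot (th t) U x) \<le> M / 2 * t powr (- \<alpha>)"
  using W_contract[OF U zero_bounded t, of M x] bounded_fieldD(2)[OF U] M by simp

lemma W_L2:
  assumes U: "bounded_field U" and t: "0 < t"
  shows "N2 (wpot (th t) U) \<le> ennreal ((120 * M * beta1 \<alpha> * t powr (1/2 - \<alpha>))\<^sup>2) * (4 * N)"
proof -
  have b: "0 \<le> beta1 \<alpha>" using beta1(2)[of \<alpha>] \<alpha> by simp
  have "N2 (wpot (th t) U) \<le> (ennreal (60 * M) * Th \<alpha> (th t))\<^sup>2 * (4 * N)"
    unfolding N2_def using M bounded_fieldD[OF U]
    by (intro wpot_L2[OF th_weight, where b=\<alpha>]) (auto simp: N2_def intro: fin[unfolded infinity_ennreal_def])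
  also have "ennreal (60 * M) * Th \<alpha> (th t) = ennreal (120 * M * beta1 \<alpha> * t powr (1/2 - \<alpha>))"
  proof -
    have "ennreal (60 * M) * Th \<alpha> (th t) = ennreal (60 * M * (2 * beta1 \<alpha> * t powr (1/2 - \<alpha>)))"
    proof -
      have "Th \<alpha> (th t) = ennreal (2 * beta1 \<alpha> * t powr (1/2 - \<alpha>))"
        using \<alpha> t by (intro Th_th_eq) auto
      then show ?thesis using M b by (simp only:) (rule ennreal_mult[symmetric]; simp)
    qed
    then show ?thesis by (simp add: mult_ac)
  qed
  finally show ?thesis using M b by (simp add: ennreal_power)
qed

text \<open>Extension by zero outside (0, T) makes the bounds in \<open>bounded_field\<close> hold
  at all positive times, so that the lifespan need not be carried along.\<close>

definition step :: "(real \<Rightarrow> space \<Rightarrow> space) \<Rightarrow> real \<Rightarrow> space \<Rightarrow> space" where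
  "step U t x = (if 0 < t \<and> t < T then heat u0 t x - wpot (th t) U x else 0)"

lemma step_bounded:
  assumes U: "bounded_field U"
  shows "bounded_field (step U)"
proof -
  note [measurable (raw)] = field_measurable[OF field_heat[OF u0]] field_measurable[OF field_wpot[OF bounded_fieldD(1)[OF U]]]
  have "(\<lambda>q. step U (fst q) (snd q)) \<in> borel_measurable (borel \<Otimes>\<^sub>M borel)"
    unfolding step_def by measurable
  then have "field (step U)" by (simp add: field_def borel_prod case_prod_beta')
  moreover have "norm (step U s y) \<le> M * s powr (- \<alpha>)" if "0 < s" for s y
  proof (cases "s < T")
    case True
    then show ?thesis
      using norm_triangle_ineq4[of "heat u0 s y" "wpot (th s) U y"] heat_le[OF that, of y] W_le[OF U that True, of y] that
      by (simp add: step_def)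
  qed (use M in \<open>simp add: step_def\<close>)
  moreover have "N2 (step U s) \<le> 4 * N" if "0 < s" for s
  proof (cases "s < T")
    case True
    have "N2 (wpot (th s) U) \<le> ennreal ((120 * M * beta1 \<alpha> * s powr (1/2 - \<alpha>))\<^sup>2) * (4 * N)"
      by (rule W_L2[OF U that])
    also have "\<dots> \<le> ennreal ((1/4)\<^sup>2) * (4 * N)"
      using small_t(2)[OF that True] M beta1(2)[of \<alpha>] \<alpha>
      by (intro mult_right_mono ennreal_leI power_mono) auto
    also have "\<dots> = ennreal (1/4) * N"
    proof -
      have "ennreal ((1/4)\<^sup>2) * (4 * N) = (ennreal ((1/4)\<^sup>2) * ennreal 4) * N" by (simp add: mult.assoc)
      also have "ennreal ((1/4)\<^sup>2) * ennreal 4 = ennreal (1/4)"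
        by (subst ennreal_mult[symmetric]) (auto simp: power2_eq_square)
      finally show ?thesis .
    qed
    also have "\<dots> \<le> 1 * N" by (intro mult_right_mono) (auto simp: ennreal_le_1)
    finally have W: "N2 (wpot (th s) U) \<le> N" by simp
    have "N2 (step U s) = N2 (\<lambda>x. heat u0 s x - wpot (th s) U x)"
      using that True by (simp add: step_def[abs_def])
    also have "\<dots> \<le> 2 * N2 (heat u0 s) + 2 * N2 (wpot (th s) U)"
      by (rule N2_diff_le[OF field_slice[OF field_heat[OF u0]] field_slice[OF field_wpot[OF bounded_fieldD(1)[OF U]]]])
    also have "\<dots> \<le> 2 * N + 2 * N"
      by (intro add_mono mult_left_mono heat_L2 W that) auto
    also have "\<dots> = 4 * N" by (simp flip: distrib_right)
    finally show ?thesis .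
  qed (simp add: step_def[abs_def] N2_def)
  ultimately show ?thesis by (simp add: bounded_field_def)
qed

section \<open>Convergence of the iteration\<close>

definition iter :: "nat \<Rightarrow> real \<Rightarrow> space \<Rightarrow> space" where
  "iter n = (step ^^ n) (\<lambda>_ _. 0)"

lemma iter_simps: "iter 0 = (\<lambda>_ _. 0)" "iter (Suc n) = step (iter n)"
  by (simp_all add: iter_def)

lemma iter_bounded: "bounded_field (iter n)"
  by (induction n) (auto simp: iter_simps zero_bounded step_bounded)

text \<open>The heat flow cancels in the difference of two iterates, so that
  \<open>W_contract\<close> halves the bound at every step.\<close>

lemma iter_diff: "0 < t \<Longrightarrow> norm (iter (Suc n) t x - iter n t x) \<le> M * (1/2) ^ n * t powr (- \<alpha>)"
proof (induction n arbitrary: t x)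
  case 0
  then show ?case using bounded_fieldD(2)[OF iter_bounded, of t 1 x] by (simp add: iter_simps)
next
  case (Suc n)
  show ?case
  proof (cases "t < T")
    case True
    have "iter (Suc (Suc n)) t x - iter (Suc n) t x = wpot (th t) (iter n) x - wpot (th t) (iter (Suc n)) x"
      using True Suc.prems by (simp add: iter_simps(2)[of "Suc n"] iter_simps(2)[of n] step_def)
    also have "norm \<dots> \<le> M * (1/2) ^ n / 2 * t powr (- \<alpha>)"
    proof (rule W_contract[OF iter_bounded iter_bounded Suc.prems True])
      show "norm (iter n s y - iter (Suc n) s y) \<le> M * (1/2) ^ n * s powr (- \<alpha>)" if "0 < s" for s y
        using Suc.IH[OF that, of y] by (simp add: norm_minus_commute)
    qed (use M in simp)
    finally show ?thesis by simp
  next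
    case False
    then have "iter (Suc (Suc n)) t x - iter (Suc n) t x = 0" by (simp add: iter_simps step_def)
    then show ?thesis using M by simp
  qed
qed

lemma iter_diff_add:
  assumes t: "0 < t"
  shows "norm (iter (n + k) t x - iter n t x) \<le> 2 * M * (1/2) ^ n * t powr (- \<alpha>)"
proof -
  have "norm (iter (n + k) t x - iter n t x) \<le> 2 * M * ((1/2) ^ n - (1/2) ^ (n + k)) * t powr (- \<alpha>)"
  proof (induction k)
    case (Suc k)
    have "norm (iter (n + Suc k) t x - iter n t x) \<le> norm (iter (Suc (n + k)) t x - iter (n + k) t x) + norm (iter (n + k) t x - iter n t x)"
      using norm_triangle_ineq[of "iter (Suc (n + k)) t x - iter (n + k) t x" "iter (n + k) t x - iter n t x"] by simp
    also have "\<dots> \<le> M * (1/2) ^ (n + k) * t powr (- \<alpha>) + 2 * M * ((1/2) ^ n - (1/2) ^ (n + k)) * t powr (- \<alpha>)"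
      by (intro add_mono iter_diff t Suc)
    also have "\<dots> = 2 * M * ((1/2) ^ n - (1/2) ^ (n + Suc k)) * t powr (- \<alpha>)"
      by (simp add: algebra_simps)
    finally show ?case .
  qed simp
  also have "\<dots> \<le> 2 * M * (1/2) ^ n * t powr (- \<alpha>)"
    using M by (intro mult_right_mono mult_left_mono) auto
  finally show ?thesis .
qed

text \<open>The limit is taken at every point, so that it inherits joint measurability and satisfies
  the integral equation everywhere on (0, T).\<close>

definition sol :: "real \<Rightarrow> space \<Rightarrow> space" where
  "sol t x = (if 0 < t then lim (\<lambda>n. iter n t x) else 0)"

lemma iter_tendsto:
  assumes t: "0 < t"
  shows "(\<lambda>n. iter n t x) \<longlonglongrightarrow> sol t x"
proof -
  have "Cauchy (\<lambda>n. iter n t x)"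
  proof (rule CauchyI)
    fix e :: real assume e: "0 < e"
    have "(\<lambda>n. 4 * M * t powr (- \<alpha>) * (1/2) ^ n) \<longlonglongrightarrow> 4 * M * t powr (- \<alpha>) * 0"
      by (intro tendsto_mult tendsto_const LIMSEQ_realpow_zero) auto
    then have "\<forall>\<^sub>F n in sequentially. 4 * M * t powr (- \<alpha>) * (1/2) ^ n < e"
      using e by (intro order_tendstoD) auto
    then obtain n where n: "4 * M * t powr (- \<alpha>) * (1/2) ^ n < e" by (auto simp: eventually_sequentially)
    have "norm (iter m t x - iter k t x) < e" if "m \<ge> n" "k \<ge> n" for m k
    proof -
      have "norm (iter m t x - iter k t x) \<le> norm (iter m t x - iter n t x) + norm (iter k t x - iter n t x)"
        using norm_triangle_ineq4[of "iter m t x - iter n t x" "iter k t x - iter n t x"] by simp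
      also have "\<dots> \<le> 2 * M * (1/2) ^ n * t powr (- \<alpha>) + 2 * M * (1/2) ^ n * t powr (- \<alpha>)"
        using iter_diff_add[OF t, of n "m - n" x] iter_diff_add[OF t, of n "k - n" x] that by (intro add_mono) auto
      finally show ?thesis using n by (simp add: mult_ac)
    qed
    then show "\<exists>n. \<forall>m\<ge>n. \<forall>k\<ge>n. norm (iter m t x - iter k t x) < e" by blast
  qed
  then show ?thesis using t by (simp add: sol_def Cauchy_convergent_iff convergent_LIMSEQ_iff)
qed

lemma sol_iter_diff:
  assumes t: "0 < t"
  shows "norm (iter n t x - sol t x) \<le> 2 * M * (1/2) ^ n * t powr (- \<alpha>)"
proof -
  have "(\<lambda>k. norm (iter (k + n) t x - iter n t x)) \<longlonglongrightarrow> norm (sol t x - iter n t x)"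
    by (intro tendsto_norm tendsto_diff tendsto_const LIMSEQ_ignore_initial_segment iter_tendsto t)
  then have "norm (sol t x - iter n t x) \<le> 2 * M * (1/2) ^ n * t powr (- \<alpha>)"
    by (rule LIMSEQ_le_const2) (use iter_diff_add[OF t, of n _ x] in \<open>auto simp: add.commute\<close>)
  then show ?thesis by (simp add: norm_minus_commute)
qed

lemma sol_bounded: "bounded_field sol"
proof -
  have "(\<lambda>q. sol (fst q) (snd q)) \<in> borel_measurable borel"
  proof (rule borel_measurable_LIMSEQ_metric)
    show "(\<lambda>q. if 0 < fst q then iter n (fst q) (snd q) else 0) \<in> borel_measurable borel" for n
    proof -
      note [measurable (raw)] = field_measurable[OF bounded_fieldD(1)[OF iter_bounded[of n]]]
      show ?thesis unfolding borel_prod[symmetric] by measurable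
    qed
    show "(\<lambda>n. if 0 < fst q then iter n (fst q) (snd q) else 0) \<longlonglongrightarrow> sol (fst q) (snd q)" for q
      using iter_tendsto[of "fst q" "snd q"] by (auto simp: sol_def)
  qed
  then have "field sol" by (simp add: field_def case_prod_beta')
  moreover have "norm (sol s y) \<le> M * s powr (- \<alpha>)" if "0 < s" for s y
    using tendsto_norm[OF iter_tendsto[OF that, of y]]
    by (rule LIMSEQ_le_const2) (use bounded_fieldD(2)[OF iter_bounded that] in auto)
  moreover have "N2 (sol s) \<le> 4 * N" if "0 < s" for s
  proof -
    have [measurable]: "iter n s \<in> borel_measurable borel" for n
      by (rule field_slice[OF bounded_fieldD(1)[OF iter_bounded]])
    \<comment> \<open>Convergence is known pointwise and not in L^2, so the bound is passed to the
      limit by Fatou's lemma.\<close>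
    have "N2 (sol s) = (\<integral>\<^sup>+x. liminf (\<lambda>n. (ennreal (norm (iter n s x)))\<^sup>2) \<partial>lborel)"
      unfolding N2_def
    proof (intro nn_integral_cong)
      fix x
      have "(\<lambda>n. (ennreal (norm (iter n s x)))\<^sup>2) \<longlonglongrightarrow> (ennreal (norm (sol s x)))\<^sup>2"
        unfolding ennreal_power[OF norm_ge_zero]
        by (intro tendsto_ennrealI tendsto_power tendsto_norm iter_tendsto that)
      then show "(ennreal (norm (sol s x)))\<^sup>2 = liminf (\<lambda>n. (ennreal (norm (iter n s x)))\<^sup>2)"
        by (simp add: lim_imp_Liminf)
    qed
    also have "\<dots> \<le> liminf (\<lambda>n. N2 (iter n s))"
      unfolding N2_def by (rule nn_integral_liminf) measurable
    also have "\<dots> \<le> 4 * N"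
    proof -
      have "liminf (\<lambda>n. N2 (iter n s)) \<le> liminf (\<lambda>n. 4 * N)"
        by (intro Liminf_mono always_eventually allI bounded_fieldD(3)[OF iter_bounded that])
      then show ?thesis by (simp add: Liminf_const)
    qed
    finally show ?thesis .
  qed
  ultimately show ?thesis by (simp add: bounded_field_def)
qed

lemma sol_eq:
  assumes t: "0 < t" "t < T"
  shows "sol t x = heat u0 t x - wpot (th t) sol x"
proof -
  have "(\<lambda>n. wpot (th t) (iter n) x) \<longlonglongrightarrow> wpot (th t) sol x"
  proof (rule LIM_zero_cancel, rule Lim_null_comparison)
    show "\<forall>\<^sub>F n in sequentially. norm (wpot (th t) (iter n) x - wpot (th t) sol x) \<le> 2 * M * (1/2) ^ n / 2 * t powr (- \<alpha>)"
      using M by (intro always_eventually allI W_contract[OF iter_bounded sol_bounded t sol_iter_diff]) auto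
    have "(\<lambda>n. M * t powr (- \<alpha>) * (1/2) ^ n) \<longlonglongrightarrow> M * t powr (- \<alpha>) * 0"
      by (intro tendsto_mult tendsto_const LIMSEQ_realpow_zero) auto
    then show "(\<lambda>n. 2 * M * (1/2) ^ n / 2 * t powr (- \<alpha>)) \<longlonglongrightarrow> 0" by (simp add: mult_ac)
  qed
  then have "(\<lambda>n. heat u0 t x - wpot (th t) (iter n) x) \<longlonglongrightarrow> heat u0 t x - wpot (th t) sol x"
    by (intro tendsto_intros)
  moreover have "(\<lambda>n. heat u0 t x - wpot (th t) (iter n) x) = (\<lambda>n. iter (Suc n) t x)"
    using t by (simp add: iter_simps step_def)
  ultimately have "(\<lambda>n. iter (Suc n) t x) \<longlonglongrightarrow> heat u0 t x - wpot (th t) sol x" by simp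
  then show ?thesis
    using LIMSEQ_Suc[OF iter_tendsto[OF t(1), of x]] by (rule LIMSEQ_unique[rotated])
qed

end

subsection \<open>Continuity in time and space\<close>

lemma ennreal_power2_le: "(ennreal y)\<^sup>2 \<le> ennreal (y\<^sup>2)"
  by (cases "0 \<le> y") (auto simp: ennreal_power ennreal_neg)

lemma th_diff_weight: "weight (\<lambda>s \<sigma>. th t' s \<sigma> - th t s \<sigma>)"
proof -
  note [measurable (raw)] = weight_measurable[OF th_weight]
  have "(\<lambda>p. th t' (fst p) (snd p) - th t (fst p) (snd p)) \<in> borel_measurable (borel \<Otimes>\<^sub>M borel)"
    by measurable
  then show ?thesis
    by (auto simp: weight_def borel_prod case_prod_beta' th_def split: if_splits)
qed

text \<open>\<open>ennreal\<close> sends a negative \<open>c\<close> to 0. The absolute value makes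
  it unnecessary to know the sign of moduli such as \<open>dW\<close>.\<close>

lemma norm_le_of_ennreal: "ennreal (norm x) \<le> ennreal c \<Longrightarrow> norm x \<le> \<bar>c\<bar>"
proof -
  assume "ennreal (norm x) \<le> ennreal c"
  also have "\<dots> \<le> ennreal \<bar>c\<bar>" by (rule ennreal_leI) simp
  finally show ?thesis by (simp add: ennreal_le_iff)
qed

lemma sqrt_divide_sqrt: "0 < t \<Longrightarrow> sqrt (c / sqrt t) = sqrt c / t powr (1/4)"
  by (simp add: real_sqrt_divide powr_half_sqrt[of t, symmetric] powr_half_sqrt[of "t powr (1/2)", symmetric] powr_powr)

context picard
begin

section \<open>Moduli of continuity of the solution\<close>

definition Nr :: real where "Nr = enn2real N"

lemma Nr: "N = ennreal Nr" "0 \<le> Nr"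
  using L2(2) by (auto simp: Nr_def)

text \<open>Time and position may both change, so that this serves the increments in time and those
  in space.\<close>

lemma heat_diff_nn:
  assumes t: "0 < t" and s: "0 < s" and k: "\<And>y. \<bar>gauss t (x - y) - gauss s (x' - y)\<bar> \<le> c * g y" and c: "0 \<le> c" "\<And>y. 0 \<le> g y"
    and g [measurable]: "g \<in> borel_measurable borel"
  shows "ennreal (norm (heat u0 t x - heat u0 s x')) \<le> ennreal c * (\<integral>\<^sup>+y. ennreal (g y) * ennreal (norm (u0 y)) \<partial>lborel)"
proof -
  have "heat u0 t x - heat u0 s x' = (LINT y|lborel. gauss t (x - y) *\<^sub>R u0 y - gauss s (x' - y) *\<^sub>R u0 y)"
    unfolding heat_def using heat_integrable[OF t] heat_integrable[OF s] by simp
  also have "ennreal (norm \<dots>) \<le> (\<integral>\<^sup>+y. ennreal (norm (gauss t (x - y) *\<^sub>R u0 y - gauss s (x' - y) *\<^sub>R u0 y)) \<partial>lborel)"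
    using heat_integrable[OF t] heat_integrable[OF s] by (intro integral_norm_bound_ennreal) simp
  also have "\<dots> \<le> (\<integral>\<^sup>+y. ennreal c * (ennreal (g y) * ennreal (norm (u0 y))) \<partial>lborel)"
  proof (rule nn_integral_mono)
    fix y
    have "norm (gauss t (x - y) *\<^sub>R u0 y - gauss s (x' - y) *\<^sub>R u0 y) = \<bar>gauss t (x - y) - gauss s (x' - y)\<bar> * norm (u0 y)"
      by (simp flip: scaleR_diff_left)
    also have "\<dots> \<le> c * g y * norm (u0 y)" by (intro mult_right_mono k) auto
    finally show "ennreal (norm (gauss t (x - y) *\<^sub>R u0 y - gauss s (x' - y) *\<^sub>R u0 y)) \<le> ennreal c * (ennreal (g y) * ennreal (norm (u0 y)))"
      using c by (simp add: ennreal_mult[symmetric] ennreal_leI mult.assoc)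
  qed
  also have "\<dots> = ennreal c * (\<integral>\<^sup>+y. ennreal (g y) * ennreal (norm (u0 y)) \<partial>lborel)"
    by (rule nn_integral_cmult) measurable
  finally show ?thesis .
qed

text \<open>By \<open>gauss_time_diff_le\<close> the increment is dominated by the potential of |u0|
  at time 4t, for which the sup bound \<open>pot\<close> and the L^2 bound \<open>pot_L2\<close> are
  available.\<close>

lemma heat_time_diff:
  assumes t: "0 < t" "t \<le> t'" "t' \<le> 2 * t"
  shows "norm (heat u0 t' x - heat u0 t x) \<le> 51 * ((t' - t) / t) * (M / 2 * (4 * t) powr (- \<alpha>))"
    and "N2 (\<lambda>x. heat u0 t' x - heat u0 t x) \<le> ennreal ((51 * ((t' - t) / t))\<^sup>2 * Nr)"
proof -
  define c where "c = 51 * ((t' - t) / t)"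
  have c: "0 \<le> c" using t by (simp add: c_def)
  have nn: "ennreal (norm (heat u0 t' x - heat u0 t x)) \<le> ennreal c * (\<integral>\<^sup>+y. ennreal (gauss (4 * t) (x - y)) * ennreal (norm (u0 y)) \<partial>lborel)" for x
    using t c unfolding c_def by (intro heat_diff_nn gauss_time_diff_le) auto
  have "ennreal (norm (heat u0 t' x - heat u0 t x)) \<le> ennreal c * ennreal (M / 2 * (4 * t) powr (- \<alpha>))"
    using nn[of x] pot[of "4 * t" x] t by (simp add: ennreal_mult) (meson mult_left_mono order_trans zero_le)
  then have "ennreal (norm (heat u0 t' x - heat u0 t x)) \<le> ennreal (c * (M / 2 * (4 * t) powr (- \<alpha>)))"
    using c M by (subst ennreal_mult) auto
  then show "norm (heat u0 t' x - heat u0 t x) \<le> 51 * ((t' - t) / t) * (M / 2 * (4 * t) powr (- \<alpha>))"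
    using c M unfolding c_def[symmetric] by (subst (asm) ennreal_le_iff) auto
  have "N2 (\<lambda>x. heat u0 t' x - heat u0 t x) \<le> (\<integral>\<^sup>+x. (ennreal c)\<^sup>2 * (\<integral>\<^sup>+y. ennreal (gauss (4 * t) (x - y)) * ennreal (norm (u0 y)) \<partial>lborel)\<^sup>2 \<partial>lborel)"
    unfolding N2_def power_mult_distrib[symmetric] by (intro nn_integral_mono power_mono nn) auto
  also have "\<dots> = (ennreal c)\<^sup>2 * (\<integral>\<^sup>+x. (\<integral>\<^sup>+y. ennreal (gauss (4 * t) (x - y)) * ennreal (norm (u0 y)) \<partial>lborel)\<^sup>2 \<partial>lborel)"
    by (rule nn_integral_cmult) measurable
  also have "\<dots> \<le> (ennreal c)\<^sup>2 * N"
    using t by (intro mult_left_mono pot_L2) auto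
  also have "\<dots> = ennreal (c\<^sup>2 * Nr)"
    using c Nr by (simp add: ennreal_power ennreal_mult)
  finally show "N2 (\<lambda>x. heat u0 t' x - heat u0 t x) \<le> ennreal ((51 * ((t' - t) / t))\<^sup>2 * Nr)" by (simp only: c_def)
qed

definition dW :: "real \<Rightarrow> real \<Rightarrow> real \<Rightarrow> real" where
  "dW a t t' = 2 * beta1 a * (t powr (1/2 - a) - t' powr (1/2 - a)) + 8 * t powr (- a) * sqrt (t' - t)"

text \<open>As in \<open>wpot_le\<close> and \<open>wpot_L2\<close>, the sup bound involves the mass
  with exponent 2\<alpha> and the L^2 bound that with exponent \<alpha>, now for the difference of
  two weights.\<close>

lemma W_time_diff:
  assumes t: "0 < t" "t < t'"
  shows "norm (wpot (th t') sol x - wpot (th t) sol x) \<le> \<bar>60 * M * M * dW (2 * \<alpha>) t t'\<bar>"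
    and "N2 (\<lambda>x. wpot (th t') sol x - wpot (th t) sol x) \<le> ennreal ((60 * M * dW \<alpha> t t')\<^sup>2 * (4 * Nr))"
proof -
  note U = bounded_fieldD[OF sol_bounded]
  have eq: "wpot (th t') sol x - wpot (th t) sol x = wpot (\<lambda>s \<sigma>. th t' s \<sigma> - th t s \<sigma>) sol x" for x
    by (rule wpot_weight_diff[OF th_weight th_weight U(1) U(2) _ fin(1) fin(1)]) (use M in auto)
  have Th1: "Th (2 * \<alpha>) (\<lambda>s \<sigma>. th t' s \<sigma> - th t s \<sigma>) \<le> ennreal (dW (2 * \<alpha>) t t')"
    unfolding dW_def by (rule Th_th_diff) (use \<alpha> t in auto)
  have Th2: "Th \<alpha> (\<lambda>s \<sigma>. th t' s \<sigma> - th t s \<sigma>) \<le> ennreal (dW \<alpha> t t')"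
    unfolding dW_def by (rule Th_th_diff) (use \<alpha> t in auto)
  have fin1: "Th (2 * \<alpha>) (\<lambda>s \<sigma>. th t' s \<sigma> - th t s \<sigma>) < \<infinity>"
    using Th1 by (rule order_le_less_trans) simp
  have "ennreal (norm (wpot (th t') sol x - wpot (th t) sol x)) \<le> ennreal (60 * M * M) * Th (2 * \<alpha>) (\<lambda>s \<sigma>. th t' s \<sigma> - th t s \<sigma>)"
    unfolding eq using M by (intro wpot_le(2)[OF th_diff_weight U(1) U(2)] fin1) auto
  also have "\<dots> \<le> ennreal (60 * M * M) * ennreal (dW (2 * \<alpha>) t t')"
    by (intro mult_left_mono Th1) simp
  also have "\<dots> = ennreal (60 * M * M * dW (2 * \<alpha>) t t')"
    using M by (intro ennreal_mult'[symmetric]) simp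
  finally show "norm (wpot (th t') sol x - wpot (th t) sol x) \<le> \<bar>60 * M * M * dW (2 * \<alpha>) t t'\<bar>"
    by (rule norm_le_of_ennreal)
  have "N2 (\<lambda>x. wpot (th t') sol x - wpot (th t) sol x) \<le> (ennreal (60 * M) * Th \<alpha> (\<lambda>s \<sigma>. th t' s \<sigma> - th t s \<sigma>))\<^sup>2 * (4 * N)"
    unfolding eq N2_def
    by (rule wpot_L2[OF th_diff_weight U(1) U(2) _ _ fin1]) (use M U(3) in \<open>auto simp: N2_def\<close>)
  also have "\<dots> \<le> (ennreal (60 * M) * ennreal (dW \<alpha> t t'))\<^sup>2 * (4 * N)"
    by (intro mult_right_mono power_mono mult_left_mono Th2) auto
  also have "ennreal (60 * M) * ennreal (dW \<alpha> t t') = ennreal (60 * M * dW \<alpha> t t')"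
    using M by (intro ennreal_mult'[symmetric]) simp
  also have "(ennreal (60 * M * dW \<alpha> t t'))\<^sup>2 * (4 * N) \<le> ennreal ((60 * M * dW \<alpha> t t')\<^sup>2) * ennreal (4 * Nr)"
    using Nr by (intro mult_mono ennreal_power2_le) (auto simp: ennreal_mult)
  also have "\<dots> = ennreal ((60 * M * dW \<alpha> t t')\<^sup>2 * (4 * Nr))"
    using Nr by (intro ennreal_mult[symmetric]) auto
  finally show "N2 (\<lambda>x. wpot (th t') sol x - wpot (th t) sol x) \<le> ennreal ((60 * M * dW \<alpha> t t')\<^sup>2 * (4 * Nr))" .
qed

definition sup_mod :: "real \<Rightarrow> real \<Rightarrow> real" where
  "sup_mod t t' = 51 * ((t' - t) / t) * (M / 2 * (4 * t) powr (- \<alpha>)) + \<bar>60 * M * M * dW (2 * \<alpha>) t t'\<bar>"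

text \<open>A modulus for the square of the L^2 norm, since \<open>N2\<close> is not a norm but its
  square.\<close>

definition L2_mod :: "real \<Rightarrow> real \<Rightarrow> real" where
  "L2_mod t t' = 2 * ((51 * ((t' - t) / t))\<^sup>2 * Nr) + 2 * ((60 * M * dW \<alpha> t t')\<^sup>2 * (4 * Nr))"

lemma sol_slice: "sol t \<in> borel_measurable borel"
  by (rule field_slice[OF bounded_fieldD(1)[OF sol_bounded]])

lemma heat_slice: "heat u0 t \<in> borel_measurable borel"
  by (rule field_slice[OF field_heat[OF u0]])

lemma W_slice: "wpot (th t) sol \<in> borel_measurable borel"
  by (rule field_slice[OF field_wpot[OF bounded_fieldD(1)[OF sol_bounded]]])

lemma sol_time_diff:
  assumes t: "0 < t" "t < t'" "t' \<le> 2 * t" "t' < T"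
  shows "norm (sol t' x - sol t x) \<le> sup_mod t t'"
    and "N2 (\<lambda>x. sol t' x - sol t x) \<le> ennreal (L2_mod t t')"
proof -
  have eq: "sol t' x - sol t x = (heat u0 t' x - heat u0 t x) - (wpot (th t') sol x - wpot (th t) sol x)" for x
    using t by (simp add: sol_eq)
  show "norm (sol t' x - sol t x) \<le> sup_mod t t'"
    unfolding eq sup_mod_def using t
    by (intro order_trans[OF norm_triangle_ineq4] add_mono heat_time_diff W_time_diff) auto
  have "N2 (\<lambda>x. sol t' x - sol t x) \<le> 2 * N2 (\<lambda>x. heat u0 t' x - heat u0 t x) + 2 * N2 (\<lambda>x. wpot (th t') sol x - wpot (th t) sol x)"
    unfolding eq by (intro N2_diff_le borel_measurable_diff heat_slice W_slice)
  also have "\<dots> \<le> 2 * ennreal ((51 * ((t' - t) / t))\<^sup>2 * Nr) + 2 * ennreal ((60 * M * dW \<alpha> t t')\<^sup>2 * (4 * Nr))"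
    using t by (intro add_mono mult_left_mono heat_time_diff W_time_diff) auto
  also have "\<dots> = ennreal (L2_mod t t')"
  proof -
    have "2 * ennreal P + 2 * ennreal Q = ennreal (2 * P + 2 * Q)" if "0 \<le> P" "0 \<le> Q" for P Q
      using that by (simp add: ennreal_mult)
    then show ?thesis unfolding L2_mod_def using Nr(2) by simp
  qed
  finally show "N2 (\<lambda>x. sol t' x - sol t x) \<le> ennreal (L2_mod t t')" .
qed

text \<open>The increments are estimated with constants taken at the earlier of the two times. With
  \<open>min\<close> and \<open>max\<close> one expression covers the approach from both
  sides.\<close>

lemma mod_tendsto:
  assumes t: "0 < t"
  shows "((\<lambda>t'. sup_mod (min t t') (max t t')) \<longlongrightarrow> 0) (at t within S)"
    and "((\<lambda>t'. L2_mod (min t t') (max t t')) \<longlongrightarrow> 0) (at t within S)"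
proof -
  have mm: "((\<lambda>t'. min t t') \<longlongrightarrow> t) (at t within S)" "((\<lambda>t'. max t t') \<longlongrightarrow> t) (at t within S)"
    by (auto intro!: tendsto_eq_intros)
  have dW: "((\<lambda>t'. dW a (min t t') (max t t')) \<longlongrightarrow> 0) (at t within S)" for a
    unfolding dW_def using t by (auto intro!: tendsto_eq_intros mm)
  show "((\<lambda>t'. sup_mod (min t t') (max t t')) \<longlongrightarrow> 0) (at t within S)"
    "((\<lambda>t'. L2_mod (min t t') (max t t')) \<longlongrightarrow> 0) (at t within S)"
    unfolding sup_mod_def L2_mod_def using t by (auto intro!: tendsto_eq_intros mm dW)
qed

lemma sol_time_diff_near:
  assumes t: "0 < t" "t < T"
  shows "\<forall>\<^sub>F t' in at t within S. (\<forall>x. norm (sol t' x - sol t x) \<le> sup_mod (min t t') (max t t'))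
    \<and> N2 (\<lambda>x. sol t' x - sol t x) \<le> ennreal (L2_mod (min t t') (max t t'))"
proof -
  \<comment> \<open>In this neighbourhood each of t and t' is at most twice the other, which
    \<open>sol_time_diff\<close> asks of the later one.\<close>
  have "\<forall>\<^sub>F t' in at t within S. t' \<in> {t / 2<..<min T (2 * t)}"
    using t by (intro eventually_at_in_open'[THEN filter_leD[OF at_le[OF subset_UNIV]]]) auto
  moreover have "\<forall>\<^sub>F t' in at t within S. t' \<noteq> t"
    by (simp add: eventually_at_filter)
  ultimately show ?thesis
  proof eventually_elim
    case (elim t')
    show ?case
    proof (cases "t < t'")
      case True
      then have "min t t' = t" "max t t' = t'" by auto
      then show ?thesis using True elim t sol_time_diff[of t t'] by auto
    next
      case False
      then have lt: "t' < t" and mm: "min t t' = t'" "max t t' = t" using elim by auto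
      have "norm (sol t' x - sol t x) = norm (sol t x - sol t' x)" for x by (rule norm_minus_commute)
      moreover have "N2 (\<lambda>x. sol t' x - sol t x) = N2 (\<lambda>x. sol t x - sol t' x)"
        by (simp add: N2_def norm_minus_commute)
      ultimately show ?thesis unfolding mm using lt elim t sol_time_diff[of t' t] by auto
    qed
  qed
qed

text \<open>Three Gaussians occur in \<open>gauss_shift_le\<close>, and each has a potential of at
  most \<open>M / 2 * t powr (- \<alpha>)\<close>; this gives 36 * 3 / 2 = 54.\<close>

lemma heat_shift:
  assumes t: "0 < t"
  shows "norm (heat u0 t (x + h) - heat u0 t x) \<le> 54 * M * t powr (- \<alpha>) * sqrt (norm h / sqrt t)"
proof -
  let ?g = "\<lambda>y. gauss (2 * t) (x + h - y) + gauss (2 * t) (x - y) + gauss (4 * t) (x - y)"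
  let ?c = "36 * sqrt (norm h / sqrt t)"
  have c: "0 \<le> ?c" using t by simp
  have k: "\<bar>gauss t (x + h - y) - gauss t (x - y)\<bar> \<le> ?c * ?g y" for y
    using gauss_shift_le[OF t, of "x - y" h] by (simp add: algebra_simps)
  have "ennreal (norm (heat u0 t (x + h) - heat u0 t x)) \<le> ennreal ?c * (\<integral>\<^sup>+y. ennreal (?g y) * ennreal (norm (u0 y)) \<partial>lborel)"
    by (rule heat_diff_nn[OF t t k c]) auto
  note le = this
  have "(\<integral>\<^sup>+y. ennreal (?g y) * ennreal (norm (u0 y)) \<partial>lborel)
     = (\<integral>\<^sup>+y. ennreal (gauss (2 * t) (x + h - y) * norm (u0 y)) + ennreal (gauss (2 * t) (x - y) * norm (u0 y)) + ennreal (gauss (4 * t) (x - y) * norm (u0 y)) \<partial>lborel)"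
    by (intro nn_integral_cong) (simp add: ennreal_mult[symmetric] ennreal_plus[symmetric] algebra_simps del: ennreal_plus)
  also have "\<dots> = (\<integral>\<^sup>+y. ennreal (gauss (2 * t) (x + h - y) * norm (u0 y)) \<partial>lborel) + (\<integral>\<^sup>+y. ennreal (gauss (2 * t) (x - y) * norm (u0 y)) \<partial>lborel)
     + (\<integral>\<^sup>+y. ennreal (gauss (4 * t) (x - y) * norm (u0 y)) \<partial>lborel)"
    by (simp add: nn_integral_add)
  also have "\<dots> \<le> ennreal (M / 2 * t powr (- \<alpha>)) + ennreal (M / 2 * t powr (- \<alpha>)) + ennreal (M / 2 * t powr (- \<alpha>))"
  proof -
    have p: "(\<integral>\<^sup>+y. ennreal (gauss (c * t) (x - y) * norm (u0 y)) \<partial>lborel) \<le> ennreal (M / 2 * t powr (- \<alpha>))" if "1 \<le> c" for c x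
    proof -
      have "0 < c * t" using that t by simp
      from pot[OF this, of x] have "(\<integral>\<^sup>+y. ennreal (gauss (c * t) (x - y) * norm (u0 y)) \<partial>lborel) \<le> ennreal (M / 2 * (c * t) powr (- \<alpha>))" .
      also have "\<dots> \<le> ennreal (M / 2 * t powr (- \<alpha>))"
        using that t \<alpha> M by (intro ennreal_leI mult_left_mono powr_mono2') auto
      finally show ?thesis .
    qed
    show ?thesis by (intro add_mono p) auto
  qed
  also have "\<dots> = ennreal (3 * (M / 2 * t powr (- \<alpha>)))"
    using M by (simp flip: ennreal_plus)
  finally have "ennreal (norm (heat u0 t (x + h) - heat u0 t x)) \<le> ennreal ?c * ennreal (3 * (M / 2 * t powr (- \<alpha>)))"
    by (rule order_trans[OF le mult_left_mono]) simp
  also have "\<dots> = ennreal (?c * (3 * (M / 2 * t powr (- \<alpha>))))"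
    using c M by (intro ennreal_mult[symmetric]) auto
  finally have "ennreal (norm (heat u0 t (x + h) - heat u0 t x)) \<le> ennreal (?c * (3 * (M / 2 * t powr (- \<alpha>))))" .
  then have "norm (heat u0 t (x + h) - heat u0 t x) \<le> ?c * (3 * (M / 2 * t powr (- \<alpha>)))"
    using c M by (subst (asm) ennreal_le_iff) auto
  then show ?thesis by (simp add: mult_ac)
qed

text \<open>The exponent 3/4 is the 1/2 of the Duhamel kernel plus the 1/4 that half a derivative in
  space costs.\<close>

definition B34 :: real where "B34 = enn2real (beta_int (2 * \<alpha>) (3/4) 1)"

lemma B34: "beta_int (2 * \<alpha>) (3/4) 1 = ennreal B34" "0 \<le> B34"
proof -
  have "beta_int (2 * \<alpha>) (3/4) 1 \<le> ennreal (2 / (1 - 2 * \<alpha>) + 2 / (1 - 3/4))"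
    using \<alpha> by (intro beta_int_1_le) auto
  then have "beta_int (2 * \<alpha>) (3/4) 1 < \<infinity>" by (rule order_le_less_trans) simp
  then show "beta_int (2 * \<alpha>) (3/4) 1 = ennreal B34" "0 \<le> B34" by (auto simp: B34_def)
qed

text \<open>3840 = 960 * 4: the three Gaussians of \<open>oseen_shift_le\<close> have total mass 3,
  and the integral of \<sigma>^(-7/4) over \<sigma> > t - s contributes the factor 4/3.\<close>

lemma W_shift:
  assumes t: "0 < t"
  shows "norm (wpot (th t) sol (x + h) - wpot (th t) sol x) \<le> 3840 * M\<^sup>2 * B34 * t powr (1/4 - 2 * \<alpha>) * sqrt (norm h)"
proof -
  note U = bounded_fieldD[OF sol_bounded]
  have i: "integrable M3 (oz (th t) sol x)" for x
    by (rule wpot_le(1)[OF th_weight U(1) U(2) _ fin(1)]) (use M in auto)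
  note [measurable] = oz_measurable(1)[OF th_weight U(1)]
  note [measurable (raw)] = weight_measurable[OF th_weight]
  define G where "G = (\<lambda>\<sigma> y. gauss (2 * \<sigma>) (x + h - y) + gauss (2 * \<sigma>) (x - y) + gauss (4 * \<sigma>) (x - y))"
  define c where "c = 960 * M\<^sup>2 * sqrt (norm h)"
  have c: "0 \<le> c" by (simp add: c_def)
  have pw: "norm (oz (th t) sol (x + h) ((s, y), \<sigma>) - oz (th t) sol x ((s, y), \<sigma>))
     \<le> c * (th t s \<sigma> * s powr (- (2 * \<alpha>)) * \<sigma> powr (- (7/4)) * G \<sigma> y)" for s y \<sigma>
  proof (cases "th t s \<sigma> = 0")
    case False
    then have pos: "0 < s" "0 < \<sigma>" using th_weight[of t] by (auto simp: weight_def)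
    have tn: "0 \<le> th t s \<sigma>" by (simp add: th_def)
    have "norm (oz (th t) sol (x + h) ((s, y), \<sigma>) - oz (th t) sol x ((s, y), \<sigma>))
      = th t s \<sigma> * norm (oseen \<sigma> ((x - y) + h) (sol s y) - oseen \<sigma> (x - y) (sol s y))"
      using tn by (simp add: oz_def algebra_simps flip: scaleR_diff_right)
    also have "\<dots> \<le> th t s \<sigma> * (960 * (norm (sol s y))\<^sup>2 * \<sigma> powr (- 3 / 2) * sqrt (norm h / sqrt \<sigma>) * (gauss (2 * \<sigma>) ((x - y) + h) + gauss (2 * \<sigma>) (x - y) + gauss (4 * \<sigma>) (x - y)))"
      by (intro mult_left_mono oseen_shift_le pos tn)
    also have "\<dots> = th t s \<sigma> * (960 * (norm (sol s y))\<^sup>2 * \<sigma> powr (- 3 / 2) * sqrt (norm h / sqrt \<sigma>) * G \<sigma> y)"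
      by (simp add: G_def algebra_simps)
    also have "\<dots> \<le> th t s \<sigma> * (960 * (M * s powr (- \<alpha>))\<^sup>2 * \<sigma> powr (- 3 / 2) * sqrt (norm h / sqrt \<sigma>) * G \<sigma> y)"
      using pos tn by (intro mult_left_mono mult_right_mono power_mono U(2)) (auto simp: G_def)
    also have "\<dots> = c * (th t s \<sigma> * s powr (- (2 * \<alpha>)) * \<sigma> powr (- (7/4)) * G \<sigma> y)"
    proof -
      have "(M * s powr (- \<alpha>))\<^sup>2 = M\<^sup>2 * s powr (- (2 * \<alpha>))"
        using pos by (simp add: power_mult_distrib powr_power)
      moreover have "\<sigma> powr (- 3 / 2) * sqrt (norm h / sqrt \<sigma>) = sqrt (norm h) * \<sigma> powr (- (7/4))"
      proof -
        note e1 = sqrt_divide_sqrt[OF pos(2), of "norm h"]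
        have e2: "\<sigma> powr (- 3 / 2) / \<sigma> powr (1/4) = \<sigma> powr (- (7/4))"
          using pos by (simp add: powr_diff[symmetric])
        show ?thesis unfolding e1 e2[symmetric] by (simp add: mult.commute)
      qed
      ultimately show ?thesis by (simp add: c_def mult_ac)
    qed
    finally show ?thesis .
  qed (simp add: oz_def)
  have m: "(\<lambda>w. c * (th t (fst (fst w)) (snd w) * fst (fst w) powr (- (2 * \<alpha>)) * snd w powr (- (7/4)) * G (snd w) (snd (fst w)))) \<in> borel_measurable M3"
    unfolding G_def by measurable
  have "wpot (th t) sol (x + h) - wpot (th t) sol x = (LINT w|M3. oz (th t) sol (x + h) w - oz (th t) sol x w)"
    unfolding wpot_def using i by simp
  also have "ennreal (norm \<dots>) \<le> (\<integral>\<^sup>+w. ennreal (norm (oz (th t) sol (x + h) w - oz (th t) sol x w)) \<partial>M3)"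
    using i by (intro integral_norm_bound_ennreal) simp
  also have "\<dots> \<le> (\<integral>\<^sup>+w. ennreal (c * (th t (fst (fst w)) (snd w) * fst (fst w) powr (- (2 * \<alpha>)) * snd w powr (- (7/4)) * G (snd w) (snd (fst w)))) \<partial>M3)"
  proof (intro nn_integral_mono ennreal_leI)
    fix w :: "(real \<times> space) \<times> real"
    show "norm (oz (th t) sol (x + h) w - oz (th t) sol x w) \<le> c * (th t (fst (fst w)) (snd w) * fst (fst w) powr (- (2 * \<alpha>)) * snd w powr (- (7/4)) * G (snd w) (snd (fst w)))"
      using pw[of "fst (fst w)" "snd (fst w)" "snd w"] by simp
  qed
  also have "\<dots> = (\<integral>\<^sup>+s. \<integral>\<^sup>+\<sigma>. \<integral>\<^sup>+y. ennreal (c * (th t s \<sigma> * s powr (- (2 * \<alpha>)) * \<sigma> powr (- (7/4)) * G \<sigma> y)) \<partial>lborel \<partial>lborel \<partial>lborel)"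
    using m by (subst nn_integral_M3) auto
  also have "\<dots> = (\<integral>\<^sup>+s. \<integral>\<^sup>+\<sigma>. ennreal (3 * c * (th t s \<sigma> * s powr (- (2 * \<alpha>)) * \<sigma> powr (- (7/4)))) \<partial>lborel \<partial>lborel)"
  proof (intro nn_integral_cong)
    fix s \<sigma> :: real
    show "(\<integral>\<^sup>+y. ennreal (c * (th t s \<sigma> * s powr (- (2 * \<alpha>)) * \<sigma> powr (- (7/4)) * G \<sigma> y)) \<partial>lborel)
       = ennreal (3 * c * (th t s \<sigma> * s powr (- (2 * \<alpha>)) * \<sigma> powr (- (7/4))))"
    proof (cases "th t s \<sigma> = 0")
      case False
      then have pos: "0 < s" "0 < \<sigma>" using th_weight[of t] by (auto simp: weight_def)
      define d where "d = c * (th t s \<sigma> * s powr (- (2 * \<alpha>)) * \<sigma> powr (- (7/4)))"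
      have d: "0 \<le> d" using c by (simp add: d_def th_def)
      have [measurable]: "(\<lambda>y. G \<sigma> y) \<in> borel_measurable borel" unfolding G_def by measurable
      have "(\<integral>\<^sup>+y. ennreal (G \<sigma> y) \<partial>lborel) = 3"
        unfolding G_def using pos by (simp add: nn_integral_add nn_integral_gauss_shift)
      moreover have "(\<integral>\<^sup>+y. ennreal d * ennreal (G \<sigma> y) \<partial>lborel) = ennreal d * (\<integral>\<^sup>+y. ennreal (G \<sigma> y) \<partial>lborel)"
        by (rule nn_integral_cmult) measurable
      moreover have "ennreal (c * (th t s \<sigma> * s powr (- (2 * \<alpha>)) * \<sigma> powr (- (7/4)) * G \<sigma> y)) = ennreal d * ennreal (G \<sigma> y)" for y
      proof -
        have "0 \<le> G \<sigma> y" by (simp add: G_def)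
        from ennreal_mult[OF d this] show ?thesis by (simp add: d_def mult_ac)
      qed
      moreover have "ennreal d * 3 = ennreal (3 * d)"
        using d by (simp add: ennreal_mult mult.commute)
      ultimately show ?thesis by (simp add: d_def mult_ac)
    qed simp
  qed
  also have "\<dots> = (\<integral>\<^sup>+s. ennreal (4 * c) * (ennreal (s powr - (2 * \<alpha>) * (t - s) powr - (3/4)) * indicator {0<..<t} s) \<partial>lborel)"
  proof (intro nn_integral_cong)
    fix s :: real
    show "(\<integral>\<^sup>+\<sigma>. ennreal (3 * c * (th t s \<sigma> * s powr (- (2 * \<alpha>)) * \<sigma> powr (- (7/4)))) \<partial>lborel)
      = ennreal (4 * c) * (ennreal (s powr - (2 * \<alpha>) * (t - s) powr - (3/4)) * indicator {0<..<t} s)"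
    proof (cases "0 < s \<and> s < t")
      case True
      have "(\<integral>\<^sup>+\<sigma>. ennreal (3 * c * (th t s \<sigma> * s powr (- (2 * \<alpha>)) * \<sigma> powr (- (7/4)))) \<partial>lborel)
         = (\<integral>\<^sup>+\<sigma>. ennreal (3 * c * s powr (- (2 * \<alpha>))) * (ennreal (\<sigma> powr - (7/4)) * indicator {t - s<..} \<sigma>) \<partial>lborel)"
        using True c by (intro nn_integral_cong) (auto simp: th_def indicator_def ennreal_mult[symmetric] mult_ac)
      also have "\<dots> = ennreal (3 * c * s powr (- (2 * \<alpha>))) * ennreal ((t - s) powr (1 - 7/4) / (7/4 - 1))"
        using True by (subst nn_integral_cmult) (auto simp: nn_integral_powr_tail)
      also have "\<dots> = ennreal (3 * c * s powr (- (2 * \<alpha>)) * ((t - s) powr (1 - 7/4) / (7/4 - 1)))"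
        using c by (intro ennreal_mult[symmetric]) auto
      also have "\<dots> = ennreal (4 * c * (s powr - (2 * \<alpha>) * (t - s) powr - (3/4)))"
        by (simp add: mult_ac)
      also have "\<dots> = ennreal (4 * c) * (ennreal (s powr - (2 * \<alpha>) * (t - s) powr - (3/4)) * indicator {0<..<t} s)"
        using True c by (subst ennreal_mult) auto
      finally show ?thesis .
    qed (auto simp: th_def)
  qed
  also have "\<dots> = ennreal (4 * c) * beta_int (2 * \<alpha>) (3/4) t"
    unfolding beta_int_def by (rule nn_integral_cmult) measurable
  also have "\<dots> = ennreal (4 * c * (t powr (1/4 - 2 * \<alpha>) * B34))"
  proof -
    have "beta_int (2 * \<alpha>) (3/4) t = ennreal (t powr (1/4 - 2 * \<alpha>) * B34)"
      unfolding beta_int_scale[OF t] B34(1) using B34(2) by (subst ennreal_mult) (auto simp: algebra_simps)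
    then show ?thesis using c B34(2) by (simp only:) (rule ennreal_mult[symmetric]; simp)
  qed
  finally have "norm (wpot (th t) sol (x + h) - wpot (th t) sol x) \<le> 4 * c * (t powr (1/4 - 2 * \<alpha>) * B34)"
    using c B34(2) by (subst (asm) ennreal_le_iff) auto
  then show ?thesis by (simp add: c_def mult_ac)
qed

text \<open>Despite its name this is a Hoelder constant, for the exponent 1/2. It blows up as t
  tends to 0.\<close>

definition Lip :: "real \<Rightarrow> real" where
  "Lip t = 54 * M * t powr (- \<alpha>) * t powr (- (1/4)) + 3840 * M\<^sup>2 * B34 * t powr (1/4 - 2 * \<alpha>)"

lemma Lip_nonneg: "0 \<le> Lip t"
  using M B34(2) by (simp add: Lip_def)

lemma sol_holder:
  assumes t: "0 < t" "t < T"
  shows "norm (sol t y - sol t x) \<le> Lip t * sqrt (norm (x - y))"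
proof -
  have e: "sqrt (norm (y - x) / sqrt t) = t powr (- (1/4)) * sqrt (norm (y - x))"
    unfolding sqrt_divide_sqrt[OF t(1)] by (simp only: powr_minus divide_inverse mult.commute)
  have "sol t y - sol t x = (heat u0 t (x + (y - x)) - heat u0 t x) - (wpot (th t) sol (x + (y - x)) - wpot (th t) sol x)"
    using t by (simp add: sol_eq)
  also have "norm \<dots> \<le> 54 * M * t powr (- \<alpha>) * sqrt (norm (y - x) / sqrt t) + 3840 * M\<^sup>2 * B34 * t powr (1/4 - 2 * \<alpha>) * sqrt (norm (y - x))"
    by (intro order_trans[OF norm_triangle_ineq4] add_mono heat_shift W_shift t)
  also have "\<dots> = Lip t * sqrt (norm (x - y))"
    unfolding e Lip_def by (simp add: algebra_simps norm_minus_commute)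
  finally show ?thesis .
qed

end

subsection \<open>The initial value\<close>

lemma weighted_cauchy_schwarz:
  fixes k g :: "'a \<Rightarrow> ennreal"
  assumes [measurable]: "k \<in> borel_measurable M" "g \<in> borel_measurable M"
  shows "(\<integral>\<^sup>+w. k w * g w \<partial>M)\<^sup>2 \<le> (\<integral>\<^sup>+w. k w \<partial>M) * (\<integral>\<^sup>+w. k w * (g w)\<^sup>2 \<partial>M)"
proof -
  have "(\<integral>\<^sup>+w. k w * g w \<partial>M)\<^sup>2 = (\<integral>\<^sup>+w. 1 * g w \<partial>density M k)\<^sup>2"
    by (simp add: nn_integral_density)
  also have "\<dots> \<le> (\<integral>\<^sup>+w. 1\<^sup>2 \<partial>density M k) * (\<integral>\<^sup>+w. (g w)\<^sup>2 \<partial>density M k)"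
    by (rule Cauchy_Schwarz_nn_integral) auto
  also have "\<dots> = (\<integral>\<^sup>+w. k w \<partial>M) * (\<integral>\<^sup>+w. k w * (g w)\<^sup>2 \<partial>M)"
    by (simp add: emeasure_density nn_integral_density)
  finally show ?thesis .
qed

section \<open>Continuity of translations in L^2\<close>

lemma N2_translate:
  assumes [measurable]: "v \<in> borel_measurable borel"
  shows "N2 (\<lambda>x. v (x - z)) = N2 v"
  using nn_integral_translate[of "\<lambda>x. (ennreal (norm (v x)))\<^sup>2" "- z"] by (simp add: N2_def)

text \<open>A truncation that is continuous in both arguments: a piecewise linear cutoff in
  \<open>x\<close> between the radii R and R + 1, times the radial projection of \<open>v\<close> to
  the ball of radius R.\<close>

definition cut :: "real \<Rightarrow> space \<Rightarrow> space \<Rightarrow> space" where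
  "cut R x v = (max 0 (min 1 (R + 1 - norm x)) * (R / max R (norm v))) *\<^sub>R v"

lemma cut_le:
  assumes "0 < R"
  shows "norm (cut R x v) \<le> norm v" "norm (cut R x v) \<le> R" "norm x > R + 1 \<Longrightarrow> cut R x v = 0"
    "norm x \<le> R \<Longrightarrow> norm v \<le> R \<Longrightarrow> cut R x v = v"
proof -
  let ?c = "max 0 (min 1 (R + 1 - norm x))" and ?d = "R / max R (norm v)"
  have c: "0 \<le> ?c" "?c \<le> 1" by auto
  have d: "0 \<le> ?d" "?d \<le> 1" using assms by (auto simp: divide_simps)
  have "?d * norm v \<le> R"
    using assms by (auto simp: divide_simps max_def mult_left_mono)
  then have "?c * (?d * norm v) \<le> 1 * R" using c d assms by (intro mult_mono) auto
  moreover have eq: "norm (cut R x v) = ?c * (?d * norm v)"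
    by (simp only: cut_def norm_scaleR abs_of_nonneg[OF mult_nonneg_nonneg[OF c(1) d(1)]] mult.assoc)
  ultimately show "norm (cut R x v) \<le> R" by simp
  have "?c * ?d * norm v \<le> 1 * norm v" using c d by (intro mult_right_mono mult_le_one) auto
  then show "norm (cut R x v) \<le> norm v" unfolding eq by (simp only: mult.assoc mult_1)
  show "norm x > R + 1 \<Longrightarrow> cut R x v = 0" by (simp add: cut_def)
  show "norm x \<le> R \<Longrightarrow> norm v \<le> R \<Longrightarrow> cut R x v = v" using assms by (simp add: cut_def)
qed

lemma cut_tendsto:
  assumes "0 < R" "(\<lambda>n. f n) \<longlonglongrightarrow> v"
  shows "(\<lambda>n. cut R x (f n)) \<longlonglongrightarrow> cut R x v"
  unfolding cut_def using assms by (auto intro!: tendsto_intros)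

lemma cut_continuous:
  assumes "0 < R" "continuous_on UNIV f"
  shows "continuous_on UNIV (\<lambda>x. cut R x (f x))"
  unfolding cut_def using assms by (auto intro!: continuous_intros)

lemma cut_measurable:
  assumes [measurable]: "f \<in> borel_measurable borel"
  shows "(\<lambda>x. cut R x (f x)) \<in> borel_measurable borel"
  unfolding cut_def by measurable

lemma N2_tendsto_0:
  assumes [measurable]: "\<And>n. f n \<in> borel_measurable borel" "w \<in> borel_measurable borel"
    and w: "(\<integral>\<^sup>+x. w x \<partial>lborel) < \<infinity>" and b: "\<And>n x. (ennreal (norm (f n x)))\<^sup>2 \<le> w x"
    and lim: "AE x in lborel. (\<lambda>n. f n x) \<longlonglongrightarrow> 0"
  shows "(\<lambda>n. N2 (f n)) \<longlonglongrightarrow> 0"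
proof -
  have "(\<lambda>n. \<integral>\<^sup>+x. (ennreal (norm (f n x)))\<^sup>2 \<partial>lborel) \<longlonglongrightarrow> (\<integral>\<^sup>+x. 0 \<partial>(lborel :: space measure))"
  proof (rule nn_integral_dominated_convergence[where w=w])
    show "AE x in lborel. (\<lambda>n. (ennreal (norm (f n x)))\<^sup>2) \<longlonglongrightarrow> 0"
      using lim
    proof eventually_elim
      case (elim x)
      then have "(\<lambda>n. (norm (f n x))\<^sup>2) \<longlonglongrightarrow> (norm (0 :: space))\<^sup>2" by (intro tendsto_intros)
      then have "(\<lambda>n. ennreal ((norm (f n x))\<^sup>2)) \<longlonglongrightarrow> ennreal 0" by (intro tendsto_ennrealI) simp
      then show ?case by (simp add: ennreal_power)
    qed
  qed (use w b in auto)
  then show ?thesis by (simp add: N2_def)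
qed

text \<open>Measurability provides continuous functions that converge to \<open>v\<close> almost
  everywhere, but nothing that dominates them. Applying \<open>cut\<close> to them and to
  \<open>v\<close> supplies a dominating function, and the error made by truncating \<open>v\<close>
  itself is small.\<close>

lemma L2_approx:
  assumes v [measurable]: "v \<in> borel_measurable borel" and fin: "N2 v < \<infinity>" and e: "0 < e"
  shows "\<exists>\<phi> R. continuous_on UNIV \<phi> \<and> (\<forall>x. norm x > R \<longrightarrow> \<phi> x = 0) \<and> N2 (\<lambda>x. v x - \<phi> x) < ennreal e"
proof -
  have "v \<in> borel_measurable lebesgue" using measurable_completion[of v lborel borel] v by simp
  then have "v measurable_on UNIV" by (rule lebesgue_measurable_imp_measurable_on) simp
  then obtain N g where N: "negligible N" and g: "\<And>n. continuous_on UNIV (g n)" "\<And>x. x \<notin> N \<Longrightarrow> (\<lambda>n. g n x) \<longlonglongrightarrow> v x"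
    unfolding measurable_on_def by auto
  \<comment> \<open>There are two errors, truncation and approximation; each gets e/4 and is doubled
    by \<open>N2_add_le\<close>.\<close>
  have e4: "0 < ennreal (e / 4)" using e by simp
  have "(\<lambda>k. N2 (\<lambda>x. v x - cut (real k + 1) x (v x))) \<longlonglongrightarrow> 0"
  proof (rule N2_tendsto_0[where w="\<lambda>x. 4 * (ennreal (norm (v x)))\<^sup>2"])
    show "(\<lambda>x. v x - cut (real n + 1) x (v x)) \<in> borel_measurable borel" for n
      using cut_measurable[OF v] by measurable
    show "(\<integral>\<^sup>+x. 4 * (ennreal (norm (v x)))\<^sup>2 \<partial>lborel) < \<infinity>"
      using fin by (simp add: nn_integral_cmult N2_def ennreal_mult_less_top)
    show "(ennreal (norm (v x - cut (real n + 1) x (v x))))\<^sup>2 \<le> 4 * (ennreal (norm (v x)))\<^sup>2" for n x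
    proof -
      have "norm (v x - cut (real n + 1) x (v x)) \<le> 2 * norm (v x)"
        using norm_triangle_ineq4[of "v x" "cut (real n + 1) x (v x)"] cut_le(1)[of "real n + 1" x "v x"] by simp
      then have "(norm (v x - cut (real n + 1) x (v x)))\<^sup>2 \<le> (2 * norm (v x))\<^sup>2" by (intro power_mono) auto
      then have "ennreal ((norm (v x - cut (real n + 1) x (v x)))\<^sup>2) \<le> ennreal (4 * (norm (v x))\<^sup>2)"
        by (intro ennreal_leI) (simp add: power_mult_distrib)
      then show ?thesis by (simp add: ennreal_power ennreal_mult)
    qed
    show "AE x in lborel. (\<lambda>n. v x - cut (real n + 1) x (v x)) \<longlonglongrightarrow> 0"
    proof (rule AE_I2)
      fix x
      obtain k where k: "max (norm x) (norm (v x)) \<le> real k" using real_arch_simple by blast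
      have "\<forall>\<^sub>F n in sequentially. v x - cut (real n + 1) x (v x) = 0"
        using eventually_ge_at_top[of k]
      proof eventually_elim
        case (elim n)
        then have "norm x \<le> real n + 1" "norm (v x) \<le> real n + 1" using k by auto
        then show ?case by (simp add: cut_le(4))
      qed
      then show "(\<lambda>n. v x - cut (real n + 1) x (v x)) \<longlonglongrightarrow> 0" by (rule tendsto_eventually)
    qed
  qed auto
  from order_tendstoD(2)[OF this e4] obtain k where k: "N2 (\<lambda>x. v x - cut (real k + 1) x (v x)) < ennreal (e / 4)"
    by (auto simp: eventually_sequentially)
  define R where "R = real k + 1"
  have R: "0 < R" by (simp add: R_def)
  have [measurable]: "cball (0 :: space) (R + 1) \<in> sets borel" by simp
  have gm [measurable]: "g n \<in> borel_measurable borel" for n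
    using g(1) by (rule borel_measurable_continuous_onI)
  have "(\<lambda>n. N2 (\<lambda>x. cut R x (v x) - cut R x (g n x))) \<longlonglongrightarrow> 0"
  proof (rule N2_tendsto_0[where w="\<lambda>x. ennreal ((2 * R)\<^sup>2) * indicator (cball 0 (R + 1)) x"])
    show "(\<lambda>x. cut R x (v x) - cut R x (g n x)) \<in> borel_measurable borel" for n
      using cut_measurable[OF v, of R] cut_measurable[OF gm, of R n] by measurable
    show "(\<integral>\<^sup>+x. ennreal ((2 * R)\<^sup>2) * indicator (cball 0 (R + 1)) x \<partial>(lborel :: space measure)) < \<infinity>"
      using emeasure_compact_finite[OF compact_cball, of "0 :: space" "R + 1"]
      by (subst nn_integral_cmult_indicator) (auto simp: ennreal_mult_less_top)
    show "(ennreal (norm (cut R x (v x) - cut R x (g n x))))\<^sup>2 \<le> ennreal ((2 * R)\<^sup>2) * indicator (cball 0 (R + 1)) x" for n x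
    proof (cases "norm x \<le> R + 1")
      case True
      have "norm (cut R x (v x) - cut R x (g n x)) \<le> 2 * R"
        using norm_triangle_ineq4[of "cut R x (v x)" "cut R x (g n x)"] cut_le(2)[OF R, of x "v x"] cut_le(2)[OF R, of x "g n x"] by simp
      then have "(norm (cut R x (v x) - cut R x (g n x)))\<^sup>2 \<le> (2 * R)\<^sup>2" by (intro power_mono) auto
      then have "ennreal ((norm (cut R x (v x) - cut R x (g n x)))\<^sup>2) \<le> ennreal ((2 * R)\<^sup>2)" by (rule ennreal_leI)
      then show ?thesis using True by (simp add: ennreal_power)
    next
      case False
      then show ?thesis using cut_le(3)[OF R] by simp
    qed
    show "AE x in lborel. (\<lambda>n. cut R x (v x) - cut R x (g n x)) \<longlonglongrightarrow> 0"
    proof -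
      have "N \<in> null_sets lebesgue" using N by (simp add: negligible_iff_null_sets)
      then have "AE x in lebesgue. x \<notin> N" by (rule AE_not_in)
      then have "AE x in lborel. x \<notin> N" by (simp add: AE_completion_iff)
      then show ?thesis
      proof eventually_elim
        case (elim x)
        have "(\<lambda>n. cut R x (v x) - cut R x (g n x)) \<longlonglongrightarrow> cut R x (v x) - cut R x (v x)"
          by (intro tendsto_diff tendsto_const cut_tendsto R g(2) elim)
        then show ?case by simp
      qed
    qed
  qed measurable
  from order_tendstoD(2)[OF this e4] obtain n where n: "N2 (\<lambda>x. cut R x (v x) - cut R x (g n x)) < ennreal (e / 4)"
    by (auto simp: eventually_sequentially)
  have "N2 (\<lambda>x. v x - cut R x (g n x)) = N2 (\<lambda>x. (v x - cut R x (v x)) + (cut R x (v x) - cut R x (g n x)))"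
    by (simp add: N2_def)
  also have "\<dots> \<le> 2 * N2 (\<lambda>x. v x - cut R x (v x)) + 2 * N2 (\<lambda>x. cut R x (v x) - cut R x (g n x))"
    by (intro N2_add_le borel_measurable_diff v cut_measurable gm)
  also have "\<dots> < 2 * ennreal (e / 4) + 2 * ennreal (e / 4)"
    using k n unfolding R_def by (intro add_strict_mono ennreal_mult_strict_left_mono) auto
  also have "\<dots> = ennreal e"
  proof -
    have "2 * ennreal r + 2 * ennreal r = ennreal (4 * r)" if "0 \<le> r" for r
      using that by (simp add: ennreal_mult flip: distrib_right)
    from this[of "e / 4"] show ?thesis using e by simp
  qed
  finally show ?thesis
    using cut_continuous[OF R g(1)[of n]] cut_le(3)[OF R] by blast
qed

lemma continuous_shift_small:
  fixes \<phi> :: "space \<Rightarrow> space"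
  assumes c: "continuous_on UNIV \<phi>" and R: "\<And>x. norm x > R \<Longrightarrow> \<phi> x = 0" and e: "0 < e"
  shows "\<exists>\<delta>>0. \<forall>z. norm z < \<delta> \<longrightarrow> N2 (\<lambda>x. \<phi> (x - z) - \<phi> x) \<le> ennreal e"
proof -
  define V where "V = measure lborel (cball (0 :: space) (R + 1))"
  have V: "emeasure lborel (cball (0 :: space) (R + 1)) = ennreal V"
    unfolding V_def using emeasure_compact_finite[OF compact_cball, of "0 :: space" "R + 1"]
    by (intro emeasure_eq_ennreal_measure) auto
  \<comment> \<open>For shifts shorter than 1 the increment is supported in a ball of volume
    \<open>V\<close>, so its squared norm is at most \<eta>^2 V. The 1 in the denominator covers V =
    0.\<close>
  define \<eta> where "\<eta> = sqrt (e / (V + 1))"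
  have Vn: "0 \<le> V" by (simp add: V_def)
  have \<eta>: "0 < \<eta>" "\<eta>\<^sup>2 * V \<le> e"
    using e Vn by (auto simp: \<eta>_def divide_simps mult_left_mono)
  have "uniformly_continuous_on (cball 0 (R + 2)) \<phi>"
    by (intro compact_uniformly_continuous continuous_on_subset[OF c]) auto
  then obtain d where d: "0 < d" "\<And>x x'. x \<in> cball 0 (R + 2) \<Longrightarrow> x' \<in> cball 0 (R + 2) \<Longrightarrow> dist x' x < d \<Longrightarrow> dist (\<phi> x') (\<phi> x) < \<eta>"
    unfolding uniformly_continuous_on_def using \<eta>(1) by metis
  have "N2 (\<lambda>x. \<phi> (x - z) - \<phi> x) \<le> ennreal e" if z: "norm z < min d 1" for z
  proof -
    have "N2 (\<lambda>x. \<phi> (x - z) - \<phi> x) \<le> (\<integral>\<^sup>+x. ennreal (\<eta>\<^sup>2) * indicator (cball (0 :: space) (R + 1)) x \<partial>lborel)"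
      unfolding N2_def
    proof (rule nn_integral_mono)
      fix x
      have nz: "norm (x - z) \<le> norm x + norm z" "norm x \<le> norm (x - z) + norm z"
        using norm_triangle_ineq4[of x z] norm_triangle_ineq[of "x - z" z] by auto
      have nzc: "norm (z - x) = norm (x - z)" by (rule norm_minus_commute)
      show "(ennreal (norm (\<phi> (x - z) - \<phi> x)))\<^sup>2 \<le> ennreal (\<eta>\<^sup>2) * indicator (cball 0 (R + 1)) x"
      proof (cases "norm x \<le> R + 1")
        case True
        then have "dist (\<phi> (x - z)) (\<phi> x) < \<eta>"
          using nz nzc z by (intro d(2)) (auto simp: dist_norm)
        then have "(norm (\<phi> (x - z) - \<phi> x))\<^sup>2 \<le> \<eta>\<^sup>2" by (intro power_mono) (auto simp: dist_norm)
        then show ?thesis using True by (simp add: ennreal_power ennreal_leI)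
      next
        case False
        then have "norm x > R" "norm (x - z) > R" using nz z by auto
        then show ?thesis using R by simp
      qed
    qed
    also have "\<dots> = ennreal (\<eta>\<^sup>2) * ennreal V"
      by (simp add: nn_integral_cmult_indicator V)
    also have "\<dots> \<le> ennreal e"
      using \<eta> Vn by (simp add: ennreal_mult[symmetric] ennreal_leI)
    finally show ?thesis .
  qed
  then show ?thesis using d(1) by (intro exI[of _ "min d 1"]) auto
qed

lemma L2_shift_small:
  assumes v [measurable]: "v \<in> borel_measurable borel" and fin: "N2 v < \<infinity>" and e: "0 < e"
  shows "\<exists>\<delta>>0. \<forall>z. norm z < \<delta> \<longrightarrow> N2 (\<lambda>x. v (x - z) - v x) \<le> ennreal e"
proof -
  \<comment> \<open>The approximation error enters with the factors 2 and 4, the shift of the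
    continuous function with the factor 4; together they make 10.\<close>
  have e10: "0 < e / 10" using e by simp
  obtain \<phi> R where \<phi>: "continuous_on UNIV \<phi>" "\<And>x. norm x > R \<Longrightarrow> \<phi> x = 0" "N2 (\<lambda>x. v x - \<phi> x) < ennreal (e / 10)"
    using L2_approx[OF v fin e10] by blast
  obtain \<delta> where \<delta>: "0 < \<delta>" "\<And>z. norm z < \<delta> \<Longrightarrow> N2 (\<lambda>x. \<phi> (x - z) - \<phi> x) \<le> ennreal (e / 10)"
    using continuous_shift_small[OF \<phi>(1,2) e10] by blast
  have [measurable]: "\<phi> \<in> borel_measurable borel" using \<phi>(1) by (rule borel_measurable_continuous_onI)
  have "N2 (\<lambda>x. v (x - z) - v x) \<le> ennreal e" if z: "norm z < \<delta>" for z
  proof -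
    have "N2 (\<lambda>x. v (x - z) - v x) = N2 (\<lambda>x. (v (x - z) - \<phi> (x - z)) + ((\<phi> (x - z) - \<phi> x) - (v x - \<phi> x)))"
      by (simp add: N2_def)
    also have "\<dots> \<le> 2 * N2 (\<lambda>x. v (x - z) - \<phi> (x - z)) + 2 * N2 (\<lambda>x. (\<phi> (x - z) - \<phi> x) - (v x - \<phi> x))"
      by (rule N2_add_le) measurable
    also have "N2 (\<lambda>x. (\<phi> (x - z) - \<phi> x) - (v x - \<phi> x)) \<le> 2 * N2 (\<lambda>x. \<phi> (x - z) - \<phi> x) + 2 * N2 (\<lambda>x. v x - \<phi> x)"
      by (rule N2_diff_le) measurable
    also have "N2 (\<lambda>x. v (x - z) - \<phi> (x - z)) = N2 (\<lambda>x. v x - \<phi> x)"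
      by (rule N2_translate) measurable
    also have "2 * N2 (\<lambda>x. v x - \<phi> x) + 2 * (2 * N2 (\<lambda>x. \<phi> (x - z) - \<phi> x) + 2 * N2 (\<lambda>x. v x - \<phi> x))
      \<le> 2 * ennreal (e / 10) + 2 * (2 * ennreal (e / 10) + 2 * ennreal (e / 10))"
      using \<phi>(3) \<delta>(2)[OF z] by (intro add_mono mult_left_mono) auto
    also have "\<dots> = ennreal e"
    proof -
      have "2 * ennreal r + 2 * (2 * ennreal r + 2 * ennreal r) = ennreal (10 * r)" if "0 \<le> r" for r
      proof -
        have "2 * ennreal r + 2 * (2 * ennreal r + 2 * ennreal r) = 10 * ennreal r"
          by (simp add: distrib_left mult.assoc[symmetric] flip: distrib_right)
        then show ?thesis using that by (simp add: ennreal_mult)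
      qed
      from this[of "e / 10"] show ?thesis using e by simp
    qed
    finally show ?thesis by (simp add: add_left_mono mult_left_mono)
  qed
  then show ?thesis using \<delta>(1) by blast
qed

context picard
begin

text \<open>The Gaussian is a probability density, so Jensen's inequality, in the form of
  Cauchy-Schwarz, moves the square inside the average over shifts.\<close>

lemma heat_N2_shift:
  assumes t: "0 < t"
  shows "N2 (\<lambda>x. heat u0 t x - u0 x) \<le> (\<integral>\<^sup>+z. ennreal (gauss t z) * N2 (\<lambda>x. u0 (x - z) - u0 x) \<partial>lborel)"
proof -
  have g1: "(\<integral>\<^sup>+z. ennreal (gauss t z) \<partial>lborel) = 1" by (rule nn_integral_gauss[OF t])
  have gi: "integrable lborel (gauss t)" using g1 by (intro integrableI_bounded) auto
  have gI: "(LINT z|lborel. gauss t z) = 1" using g1 by (simp add: integral_eq_nn_integral)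
  have "(ennreal (norm (heat u0 t x - u0 x)))\<^sup>2 \<le> (\<integral>\<^sup>+z. ennreal (gauss t z) * (ennreal (norm (u0 (x - z) - u0 x)))\<^sup>2 \<partial>lborel)" for x
  proof -
    have m: "(\<lambda>y. gauss t (x - y) *\<^sub>R u0 y) \<in> borel_measurable borel" by measurable
    have h: "heat u0 t x = (LINT z|lborel. gauss t z *\<^sub>R u0 (x - z))"
      unfolding heat_def using integral_reflect[OF m, of x] by simp
    have i: "integrable lborel (\<lambda>z. gauss t z *\<^sub>R u0 (x - z))"
      using heat_integrable[OF t, of x] integrable_reflect[OF m, of x] by simp
    have i2: "integrable lborel (\<lambda>z. gauss t z *\<^sub>R u0 x)" using gi by simp
    have "heat u0 t x - u0 x = (LINT z|lborel. gauss t z *\<^sub>R u0 (x - z)) - (LINT z|lborel. gauss t z *\<^sub>R u0 x)"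
      using h gI gi by simp
    also have "\<dots> = (LINT z|lborel. gauss t z *\<^sub>R (u0 (x - z) - u0 x))"
      using Bochner_Integration.integral_diff[OF i i2] by (simp add: scaleR_diff_right)
    also have "ennreal (norm \<dots>) \<le> (\<integral>\<^sup>+z. ennreal (norm (gauss t z *\<^sub>R (u0 (x - z) - u0 x))) \<partial>lborel)"
      using Bochner_Integration.integrable_diff[OF i i2] by (intro integral_norm_bound_ennreal) (simp add: scaleR_diff_right)
    also have "\<dots> = (\<integral>\<^sup>+z. ennreal (gauss t z) * ennreal (norm (u0 (x - z) - u0 x)) \<partial>lborel)"
      by (simp add: ennreal_mult)
    finally have "(ennreal (norm (heat u0 t x - u0 x)))\<^sup>2 \<le> (\<integral>\<^sup>+z. ennreal (gauss t z) * ennreal (norm (u0 (x - z) - u0 x)) \<partial>lborel)\<^sup>2"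
      by (intro power_mono) auto
    also have "\<dots> \<le> (\<integral>\<^sup>+z. ennreal (gauss t z) \<partial>lborel) * (\<integral>\<^sup>+z. ennreal (gauss t z) * (ennreal (norm (u0 (x - z) - u0 x)))\<^sup>2 \<partial>lborel)"
      by (rule weighted_cauchy_schwarz) measurable
    finally show ?thesis unfolding g1 by simp
  qed
  then have "N2 (\<lambda>x. heat u0 t x - u0 x) \<le> (\<integral>\<^sup>+x. \<integral>\<^sup>+z. ennreal (gauss t z) * (ennreal (norm (u0 (x - z) - u0 x)))\<^sup>2 \<partial>lborel \<partial>lborel)"
    unfolding N2_def by (intro nn_integral_mono)
  also have "\<dots> = (\<integral>\<^sup>+z. \<integral>\<^sup>+x. ennreal (gauss t z) * (ennreal (norm (u0 (x - z) - u0 x)))\<^sup>2 \<partial>lborel \<partial>lborel)"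
    by (rule lborel_pair.Fubini') measurable
  also have "\<dots> = (\<integral>\<^sup>+z. ennreal (gauss t z) * N2 (\<lambda>x. u0 (x - z) - u0 x) \<partial>lborel)"
    unfolding N2_def by (intro nn_integral_cong nn_integral_cmult) measurable
  finally show ?thesis .
qed

lemma N2_shift_measurable: "(\<lambda>z. N2 (\<lambda>x. u0 (x - z) - u0 x)) \<in> borel_measurable borel"
  unfolding N2_def by measurable

text \<open>Shifts shorter than \<delta> are controlled by \<open>L2_shift_small\<close>. For the
  others |z| / \<delta> \<ge> 1 may be inserted, and the first moment of the Gaussian is of order
  sqrt t.\<close>

lemma heat_tendsto_0: "((\<lambda>t. N2 (\<lambda>x. heat u0 t x - u0 x)) \<longlongrightarrow> 0) (at_right 0)"
proof (rule order_tendstoI)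
  fix e :: ennreal assume "0 < e"
  then obtain r :: real where r: "0 < r" "ennreal r < e"
  proof -
    obtain e' where e': "0 < e'" "e' < e" using dense[OF \<open>0 < e\<close>] by blast
    then have "e' < top" using less_le_trans[OF e'(2) top_greatest] by simp
    then have "ennreal (enn2real e') = e'" by simp
    moreover from this e'(1) have "0 < enn2real e'" by (simp add: enn2real_positive_iff \<open>e' < top\<close>)
    ultimately show ?thesis using that[of "enn2real e'"] e'(2) by simp
  qed
  note [measurable] = N2_shift_measurable
  have r2: "0 < r / 2" using r by simp
  have N2fin: "N2 u0 < \<infinity>" using L2 by (rule order_le_less_trans)
  obtain \<delta> where \<delta>: "0 < \<delta>" "\<And>z. norm z < \<delta> \<Longrightarrow> N2 (\<lambda>x. u0 (x - z) - u0 x) \<le> ennreal (r / 2)"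
    using L2_shift_small[OF u0 N2fin r2] by blast
  have le: "N2 (\<lambda>x. heat u0 t x - u0 x) \<le> ennreal (r / 2 + 48 * Nr / \<delta> * sqrt t)" if t: "0 < t" for t
  proof -
    have "N2 (\<lambda>x. heat u0 t x - u0 x) \<le> (\<integral>\<^sup>+z. ennreal (gauss t z) * N2 (\<lambda>x. u0 (x - z) - u0 x) \<partial>lborel)"
      by (rule heat_N2_shift[OF t])
    also have "\<dots> \<le> (\<integral>\<^sup>+z. ennreal (r / 2) * ennreal (gauss t z) + ennreal (48 * Nr / \<delta> * sqrt t) * ennreal (gauss (2 * t) z) \<partial>lborel)"
    proof (rule nn_integral_mono)
      fix z
      show "ennreal (gauss t z) * N2 (\<lambda>x. u0 (x - z) - u0 x) \<le> ennreal (r / 2) * ennreal (gauss t z) + ennreal (48 * Nr / \<delta> * sqrt t) * ennreal (gauss (2 * t) z)"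
      proof (cases "norm z < \<delta>")
        case True
        have "ennreal (gauss t z) * N2 (\<lambda>x. u0 (x - z) - u0 x) \<le> ennreal (gauss t z) * ennreal (r / 2)"
          by (intro mult_left_mono \<delta>(2) True) simp
        then show ?thesis by (simp add: mult.commute add_increasing2)
      next
        case False
        have "N2 (\<lambda>x. u0 (x - z) - u0 x) \<le> 2 * N2 (\<lambda>x. u0 (x - z)) + 2 * N2 u0"
          by (rule N2_diff_le) measurable
        also have "\<dots> = 4 * N2 u0" by (simp add: N2_translate flip: distrib_right)
        also have "\<dots> \<le> 4 * ennreal Nr" using L2(1) Nr by (intro mult_left_mono) auto
        also have "\<dots> = ennreal (4 * Nr)" using Nr(2) by (simp add: ennreal_mult)
        finally have "ennreal (gauss t z) * N2 (\<lambda>x. u0 (x - z) - u0 x) \<le> ennreal (gauss t z) * ennreal (4 * Nr)"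
          by (intro mult_left_mono) auto
        also have "\<dots> = ennreal (gauss t z * (4 * Nr))" using Nr(2) by (intro ennreal_mult[symmetric]) auto
        also have "\<dots> \<le> ennreal (48 * Nr / \<delta> * sqrt t * gauss (2 * t) z)"
        proof (rule ennreal_leI)
          have "\<delta> * gauss t z \<le> norm z * gauss t z" using False by (intro mult_right_mono) auto
          also have "\<dots> \<le> 12 * sqrt t * gauss (2 * t) z" by (rule power_gauss_bounds(2)[OF t])
          finally have "gauss t z \<le> 12 * sqrt t * gauss (2 * t) z / \<delta>"
            using \<delta>(1) by (simp add: field_simps)
          then have "gauss t z * (4 * Nr) \<le> (12 * sqrt t * gauss (2 * t) z / \<delta>) * (4 * Nr)"
            using Nr(2) by (intro mult_right_mono) auto
          then show "gauss t z * (4 * Nr) \<le> 48 * Nr / \<delta> * sqrt t * gauss (2 * t) z" by (simp add: mult_ac)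
        qed
        also have "\<dots> = ennreal (48 * Nr / \<delta> * sqrt t) * ennreal (gauss (2 * t) z)"
          using Nr(2) \<delta>(1) t by (intro ennreal_mult) auto
        finally show ?thesis by (rule order_trans) (simp add: add_increasing)
      qed
    qed
    also have "\<dots> = ennreal (r / 2) + ennreal (48 * Nr / \<delta> * sqrt t)"
      using t by (simp add: nn_integral_add nn_integral_cmult nn_integral_gauss)
    also have "\<dots> = ennreal (r / 2 + 48 * Nr / \<delta> * sqrt t)"
      using r Nr(2) \<delta>(1) t by (intro ennreal_plus[symmetric]) auto
    finally show ?thesis .
  qed
  have "((\<lambda>t. r / 2 + 48 * Nr / \<delta> * sqrt t) \<longlongrightarrow> r / 2 + 48 * Nr / \<delta> * sqrt 0) (at_right 0)"
    by (intro tendsto_intros)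
  moreover have "r / 2 + 48 * Nr / \<delta> * sqrt 0 < r" using r by simp
  ultimately have "\<forall>\<^sub>F t in at_right 0. r / 2 + 48 * Nr / \<delta> * sqrt t < r"
    by (rule order_tendstoD(2))
  moreover have "\<forall>\<^sub>F t::real in at_right 0. 0 < t" by (simp add: eventually_at_right_less)
  ultimately show "\<forall>\<^sub>F t in at_right 0. N2 (\<lambda>x. heat u0 t x - u0 x) < e"
  proof eventually_elim
    case (elim t)
    have "N2 (\<lambda>x. heat u0 t x - u0 x) \<le> ennreal (r / 2 + 48 * Nr / \<delta> * sqrt t)" by (rule le[OF elim(2)])
    also have "\<dots> \<le> ennreal r" using elim(1) by (intro ennreal_leI) simp
    finally show ?case using r(2) by (rule order_le_less_trans)
  qed
qed simp

lemma sol_tendsto_0: "((\<lambda>t. N2 (\<lambda>x. sol t x - u0 x)) \<longlongrightarrow> 0) (at_right 0)"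
proof -
  define q where "q t = (120 * M * beta1 \<alpha> * t powr (1/2 - \<alpha>))\<^sup>2 * (4 * Nr)" for t
  have ev: "\<forall>\<^sub>F t :: real in at_right 0. 0 \<le> t"
    by (rule eventually_mono[OF eventually_at_right_less]) simp
  \<comment> \<open>Here \<alpha> < 1/2 is essential: a positive exponent makes the quadratic term
    vanish at time 0.\<close>
  have "((\<lambda>t. t powr (1/2 - \<alpha>)) \<longlongrightarrow> 0 powr (1/2 - \<alpha>)) (at_right 0)"
    by (rule tendsto_powr') (use \<alpha> ev in \<open>auto intro: tendsto_intros\<close>)
  then have "(q \<longlongrightarrow> (120 * M * beta1 \<alpha> * 0 powr (1/2 - \<alpha>))\<^sup>2 * (4 * Nr)) (at_right 0)"
    unfolding q_def by (intro tendsto_mult tendsto_power tendsto_const)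
  then have "(q \<longlongrightarrow> 0) (at_right 0)" by simp
  then have q: "((\<lambda>t. ennreal (q t)) \<longlongrightarrow> 0) (at_right 0)"
    using tendsto_ennrealI by fastforce
  have "((\<lambda>t. 2 * N2 (\<lambda>x. heat u0 t x - u0 x) + 2 * ennreal (q t)) \<longlongrightarrow> 2 * 0 + 2 * 0) (at_right 0)"
    by (intro tendsto_add ennreal_tendsto_cmult heat_tendsto_0 q) auto
  then have lim: "((\<lambda>t. 2 * N2 (\<lambda>x. heat u0 t x - u0 x) + 2 * ennreal (q t)) \<longlongrightarrow> 0) (at_right 0)" by simp
  have "\<forall>\<^sub>F t in at_right 0. t \<in> {0<..<T}" using T by (intro eventually_at_right_real)
  then have le: "\<forall>\<^sub>F t in at_right 0. N2 (\<lambda>x. sol t x - u0 x) \<le> 2 * N2 (\<lambda>x. heat u0 t x - u0 x) + 2 * ennreal (q t)"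
  proof eventually_elim
    case (elim t)
    then have t: "0 < t" "t < T" by auto
    have "N2 (\<lambda>x. sol t x - u0 x) = N2 (\<lambda>x. (heat u0 t x - u0 x) - wpot (th t) sol x)"
      using t by (simp add: sol_eq algebra_simps)
    also have "\<dots> \<le> 2 * N2 (\<lambda>x. heat u0 t x - u0 x) + 2 * N2 (wpot (th t) sol)"
      by (intro N2_diff_le borel_measurable_diff heat_slice W_slice u0)
    also have "N2 (wpot (th t) sol) \<le> ennreal ((120 * M * beta1 \<alpha> * t powr (1/2 - \<alpha>))\<^sup>2) * (4 * N)"
      by (rule W_L2[OF sol_bounded t(1)])
    also have "\<dots> = ennreal (q t)"
    proof -
      have "4 * N = ennreal (4 * Nr)" using Nr by (simp add: ennreal_mult)
      then show ?thesis unfolding q_def using Nr(2) by (simp only:) (rule ennreal_mult[symmetric]; simp)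
    qed
    finally show ?case by (simp add: add_left_mono mult_left_mono)
  qed
  show ?thesis
    by (rule tendsto_sandwich[OF _ le tendsto_const lim]) simp
qed

end

subsection \<open>The pressure\<close>

text \<open>The kernel is a derivative of the integrable function \<open>G1\<close>. Its mean zero
  allows the velocity at \<open>x\<close> to be subtracted in \<open>pr_bound\<close>.\<close>

lemma G2_integral_0:
  assumes r: "0 < \<rho>"
  shows "integrable lborel (\<lambda>y. G2 \<rho> (x - y) a a)" "(LINT y|lborel. G2 \<rho> (x - y) a a) = 0"
proof -
  have r2: "0 < 2 * \<rho>" using r by simp
  have gi: "integrable lborel (\<lambda>z. gauss (2 * \<rho>) z)"
    using gauss_integral(3)[OF r2, of 0] by simp
  have i1: "integrable lborel (\<lambda>z. G1 \<rho> z a)"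
  proof (rule Bochner_Integration.integrable_bound)
    show "integrable lborel (\<lambda>z. 6 * (norm a / sqrt \<rho>) * gauss (2 * \<rho>) z)" using gi by simp
    show "AE z in lborel. norm (G1 \<rho> z a) \<le> norm (6 * (norm a / sqrt \<rho>) * gauss (2 * \<rho>) z)"
      unfolding real_norm_def by (intro AE_I2 order_trans[OF G1_le[OF r] abs_ge_self])
  qed (use borel_measurable_continuous_onI[OF kernels_continuous(2)[OF r]] in simp)
  have i2: "integrable lborel (\<lambda>z. G2 \<rho> z a a)"
  proof (rule Bochner_Integration.integrable_bound)
    show "integrable lborel (\<lambda>z. 14 * (norm a)\<^sup>2 * (gauss (2 * \<rho>) z / \<rho>))" using gi by simp
    show "AE z in lborel. norm (G2 \<rho> z a a) \<le> norm (14 * (norm a)\<^sup>2 * (gauss (2 * \<rho>) z / \<rho>))"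
      unfolding real_norm_def by (intro AE_I2 order_trans[OF G2_le[OF r] abs_ge_self])
  qed (use borel_measurable_continuous_onI[OF kernels_continuous(3)[OF r]] in simp)
  have "(LINT z|lborel. G2 \<rho> z a a) = 0"
    by (rule integral_line_derivative_0[OF i1 i2 G1_deriv[OF r] kernels_continuous(3)[OF r]])
  moreover have "(\<lambda>z. G2 \<rho> z a a) \<in> borel_measurable borel" by measurable
  ultimately show "integrable lborel (\<lambda>y. G2 \<rho> (x - y) a a)" "(LINT y|lborel. G2 \<rho> (x - y) a a) = 0"
    using i2 integral_reflect[of "\<lambda>z. G2 \<rho> z a a" x] integrable_reflect[of "\<lambda>z. G2 \<rho> z a a" x] by simp_all
qed

context picard
begin

definition pr :: "real \<Rightarrow> space \<Rightarrow> real \<Rightarrow> real" where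
  "pr \<rho> x s = (LINT y|lborel. G2 \<rho> (x - y) (sol s y) (sol s y))"

text \<open>This is the inverse of -\<Delta> applied to the double divergence of u \<otimes> u, with
  the inverse written as an integral of heat kernels; \<open>pr\<close> is the contribution of the
  heat time \<rho>.\<close>

definition press :: "space \<times> real \<Rightarrow> real" where
  "press z = (LINT \<rho>|lborel. pr \<rho> (fst z) (snd z) * indicator {0<..} \<rho>)"

definition Cp :: "real \<Rightarrow> real" where
  "Cp s = 136 * Lip s * (M * s powr (- \<alpha>)) + 56 * Nr"

lemma Cp_nonneg: "0 \<le> Cp s"
  using Lip_nonneg[of s] M Nr(2) by (simp add: Cp_def)

lemma sol_L2:
  assumes "0 < s"
  shows "integrable lborel (\<lambda>y. (norm (sol s y))\<^sup>2)" "(LINT y|lborel. (norm (sol s y))\<^sup>2) \<le> 4 * Nr"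
proof -
  note [measurable] = sol_slice[of s]
  have "N2 (sol s) \<le> ennreal (4 * Nr)"
    using bounded_fieldD(3)[OF sol_bounded assms] Nr by (simp add: ennreal_mult)
  then have le: "(\<integral>\<^sup>+y. ennreal ((norm (sol s y))\<^sup>2) \<partial>lborel) \<le> ennreal (4 * Nr)"
    by (simp add: N2_def ennreal_power)
  have "(\<integral>\<^sup>+y. ennreal (norm ((norm (sol s y))\<^sup>2)) \<partial>lborel) < \<infinity>"
    using order_le_less_trans[OF le] by simp
  then show i: "integrable lborel (\<lambda>y. (norm (sol s y))\<^sup>2)"
    by (intro integrableI_bounded) measurable
  have "ennreal (LINT y|lborel. (norm (sol s y))\<^sup>2) \<le> ennreal (4 * Nr)"
    using le nn_integral_eq_integral[OF i] by simp
  then show "(LINT y|lborel. (norm (sol s y))\<^sup>2) \<le> 4 * Nr"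
    using Nr(2) by (simp add: ennreal_le_iff)
qed

lemma pr_integrable:
  assumes s: "0 < s" and r: "0 < \<rho>"
  shows "integrable lborel (\<lambda>y. G2 \<rho> (x - y) (sol s y) (sol s y))"
proof (rule Bochner_Integration.integrable_bound)
  note [measurable] = sol_slice[of s]
  have gb: "gauss (2 * \<rho>) z \<le> (2 * \<rho>) powr (- 3 / 2)" for z using r by (intro gauss_le) simp
  show "integrable lborel (\<lambda>y. 14 * ((2 * \<rho>) powr (- 3 / 2) / \<rho>) * (norm (sol s y))\<^sup>2)"
    using sol_L2(1)[OF s] by simp
  show "AE y in lborel. norm (G2 \<rho> (x - y) (sol s y) (sol s y)) \<le> norm (14 * ((2 * \<rho>) powr (- 3 / 2) / \<rho>) * (norm (sol s y))\<^sup>2)"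
  proof (rule AE_I2)
    fix y
    have "norm (G2 \<rho> (x - y) (sol s y) (sol s y)) \<le> 14 * (norm (sol s y))\<^sup>2 * (gauss (2 * \<rho>) (x - y) / \<rho>)"
      using G2_le[OF r] by simp
    also have "\<dots> \<le> 14 * (norm (sol s y))\<^sup>2 * ((2 * \<rho>) powr (- 3 / 2) / \<rho>)"
      using r by (intro mult_left_mono divide_right_mono gb) auto
    finally show "norm (G2 \<rho> (x - y) (sol s y) (sol s y)) \<le> norm (14 * ((2 * \<rho>) powr (- 3 / 2) / \<rho>) * (norm (sol s y))\<^sup>2)"
      using r by (simp add: mult_ac)
  qed
qed (use sol_slice[of s] in measurable)

text \<open>For \<rho> \<le> 1 the velocity at \<open>x\<close> is subtracted and the Hoelder bound
  applies, with 136 = 2 * 68. The bound for large \<rho> comes from the squared L^2 norm, at most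
  \<open>4 * Nr\<close>, with 56 = 14 * 4.\<close>

lemma pr_bound:
  assumes s: "0 < s" "s < T" and r: "0 < \<rho>"
  shows "\<bar>pr \<rho> x s\<bar> \<le> Cp s * major \<rho>"
  unfolding Cp_def
proof (rule le_major[OF r])
  have r2: "0 < 2 * \<rho>" using r by simp
  note gi = gauss_integral[OF r2]
  note i = pr_integrable[OF s(1) r] and i0 = G2_integral_0[OF r]
  show "\<bar>pr \<rho> x s\<bar> \<le> 136 * Lip s * (M * s powr (- \<alpha>)) * \<rho> powr (- 3 / 4)"
  proof -
    have eq: "pr \<rho> x s = (LINT y|lborel. G2 \<rho> (x - y) (sol s y) (sol s y) - G2 \<rho> (x - y) (sol s x) (sol s x))"
      unfolding pr_def using i i0 by simp
    have "\<bar>pr \<rho> x s\<bar> \<le> (LINT y|lborel. norm (G2 \<rho> (x - y) (sol s y) (sol s y) - G2 \<rho> (x - y) (sol s x) (sol s x)))"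
      using integral_norm_bound[of lborel "\<lambda>y. G2 \<rho> (x - y) (sol s y) (sol s y) - G2 \<rho> (x - y) (sol s x) (sol s x)"]
      unfolding eq by simp
    also have "\<dots> \<le> (LINT y|lborel. (136 * Lip s * (M * s powr (- \<alpha>)) * \<rho> powr (- 3 / 4)) * gauss (2 * \<rho>) (x - y))"
    proof (rule integral_mono)
      show "norm (G2 \<rho> (x - y) (sol s y) (sol s y) - G2 \<rho> (x - y) (sol s x) (sol s x))
        \<le> (136 * Lip s * (M * s powr (- \<alpha>)) * \<rho> powr (- 3 / 4)) * gauss (2 * \<rho>) (x - y)" for y
      proof -
        have "norm (G2 \<rho> (x - y) (sol s y) (sol s y) - G2 \<rho> (x - y) (sol s x) (sol s x))
          \<le> 68 * Lip s * (norm (sol s y) + norm (sol s x)) * (\<rho> powr (- 3 / 4) * gauss (2 * \<rho>) (x - y))"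
          using G2_diff_sqrt_le[OF r sol_holder[OF s] Lip_nonneg] by simp
        also have "\<dots> \<le> 68 * Lip s * (2 * (M * s powr (- \<alpha>))) * (\<rho> powr (- 3 / 4) * gauss (2 * \<rho>) (x - y))"
        proof (intro mult_right_mono mult_left_mono)
          show "norm (sol s y) + norm (sol s x) \<le> 2 * (M * s powr (- \<alpha>))"
            using bounded_fieldD(2)[OF sol_bounded s(1), of y] bounded_fieldD(2)[OF sol_bounded s(1), of x] by simp
        qed (use Lip_nonneg[of s] in auto)
        finally show ?thesis by (simp add: mult_ac)
      qed
    qed (use i i0 gi in auto)
    finally show ?thesis using gi by simp
  qed
  have "\<bar>pr \<rho> x s\<bar> \<le> (LINT y|lborel. norm (G2 \<rho> (x - y) (sol s y) (sol s y)))"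
    unfolding pr_def using integral_norm_bound[of lborel "\<lambda>y. G2 \<rho> (x - y) (sol s y) (sol s y)"] by simp
  also have "\<dots> \<le> (LINT y|lborel. 14 * \<rho> powr (- 5 / 2) * (norm (sol s y))\<^sup>2)"
  proof (rule integral_mono)
    show "norm (G2 \<rho> (x - y) (sol s y) (sol s y)) \<le> 14 * \<rho> powr (- 5 / 2) * (norm (sol s y))\<^sup>2" for y
    proof -
      have "gauss (2 * \<rho>) (x - y) \<le> (2 * \<rho>) powr (- 3 / 2)" by (rule gauss_le[OF r2])
      also have "\<dots> \<le> \<rho> powr (- 3 / 2)" using r by (intro powr_mono2') auto
      finally have "gauss (2 * \<rho>) (x - y) / \<rho> \<le> \<rho> powr (- 3 / 2) / \<rho>"
        using r by (intro divide_right_mono) auto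
      also have "\<dots> = \<rho> powr (- 5 / 2)"
        using r powr_diff[of \<rho> "- 3/2" 1] by simp
      finally have g: "gauss (2 * \<rho>) (x - y) / \<rho> \<le> \<rho> powr (- 5 / 2)" .
      have "norm (G2 \<rho> (x - y) (sol s y) (sol s y)) \<le> 14 * (norm (sol s y))\<^sup>2 * (gauss (2 * \<rho>) (x - y) / \<rho>)"
        using G2_le[OF r] by simp
      also have "\<dots> \<le> 14 * (norm (sol s y))\<^sup>2 * \<rho> powr (- 5 / 2)"
        using g by (intro mult_left_mono) auto
      finally show ?thesis by (simp add: mult_ac)
    qed
  qed (use i sol_L2(1)[OF s(1)] in auto)
  also have "\<dots> = 14 * \<rho> powr (- 5 / 2) * (LINT y|lborel. (norm (sol s y))\<^sup>2)" by simp
  also have "\<dots> \<le> 14 * \<rho> powr (- 5 / 2) * (4 * Nr)"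
    by (intro mult_left_mono sol_L2 s) auto
  finally show "\<bar>pr \<rho> x s\<bar> \<le> 56 * Nr * \<rho> powr (- 5 / 2)" by (simp add: mult_ac)
qed (use Lip_nonneg[of s] M Nr(2) in auto)

lemma pr_measurable [measurable (raw)]:
  assumes [measurable]: "f \<in> borel_measurable P" "g \<in> borel_measurable P" "h \<in> borel_measurable P"
  shows "(\<lambda>w. pr (f w) (g w) (h w)) \<in> borel_measurable P"
proof -
  note [measurable (raw)] = field_measurable[OF bounded_fieldD(1)[OF sol_bounded]]
  show ?thesis unfolding pr_def by measurable
qed

lemma press_measurable: "press \<in> borel_measurable borel"
  unfolding press_def[abs_def] borel_prod[symmetric] by measurable

lemma pr_integrable_rho:
  assumes s: "0 < s" "s < T"
  shows "integrable lborel (\<lambda>\<rho>. pr \<rho> x s * indicator {0<..} \<rho>)"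
proof (rule Bochner_Integration.integrable_bound)
  show "integrable lborel (\<lambda>\<rho>. Cp s * major \<rho>)" using major_integrable by simp
  show "AE \<rho> in lborel. norm (pr \<rho> x s * indicator {0<..} \<rho>) \<le> norm (Cp s * major \<rho>)"
  proof (rule AE_I2)
    fix \<rho>
    show "norm (pr \<rho> x s * indicator {0<..} \<rho>) \<le> norm (Cp s * major \<rho>)"
      using pr_bound[OF s, of \<rho> x] Cp_nonneg[of s] by (cases "0 < \<rho>") auto
  qed
qed measurable

lemma press_bound:
  assumes s: "0 < s" "s < T"
  shows "\<bar>press (x, s)\<bar> \<le> Cp s * (LINT \<rho>|lborel. major \<rho>)"
proof -
  have "\<bar>press (x, s)\<bar> \<le> (LINT \<rho>|lborel. norm (pr \<rho> x s * indicator {0<..} \<rho>))"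
    using integral_norm_bound[of lborel "\<lambda>\<rho>. pr \<rho> x s * indicator {0<..} \<rho>"] by (simp add: press_def)
  also have "\<dots> \<le> (LINT \<rho>|lborel. Cp s * major \<rho>)"
  proof (rule integral_mono)
    show "norm (pr \<rho> x s * indicator {0<..} \<rho>) \<le> Cp s * major \<rho>" for \<rho>
      using pr_bound[OF s, of \<rho> x] Cp_nonneg[of s] by (cases "0 < \<rho>") auto
  qed (use pr_integrable_rho[OF s] major_integrable in auto)
  finally show ?thesis by simp
qed

lemma Cp_bounded:
  assumes "0 < a"
  shows "\<exists>C\<ge>0. \<forall>s\<in>{a..b}. Cp s \<le> C"
proof -
  have "continuous_on {a..b} Cp"
    unfolding Cp_def Lip_def using assms by (intro continuous_intros) auto
  then have "compact (Cp ` {a..b})" by (intro compact_continuous_image) auto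
  then have "\<exists>C. \<forall>c\<in>Cp ` {a..b}. norm c \<le> C"
    by (rule iffD1[OF bounded_iff, OF compact_imp_bounded])
  then obtain C where C: "\<forall>c\<in>Cp ` {a..b}. norm c \<le> C" ..
  have "Cp s \<le> max 0 C" if "s \<in> {a..b}" for s
    using bspec[OF C imageI[OF that]] by simp
  then show ?thesis by (intro exI[of _ "max 0 C"]) simp
qed

lemma compact_time_bounds:
  fixes K :: "(space \<times> real) set"
  assumes "compact K" "K \<subseteq> UNIV \<times> {0<..<T}"
  shows "\<exists>a b. 0 < a \<and> a < b \<and> b < T \<and> snd ` K \<subseteq> {a..b}"
proof (cases "K = {}")
  case True
  then show ?thesis using T by (intro exI[of _ "T/3"] exI[of _ "T/2"]) auto
next
  case False
  have c: "compact (snd ` K)" by (rule compact_projections[OF assms(1)])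
  have ne: "snd ` K \<noteq> {}" using False by simp
  obtain m where m: "m \<in> snd ` K" "\<And>t. t \<in> snd ` K \<Longrightarrow> m \<le> t"
    using compact_attains_inf[OF c ne] by blast
  obtain M' where M': "M' \<in> snd ` K" "\<And>t. t \<in> snd ` K \<Longrightarrow> t \<le> M'"
    using compact_attains_sup[OF c ne] by blast
  have mM: "0 < m" "M' < T" "m \<le> M'" using m M' assms(2) by auto
  have "snd ` K \<subseteq> {m / 2..(M' + T) / 2}"
  proof
    fix t assume "t \<in> snd ` K"
    from m(2)[OF this] M'(2)[OF this] mM show "t \<in> {m / 2..(M' + T) / 2}" by auto
  qed
  moreover have "0 < m / 2" "m / 2 < (M' + T) / 2" "(M' + T) / 2 < T" using mM by auto
  ultimately show ?thesis by blast
qed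

text \<open>On a compact subset of the open strip time stays away from 0 and T, and there the
  pressure is even bounded.\<close>

lemma press_L1_loc: "press \<in> L1_loc (UNIV \<times> {0<..<T})"
  unfolding L1_loc_def
proof (intro CollectI allI impI)
  fix K :: "(space \<times> real) set" assume K: "compact K \<and> K \<subseteq> UNIV \<times> {0<..<T}"
  from compact_time_bounds[OF conjunct1[OF K] conjunct2[OF K]]
  obtain a b where ab: "0 < a" "a < b" "b < T" "snd ` K \<subseteq> {a..b}" by blast
  obtain C where C: "0 \<le> C" "\<And>s. s \<in> {a..b} \<Longrightarrow> Cp s \<le> C" using Cp_bounded[OF ab(1)] by blast
  define I where "I = (LINT \<rho>|lborel. major \<rho>)"
  have I: "0 \<le> I" unfolding I_def by (intro Bochner_Integration.integral_nonneg) auto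
  have bound: "\<bar>press z\<bar> \<le> C * I" if "z \<in> K" for z
  proof -
    have s: "snd z \<in> {a..b}" using ab(4) that by auto
    have "\<bar>press (fst z, snd z)\<bar> \<le> Cp (snd z) * I"
      unfolding I_def using s ab by (intro press_bound) auto
    also have "\<dots> \<le> C * I" using C(2)[OF s] I by (intro mult_right_mono)
    finally show ?thesis by simp
  qed
  have Kb: "K \<in> sets borel" using K by (simp add: borel_compact)
  have "integrable lborel (\<lambda>z. indicator K z *\<^sub>R press z)"
  proof (rule Bochner_Integration.integrable_bound)
    show "integrable lborel (\<lambda>z. (C * I) * indicator K z)"
      using emeasure_compact_finite[of K] K Kb by (intro integrable_mult_right integrable_real_indicator) auto
    show "AE z in lborel. norm (indicator K z *\<^sub>R press z) \<le> norm ((C * I) * indicator K z)"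
      using bound C I by (intro AE_I2) (auto simp: indicator_def)
  qed (use press_measurable Kb in measurable)
  then show "press absolutely_integrable_on K"
    unfolding set_integrable_def by (simp add: integrable_completion borel_measurable_integrable)
qed

end

subsection \<open>Divergence\<close>

text \<open>In the divergence of the kernel both terms of the operator become the second derivative
  along \<open>a\<close> of the Laplacian of the Gaussian, with opposite signs. This is how the
  projection P shows in the kernel.\<close>

lemma oseen_div_free:
  assumes s: "0 < s"
  shows "(\<Sum>i\<in>UNIV. oseen_deriv s z a (axis i 1) $ i) = 0"
proof -
  define g where "g = gauss s z" define zz where "zz = z \<bullet> z" define za where "za = z \<bullet> a" define aa where "aa = a \<bullet> a"
  define c where "c = - za\<^sup>2 / (8 * s ^ 3) + aa / (4 * s\<^sup>2)"
  have comp: "oseen_deriv s z a (axis i 1) $ i = g * ((zz / (8 * s ^ 3) - 3 / (4 * s\<^sup>2)) * (a $ i * a $ i)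
      - ((zz * za / (8 * s ^ 3) - 3 * za / (4 * s\<^sup>2)) / (2 * s)) * (z $ i * a $ i)
      - (c / (2 * s)) * (z $ i * z $ i) + c)" for i
    unfolding oseen_deriv_def G1_def oseen2_def g_def[symmetric] zz_def[symmetric] za_def[symmetric] aa_def[symmetric] c_def[symmetric]
    by (simp add: inner_axis inner_axis' algebra_simps add_divide_distrib diff_divide_distrib)
  have sums: "(\<Sum>i\<in>UNIV. a $ i * a $ i) = aa" "(\<Sum>i\<in>UNIV. z $ i * a $ i) = za" "(\<Sum>i\<in>UNIV. z $ i * z $ i) = zz"
    by (simp_all add: aa_def za_def zz_def inner_vec_def)
  have gen: "(\<Sum>i\<in>UNIV. g * (k1 * A i - k2 * B i - k3 * D i + d)) = g * (k1 * (\<Sum>i\<in>UNIV. A i) - k2 * (\<Sum>i\<in>UNIV. B i) - k3 * (\<Sum>i\<in>UNIV. D i) + 3 * d)"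
    for k1 k2 k3 d and A B D :: "3 \<Rightarrow> real"
    by (simp add: sum_3 algebra_simps)
  have "(\<Sum>i\<in>UNIV. oseen_deriv s z a (axis i 1) $ i) = g * ((zz / (8 * s ^ 3) - 3 / (4 * s\<^sup>2)) * aa
      - ((zz * za / (8 * s ^ 3) - 3 * za / (4 * s\<^sup>2)) / (2 * s)) * za - (c / (2 * s)) * zz + 3 * c)"
    unfolding comp gen sums ..
  also have "\<dots> = 0"
    unfolding c_def using s by (simp add: field_simps power2_eq_square power3_eq_cube)
  finally show ?thesis .
qed

lemma grad_nth: "grad g x $ i = dderiv (axis i 1) g x"
  by (simp add: grad_def)

lemma grad_continuous: "g \<in> test_fun \<Omega> \<Longrightarrow> continuous_on UNIV (grad g)"
proof -
  assume g: "g \<in> test_fun \<Omega>"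
  have "continuous_on UNIV (\<lambda>x. \<chi> j. dderiv (axis j 1) g x)"
    by (intro continuous_on_vec_lambda smooth_continuous smooth_dderiv test_fun_smooth[OF g])
  then show ?thesis by (simp add: grad_def[abs_def])
qed

lemma grad_support:
  assumes "g \<in> test_fun \<Omega>"
  shows "\<exists>K. compact K \<and> (\<forall>x. x \<notin> K \<longrightarrow> g x = 0 \<and> grad g x = 0)"
proof -
  obtain K where K: "compact K" "\<And>z. z \<notin> K \<Longrightarrow> g z = 0" using test_fun_support[OF assms] by blast
  have "grad g x = 0" if "x \<notin> K" for x
    using dderiv_eq_0[OF K that] by (simp add: grad_def vec_eq_iff)
  then show ?thesis using K by blast
qed

lemma grad_integrable: "g \<in> test_fun \<Omega> \<Longrightarrow> integrable lborel (grad g)"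
proof -
  assume g: "g \<in> test_fun \<Omega>"
  obtain K where K: "compact K" "\<forall>x. x \<notin> K \<longrightarrow> g x = 0 \<and> grad g x = 0" using grad_support[OF g] by blast
  show ?thesis by (rule integrable_compact_support[OF grad_continuous[OF g] K(1)]) (use K(2) in blast)
qed

text \<open>One integration by parts in each coordinate turns the pairing with a gradient into the
  divergence of the kernel.\<close>

lemma oseen_grad_0:
  assumes g: "g \<in> test_fun UNIV" and s: "0 < s"
  shows "(LINT x|lborel. oseen s (x - y) a \<bullet> grad g x) = 0"
proof -
  obtain K where K: "compact K" "\<forall>x. x \<notin> K \<longrightarrow> g x = 0 \<and> grad g x = 0" using grad_support[OF g] by blast
  have K1: "g x = 0" "dderiv (axis i 1) g x = 0" if "x \<notin> K" for x i
    using K(2) that grad_nth[of g x i] by auto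
  have cg: "continuous_on UNIV g" "continuous_on UNIV (dderiv v g)" for v
    by (intro smooth_continuous smooth_dderiv test_fun_smooth[OF g])+
  have co: "continuous_on UNIV (\<lambda>z. oseen s z a $ i)" "continuous_on UNIV (\<lambda>z. oseen_deriv s z a h $ i)" for i h
    using s unfolding oseen_def oseen_deriv_def oseen1_def oseen2_def G1_def gauss_def
    by (intro continuous_intros; simp)+
  have co': "continuous_on UNIV (\<lambda>x. oseen s (x - y) a $ i)" "continuous_on UNIV (\<lambda>x. oseen_deriv s (x - y) a h $ i)" for i h
    by (rule continuous_on_compose2[OF co(1)] continuous_on_compose2[OF co(2)]; auto intro!: continuous_intros)+
  have ii: "integrable lborel (\<lambda>x. oseen s (x - y) a $ i * dderiv (axis i 1) g x)"
    "integrable lborel (\<lambda>x. oseen_deriv s (x - y) a (axis i 1) $ i * g x)" for i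
    by (rule integrable_compact_support[OF _ K(1)]; use K1 in \<open>simp add: continuous_on_mult co' cg\<close>)+
  have "(LINT x|lborel. oseen s (x - y) a \<bullet> grad g x) = (LINT x|lborel. (\<Sum>i\<in>UNIV. oseen s (x - y) a $ i * dderiv (axis i 1) g x))"
    by (simp add: inner_vec_def grad_nth)
  also have "\<dots> = (\<Sum>i\<in>UNIV. LINT x|lborel. oseen s (x - y) a $ i * dderiv (axis i 1) g x)"
    by (intro Bochner_Integration.integral_sum ii)
  also have "\<dots> = (\<Sum>i\<in>UNIV. - (LINT x|lborel. oseen_deriv s (x - y) a (axis i 1) $ i * g x))"
  proof (rule sum.cong[OF refl])
    fix i :: 3
    have "(LINT x|lborel. oseen_deriv s (x - y) a (axis i 1) $ i * g x) = - (LINT x|lborel. oseen s (x - y) a $ i * dderiv (axis i 1) g x)"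
    proof (rule integration_by_parts_line[OF co cg K(1) K1])
      show "((\<lambda>r. oseen s (z + r *\<^sub>R axis i 1) a $ i) has_real_derivative oseen_deriv s (z + r *\<^sub>R axis i 1) a (axis i 1) $ i) (at r)" for z r
        using bounded_linear.has_vector_derivative[OF bounded_linear_vec_nth oseen_has_deriv[OF s]]
        by (simp add: has_real_derivative_iff_has_vector_derivative)
      show "((\<lambda>r. g (z + r *\<^sub>R axis i 1)) has_real_derivative dderiv (axis i 1) g (z + r *\<^sub>R axis i 1)) (at r)" for z r
        by (rule smooth_line_derivative_real[OF test_fun_smooth[OF g]])
    qed
    then show "(LINT x|lborel. oseen s (x - y) a $ i * dderiv (axis i 1) g x) = - (LINT x|lborel. oseen_deriv s (x - y) a (axis i 1) $ i * g x)"
      by simp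
  qed
  also have "\<dots> = - (LINT x|lborel. (\<Sum>i\<in>UNIV. oseen_deriv s (x - y) a (axis i 1) $ i * g x))"
    unfolding sum_negf by (intro arg_cong[of _ _ uminus] Bochner_Integration.integral_sum[symmetric] ii)
  also have "\<dots> = 0"
    unfolding sum_distrib_right[symmetric] oseen_div_free[OF s] by simp
  finally show ?thesis .
qed

lemma test_fun_translate:
  assumes g: "g \<in> test_fun UNIV"
  shows "(\<lambda>x. g (x + z)) \<in> test_fun UNIV"
proof -
  obtain K where K: "compact K" "\<And>z. z \<notin> K \<Longrightarrow> g z = 0" using test_fun_support[OF g] by blast
  show ?thesis
  proof (rule test_funI[OF smooth_translate[OF test_fun_smooth[OF g]]])
    show "compact ((\<lambda>x. x - z) ` K)"
      by (intro compact_continuous_image continuous_intros K)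
    show "g (x + z) = 0" if "x \<notin> (\<lambda>x. x - z) ` K" for x
    proof (rule K(2))
      show "x + z \<notin> K"
      proof
        assume "x + z \<in> K"
        from imageI[OF this, of "\<lambda>x. x - z"] that show False by simp
      qed
    qed
  qed simp
qed

lemma grad_translate:
  assumes g: "g \<in> test_fun UNIV"
  shows "grad (\<lambda>x. g (x + z)) x = grad g (x + z)"
  unfolding grad_def by (simp add: dderiv_translate smooth_differentiable test_fun_smooth[OF g])

lemma integral_lebesgue_eq:
  fixes f :: "'a::euclidean_space \<Rightarrow> 'b::{banach, second_countable_topology}"
  assumes "f \<in> borel_measurable borel"
  shows "(LINT x|lebesgue. f x) = (LINT x|lborel. f x)"
  using assms by (intro integral_completion) simp

section \<open>Divergence of the heat flow and of the quadratic term\<close>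

context picard
begin

text \<open>Written as an average over shifts \<open>z\<close>, the heat flow tests
  \<open>u0\<close> against translates of \<open>grad g\<close>, and these are again gradients of
  test functions.\<close>

lemma heat_div_free:
  assumes div: "weakly_div_free u0" and g: "g \<in> test_fun UNIV" and t: "0 < t"
  shows "(LINT x|lborel. heat u0 t x \<bullet> grad g x) = 0"
proof -
  note gm [measurable] = borel_measurable_continuous_onI[OF grad_continuous[OF g]]
  define F where "F = (\<lambda>(x, z). gauss t z * (u0 (x - z) \<bullet> grad g x))"
  have Fm: "F \<in> borel_measurable (lborel \<Otimes>\<^sub>M lborel)"
    unfolding F_def by measurable
  have int: "integrable (lborel \<Otimes>\<^sub>M lborel) F"
  proof (rule integrableI_bounded[OF Fm])
    have "(\<integral>\<^sup>+w. ennreal (norm (F w)) \<partial>(lborel \<Otimes>\<^sub>M lborel)) = (\<integral>\<^sup>+x. \<integral>\<^sup>+z. ennreal (norm (F (x, z))) \<partial>lborel \<partial>lborel)"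
      using Fm by (intro lborel.nn_integral_fst[symmetric]) simp
    also have "\<dots> \<le> (\<integral>\<^sup>+x. ennreal (M / 2 * t powr (- \<alpha>)) * ennreal (norm (grad g x)) \<partial>lborel)"
    proof (rule nn_integral_mono)
      fix x
      have "(\<integral>\<^sup>+z. ennreal (norm (F (x, z))) \<partial>lborel) \<le> (\<integral>\<^sup>+z. ennreal (gauss t z * norm (u0 (x - z))) * ennreal (norm (grad g x)) \<partial>lborel)"
      proof (rule nn_integral_mono)
        fix z
        have "norm (F (x, z)) \<le> gauss t z * (norm (u0 (x - z)) * norm (grad g x))"
          unfolding F_def by (simp add: abs_mult mult_left_mono Cauchy_Schwarz_ineq2)
        then show "ennreal (norm (F (x, z))) \<le> ennreal (gauss t z * norm (u0 (x - z))) * ennreal (norm (grad g x))"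
          by (simp add: ennreal_mult[symmetric] ennreal_leI mult.assoc)
      qed
      also have "\<dots> = (\<integral>\<^sup>+z. ennreal (gauss t z * norm (u0 (x - z))) \<partial>lborel) * ennreal (norm (grad g x))"
        by (rule nn_integral_multc) measurable
      also have "(\<integral>\<^sup>+z. ennreal (gauss t z * norm (u0 (x - z))) \<partial>lborel) = (\<integral>\<^sup>+y. ennreal (gauss t (x - y) * norm (u0 y)) \<partial>lborel)"
        using nn_integral_reflect[of "\<lambda>y. ennreal (gauss t (x - y) * norm (u0 y))" x] by simp
      also have "\<dots> * ennreal (norm (grad g x)) \<le> ennreal (M / 2 * t powr (- \<alpha>)) * ennreal (norm (grad g x))"
        by (intro mult_right_mono pot t) simp
      finally show "(\<integral>\<^sup>+z. ennreal (norm (F (x, z))) \<partial>lborel) \<le> ennreal (M / 2 * t powr (- \<alpha>)) * ennreal (norm (grad g x))" .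
    qed
    also have "\<dots> = ennreal (M / 2 * t powr (- \<alpha>)) * (\<integral>\<^sup>+x. ennreal (norm (grad g x)) \<partial>lborel)"
      by (rule nn_integral_cmult) measurable
    also have "\<dots> < \<infinity>"
      using grad_integrable[OF g] by (simp add: integrable_iff_bounded ennreal_mult_less_top)
    finally show "(\<integral>\<^sup>+w. ennreal (norm (F w)) \<partial>(lborel \<Otimes>\<^sub>M lborel)) < \<infinity>" .
  qed
  have "heat u0 t x \<bullet> grad g x = (LINT z|lborel. F (x, z))" for x
  proof -
    have m: "(\<lambda>y. gauss t (x - y) *\<^sub>R u0 y) \<in> borel_measurable borel" by measurable
    have h: "heat u0 t x = (LINT z|lborel. gauss t z *\<^sub>R u0 (x - z))"
      unfolding heat_def using integral_reflect[OF m, of x] by simp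
    have i: "integrable lborel (\<lambda>z. gauss t z *\<^sub>R u0 (x - z))"
      using heat_integrable[OF t, of x] integrable_reflect[OF m, of x] by simp
    show ?thesis
      unfolding h F_def using integral_inner_left[OF i, of "grad g x"] by simp
  qed
  then have "(LINT x|lborel. heat u0 t x \<bullet> grad g x) = (LINT x|lborel. LINT z|lborel. F (x, z))" by simp
  also have "\<dots> = (LINT z|lborel. LINT x|lborel. F (x, z))"
    using lborel_pair.Fubini_integral[of "\<lambda>x z. F (x, z)"] int by simp
  also have "\<dots> = (LINT z|(lborel :: space measure). 0 :: real)"
  proof (rule Bochner_Integration.integral_cong[OF refl])
    fix z
    have "(LINT x|lborel. u0 (x - z) \<bullet> grad g x) = (LINT x|lborel. u0 x \<bullet> grad g (x + z))"
      using integral_translate[of "\<lambda>x. u0 (x - z) \<bullet> grad g x" z] by simp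
    also have "\<dots> = (LINT x|lebesgue. u0 x \<bullet> grad (\<lambda>x. g (x + z)) x)"
      unfolding grad_translate[OF g] by (rule integral_lebesgue_eq[symmetric]) measurable
    also have "\<dots> = 0"
      using div test_fun_translate[OF g] by (simp add: weakly_div_free_def)
    finally show "(LINT x|lborel. F (x, z)) = 0" by (simp add: F_def)
  qed
  finally show ?thesis by simp
qed

lemma oz_integrable: "integrable M3 (oz (th t) sol x)"
  by (rule wpot_le(1)[OF th_weight bounded_fieldD(1,2)[OF sol_bounded] _ fin(1)]) (use M in auto)

lemma oz_nn_le:
  "(\<integral>\<^sup>+w. ennreal (norm (oz (th t) sol x w)) \<partial>M3) \<le> ennreal (60 * M * M) * Th (2 * \<alpha>) (th t)"
proof -
  note [measurable] = pk_measurable[OF th_weight]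
  have "(\<integral>\<^sup>+w. ennreal (norm (oz (th t) sol x w)) \<partial>M3) \<le> (\<integral>\<^sup>+w. ennreal (60 * M * M) * ennreal (pk (th t) (2 * \<alpha>) x w) \<partial>M3)"
  proof (rule nn_integral_mono)
    fix w
    have "norm (oz (th t) sol x w) \<le> 60 * M * M * pk (th t) (2 * \<alpha>) x w"
      using M by (intro oz_le th_weight bounded_fieldD[OF sol_bounded]) auto
    then show "ennreal (norm (oz (th t) sol x w)) \<le> ennreal (60 * M * M) * ennreal (pk (th t) (2 * \<alpha>) x w)"
      using M by (simp add: ennreal_mult[symmetric] ennreal_leI)
  qed
  also have "\<dots> = ennreal (60 * M * M) * Th (2 * \<alpha>) (th t)"
    by (subst nn_integral_cmult) (simp_all add: pk_total[OF th_weight])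
  finally show ?thesis .
qed

text \<open>The quadratic term is a superposition of kernels that are divergence free by
  \<open>oseen_grad_0\<close>; only the exchange of integrals has to be justified.\<close>

lemma W_div_free:
  assumes g: "g \<in> test_fun UNIV"
  shows "(LINT x|lborel. wpot (th t) sol x \<bullet> grad g x) = 0"
proof -
  note gm [measurable] = borel_measurable_continuous_onI[OF grad_continuous[OF g]]
  note [measurable] = oz_measurable[OF th_weight bounded_fieldD(1)[OF sol_bounded]]
  interpret M3: sigma_finite_measure M3 by (rule sigma_finite_M3)
  interpret Q: pair_sigma_finite lborel M3 ..
  define F where "F = (\<lambda>(x, w). oz (th t) sol x w \<bullet> grad g x)"
  have Fm: "F \<in> borel_measurable (lborel \<Otimes>\<^sub>M M3)" unfolding F_def by measurable
  have int: "integrable (lborel \<Otimes>\<^sub>M M3) F"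
  proof (rule integrableI_bounded[OF Fm])
    have "(\<integral>\<^sup>+w. ennreal (norm (F w)) \<partial>(lborel \<Otimes>\<^sub>M M3)) = (\<integral>\<^sup>+x. \<integral>\<^sup>+w. ennreal (norm (F (x, w))) \<partial>M3 \<partial>lborel)"
      using Fm by (intro M3.nn_integral_fst[symmetric]) simp
    also have "\<dots> \<le> (\<integral>\<^sup>+x. (ennreal (60 * M * M) * Th (2 * \<alpha>) (th t)) * ennreal (norm (grad g x)) \<partial>lborel)"
    proof (rule nn_integral_mono)
      fix x
      have "(\<integral>\<^sup>+w. ennreal (norm (F (x, w))) \<partial>M3) \<le> (\<integral>\<^sup>+w. ennreal (norm (oz (th t) sol x w)) * ennreal (norm (grad g x)) \<partial>M3)"
        unfolding F_def by (intro nn_integral_mono) (simp add: ennreal_mult[symmetric] ennreal_leI Cauchy_Schwarz_ineq2)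
      also have "\<dots> = (\<integral>\<^sup>+w. ennreal (norm (oz (th t) sol x w)) \<partial>M3) * ennreal (norm (grad g x))"
        by (rule nn_integral_multc) measurable
      also have "\<dots> \<le> (ennreal (60 * M * M) * Th (2 * \<alpha>) (th t)) * ennreal (norm (grad g x))"
        by (intro mult_right_mono oz_nn_le) simp
      finally show "(\<integral>\<^sup>+w. ennreal (norm (F (x, w))) \<partial>M3) \<le> (ennreal (60 * M * M) * Th (2 * \<alpha>) (th t)) * ennreal (norm (grad g x))" .
    qed
    also have "\<dots> = (ennreal (60 * M * M) * Th (2 * \<alpha>) (th t)) * (\<integral>\<^sup>+x. ennreal (norm (grad g x)) \<partial>lborel)"
      by (rule nn_integral_cmult) measurable
    also have "\<dots> < \<infinity>"
      using grad_integrable[OF g] fin(1)[of t] by (simp add: integrable_iff_bounded ennreal_mult_less_top)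
    finally show "(\<integral>\<^sup>+w. ennreal (norm (F w)) \<partial>(lborel \<Otimes>\<^sub>M M3)) < \<infinity>" .
  qed
  have "(LINT x|lborel. wpot (th t) sol x \<bullet> grad g x) = (LINT x|lborel. LINT w|M3. F (x, w))"
    unfolding wpot_def F_def using integral_inner_left[OF oz_integrable] by simp
  also have "\<dots> = (LINT w|M3. LINT x|lborel. F (x, w))"
    using Q.Fubini_integral[of "\<lambda>x w. F (x, w)"] int by simp
  also have "\<dots> = (LINT w|M3. 0 :: real)"
  proof (rule Bochner_Integration.integral_cong[OF refl])
    fix w :: "(real \<times> space) \<times> real"
    obtain s y \<sigma> where ws: "w = ((s, y), \<sigma>)" by (metis surj_pair)
    show "(LINT x|lborel. F (x, w)) = 0"
    proof (cases "th t s \<sigma> = 0")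
      case False
      then have "0 < \<sigma>" using th_weight[of t] by (auto simp: weight_def)
      then show ?thesis by (simp add: F_def oz_def ws oseen_grad_0[OF g])
    qed (simp add: F_def oz_def ws)
  qed
  finally show ?thesis by simp
qed

lemma sol_div_free:
  assumes div: "weakly_div_free u0" and t: "0 < t" "t < T"
  shows "weakly_div_free (sol t)"
  unfolding weakly_div_free_def
proof
  fix g :: "space \<Rightarrow> real" assume g: "g \<in> test_fun UNIV"
  note gm [measurable] = borel_measurable_continuous_onI[OF grad_continuous[OF g]]
  note [measurable] = sol_slice heat_slice W_slice
  have "(LINT x|lebesgue. sol t x \<bullet> grad g x) = (LINT x|lborel. sol t x \<bullet> grad g x)"
    by (rule integral_lebesgue_eq) measurable
  also have "\<dots> = (LINT x|lborel. heat u0 t x \<bullet> grad g x - wpot (th t) sol x \<bullet> grad g x)"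
    using t by (simp add: sol_eq inner_diff_left)
  also have "\<dots> = (LINT x|lborel. heat u0 t x \<bullet> grad g x) - (LINT x|lborel. wpot (th t) sol x \<bullet> grad g x)"
  proof (rule Bochner_Integration.integral_diff)
    have i: "integrable lborel (\<lambda>x. (M / 2 * t powr (- \<alpha>)) * norm (grad g x))"
      using grad_integrable[OF g] by simp
    have b: "norm (v \<bullet> grad g x) \<le> norm ((M / 2 * t powr (- \<alpha>)) * norm (grad g x))" if "norm v \<le> M / 2 * t powr (- \<alpha>)" for v x
    proof -
      have "norm (v \<bullet> grad g x) \<le> norm v * norm (grad g x)" by (simp add: Cauchy_Schwarz_ineq2)
      also have "\<dots> \<le> (M / 2 * t powr (- \<alpha>)) * norm (grad g x)" using that by (intro mult_right_mono) auto
      finally show ?thesis by simp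
    qed
    show "integrable lborel (\<lambda>x. heat u0 t x \<bullet> grad g x)"
      by (rule Bochner_Integration.integrable_bound[OF i], measurable, intro AE_I2 b heat_le t)
    show "integrable lborel (\<lambda>x. wpot (th t) sol x \<bullet> grad g x)"
      by (rule Bochner_Integration.integrable_bound[OF i], measurable, intro AE_I2 b W_le sol_bounded t)
  qed
  finally show "(LINT x|lebesgue. sol t x \<bullet> grad g x) = 0"
    using heat_div_free[OF div g t(1)] W_div_free[OF g] by simp
qed

end

subsection \<open>The weak equation\<close>

lemma fubini_bound:
  fixes F :: "'a \<Rightarrow> 'b \<Rightarrow> 'c::{banach, second_countable_topology}"
  assumes MN: "sigma_finite_measure M" "sigma_finite_measure N"
    and F: "case_prod F \<in> borel_measurable (M \<Otimes>\<^sub>M N)"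
    and b: "\<And>x. (\<integral>\<^sup>+w. ennreal (norm (F x w)) \<partial>N) \<le> ennreal (g x)" and g: "integrable M g"
  shows "integrable (M \<Otimes>\<^sub>M N) (case_prod F)" "integrable N (\<lambda>w. LINT x|M. F x w)"
    "(LINT x|M. LINT w|N. F x w) = (LINT w|N. LINT x|M. F x w)"
proof -
  interpret M: sigma_finite_measure M by fact
  interpret N: sigma_finite_measure N by fact
  interpret Q: pair_sigma_finite M N ..
  show i: "integrable (M \<Otimes>\<^sub>M N) (case_prod F)"
  proof (rule integrableI_bounded[OF F])
    have "(\<integral>\<^sup>+z. ennreal (norm (case_prod F z)) \<partial>(M \<Otimes>\<^sub>M N)) = (\<integral>\<^sup>+x. \<integral>\<^sup>+w. ennreal (norm (case_prod F (x, w))) \<partial>N \<partial>M)"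
      using F by (intro N.nn_integral_fst[symmetric]) simp
    also have "\<dots> = (\<integral>\<^sup>+x. \<integral>\<^sup>+w. ennreal (norm (F x w)) \<partial>N \<partial>M)" by simp
    also have "\<dots> \<le> (\<integral>\<^sup>+x. ennreal (norm (g x)) \<partial>M)"
      by (intro nn_integral_mono order_trans[OF b] ennreal_leI) simp
    also have "\<dots> < \<infinity>" using g by (simp add: integrable_iff_bounded)
    finally show "(\<integral>\<^sup>+z. ennreal (norm (case_prod F z)) \<partial>(M \<Otimes>\<^sub>M N)) < \<infinity>" .
  qed
  show "integrable N (\<lambda>w. LINT x|M. F x w)" by (rule Q.integrable_snd[OF i])
  show "(LINT x|M. LINT w|N. F x w) = (LINT w|N. LINT x|M. F x w)" by (rule Q.Fubini_integral[OF i, symmetric])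
qed

lemma nn_integral_product_bound:
  fixes F :: "'b \<Rightarrow> 'c::{banach, second_countable_topology}" and q :: "'b \<Rightarrow> real"
  assumes "integrable N q" "0 \<le> p" "\<And>w. norm (F w) \<le> p * q w"
  shows "(\<integral>\<^sup>+w. ennreal (norm (F w)) \<partial>N) \<le> ennreal (p * (LINT w|N. norm (q w)))"
proof -
  have [measurable]: "q \<in> borel_measurable N" using assms(1) by simp
  have "(\<integral>\<^sup>+w. ennreal (norm (F w)) \<partial>N) \<le> (\<integral>\<^sup>+w. ennreal p * ennreal (norm (q w)) \<partial>N)"
  proof (rule nn_integral_mono)
    fix w
    have "norm (F w) \<le> p * q w" by (rule assms)
    also have "\<dots> \<le> p * norm (q w)" using assms(2) by (intro mult_left_mono) auto
    finally show "ennreal (norm (F w)) \<le> ennreal p * ennreal (norm (q w))"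
      using assms(2) by (simp add: ennreal_mult[symmetric] ennreal_leI)
  qed
  also have "\<dots> = ennreal p * ennreal (LINT w|N. norm (q w))"
    by (subst nn_integral_cmult) (simp_all add: nn_integral_eq_integral integrable_norm assms(1))
  also have "\<dots> = ennreal (p * (LINT w|N. norm (q w)))"
    using assms(2) by (intro ennreal_mult[symmetric] Bochner_Integration.integral_nonneg) auto
  finally show ?thesis .
qed

lemma fubini_product_bound:
  fixes F :: "'a \<Rightarrow> 'b \<Rightarrow> 'c::{banach, second_countable_topology}" and p :: "'a \<Rightarrow> real" and q :: "'b \<Rightarrow> real"
  assumes MN: "sigma_finite_measure M" "sigma_finite_measure N"
    and F: "case_prod F \<in> borel_measurable (M \<Otimes>\<^sub>M N)"
    and b: "\<And>x w. norm (F x w) \<le> p x * q w" and p: "integrable M p" "\<And>x. 0 \<le> p x" and q: "integrable N q"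
  shows "integrable (M \<Otimes>\<^sub>M N) (case_prod F)" "integrable N (\<lambda>w. LINT x|M. F x w)"
    "(LINT x|M. LINT w|N. F x w) = (LINT w|N. LINT x|M. F x w)"
  by (rule fubini_bound[OF MN F nn_integral_product_bound[OF q p(2) b]]; use p(1) in simp)+

lemma test_swap_integrable:
  fixes q :: "space \<times> real \<Rightarrow> 'b::euclidean_space"
  assumes q: "q \<in> test_fun \<Omega>"
  shows "integrable (lborel \<Otimes>\<^sub>M lborel) (\<lambda>z. q (snd z, fst z))"
proof -
  have "integrable (lborel \<Otimes>\<^sub>M lborel) q" using test_fun_integrable[OF q] by (simp add: lborel_prod)
  from lborel_pair.integrable_product_swap[OF this] show ?thesis by (simp add: case_prod_beta')
qed

text \<open>\<open>oseen_duality\<close> in the order of integration in which it will be met: the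
  source and the heat time \<sigma> fixed outside, the observation point (t, x) inside. The
  substitution is \<sigma> = \<rho> + \<tau> with \<tau> = t - s, and \<open>th\<close> encodes
  \<rho> > 0 and \<tau> > 0.\<close>

lemma th_oseen_duality:
  assumes f: "f \<in> test_fun UNIV" and s: "0 < s"
  shows "(LINT \<sigma>|lborel. LINT z|(lborel \<Otimes>\<^sub>M lborel). th (fst z) s \<sigma> * (oseen \<sigma> (snd z - y) a \<bullet> heat_op f (snd z, fst z)))
    = dderiv (a, 0) (\<lambda>z. f z \<bullet> a) (y, s)
      + (LINT \<rho>|lborel. (LINT x|lborel. G2 \<rho> (x - y) a a * divergence f (x, s)) * indicator {0<..} \<rho>)"
proof -
  define h where "h = heat_op f"
  have h: "h \<in> test_fun UNIV" unfolding h_def by (rule heat_op_test[OF f])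
  note hm = test_fun_measurable[OF h]
  note [measurable (raw)] = measurable_pair_compose[OF hm] weight_measurable[OF th_weight]
  have th_m [measurable (raw)]: "(\<lambda>w. th (f w) s (g w)) \<in> borel_measurable P"
    if [measurable]: "f \<in> borel_measurable P" "g \<in> borel_measurable P" for P and f g :: "'z \<Rightarrow> real"
    unfolding th_def by measurable
  obtain B where B: "0 \<le> B" "\<And>z. norm (h z) \<le> B" using test_fun_bounded[OF h] by metis
  obtain K where K: "compact K" "\<And>z. z \<notin> K \<Longrightarrow> h z = 0" using test_fun_support[OF h] by blast
  have "bounded (snd ` K)" using compact_projections(2)[OF K(1)] by (rule compact_imp_bounded)
  then have "\<exists>c. \<forall>t\<in>snd ` K. norm t \<le> c" by (simp only: bounded_iff)
  then obtain c where c: "\<forall>t\<in>snd ` K. norm t \<le> c" ..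
  have h0: "h (x, t) = 0" if "c + 1 \<le> t" for x t
  proof (rule K(2), rule notin_projections(2))
    show "t \<notin> snd ` K"
    proof
      assume "t \<in> snd ` K"
      from bspec[OF c this] that show False by simp
    qed
  qed
  define Q where "Q \<sigma> t = (LINT x|lborel. oseen \<sigma> (x - y) a \<bullet> h (x, t))" for \<sigma> t
  have Qm [measurable (raw)]: "(\<lambda>w. Q (f w) (g w)) \<in> borel_measurable P"
    if [measurable]: "f \<in> borel_measurable P" "g \<in> borel_measurable P" for P and f g :: "'z \<Rightarrow> real"
    unfolding Q_def by measurable
  define A where "A = 60 * (norm a)\<^sup>2 * B"
  have A: "0 \<le> A" using B by (simp add: A_def)
  have Qb: "\<bar>Q \<sigma> t\<bar> \<le> A * \<sigma> powr (- 3 / 2)" if "0 < \<sigma>" for \<sigma> t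
    unfolding Q_def A_def by (rule oseen_test_bound(2)[OF B(2,1) hm that])
  have Q0: "Q \<sigma> t = 0" if "c + 1 \<le> t" for \<sigma> t unfolding Q_def using h0[OF that] by simp
  have inner: "(LINT z|(lborel \<Otimes>\<^sub>M lborel). th (fst z) s \<sigma> * (oseen \<sigma> (snd z - y) a \<bullet> h (snd z, fst z)))
     = (LINT t|lborel. th t s \<sigma> * Q \<sigma> t)" for \<sigma>
  proof (cases "0 < \<sigma>")
    case True
    have i: "integrable (lborel \<Otimes>\<^sub>M lborel) (\<lambda>z. th (fst z) s \<sigma> * (oseen \<sigma> (snd z - y) a \<bullet> h (snd z, fst z)))"
    proof (rule Bochner_Integration.integrable_bound)
      show "integrable (lborel \<Otimes>\<^sub>M lborel) (\<lambda>z. (60 * (norm a)\<^sup>2 * (\<sigma> powr (- 3 / 2) * (2 * \<sigma>) powr (- 3 / 2))) * norm (h (snd z, fst z)))"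
        using test_swap_integrable[OF h] by simp
      show "AE z in lborel \<Otimes>\<^sub>M lborel. norm (th (fst z) s \<sigma> * (oseen \<sigma> (snd z - y) a \<bullet> h (snd z, fst z)))
        \<le> norm ((60 * (norm a)\<^sup>2 * (\<sigma> powr (- 3 / 2) * (2 * \<sigma>) powr (- 3 / 2))) * norm (h (snd z, fst z)))"
      proof (rule AE_I2)
        fix z :: "real \<times> space"
        have "norm (th (fst z) s \<sigma> * (oseen \<sigma> (snd z - y) a \<bullet> h (snd z, fst z))) \<le> \<bar>oseen \<sigma> (snd z - y) a \<bullet> h (snd z, fst z)\<bar>"
          by (simp add: th_def)
        also have "\<dots> \<le> norm (oseen \<sigma> (snd z - y) a) * norm (h (snd z, fst z))"
          by (rule Cauchy_Schwarz_ineq2)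
        also have "\<dots> \<le> (60 * (norm a)\<^sup>2 * (\<sigma> powr (- 3 / 2) * (2 * \<sigma>) powr (- 3 / 2))) * norm (h (snd z, fst z))"
        proof (rule mult_right_mono)
          have "gauss (2 * \<sigma>) (snd z - y) \<le> (2 * \<sigma>) powr (- 3 / 2)" using True by (intro gauss_le) simp
          then have "60 * (norm a)\<^sup>2 * (\<sigma> powr (- 3 / 2) * gauss (2 * \<sigma>) (snd z - y)) \<le> 60 * (norm a)\<^sup>2 * (\<sigma> powr (- 3 / 2) * (2 * \<sigma>) powr (- 3 / 2))"
            by (intro mult_left_mono) auto
          then show "norm (oseen \<sigma> (snd z - y) a) \<le> 60 * (norm a)\<^sup>2 * (\<sigma> powr (- 3 / 2) * (2 * \<sigma>) powr (- 3 / 2))"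
            using oseen_le[OF True, of "snd z - y" a] by (rule order_trans[rotated])
        qed simp
        finally show "norm (th (fst z) s \<sigma> * (oseen \<sigma> (snd z - y) a \<bullet> h (snd z, fst z)))
          \<le> norm ((60 * (norm a)\<^sup>2 * (\<sigma> powr (- 3 / 2) * (2 * \<sigma>) powr (- 3 / 2))) * norm (h (snd z, fst z)))"
          unfolding real_norm_def by (rule order_trans[OF _ abs_ge_self])
      qed
    qed measurable
    show ?thesis using lborel_pair.integral_fst'[OF i] by (simp add: Q_def)
  next
    case False
    then have "th t s \<sigma> = 0" for t by (auto simp: th_def)
    then show ?thesis by simp
  qed
  \<comment> \<open>The singularity (t - s)^(-1/2) comes from the \<sigma>-integral
    \<open>th_inner\<close>; the cut at time c + 1, past the support of \<open>h\<close>, makes it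
    integrable.\<close>
  define g where "g t = (2 * A) * ((t - s) powr - (1/2) * indicator {0<..<c + 1 - s} (t - s))" for t
  have "integrable lborel (\<lambda>\<tau>::real. \<tau> powr - (1/2) * indicator {0<..<c + 1 - s} \<tau>)"
  proof (rule integrableI_bounded)
    have "(\<integral>\<^sup>+\<tau>. ennreal (norm (\<tau> powr - (1/2) * indicator {0<..<c + 1 - s} \<tau>)) \<partial>lborel)
      \<le> (\<integral>\<^sup>+\<tau>. ennreal (\<tau> powr - (1/2)) * indicator {0<..<\<bar>c + 1 - s\<bar> + 1} \<tau> \<partial>lborel)"
      by (intro nn_integral_mono) (auto simp: indicator_def)
    also have "\<dots> < \<infinity>" by (subst nn_integral_powr_near_0) auto
    finally show "(\<integral>\<^sup>+\<tau>. ennreal (norm (\<tau> powr - (1/2) * indicator {0<..<c + 1 - s} \<tau>)) \<partial>lborel) < \<infinity>" .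
  qed measurable
  from lborel_integrable_real_affine[OF this, of 1 "- s"]
  have gi: "integrable lborel g" unfolding g_def[abs_def] by (simp add: add.commute)
  have gb: "(\<integral>\<^sup>+\<sigma>. ennreal (norm (th t s \<sigma> * Q \<sigma> t)) \<partial>lborel) \<le> ennreal (g t)" for t
  proof (cases "s < t \<and> t < c + 1")
    case True
    have "(\<integral>\<^sup>+\<sigma>. ennreal (norm (th t s \<sigma> * Q \<sigma> t)) \<partial>lborel)
      \<le> (\<integral>\<^sup>+\<sigma>. ennreal A * ennreal (\<bar>th t s \<sigma>\<bar> * \<sigma> powr (- 3 / 2) * s powr (- 0)) \<partial>lborel)"
    proof (rule nn_integral_mono)
      fix \<sigma>
      have "norm (th t s \<sigma> * Q \<sigma> t) \<le> A * (\<bar>th t s \<sigma>\<bar> * \<sigma> powr (- 3 / 2) * s powr (- 0))"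
      proof (cases "th t s \<sigma> = 0")
        case False
        then have "0 < \<sigma>" "th t s \<sigma> = 1" by (auto simp: th_def split: if_splits)
        then show ?thesis using Qb[of \<sigma> t] s by simp
      qed simp
      then show "ennreal (norm (th t s \<sigma> * Q \<sigma> t)) \<le> ennreal A * ennreal (\<bar>th t s \<sigma>\<bar> * \<sigma> powr (- 3 / 2) * s powr (- 0))"
        using A by (simp only: ennreal_mult'[symmetric] ennreal_leI)
    qed
    also have "\<dots> = ennreal A * (ennreal 2 * (ennreal (s powr - 0 * (t - s) powr - (1/2)) * indicator {0<..<t} s))"
      unfolding th_inner[symmetric] by (rule nn_integral_cmult) measurable
    also have "\<dots> = ennreal (A * (2 * (s powr - 0 * (t - s) powr - (1/2))))"
      using True s A by (simp add: ennreal_mult')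
    also have "A * (2 * (s powr - 0 * (t - s) powr - (1/2))) = g t"
      using True s by (simp add: g_def)
    finally show ?thesis .
  next
    case False
    then have z: "norm (th t s \<sigma> * Q \<sigma> t) = 0" for \<sigma> using Q0[of t \<sigma>] by (auto simp: th_def not_less)
    show ?thesis unfolding z by simp
  qed
  have Fm: "(\<lambda>(t, \<sigma>). th t s \<sigma> * Q \<sigma> t) \<in> borel_measurable (lborel \<Otimes>\<^sub>M lborel)" by measurable
  note sf = lborel.sigma_finite_measure_axioms
  define E where "E \<tau> = (LINT \<rho>|lborel. Q (\<rho> + \<tau>) (s + \<tau>) * indicator {0<..} \<rho>) * indicator {0<..} \<tau>" for \<tau>
  have Em: "(\<lambda>\<tau>. E \<tau>) \<in> borel_measurable borel" unfolding E_def by measurable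
  have shift: "(LINT \<sigma>|lborel. th t s \<sigma> * Q \<sigma> t) = E (t - s)" for t
  proof (cases "s < t")
    case True
    have "(LINT \<sigma>|lborel. th t s \<sigma> * Q \<sigma> t) = (LINT \<rho>|lborel. th t s (\<rho> + (t - s)) * Q (\<rho> + (t - s)) t)"
      by (rule integral_translate[symmetric]) measurable
    also have "\<dots> = (LINT \<rho>|lborel. Q (\<rho> + (t - s)) (s + (t - s)) * indicator {0<..} \<rho>)"
      using True s by (intro Bochner_Integration.integral_cong) (auto simp: th_def)
    finally show ?thesis using True by (simp add: E_def)
  next
    case False
    then have "th t s \<sigma> = 0" for \<sigma> by (simp add: th_def)
    then show ?thesis using False by (simp add: E_def)
  qed
  have "(LINT \<sigma>|lborel. LINT z|(lborel \<Otimes>\<^sub>M lborel). th (fst z) s \<sigma> * (oseen \<sigma> (snd z - y) a \<bullet> h (snd z, fst z)))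
     = (LINT \<sigma>|lborel. LINT t|lborel. th t s \<sigma> * Q \<sigma> t)" by (simp only: inner)
  also have "\<dots> = (LINT t|lborel. LINT \<sigma>|lborel. th t s \<sigma> * Q \<sigma> t)"
    by (rule fubini_bound(3)[OF sf sf Fm gb gi, symmetric])
  also have "\<dots> = (LINT t|lborel. E (t - s))" by (simp only: shift)
  also have "\<dots> = (LINT \<tau>|lborel. E \<tau>)"
    using integral_translate[OF Em, of "- s"] by simp
  also have "\<dots> = dderiv (a, 0) (\<lambda>z. f z \<bullet> a) (y, s)
      + (LINT \<rho>|lborel. (LINT x|lborel. G2 \<rho> (x - y) a a * divergence f (x, s)) * indicator {0<..} \<rho>)"
    unfolding E_def Q_def h_def by (rule oseen_duality[OF f])
  finally show ?thesis unfolding h_def .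
qed

lemma heat_op_eq_0:
  assumes K: "compact K" "\<And>z. z \<notin> K \<Longrightarrow> f z = 0" and z: "z \<notin> K"
  shows "heat_op f z = 0"
proof -
  have 1: "dderiv v f w = 0" if "w \<notin> K" for v w by (rule dderiv_eq_0[OF K that])
  have "dderiv v (dderiv v' f) z = 0" for v v' by (rule dderiv_eq_0[OF K(1) 1 z])
  then show ?thesis using 1[OF z] by (simp add: heat_op_def dt_def dx_def)
qed

lemma divergence_eq_0:
  assumes K: "compact K" "\<And>z. z \<notin> K \<Longrightarrow> f z = 0" and z: "z \<notin> K"
  shows "divergence f z = 0"
  using dderiv_eq_0[OF K z] by (simp add: divergence_def dx_def)

section \<open>Weak form of the heat flow, the quadratic term and the pressure\<close>

context picard
begin

text \<open>After an exchange of integrals each source point \<open>y\<close> contributes a Gaussian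
  against \<open>heat_op\<close> of a scalar test function, and \<open>heat_identity\<close>
  evaluates this at a time before the support of \<open>f\<close>. Thus the heat flow drops out of
  the weak equation.\<close>

lemma heat_test_0:
  assumes f: "f \<in> test_fun UNIV" and a: "0 < a" and f0: "\<And>x t. t < a \<Longrightarrow> f (x, t) = 0 \<and> heat_op f (x, t) = 0"
  shows "integrable (lborel \<Otimes>\<^sub>M lborel) (\<lambda>z. heat u0 (fst z) (snd z) \<bullet> heat_op f (snd z, fst z))"
    "(LINT z|(lborel \<Otimes>\<^sub>M lborel). heat u0 (fst z) (snd z) \<bullet> heat_op f (snd z, fst z)) = 0"
proof -
  define h where "h = heat_op f"
  have h: "h \<in> test_fun UNIV" unfolding h_def by (rule heat_op_test[OF f])
  note [measurable (raw)] = measurable_pair_compose[OF test_fun_measurable[OF h]] field_measurable[OF field_heat[OF u0]]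
  have h0: "h (x, t) = 0" if "t < a" for x t using f0[OF that] by (simp add: h_def)
  define c where "c = M / 2 * a powr (- \<alpha>)"
  have c: "0 \<le> c" using M by (simp add: c_def)
  have cb: "M / 2 * t powr (- \<alpha>) \<le> c" if "a \<le> t" for t
    unfolding c_def using M a \<alpha> that by (intro mult_left_mono powr_mono2') auto
  have i: "integrable (lborel \<Otimes>\<^sub>M lborel) (\<lambda>z. c * norm (h (snd z, fst z)))"
    using test_swap_integrable[OF h] by simp
  show "integrable (lborel \<Otimes>\<^sub>M lborel) (\<lambda>z. heat u0 (fst z) (snd z) \<bullet> heat_op f (snd z, fst z))"
    unfolding h_def[symmetric]
  proof (rule Bochner_Integration.integrable_bound[OF i _ AE_I2])
    fix z :: "real \<times> space"
    show "norm (heat u0 (fst z) (snd z) \<bullet> h (snd z, fst z)) \<le> norm (c * norm (h (snd z, fst z)))"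
    proof (cases "fst z < a")
      case False
      have "norm (heat u0 (fst z) (snd z) \<bullet> h (snd z, fst z)) \<le> norm (heat u0 (fst z) (snd z)) * norm (h (snd z, fst z))"
        by (simp add: Cauchy_Schwarz_ineq2)
      also have "\<dots> \<le> c * norm (h (snd z, fst z))"
        using a False by (intro mult_right_mono order_trans[OF heat_le cb]) auto
      finally show ?thesis using c by simp
    qed (simp add: h0)
  qed measurable
  define F where "F z y = gauss (fst z) (snd z - y) * (u0 y \<bullet> h (snd z, fst z))" for z :: "real \<times> space" and y
  have Fm: "case_prod F \<in> borel_measurable ((lborel \<Otimes>\<^sub>M lborel) \<Otimes>\<^sub>M lborel)"
    unfolding F_def by measurable
  have Fb: "(\<integral>\<^sup>+y. ennreal (norm (F z y)) \<partial>lborel) \<le> ennreal (c * norm (h (snd z, fst z)))" for z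
  proof (cases "fst z < a")
    case False
    have "(\<integral>\<^sup>+y. ennreal (norm (F z y)) \<partial>lborel) \<le> (\<integral>\<^sup>+y. ennreal (gauss (fst z) (snd z - y) * norm (u0 y)) * ennreal (norm (h (snd z, fst z))) \<partial>lborel)"
    proof (rule nn_integral_mono)
      fix y
      have "norm (F z y) \<le> gauss (fst z) (snd z - y) * (norm (u0 y) * norm (h (snd z, fst z)))"
        unfolding F_def by (simp add: abs_mult mult_left_mono Cauchy_Schwarz_ineq2)
      then show "ennreal (norm (F z y)) \<le> ennreal (gauss (fst z) (snd z - y) * norm (u0 y)) * ennreal (norm (h (snd z, fst z)))"
        by (simp add: ennreal_mult[symmetric] ennreal_leI mult.assoc)
    qed
    also have "\<dots> = (\<integral>\<^sup>+y. ennreal (gauss (fst z) (snd z - y) * norm (u0 y)) \<partial>lborel) * ennreal (norm (h (snd z, fst z)))"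
      by (rule nn_integral_multc) measurable
    also have "\<dots> \<le> ennreal c * ennreal (norm (h (snd z, fst z)))"
      using a False by (intro mult_right_mono order_trans[OF pot ennreal_leI[OF cb]]) auto
    finally show ?thesis using c by (simp add: ennreal_mult)
  next
    case True
    have z: "norm (F z y) = 0" for y using True by (simp add: F_def h0)
    show ?thesis unfolding z by simp
  qed
  note fub = fubini_bound[OF sigma_finite_M2 lborel.sigma_finite_measure_axioms Fm Fb i]
  have "(LINT z|(lborel \<Otimes>\<^sub>M lborel). heat u0 (fst z) (snd z) \<bullet> h (snd z, fst z)) = (LINT z|(lborel \<Otimes>\<^sub>M lborel). LINT y|lborel. F z y)"
  proof (rule Bochner_Integration.integral_cong[OF refl])
    fix z :: "real \<times> space"
    show "heat u0 (fst z) (snd z) \<bullet> h (snd z, fst z) = (LINT y|lborel. F z y)"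
    proof (cases "fst z < a")
      case False
      have "heat u0 (fst z) (snd z) \<bullet> h (snd z, fst z) = (LINT y|lborel. (gauss (fst z) (snd z - y) *\<^sub>R u0 y) \<bullet> h (snd z, fst z))"
        unfolding heat_def using a False by (intro integral_inner_left[symmetric] heat_integrable) auto
      then show ?thesis by (simp add: F_def)
    qed (simp add: F_def h0)
  qed
  also have "\<dots> = (LINT y|lborel. LINT z|(lborel \<Otimes>\<^sub>M lborel). F z y)" by (rule fub(3))
  also have "\<dots> = (LINT y|(lborel :: space measure). 0 :: real)"
  proof (rule Bochner_Integration.integral_cong[OF refl])
    fix y :: space
    define q where "q = (\<lambda>z. f z \<bullet> u0 y)"
    have q: "q \<in> test_fun UNIV" unfolding q_def by (rule test_fun_inner[OF f])
    have hq: "heat_op q z = h z \<bullet> u0 y" for z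
      unfolding q_def h_def by (subst heat_op_bounded_linear[OF bounded_linear_inner_left test_fun_smooth[OF f]]) simp
    have iF: "integrable (lborel \<Otimes>\<^sub>M lborel) (\<lambda>z. F z y)"
    proof (rule Bochner_Integration.integrable_bound[OF _ _ AE_I2])
      show "integrable (lborel \<Otimes>\<^sub>M lborel) (\<lambda>z. (a powr (- 3 / 2) * norm (u0 y)) * norm (h (snd z, fst z)))"
        using test_swap_integrable[OF h] by simp
      show "(\<lambda>z. F z y) \<in> borel_measurable (lborel \<Otimes>\<^sub>M lborel)" unfolding F_def by measurable
      fix z :: "real \<times> space"
      show "norm (F z y) \<le> norm ((a powr (- 3 / 2) * norm (u0 y)) * norm (h (snd z, fst z)))"
      proof (cases "fst z < a")
        case False
        have "gauss (fst z) (snd z - y) \<le> fst z powr (- 3 / 2)" using a False by (intro gauss_le) simp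
        also have "\<dots> \<le> a powr (- 3 / 2)" using a False by (intro powr_mono2') auto
        finally have g: "gauss (fst z) (snd z - y) \<le> a powr (- 3 / 2)" .
        have "norm (F z y) = gauss (fst z) (snd z - y) * \<bar>u0 y \<bullet> h (snd z, fst z)\<bar>"
          unfolding F_def by (simp add: abs_mult)
        also have "\<dots> \<le> a powr (- 3 / 2) * (norm (u0 y) * norm (h (snd z, fst z)))"
          by (rule mult_mono[OF g Cauchy_Schwarz_ineq2]) auto
        finally show ?thesis by (simp add: mult.assoc)
      qed (simp add: F_def h0)
    qed
    define R where "R t = (LINT x|lborel. gauss t (x - y) * heat_op q (x, t))" for t
    note [measurable (raw)] = measurable_pair_compose[OF test_fun_measurable[OF heat_op_test[OF q]]]
    have Rm: "(\<lambda>t. R t) \<in> borel_measurable borel" unfolding R_def by measurable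
    have "(LINT z|(lborel \<Otimes>\<^sub>M lborel). F z y) = (LINT t|lborel. LINT x|lborel. F (t, x) y)"
      using lborel_pair.integral_fst'[OF iF] by simp
    also have "\<dots> = (LINT t|lborel. R t)" by (simp add: F_def R_def hq inner_commute)
    \<comment> \<open>Starting the clock at a/2 keeps the Gaussian away from its singular time 0,
      and nothing is lost because \<open>h\<close> vanishes before time \<open>a\<close>.\<close>
    also have "\<dots> = (LINT \<tau>|lborel. R (\<tau> + a / 2))" by (rule integral_translate[OF Rm, symmetric])
    also have "\<dots> = (LINT \<tau>|lborel. (LINT x|lborel. gauss (a / 2 + \<tau>) (x - y) * heat_op q (x, a / 2 + \<tau>)) * indicator {0<..} \<tau>)"
    proof (rule Bochner_Integration.integral_cong[OF refl])
      fix \<tau> :: real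
      show "R (\<tau> + a / 2) = (LINT x|lborel. gauss (a / 2 + \<tau>) (x - y) * heat_op q (x, a / 2 + \<tau>)) * indicator {0<..} \<tau>"
        using a h0 by (cases "0 < \<tau>") (simp_all add: R_def hq add.commute)
    qed
    also have "\<dots> = - (LINT x|lborel. gauss (a / 2) (x - y) * q (x, a / 2))"
      using a by (intro heat_identity[OF q]) simp
    also have "\<dots> = 0" using a f0 by (simp add: q_def)
    finally show "(LINT z|(lborel \<Otimes>\<^sub>M lborel). F z y) = 0" .
  qed
  finally show "(LINT z|(lborel \<Otimes>\<^sub>M lborel). heat u0 (fst z) (snd z) \<bullet> heat_op f (snd z, fst z)) = 0"
    unfolding h_def by simp
qed

text \<open>Set to 0 at nonpositive times, because there the weight \<open>th\<close> admits no
  source; likewise in \<open>press_term\<close>.\<close>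

definition transport :: "(space \<times> real \<Rightarrow> space) \<Rightarrow> real \<times> space \<Rightarrow> real" where
  "transport f z = (if 0 < fst z then sol (fst z) (snd z) \<bullet> advect (sol (fst z) (snd z)) f (snd z, fst z) else 0)"

text \<open>The pressure term in its dual form, where the kernel acts on the divergence of
  \<open>f\<close>; \<open>press_test\<close> moves it over to the velocity.\<close>

definition press_term :: "(space \<times> real \<Rightarrow> space) \<Rightarrow> real \<times> space \<Rightarrow> real" where
  "press_term f z = (if 0 < fst z then LINT \<rho>|lborel. (LINT x|lborel. G2 \<rho> (x - snd z) (sol (fst z) (snd z)) (sol (fst z) (snd z))
      * divergence f (x, fst z)) * indicator {0<..} \<rho> else 0)"

text \<open>The exponent 1/2 - 2\<alpha> is negative for \<alpha> > 1/4 and nonnegative otherwise.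
  The sum of the powers at both endpoints covers the two cases.\<close>

lemma Th_th_bounded:
  assumes "0 < a" "a \<le> t" "t \<le> b"
  shows "Th (2 * \<alpha>) (th t) \<le> ennreal (2 * beta1 (2 * \<alpha>) * (a powr (1/2 - 2 * \<alpha>) + b powr (1/2 - 2 * \<alpha>)))"
proof -
  have \<alpha>2: "0 \<le> 2 * \<alpha>" "2 * \<alpha> < 1" using \<alpha> by auto
  have "t powr e \<le> a powr e + b powr e" for e
  proof (cases "0 \<le> e")
    case True
    have "t powr e \<le> b powr e" using True assms by (intro powr_mono2) auto
    then show ?thesis by (rule order_trans) simp
  next
    case False
    have "t powr e \<le> a powr e" using False assms by (intro powr_mono2') auto
    then show ?thesis by (rule order_trans) simp
  qed
  then show ?thesis
    using assms beta1(2)[OF \<alpha>2] by (subst Th_th_eq[OF \<alpha>2]) (auto intro!: ennreal_leI mult_left_mono)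
qed

text \<open>The observation point is integrated first, at fixed source and heat time. The integral
  over \<sigma> is then \<open>th_oseen_duality\<close> with the velocity at the source in place of
  \<open>a\<close>; that identity holds for every fixed vector, so the nonlinearity causes no
  further difficulty.\<close>

lemma wpot_test:
  assumes f: "f \<in> test_fun UNIV" and a: "0 < a" and f0: "\<And>x t. t \<notin> {a..b} \<Longrightarrow> heat_op f (x, t) = 0"
  shows "integrable (lborel \<Otimes>\<^sub>M lborel) (\<lambda>z. wpot (th (fst z)) sol (snd z) \<bullet> heat_op f (snd z, fst z))"
    "integrable (lborel \<Otimes>\<^sub>M lborel) (\<lambda>z. transport f z + press_term f z)"
    "(LINT z|(lborel \<Otimes>\<^sub>M lborel). wpot (th (fst z)) sol (snd z) \<bullet> heat_op f (snd z, fst z))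
      = (LINT z|(lborel \<Otimes>\<^sub>M lborel). transport f z + press_term f z)"
proof -
  define h where "h = heat_op f"
  have h: "h \<in> test_fun UNIV" unfolding h_def by (rule heat_op_test[OF f])
  note [measurable (raw)] = measurable_pair_compose[OF test_fun_measurable[OF h]]
    field_measurable[OF bounded_fieldD(1)[OF sol_bounded]]
  have h0: "h (x, t) = 0" if "t \<notin> {a..b}" for x t using f0[OF that] by (simp add: h_def)
  define c where "c = 60 * M * M * (2 * beta1 (2 * \<alpha>) * (a powr (1/2 - 2 * \<alpha>) + b powr (1/2 - 2 * \<alpha>)))"
  have b1: "0 \<le> beta1 (2 * \<alpha>)" using beta1(2)[of "2 * \<alpha>"] \<alpha> by simp
  have c: "0 \<le> c" using M b1 by (simp add: c_def)
  have i: "integrable (lborel \<Otimes>\<^sub>M lborel) (\<lambda>z. c * norm (h (snd z, fst z)))"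
    using test_swap_integrable[OF h] by simp
  define F where "F z w = oz (th (fst z)) sol (snd z) w \<bullet> h (snd z, fst z)" for z :: "real \<times> space" and w
  have Fm: "case_prod F \<in> borel_measurable ((lborel \<Otimes>\<^sub>M lborel) \<Otimes>\<^sub>M M3)"
    unfolding F_def oz_def th_def by measurable
  have Fb: "(\<integral>\<^sup>+w. ennreal (norm (F z w)) \<partial>M3) \<le> ennreal (c * norm (h (snd z, fst z)))" for z
  proof (cases "fst z \<in> {a..b}")
    case True
    note [measurable] = oz_measurable[OF th_weight bounded_fieldD(1)[OF sol_bounded]]
    have "(\<integral>\<^sup>+w. ennreal (norm (F z w)) \<partial>M3) \<le> (\<integral>\<^sup>+w. ennreal (norm (oz (th (fst z)) sol (snd z) w)) * ennreal (norm (h (snd z, fst z))) \<partial>M3)"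
      unfolding F_def by (intro nn_integral_mono) (simp add: ennreal_mult[symmetric] ennreal_leI Cauchy_Schwarz_ineq2)
    also have "\<dots> = (\<integral>\<^sup>+w. ennreal (norm (oz (th (fst z)) sol (snd z) w)) \<partial>M3) * ennreal (norm (h (snd z, fst z)))"
      by (rule nn_integral_multc) measurable
    also have "\<dots> \<le> (ennreal (60 * M * M) * ennreal (2 * beta1 (2 * \<alpha>) * (a powr (1/2 - 2 * \<alpha>) + b powr (1/2 - 2 * \<alpha>)))) * ennreal (norm (h (snd z, fst z)))"
      using a True by (intro mult_right_mono order_trans[OF oz_nn_le mult_left_mono[OF Th_th_bounded]]) auto
    also have "\<dots> = ennreal c * ennreal (norm (h (snd z, fst z)))"
      unfolding c_def using M b1 by (subst ennreal_mult[symmetric]) auto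
    finally show ?thesis using c by (simp add: ennreal_mult)
  next
    case False
    have z: "norm (F z w) = 0" for w using False by (simp add: F_def h0)
    show ?thesis unfolding z by simp
  qed
  interpret M2: sigma_finite_measure "(lborel :: real measure) \<Otimes>\<^sub>M (lborel :: space measure)" by (rule sigma_finite_M2)
  interpret M3: sigma_finite_measure M3 by (rule sigma_finite_M3)
  interpret Q: pair_sigma_finite "(lborel :: real measure) \<Otimes>\<^sub>M (lborel :: space measure)" M3 ..
  interpret Q3: pair_sigma_finite "(lborel :: real measure) \<Otimes>\<^sub>M (lborel :: space measure)" "lborel :: real measure" ..
  note fub = fubini_bound[OF sigma_finite_M2 sigma_finite_M3 Fm Fb i]
  have W: "wpot (th (fst z)) sol (snd z) \<bullet> h (snd z, fst z) = (LINT w|M3. F z w)" for z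
    unfolding wpot_def F_def by (rule integral_inner_left[OF oz_integrable, symmetric])
  show "integrable (lborel \<Otimes>\<^sub>M lborel) (\<lambda>z. wpot (th (fst z)) sol (snd z) \<bullet> heat_op f (snd z, fst z))"
    unfolding h_def[symmetric] W by (rule Q.integrable_fst[OF fub(1)])
  define J where "J w = (LINT z|(lborel \<Otimes>\<^sub>M lborel). F z w)" for w
  have iJ: "integrable M3 J" unfolding J_def by (rule fub(2))
  have Jeq: "(LINT \<sigma>|lborel. J (v, \<sigma>)) = transport f v + press_term f v" for v
  proof -
    obtain s y where v: "v = (s, y)" by (metis surj_pair)
    show ?thesis
    proof (cases "0 < s")
      case True
      have "(LINT \<sigma>|lborel. J (v, \<sigma>)) = (LINT \<sigma>|lborel. LINT z|(lborel \<Otimes>\<^sub>M lborel). th (fst z) s \<sigma> * (oseen \<sigma> (snd z - y) (sol s y) \<bullet> heat_op f (snd z, fst z)))"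
        by (simp add: J_def F_def oz_def v h_def)
      also have "\<dots> = dderiv (sol s y, 0) (\<lambda>z. f z \<bullet> sol s y) (y, s)
        + (LINT \<rho>|lborel. (LINT x|lborel. G2 \<rho> (x - y) (sol s y) (sol s y) * divergence f (x, s)) * indicator {0<..} \<rho>)"
        by (rule th_oseen_duality[OF f True])
      also have "dderiv (sol s y, 0) (\<lambda>z. f z \<bullet> sol s y) (y, s) = transport f v"
        unfolding dderiv_inner[OF test_fun_smooth[OF f]] dderiv_axis[OF test_fun_smooth[OF f]]
        using True by (simp add: transport_def advect_def v inner_commute)
      finally show ?thesis using True by (simp add: press_term_def v)
    next
      case False
      have "J (v, \<sigma>) = 0" for \<sigma> using False by (simp add: J_def F_def oz_def v th_def)
      then show ?thesis using False by (simp add: transport_def press_term_def v)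
    qed
  qed
  show "integrable (lborel \<Otimes>\<^sub>M lborel) (\<lambda>z. transport f z + press_term f z)"
    using Q3.integrable_fst'[OF iJ] by (simp add: Jeq)
  have "(LINT z|(lborel \<Otimes>\<^sub>M lborel). LINT w|M3. F z w) = (LINT w|M3. J w)"
    unfolding J_def by (rule fub(3))
  also have "\<dots> = (LINT v|(lborel \<Otimes>\<^sub>M lborel). LINT \<sigma>|lborel. J (v, \<sigma>))"
    by (rule Q3.integral_fst'[OF iJ, symmetric])
  finally show "(LINT z|(lborel \<Otimes>\<^sub>M lborel). wpot (th (fst z)) sol (snd z) \<bullet> heat_op f (snd z, fst z))
      = (LINT z|(lborel \<Otimes>\<^sub>M lborel). transport f z + press_term f z)"
    unfolding h_def[symmetric] W by (simp only: Jeq)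
qed

text \<open>The triple integral over x, y and \<rho> need not converge absolutely, as the kernel has
  L^1 norm of order 1/\<rho>. Hence three exchanges: y with \<rho> once x has been integrated, x
  with y at fixed \<rho>, and x with \<rho> once y has been integrated. In the first and the last
  the inner integral is controlled by \<open>major\<close>.\<close>

lemma press_test:
  fixes g :: "space \<times> real \<Rightarrow> real"
  assumes g: "g \<in> test_fun UNIV" and s: "0 < s" "s < T"
  shows "(LINT y|lborel. LINT \<rho>|lborel. (LINT x|lborel. G2 \<rho> (x - y) (sol s y) (sol s y) * g (x, s)) * indicator {0<..} \<rho>)
    = (LINT x|lborel. press (x, s) * g (x, s))"
proof -
  note [measurable (raw)] = measurable_pair_compose[OF test_fun_measurable[OF g]]
    field_measurable[OF bounded_fieldD(1)[OF sol_bounded]]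
  note sf = lborel.sigma_finite_measure_axioms
  obtain C where C: "0 \<le> C" "\<And>\<rho> y t a. 0 < \<rho> \<Longrightarrow> \<bar>LINT x|lborel. G2 \<rho> (x - y) a a * g (x, t)\<bar> \<le> C * (norm a)\<^sup>2 * major \<rho>"
    using G2_test_bound[OF g] by blast
  note gi = test_slice_integrable[OF g, of s]
  define F where "F y \<rho> = (LINT x|lborel. G2 \<rho> (x - y) (sol s y) (sol s y) * g (x, s)) * indicator {0<..} \<rho>" for y \<rho>
  have Fm: "case_prod F \<in> borel_measurable (lborel \<Otimes>\<^sub>M lborel)" unfolding F_def by measurable
  have Fb: "norm (F y \<rho>) \<le> (C * (norm (sol s y))\<^sup>2) * major \<rho>" for y \<rho>
    using C(1) C(2)[of \<rho> y "sol s y" s] by (cases "0 < \<rho>") (auto simp: F_def)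
  have iC: "integrable lborel (\<lambda>y. C * (norm (sol s y))\<^sup>2)" using sol_L2(1)[OF s(1)] by simp
  have swap1: "(LINT y|lborel. LINT \<rho>|lborel. F y \<rho>) = (LINT \<rho>|lborel. LINT y|lborel. F y \<rho>)"
    by (rule fubini_product_bound(3)[OF sf sf Fm Fb iC _ major_integrable]) (use C(1) in simp)
  define E where "E x \<rho> = pr \<rho> x s * indicator {0<..} \<rho> * g (x, s)" for x \<rho>
  have Em: "case_prod E \<in> borel_measurable (lborel \<Otimes>\<^sub>M lborel)" unfolding E_def by measurable
  have Eb: "norm (E x \<rho>) \<le> (Cp s * norm (g (x, s))) * major \<rho>" for x \<rho>
  proof (cases "0 < \<rho>")
    case True
    have "\<bar>pr \<rho> x s\<bar> * \<bar>g (x, s)\<bar> \<le> (Cp s * major \<rho>) * \<bar>g (x, s)\<bar>"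
      by (intro mult_right_mono pr_bound s True) simp
    then show ?thesis using True by (simp add: E_def abs_mult mult_ac)
  qed (use Cp_nonneg[of s] in \<open>simp add: E_def\<close>)
  have iE: "integrable lborel (\<lambda>x. Cp s * norm (g (x, s)))" using gi by simp
  have swap3: "(LINT x|lborel. LINT \<rho>|lborel. E x \<rho>) = (LINT \<rho>|lborel. LINT x|lborel. E x \<rho>)"
    by (rule fubini_product_bound(3)[OF sf sf Em Eb iE _ major_integrable]) (use Cp_nonneg[of s] in simp)
  have swap2: "(LINT y|lborel. F y \<rho>) = (LINT x|lborel. E x \<rho>)" for \<rho>
  proof (cases "0 < \<rho>")
    case r: True
    define D where "D x y = G2 \<rho> (x - y) (sol s y) (sol s y) * g (x, s)" for x y
    have Dm: "case_prod D \<in> borel_measurable (lborel \<Otimes>\<^sub>M lborel)" unfolding D_def by measurable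
    have Db: "norm (D x y) \<le> norm (g (x, s)) * (14 * ((2 * \<rho>) powr (- 3 / 2) / \<rho>) * (norm (sol s y))\<^sup>2)" for x y
    proof -
      have gb: "gauss (2 * \<rho>) (x - y) \<le> (2 * \<rho>) powr (- 3 / 2)" using r by (intro gauss_le) simp
      have "\<bar>G2 \<rho> (x - y) (sol s y) (sol s y)\<bar> \<le> 14 * (norm (sol s y))\<^sup>2 * (gauss (2 * \<rho>) (x - y) / \<rho>)"
        by (rule G2_le[OF r])
      also have "\<dots> \<le> 14 * (norm (sol s y))\<^sup>2 * ((2 * \<rho>) powr (- 3 / 2) / \<rho>)"
        using r by (intro mult_left_mono divide_right_mono gb) auto
      finally have "\<bar>G2 \<rho> (x - y) (sol s y) (sol s y)\<bar> * \<bar>g (x, s)\<bar> \<le> 14 * (norm (sol s y))\<^sup>2 * ((2 * \<rho>) powr (- 3 / 2) / \<rho>) * \<bar>g (x, s)\<bar>"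
        by (rule mult_right_mono) simp
      then show ?thesis by (simp add: D_def abs_mult mult_ac)
    qed
    have iD: "integrable lborel (\<lambda>y. 14 * ((2 * \<rho>) powr (- 3 / 2) / \<rho>) * (norm (sol s y))\<^sup>2)"
      using sol_L2(1)[OF s(1)] by simp
    have "(LINT y|lborel. F y \<rho>) = (LINT y|lborel. LINT x|lborel. D x y)"
      using r by (simp add: F_def D_def)
    also have "\<dots> = (LINT x|lborel. LINT y|lborel. D x y)"
      by (rule fubini_product_bound(3)[OF sf sf Dm Db integrable_norm[OF gi] _ iD, symmetric]) simp
    also have "\<dots> = (LINT x|lborel. E x \<rho>)"
      using r by (simp add: D_def E_def pr_def)
    finally show ?thesis .
  qed (simp add: F_def E_def)
  have "(LINT y|lborel. LINT \<rho>|lborel. F y \<rho>) = (LINT x|lborel. LINT \<rho>|lborel. E x \<rho>)"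
    unfolding swap1 swap3 swap2 ..
  also have "\<dots> = (LINT x|lborel. press (x, s) * g (x, s))"
    by (simp add: E_def press_def)
  finally show ?thesis unfolding F_def .
qed

end

section \<open>Assembling the weak equation\<close>

lemma test_fun_mono: "f \<in> test_fun \<Omega> \<Longrightarrow> \<Omega> \<subseteq> \<Omega>' \<Longrightarrow> f \<in> test_fun \<Omega>'"
  by (auto simp: test_fun_def)

lemma iterated_lebesgue_integral:
  fixes \<Phi> :: "real \<times> space \<Rightarrow> real"
  assumes i: "integrable (lborel \<Otimes>\<^sub>M lborel) \<Phi>" and \<Phi>: "\<Phi> \<in> borel_measurable borel"
    and U: "\<And>t x. 0 < t \<Longrightarrow> t < T \<Longrightarrow> U t x = \<Phi> (t, x)" and \<Phi>0: "\<And>t x. t \<notin> {0<..<T} \<Longrightarrow> \<Phi> (t, x) = 0"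
  shows "(LINT t:{0<..<T}|lebesgue. LINT x|lebesgue. U t x) = (LINT z|(lborel \<Otimes>\<^sub>M lborel). \<Phi> z)"
proof -
  note [measurable (raw)] = measurable_pair_compose[OF \<Phi>]
  have e: "indicator {0<..<T} t *\<^sub>R (LINT x|lebesgue. U t x) = (LINT x|lborel. \<Phi> (t, x))" for t
  proof (cases "t \<in> {0<..<T}")
    case True
    have m: "(\<lambda>x. \<Phi> (t, x)) \<in> borel_measurable borel" by measurable
    have "(LINT x|lebesgue. U t x) = (LINT x|lebesgue. \<Phi> (t, x))"
      using True by (simp add: U)
    then show ?thesis using True integral_lebesgue_eq[OF m] by simp
  qed (simp add: \<Phi>0)
  have m: "(\<lambda>t. LINT x|lborel. \<Phi> (t, x)) \<in> borel_measurable borel" by measurable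
  have "(LINT t:{0<..<T}|lebesgue. LINT x|lebesgue. U t x) = (LINT t|lborel. LINT x|lborel. \<Phi> (t, x))"
    unfolding set_lebesgue_integral_def e by (rule integral_lebesgue_eq[OF m])
  also have "\<dots> = (LINT z|(lborel \<Otimes>\<^sub>M lborel). \<Phi> z)"
    by (rule lborel_pair.integral_fst'[OF i])
  finally show ?thesis .
qed

context picard
begin

lemma transport_measurable:
  assumes f: "f \<in> test_fun UNIV"
  shows "transport f \<in> borel_measurable borel"
proof -
  have d: "dx j f \<in> borel_measurable borel" for j
    unfolding dx_def by (rule test_fun_measurable[OF test_fun_dderiv[OF f]])
  note [measurable (raw)] = field_measurable[OF bounded_fieldD(1)[OF sol_bounded]]
  have m: "(\<lambda>z. dx j f (snd z, fst z)) \<in> borel_measurable (borel \<Otimes>\<^sub>M borel)"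
 for j
    by (rule measurable_pair_compose[OF d]; measurable)
  have m': "(\<lambda>z. sol (fst z) (snd z)) \<in> borel_measurable (borel \<Otimes>\<^sub>M borel)" by measurable
  have m'': "(\<lambda>z. sol (fst z) (snd z) $ j) \<in> borel_measurable (borel \<Otimes>\<^sub>M borel)" for j
    unfolding cart_eq_inner_axis by measurable
  show ?thesis
    unfolding transport_def[abs_def] advect_def borel_prod[symmetric]
    by (intro measurable_If borel_measurable_inner borel_measurable_sum borel_measurable_scaleR m m' m'' borel_measurable_const) measurable
qed

lemma transport_integrable:
  assumes f: "f \<in> test_fun UNIV" and a: "0 < a" and f0: "\<And>x t j. t \<notin> {a..b} \<Longrightarrow> dx j f (x, t) = 0"
  shows "integrable (lborel \<Otimes>\<^sub>M lborel) (transport f)"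
proof (rule Bochner_Integration.integrable_bound[OF _ _ AE_I2])
  define c where "c = M * a powr (- \<alpha>)"
  have c: "0 \<le> c" using M by (simp add: c_def)
  have d: "dx j f \<in> test_fun UNIV" for j unfolding dx_def by (rule test_fun_dderiv[OF f])
  show "integrable (lborel \<Otimes>\<^sub>M lborel) (\<lambda>z. c * (\<Sum>j\<in>UNIV. c * norm (dx j f (snd z, fst z))))"
    by (intro integrable_mult_right Bochner_Integration.integrable_sum integrable_norm test_swap_integrable[OF d])
  show "transport f \<in> borel_measurable (lborel \<Otimes>\<^sub>M lborel)"
    using transport_measurable[OF f] by (simp add: lborel_prod)
  fix z :: "real \<times> space"
  let ?v = "sol (fst z) (snd z)"
  show "norm (transport f z) \<le> norm (c * (\<Sum>j\<in>UNIV. c * norm (dx j f (snd z, fst z))))"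
  proof (cases "fst z \<in> {a..b}")
    case True
    have "norm ?v \<le> M * fst z powr (- \<alpha>)" using a True by (intro bounded_fieldD(2)[OF sol_bounded]) auto
    also have "\<dots> \<le> c" unfolding c_def using M a \<alpha> True by (intro mult_left_mono powr_mono2') auto
    finally have v: "norm ?v \<le> c" .
    have "norm (advect ?v f (snd z, fst z)) \<le> (\<Sum>j\<in>UNIV. c * norm (dx j f (snd z, fst z)))"
      unfolding advect_def
    proof (rule sum_norm_le)
      fix j :: 3
      have "norm ((?v $ j) *\<^sub>R dx j f (snd z, fst z)) = \<bar>?v $ j\<bar> * norm (dx j f (snd z, fst z))" by simp
      also have "\<dots> \<le> c * norm (dx j f (snd z, fst z))"
        by (intro mult_right_mono order_trans[OF component_le_norm_cart v]) simp
      finally show "norm ((?v $ j) *\<^sub>R dx j f (snd z, fst z)) \<le> c * norm (dx j f (snd z, fst z))" .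
    qed
    then have "norm ?v * norm (advect ?v f (snd z, fst z)) \<le> c * (\<Sum>j\<in>UNIV. c * norm (dx j f (snd z, fst z)))"
      by (rule mult_mono[OF v]) (use c in auto)
    moreover have "norm (transport f z) \<le> norm ?v * norm (advect ?v f (snd z, fst z))"
      by (simp add: transport_def Cauchy_Schwarz_ineq2)
    ultimately show ?thesis unfolding real_norm_def by (intro order_trans[OF _ abs_ge_self]) simp
  next
    case False
    then show ?thesis by (simp add: transport_def advect_def f0)
  qed
qed

lemma press_div_integrable:
  assumes g: "g \<in> test_fun UNIV" and ab: "0 < a" "b < T" and g0: "\<And>x t. t \<notin> {a..b} \<Longrightarrow> g (x, t) = (0::real)"
  shows "integrable (lborel \<Otimes>\<^sub>M lborel) (\<lambda>z. press (snd z, fst z) * g (snd z, fst z))"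
proof -
  obtain C where C: "0 \<le> C" "\<forall>s\<in>{a..b}. Cp s \<le> C" using Cp_bounded[OF ab(1)] by blast
  define I where "I = (LINT \<rho>|lborel. major \<rho>)"
  have I: "0 \<le> I" unfolding I_def by (intro Bochner_Integration.integral_nonneg) auto
  note [measurable (raw)] = measurable_pair_compose[OF press_measurable] measurable_pair_compose[OF test_fun_measurable[OF g]]
  show ?thesis
  proof (rule Bochner_Integration.integrable_bound[OF _ _ AE_I2])
    show "integrable (lborel \<Otimes>\<^sub>M lborel) (\<lambda>z. (C * I) * norm (g (snd z, fst z)))"
      by (intro integrable_mult_right integrable_norm test_swap_integrable[OF g])
    fix z :: "real \<times> space"
    show "norm (press (snd z, fst z) * g (snd z, fst z)) \<le> norm ((C * I) * norm (g (snd z, fst z)))"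
    proof (cases "fst z \<in> {a..b}")
      case True
      have "\<bar>press (snd z, fst z)\<bar> \<le> Cp (fst z) * I"
        unfolding I_def using True ab by (intro press_bound) auto
      also have "\<dots> \<le> C * I" using C(2) True I by (intro mult_right_mono) auto
      finally have "\<bar>press (snd z, fst z)\<bar> * \<bar>g (snd z, fst z)\<bar> \<le> (C * I) * \<bar>g (snd z, fst z)\<bar>"
        by (rule mult_right_mono) simp
      then show ?thesis using C(1) I by (simp add: abs_mult)
    qed (simp add: g0)
  qed measurable
qed

lemma weak_equation:
  assumes f: "f \<in> test_fun (UNIV \<times> {0<..<T})" and u: "\<And>t. 0 < t \<Longrightarrow> t < T \<Longrightarrow> u t = sol t"
  shows "(LINT t:{0<..<T}|lebesgue. LINT x|lebesgue.
          u t x \<bullet> (dt f (x, t) + laplacian f (x, t)) + press (x, t) * divergence f (x, t))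
      = - (LINT t:{0<..<T}|lebesgue. LINT x|lebesgue. u t x \<bullet> advect (u t x) f (x, t))"
proof -
  have f': "f \<in> test_fun UNIV" by (rule test_fun_mono[OF f subset_UNIV])
  obtain K where K: "compact K" "K \<subseteq> UNIV \<times> {0<..<T}" "\<And>z. z \<notin> K \<Longrightarrow> f z = 0"
    using test_fun_support[OF f] by blast
  obtain a b where ab: "0 < a" "a < b" "b < T" "snd ` K \<subseteq> {a..b}"
    using compact_time_bounds[OF K(1,2)] by blast
  have nK: "(x, t) \<notin> K" if "t \<notin> {a..b}" for x t
    using ab(4) that by (intro notin_projections(2)) blast
  define h where "h = heat_op f"
  define g where "g = divergence f"
  have h: "h \<in> test_fun UNIV" unfolding h_def by (rule heat_op_test[OF f'])
  have g: "g \<in> test_fun UNIV" unfolding g_def by (rule divergence_test[OF f'])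
  have f0: "f (x, t) = 0" "h (x, t) = 0" "g (x, t) = 0" "dx j f (x, t) = 0" if "t \<notin> {a..b}" for x t j
    unfolding h_def g_def dx_def using K(3)[OF nK[OF that]] heat_op_eq_0[OF K(1,3) nK[OF that]]
      divergence_eq_0[OF K(1,3) nK[OF that]] dderiv_eq_0[OF K(1,3) nK[OF that]] by auto
  note [measurable (raw)] = measurable_pair_compose[OF test_fun_measurable[OF h]] measurable_pair_compose[OF test_fun_measurable[OF g]]
    measurable_pair_compose[OF press_measurable] field_measurable[OF bounded_fieldD(1)[OF sol_bounded]]
  have fa: "f (x, t) = 0 \<and> heat_op f (x, t) = 0" if "t < a" for x t
    using f0(1,2)[of t x] that by (simp add: h_def)
  have ha: "heat_op f (x, t) = 0" if "t \<notin> {a..b}" for x t using f0(2)[OF that] by (simp add: h_def)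
  have H: "integrable (lborel \<Otimes>\<^sub>M lborel) (\<lambda>z. heat u0 (fst z) (snd z) \<bullet> h (snd z, fst z))"
    "(LINT z|(lborel \<Otimes>\<^sub>M lborel). heat u0 (fst z) (snd z) \<bullet> h (snd z, fst z)) = 0"
    unfolding h_def by (rule heat_test_0[OF f' ab(1) fa]; assumption)+
  have W: "integrable (lborel \<Otimes>\<^sub>M lborel) (\<lambda>z. wpot (th (fst z)) sol (snd z) \<bullet> h (snd z, fst z))"
    "integrable (lborel \<Otimes>\<^sub>M lborel) (\<lambda>z. transport f z + press_term f z)"
    "(LINT z|(lborel \<Otimes>\<^sub>M lborel). wpot (th (fst z)) sol (snd z) \<bullet> h (snd z, fst z)) = (LINT z|(lborel \<Otimes>\<^sub>M lborel). transport f z + press_term f z)"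
    unfolding h_def by (rule wpot_test[OF f' ab(1) ha]; assumption)+
  have TR: "integrable (lborel \<Otimes>\<^sub>M lborel) (transport f)"
    by (rule transport_integrable[OF f' ab(1) f0(4)])
  have PG: "integrable (lborel \<Otimes>\<^sub>M lborel) (\<lambda>z. press (snd z, fst z) * g (snd z, fst z))"
    by (rule press_div_integrable[OF g ab(1,3) f0(3)])
  have PT: "integrable (lborel \<Otimes>\<^sub>M lborel) (press_term f)"
    using Bochner_Integration.integrable_diff[OF W(2) TR] by simp
  have "(LINT z|(lborel \<Otimes>\<^sub>M lborel). press_term f z) = (LINT s|lborel. LINT y|lborel. press_term f (s, y))"
    by (rule lborel_pair.integral_fst'[OF PT, symmetric])
  also have "\<dots> = (LINT s|lborel. LINT x|lborel. press (x, s) * g (x, s))"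
  proof (rule Bochner_Integration.integral_cong[OF refl])
    fix s :: real
    show "(LINT y|lborel. press_term f (s, y)) = (LINT x|lborel. press (x, s) * g (x, s))"
    proof (cases "s \<in> {a..b}")
      case True
      then have s: "0 < s" "s < T" using ab by auto
      then show ?thesis using press_test[OF g s] by (simp add: press_term_def g_def)
    next
      case False
      then have "divergence f (x, s) = 0" for x using f0(3)[of s x] by (simp add: g_def)
      then have "press_term f (s, y) = 0" for y by (cases "0 < s") (simp_all add: press_term_def)
      then show ?thesis using f0(3)[OF False] by simp
    qed
  qed
  also have "\<dots> = (LINT z|(lborel \<Otimes>\<^sub>M lborel). press (snd z, fst z) * g (snd z, fst z))"
    using lborel_pair.integral_fst'[OF PG] by simp
  finally have PE: "(LINT z|(lborel \<Otimes>\<^sub>M lborel). press_term f z) = (LINT z|(lborel \<Otimes>\<^sub>M lborel). press (snd z, fst z) * g (snd z, fst z))" .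
  define \<Phi> where "\<Phi> z = sol (fst z) (snd z) \<bullet> h (snd z, fst z) + press (snd z, fst z) * g (snd z, fst z)" for z
  have \<Phi>m: "(\<lambda>z. \<Phi> z) \<in> borel_measurable borel"
    unfolding \<Phi>_def borel_prod[symmetric] by measurable
  \<comment> \<open>\<open>sol_eq\<close> is available on (0, T) only; outside [a, b] both sides
    vanish with the test function.\<close>
  have \<Phi>eq: "\<Phi> z = (heat u0 (fst z) (snd z) \<bullet> h (snd z, fst z) - wpot (th (fst z)) sol (snd z) \<bullet> h (snd z, fst z)) + press (snd z, fst z) * g (snd z, fst z)" for z
  proof (cases "fst z \<in> {a..b}")
    case True
    then have "0 < fst z" "fst z < T" using ab by auto
    then show ?thesis by (simp add: \<Phi>_def sol_eq inner_diff_left)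
  qed (simp add: \<Phi>_def f0)
  have i\<Phi>: "integrable (lborel \<Otimes>\<^sub>M lborel) \<Phi>"
    unfolding \<Phi>eq[abs_def] by (intro Bochner_Integration.integrable_add Bochner_Integration.integrable_diff H(1) W(1) PG)
  have "(LINT z|(lborel \<Otimes>\<^sub>M lborel). \<Phi> z)
    = ((LINT z|(lborel \<Otimes>\<^sub>M lborel). heat u0 (fst z) (snd z) \<bullet> h (snd z, fst z))
      - (LINT z|(lborel \<Otimes>\<^sub>M lborel). wpot (th (fst z)) sol (snd z) \<bullet> h (snd z, fst z)))
      + (LINT z|(lborel \<Otimes>\<^sub>M lborel). press (snd z, fst z) * g (snd z, fst z))"
    unfolding \<Phi>eq using H(1) W(1) PG by simp
  \<comment> \<open>The heat term is 0, the quadratic term equals the integral of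
    \<open>transport\<close> plus that of \<open>press_term\<close>, and the latter cancels against
    the pressure.\<close>
  also have "\<dots> = - (LINT z|(lborel \<Otimes>\<^sub>M lborel). transport f z)"
    using H(2) W(3) Bochner_Integration.integral_add[OF TR PT] PE by linarith
  finally have main: "(LINT z|(lborel \<Otimes>\<^sub>M lborel). \<Phi> z) = - (LINT z|(lborel \<Otimes>\<^sub>M lborel). transport f z)" .
  have out: "t \<notin> {a..b}" if "t \<notin> {0<..<T}" for t using that ab by auto
  have "(LINT t:{0<..<T}|lebesgue. LINT x|lebesgue.
          u t x \<bullet> (dt f (x, t) + laplacian f (x, t)) + press (x, t) * divergence f (x, t)) = (LINT z|(lborel \<Otimes>\<^sub>M lborel). \<Phi> z)"
  proof (rule iterated_lebesgue_integral[OF i\<Phi> \<Phi>m])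
    show "u t x \<bullet> (dt f (x, t) + laplacian f (x, t)) + press (x, t) * divergence f (x, t) = \<Phi> (t, x)" if "0 < t" "t < T" for t x
      using u[OF that] by (simp add: \<Phi>_def h_def g_def heat_op_def laplacian_def)
    show "\<Phi> (t, x) = 0" if "t \<notin> {0<..<T}" for t x
      using f0[OF out[OF that]] by (simp add: \<Phi>_def)
  qed
  moreover have "(LINT t:{0<..<T}|lebesgue. LINT x|lebesgue. u t x \<bullet> advect (u t x) f (x, t)) = (LINT z|(lborel \<Otimes>\<^sub>M lborel). transport f z)"
  proof (rule iterated_lebesgue_integral[OF TR transport_measurable[OF f']])
    show "u t x \<bullet> advect (u t x) f (x, t) = transport f (t, x)" if "0 < t" "t < T" for t x
      using u[OF that] that by (simp add: transport_def)
    show "transport f (t, x) = 0" if "t \<notin> {0<..<T}" for t x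
      using f0[OF out[OF that]] by (simp add: transport_def advect_def)
  qed
  ultimately show ?thesis using main by simp
qed

end

subsection \<open>The semi-strong solution\<close>

lemma Lp_2_norm:
  assumes v: "v \<in> borel_measurable borel" and N: "N2 v \<le> ennreal c" "0 \<le> c"
  shows "v \<in> Lp 2" "0 \<le> Lp_norm 2 v" "Lp_norm 2 v \<le> sqrt c"
proof -
  note [measurable] = v
  have p: "norm (v x) powr 2 = (norm (v x))\<^sup>2" for x by simp
  have le: "(\<integral>\<^sup>+x. ennreal ((norm (v x))\<^sup>2) \<partial>lborel) \<le> ennreal c"
    using N(1) by (simp add: N2_def ennreal_power)
  have i: "integrable lborel (\<lambda>x. (norm (v x))\<^sup>2)"
    using order_le_less_trans[OF le] by (intro integrableI_bounded) auto
  have "ennreal (LINT x|lborel. (norm (v x))\<^sup>2) \<le> ennreal c"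
    using le nn_integral_eq_integral[OF i] by simp
  then have c: "(LINT x|lborel. (norm (v x))\<^sup>2) \<le> c" using N(2) by (simp add: ennreal_le_iff)
  have vl: "v \<in> borel_measurable lebesgue" by (intro measurable_completion) simp
  show "v \<in> Lp 2"
    using vl i by (simp add: Lp_def p integrable_completion)
  show "0 \<le> Lp_norm 2 v" by (simp add: Lp_norm_def)
  have "Lp_norm 2 v = sqrt (LINT x|lborel. (norm (v x))\<^sup>2)"
    unfolding Lp_norm_def p using integral_lebesgue_eq[of "\<lambda>x. (norm (v x))\<^sup>2"]
    by (simp add: powr_half_sqrt)
  then show "Lp_norm 2 v \<le> sqrt c" using c by simp
qed

lemma Linf_norm_bound:
  assumes v: "v \<in> borel_measurable borel" and c: "\<And>x. norm (v x) \<le> c"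
  shows "v \<in> Linf" "0 \<le> Linf_norm v" "Linf_norm v \<le> c"
proof -
  note [measurable] = v
  have vl: "v \<in> borel_measurable lebesgue" "(\<lambda>x. ereal (norm (v x))) \<in> borel_measurable lebesgue"
    by (intro measurable_completion; simp)+
  have le: "esssup lebesgue (\<lambda>x. ereal (norm (v x))) \<le> ereal c"
    by (intro esssup_I vl) (simp add: c)
  \<comment> \<open>\<open>real_of_ereal\<close> sends infinite values to 0, so the essential
    supremum is first bounded from both sides by real numbers.\<close>
  have "esssup lebesgue (\<lambda>x :: space. 0 :: ereal) = 0" by (intro esssup_const) simp
  then have ge: "0 \<le> esssup lebesgue (\<lambda>x. ereal (norm (v x)))"
    using esssup_mono[OF vl(2), of "\<lambda>_. 0"] esssup_mono[of "\<lambda>_. 0" lebesgue "\<lambda>x. ereal (norm (v x))"] by simp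
  show "v \<in> Linf" using vl le by (auto simp: Linf_def intro: order_le_less_trans)
  show "0 \<le> Linf_norm v" using ge by (simp add: Linf_norm_def real_of_ereal_pos)
  show "Linf_norm v \<le> c" using le ge
    by (cases "esssup lebesgue (\<lambda>x. ereal (norm (v x)))") (auto simp: Linf_norm_def)
qed

context picard
begin

text \<open>\<open>sol\<close> is 0 at time 0 by its definition, so the initial value is put in
  separately.\<close>

definition flow :: "real \<Rightarrow> space \<Rightarrow> space" where
  "flow t x = (if t = 0 then u0 x else sol t x)"

lemma flow_pos: "0 < t \<Longrightarrow> flow t = sol t"
  by (auto simp: flow_def)

lemma flow_borel: "flow t \<in> borel_measurable borel"
  using sol_slice[of t] u0 by (cases "t = 0") (simp_all add: flow_def[abs_def])

lemma flow_L2: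
  assumes "0 \<le> t"
  shows "flow t \<in> Lp 2"
proof -
  have n: "N2 (flow t) \<le> ennreal (4 * Nr)"
  proof (cases "t = 0")
    case True
    have "N2 (flow t) \<le> ennreal Nr" using True L2(1) Nr by (simp add: flow_def[abs_def])
    also have "\<dots> \<le> ennreal (4 * Nr)" using Nr(2) by (intro ennreal_leI) simp
    finally show ?thesis .
  next
    case False
    then have "0 < t" using assms by simp
    then show ?thesis
      using bounded_fieldD(3)[OF sol_bounded \<open>0 < t\<close>] Nr by (simp add: flow_pos ennreal_mult)
  qed
  show ?thesis by (rule Lp_2_norm(1)[OF flow_borel n]) (use Nr(2) in simp)
qed

lemma flow_Linf:
  assumes "0 < t"
  shows "flow t \<in> Linf" "0 \<le> Linf_norm (flow t)" "Linf_norm (flow t) \<le> M * t powr (- \<alpha>)"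
proof -
  have b: "norm (flow t x) \<le> M * t powr (- \<alpha>)" for x
    using bounded_fieldD(2)[OF sol_bounded assms] assms by (simp add: flow_pos)
  show "flow t \<in> Linf" "0 \<le> Linf_norm (flow t)" "Linf_norm (flow t) \<le> M * t powr (- \<alpha>)"
    by (rule Linf_norm_bound[OF flow_borel b])+
qed

lemma flow_diff_borel: "(\<lambda>x. flow s x - flow t x) \<in> borel_measurable borel"
  using flow_borel[of s] flow_borel[of t] by measurable

lemma flow_tendsto:
  assumes t: "0 < t" "t < T"
  shows "((\<lambda>s. Lp_norm 2 (\<lambda>x. flow s x - flow t x)) \<longlongrightarrow> 0) (at t within S)"
    "((\<lambda>s. Linf_norm (\<lambda>x. flow s x - flow t x)) \<longlongrightarrow> 0) (at t within S)"
proof -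
  have pos: "\<forall>\<^sub>F s in at t within S. 0 < s"
    using t(1) by (rule order_tendstoD(1)[OF tendsto_ident_at])
  note near = sol_time_diff_near[OF t, of S]
  have "\<forall>\<^sub>F s in at t within S. norm (Lp_norm 2 (\<lambda>x. flow s x - flow t x)) \<le> sqrt (max 0 (L2_mod (min t s) (max t s)))"
    using pos near
  proof eventually_elim
    case (elim s)
    have "N2 (\<lambda>x. flow s x - flow t x) \<le> ennreal (L2_mod (min t s) (max t s))"
      using elim t by (simp add: flow_pos)
    also have "\<dots> \<le> ennreal (max 0 (L2_mod (min t s) (max t s)))" by (rule ennreal_leI) simp
    finally show ?case using Lp_2_norm(2,3)[OF flow_diff_borel] by simp
  qed
  moreover have "((\<lambda>s. sqrt (max 0 (L2_mod (min t s) (max t s)))) \<longlongrightarrow> 0) (at t within S)"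
    using tendsto_real_sqrt[OF tendsto_max[OF tendsto_const[of "0 :: real"] mod_tendsto(2)[OF t(1)]], of S] by simp
  ultimately show "((\<lambda>s. Lp_norm 2 (\<lambda>x. flow s x - flow t x)) \<longlongrightarrow> 0) (at t within S)"
    by (rule Lim_null_comparison)
  have "\<forall>\<^sub>F s in at t within S. norm (Linf_norm (\<lambda>x. flow s x - flow t x)) \<le> sup_mod (min t s) (max t s)"
    using pos near
  proof eventually_elim
    case (elim s)
    have b: "norm (flow s x - flow t x) \<le> sup_mod (min t s) (max t s)" for x
      using elim t by (simp add: flow_pos)
    show ?case using Linf_norm_bound(2,3)[OF flow_diff_borel b] by simp
  qed
  then show "((\<lambda>s. Linf_norm (\<lambda>x. flow s x - flow t x)) \<longlongrightarrow> 0) (at t within S)"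
    by (rule Lim_null_comparison) (rule mod_tendsto(1)[OF t(1)])
qed

lemma flow_tendsto_0: "((\<lambda>s. Lp_norm 2 (\<lambda>x. flow s x - flow 0 x)) \<longlongrightarrow> 0) (at 0 within {0..<T})"
proof (rule tendstoI)
  fix e :: real assume e: "0 < e"
  have le: "at 0 within {0..<T} \<le> at_right (0 :: real)"
    unfolding at_within_def by (intro inf_mono order_refl) auto
  have "\<forall>\<^sub>F s in at_right 0. N2 (\<lambda>x. sol s x - u0 x) < ennreal ((e / 2)\<^sup>2)"
    using e by (intro order_tendstoD(2)[OF sol_tendsto_0]) simp
  moreover have "\<forall>\<^sub>F s in at_right (0 :: real). 0 < s" by (rule eventually_at_right_less)
  ultimately have "\<forall>\<^sub>F s in at_right 0. dist (Lp_norm 2 (\<lambda>x. flow s x - flow 0 x)) 0 < e"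
  proof eventually_elim
    case (elim s)
    then have n: "N2 (\<lambda>x. flow s x - flow 0 x) \<le> ennreal ((e / 2)\<^sup>2)"
      by (simp add: flow_def less_imp_le)
    have "Lp_norm 2 (\<lambda>x. flow s x - flow 0 x) \<le> sqrt ((e / 2)\<^sup>2)"
      by (rule Lp_2_norm(3)[OF flow_diff_borel n]) simp
    moreover have "0 \<le> Lp_norm 2 (\<lambda>x. flow s x - flow 0 x)"
      by (rule Lp_2_norm(2)[OF flow_diff_borel n]) simp
    ultimately show ?case using e by simp
  qed
  then show "\<forall>\<^sub>F s in at 0 within {0..<T}. dist (Lp_norm 2 (\<lambda>x. flow s x - flow 0 x)) 0 < e"
    by (rule filter_leD[OF le])
qed

text \<open>Near 0 the integrand is at most M^2 s^(-2\<alpha>), which is integrable because \<alpha>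
  < 1/2. This is where p > 3 enters the definition of a semi-strong solution.\<close>

lemma flow_Linf_square_integrable:
  "(\<integral>\<^sup>+s\<in>{0<..<t}. ennreal ((Linf_norm (flow s))\<^sup>2) \<partial>lebesgue) < \<infinity>"
proof -
  have "(\<integral>\<^sup>+s\<in>{0<..<t}. ennreal ((Linf_norm (flow s))\<^sup>2) \<partial>lebesgue)
    \<le> (\<integral>\<^sup>+s. ennreal (M\<^sup>2) * (ennreal (s powr - (2 * \<alpha>)) * indicator {0<..<max 0 t} s) \<partial>lebesgue)"
  proof (rule nn_integral_mono)
    fix s :: real
    show "ennreal ((Linf_norm (flow s))\<^sup>2) * indicator {0<..<t} s \<le> ennreal (M\<^sup>2) * (ennreal (s powr - (2 * \<alpha>)) * indicator {0<..<max 0 t} s)"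
    proof (cases "s \<in> {0<..<t}")
      case True
      then have s: "0 < s" "s < t" by auto
      have "(Linf_norm (flow s))\<^sup>2 \<le> (M * s powr (- \<alpha>))\<^sup>2"
        by (intro power_mono flow_Linf s)
      also have "\<dots> = M\<^sup>2 * s powr - (2 * \<alpha>)"
        using powr_add[of s "- \<alpha>" "- \<alpha>"] by (simp add: power_mult_distrib power2_eq_square)
      finally have "ennreal ((Linf_norm (flow s))\<^sup>2) \<le> ennreal (M\<^sup>2) * ennreal (s powr - (2 * \<alpha>))"
        by (simp add: ennreal_mult[symmetric] ennreal_leI)
      then show ?thesis using s by simp
    qed simp
  qed
  also have "\<dots> = (\<integral>\<^sup>+s. ennreal (M\<^sup>2) * (ennreal (s powr - (2 * \<alpha>)) * indicator {0<..<max 0 t} s) \<partial>lborel)"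
    by (rule nn_integral_completion)
  also have "\<dots> = ennreal (M\<^sup>2) * ennreal (max 0 t powr (1 - 2 * \<alpha>) / (1 - 2 * \<alpha>))"
    using \<alpha> by (subst nn_integral_cmult) (simp_all add: nn_integral_powr_near_0)
  also have "\<dots> < \<infinity>" by (simp add: ennreal_mult_less_top)
  finally show ?thesis .
qed

lemma flow_semi_strong:
  assumes div: "weakly_div_free u0"
  shows "semi_strong_solution T flow"
proof -
  have "cont_into {0<..<T} (Lp 2) (Lp_norm 2) flow" "cont_into {0<..<T} Linf Linf_norm flow"
    unfolding cont_into_def using flow_L2 flow_Linf(1) flow_tendsto by auto
  moreover have "cont_into {0..<T} (Lp 2) (Lp_norm 2) flow"
    unfolding cont_into_def
  proof (intro ballI conjI)
    fix t assume t: "t \<in> {0..<T}"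
    then show "flow t \<in> Lp 2" by (simp add: flow_L2)
    show "((\<lambda>s. Lp_norm 2 (\<lambda>x. flow s x - flow t x)) \<longlongrightarrow> 0) (at t within {0..<T})"
    proof (cases "t = 0")
      case False
      with t show ?thesis by (intro flow_tendsto(1)) auto
    qed (simp only: flow_tendsto_0)
  qed
  moreover have "\<forall>t\<in>{0<..<T}. weakly_div_free (flow t)"
    using sol_div_free[OF div] by (simp add: flow_pos)
  ultimately show ?thesis
    unfolding semi_strong_solution_def strong_solution_def
    using press_L1_loc weak_equation[of _ flow, OF _ flow_pos] flow_Linf_square_integrable by blast
qed

end

text \<open>Joint measurability of the iterates needs a Borel initial value, whereas elements of
  \<open>Lp\<close> are Lebesgue measurable. Passing to a Borel version affects the initial
  condition on a null set only.\<close>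

lemma lebesgue_borel_version:
  fixes u :: "space \<Rightarrow> space"
  assumes u: "u \<in> borel_measurable lebesgue"
  shows "\<exists>v\<in>borel_measurable borel. AE x in lebesgue. u x = v x"
proof -
  have "\<exists>g\<in>borel_measurable lborel. AE x in lborel. u x $ j = g x" for j
    unfolding cart_eq_inner_axis by (intro completion_ex_borel_measurable_real borel_measurable_inner u) simp
  then have "\<forall>j. \<exists>g. g \<in> borel_measurable lborel \<and> (AE x in lborel. u x $ j = g x)" by blast
  then have "\<exists>g. \<forall>j. g j \<in> borel_measurable lborel \<and> (AE x in lborel. u x $ j = g j x)" by (rule choice)
  then obtain g where g: "\<forall>j. g j \<in> borel_measurable lborel \<and> (AE x in lborel. u x $ j = g j x)" ..
  define v where "v x = (\<Sum>j\<in>UNIV. g j x *\<^sub>R (axis j 1 :: space))" for x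
  have gm: "g j \<in> borel_measurable borel" for j using g by simp
  have "v \<in> borel_measurable borel"
    unfolding v_def[abs_def] by (intro borel_measurable_sum borel_measurable_scaleR gm) simp
  moreover have "AE x in lebesgue. u x = v x"
  proof -
    have "AE x in lborel. \<forall>j\<in>UNIV. u x $ j = g j x"
      using g by (intro AE_finite_allI) auto
    then have "AE x in lborel. u x = v x"
    proof eventually_elim
      case (elim x)
      then show ?case by (simp add: v_def vec_eq_iff axis_def if_distrib cong: if_cong)
    qed
    then show ?thesis by (rule AE_completion)
  qed
  ultimately show ?thesis by blast
qed

lemma nn_integral_norm_powr:
  assumes u: "u \<in> Lp p" and v: "AE x in lebesgue. u x = v x"
  shows "(\<integral>\<^sup>+x. ennreal (norm (v x) powr p) \<partial>lborel) = ennreal (LINT x|lebesgue. norm (u x) powr p)"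
proof -
  have i: "integrable lebesgue (\<lambda>x. norm (u x) powr p)" using u by (simp add: Lp_def)
  have "(\<integral>\<^sup>+x. ennreal (norm (v x) powr p) \<partial>lborel) = (\<integral>\<^sup>+x. ennreal (norm (v x) powr p) \<partial>lebesgue)"
    by (rule nn_integral_completion[symmetric])
  also have "\<dots> = (\<integral>\<^sup>+x. ennreal (norm (u x) powr p) \<partial>lebesgue)"
    by (rule nn_integral_cong_AE) (use v in eventually_elim, simp)
  also have "\<dots> = ennreal (LINT x|lebesgue. norm (u x) powr p)"
    by (rule nn_integral_eq_integral[OF i]) simp
  finally show ?thesis .
qed

lemma weakly_div_free_AE:
  assumes u: "u \<in> borel_measurable lebesgue" and v: "v \<in> borel_measurable borel" "AE x in lebesgue. u x = v x"
    and div: "weakly_div_free u"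
  shows "weakly_div_free v"
  unfolding weakly_div_free_def
proof
  fix g :: "space \<Rightarrow> real" assume g: "g \<in> test_fun UNIV"
  have gm: "grad g \<in> borel_measurable lebesgue" "v \<in> borel_measurable lebesgue"
    using borel_measurable_continuous_onI[OF grad_continuous[OF g]] v(1) by (simp_all add: measurable_completion)
  have "(LINT x|lebesgue. v x \<bullet> grad g x) = (LINT x|lebesgue. u x \<bullet> grad g x)"
    by (intro integral_cong_AE borel_measurable_inner gm u) (use v(2) in eventually_elim, simp)
  then show "(LINT x|lebesgue. v x \<bullet> grad g x) = 0"
    using div g by (simp add: weakly_div_free_def)
qed

theorem corollary3p18:
  shows "\<exists>C::real. C > 0 \<and>
    (\<forall>(p::real) (u\<^sub>0 :: space \<Rightarrow> space).
      p > 3 \<longrightarrow> u\<^sub>0 \<in> H_space \<inter> Lp p \<longrightarrow> \<not> (AE x in lebesgue. u\<^sub>0 x = 0) \<longrightarrow>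
      (\<exists>(T::real) (u :: real \<Rightarrow> space \<Rightarrow> space).
        T \<ge> (C * (1 - 3 / p) / Lp_norm p u\<^sub>0) powr (2 * p / (p - 3)) \<and>
        semi_strong_solution T u \<and>
        (AE x in lebesgue. u 0 x = u\<^sub>0 x)))"
\<comment> \<open>11520 = 120 * 4 * 6 * 4: the constant 120 in the smallness assumptions of
  \<open>picard\<close>, the choice of \<open>M\<close> as 4 times the L^p norm, the bound 6/(1 -
  3/p) for the beta integrals, and the threshold 1/4.\<close>
proof (rule exI[of _ "1 / 11520"], intro conjI allI impI)
  fix p :: real and u\<^sub>0 :: "space \<Rightarrow> space"
  assume p: "p > 3" and u0: "u\<^sub>0 \<in> H_space \<inter> Lp p" and ne: "\<not> (AE x in lebesgue. u\<^sub>0 x = 0)"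
  have u0m: "u\<^sub>0 \<in> borel_measurable lebesgue" and uL: "u\<^sub>0 \<in> Lp 2" "u\<^sub>0 \<in> Lp p" and div: "weakly_div_free u\<^sub>0"
    using u0 by (auto simp: H_space_def Lp_def)
  obtain v where v: "v \<in> borel_measurable borel" "AE x in lebesgue. u\<^sub>0 x = v x"
    using lebesgue_borel_version[OF u0m] by blast
  define A where "A = Lp_norm p u\<^sub>0"
  define I where "I = (LINT x|lebesgue. norm (u\<^sub>0 x) powr p)"
  have i: "integrable lebesgue (\<lambda>x. norm (u\<^sub>0 x) powr p)" using uL by (simp add: Lp_def)
  have "0 \<le> I" unfolding I_def by (intro Bochner_Integration.integral_nonneg) simp
  \<comment> \<open>Here the datum being nonzero is used: its L^p norm is positive, so that the
    division in \<open>B\<close> is a genuine one.\<close>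
  moreover have "I \<noteq> 0"
    unfolding I_def using ne integral_nonneg_eq_0_iff_AE[OF i] by simp
  ultimately have I: "0 < I" by simp
  have A: "0 < A" "A powr p = I"
    using I p by (simp_all add: A_def Lp_norm_def I_def[symmetric] powr_powr)
  define \<alpha> where "\<alpha> = 3 / (2 * p)"
  define B where "B = 1 / 11520 * (1 - 3 / p) / A"
  \<comment> \<open>The exponent is the inverse of 1/2 - \<alpha>, so that the power of T in the
    smallness assumptions is exactly \<open>B\<close>.\<close>
  define T where "T = B powr (2 * p / (p - 3))"
  have \<alpha>: "0 \<le> \<alpha>" "\<alpha> < 1/2" "1 - 2 * \<alpha> = 1 - 3 / p"
    using p by (simp_all add: \<alpha>_def field_simps)
  have d: "0 < 1 - 3 / p" using p by (simp add: field_simps)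
  have B: "0 < B" using A(1) d by (simp add: B_def)
  have T: "0 < T" using B by (simp add: T_def)
  have "2 * p / (p - 3) * (1/2 - \<alpha>) = 1" using p by (simp add: \<alpha>_def field_simps)
  then have TB: "T powr (1/2 - \<alpha>) = B" using B by (simp only: T_def powr_powr powr_one)
  have small: "120 * (4 * A) * b * T powr (1/2 - \<alpha>) \<le> 1/4" if b: "b \<le> 6 / (1 - 3 / p)" for b
  proof -
    have "120 * (4 * A) * b * B \<le> 120 * (4 * A) * (6 / (1 - 3 / p)) * B"
      using b A(1) B by (intro mult_right_mono mult_left_mono) auto
    also have "\<dots> = 1/4" unfolding B_def using A(1) d p by simp
    finally show ?thesis unfolding TB .
  qed
  have b1: "beta1 (2 * \<alpha>) \<le> 6 / (1 - 3 / p)"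
    using beta1(3)[of "2 * \<alpha>"] \<alpha> by simp
  have "beta1 \<alpha> \<le> 6 / (1 - \<alpha>)" using \<alpha> by (intro beta1(3)) auto
  also have "\<dots> \<le> 6 / (1 - 2 * \<alpha>)" using \<alpha>(1,2) by (intro divide_left_mono) auto
  finally have b2: "beta1 \<alpha> \<le> 6 / (1 - 3 / p)" unfolding \<alpha>(3) .
  have vA: "(\<integral>\<^sup>+y. ennreal (norm (v y) powr p) \<partial>lborel) \<le> ennreal (A powr p)"
    unfolding nn_integral_norm_powr[OF uL(2) v(2)] A(2) I_def ..
  have "N2 v = (\<integral>\<^sup>+y. ennreal (norm (v y) powr 2) \<partial>lborel)"
    unfolding N2_def by (intro nn_integral_cong) (simp add: ennreal_power)
  also have "\<dots> < \<infinity>" unfolding nn_integral_norm_powr[OF uL(1) v(2)] by simp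
  finally have N: "N2 v < \<infinity>" .
  have nv: "(\<lambda>y. norm (v y)) \<in> borel_measurable borel" using v(1) by simp
  \<comment> \<open>The constant in \<open>gauss_pot_Lp_le\<close> is 2 A and has to equal M / 2,
    whence M = 4 A.\<close>
  interpret picard v "4 * A" \<alpha> T "N2 v"
  proof
    show "(\<integral>\<^sup>+y. ennreal (gauss t (x - y) * norm (v y)) \<partial>lborel) \<le> ennreal (4 * A / 2 * t powr (- \<alpha>))" if "0 < t" for t x
      using gauss_pot_Lp_le[OF nv norm_ge_zero _ A(1) vA that, of x] p by (simp add: \<alpha>_def)
  qed (use v(1) N \<alpha> A(1) T small[OF b1] small[OF b2] in auto)
  have "AE x in lebesgue. flow 0 x = u\<^sub>0 x"
    using v(2) by eventually_elim (simp add: flow_def)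
  moreover have "semi_strong_solution T flow"
    by (rule flow_semi_strong[OF weakly_div_free_AE[OF u0m v div]])
  ultimately show "\<exists>T u. T \<ge> (1 / 11520 * (1 - 3 / p) / Lp_norm p u\<^sub>0) powr (2 * p / (p - 3)) \<and>
      semi_strong_solution T u \<and> (AE x in lebesgue. u 0 x = u\<^sub>0 x)"
    by (intro exI[of _ T] exI[of _ flow]) (simp add: T_def B_def A_def)
qed simp

end
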